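(* Let $D:\mathcal{N}ec\to\mathcal{W}$ be a strong monoidal functor and let $\pi:\mathcal{W}\to\mathcal{V}$ be a colimit and tensor preserving $\mathcal{V}$-functor. Suppose there exists a functor $D':\mathcal{N}ec_{-}\to\mathcal{V}$ such that $\pi D\simeq \mathrm{Lan}_{\iota}D'$. Then for any simplicial set $K$ with $a,b\in K_0$, there is an isomorphism in $\mathcal{V}$ $$\pi(L^{D}(K)(a,b))\simeq\coprod_{T\in\mathcal{N}ec}F(K^{nd}_T(a,b))\otimes D'(T).$$
   Context: Setting. $(\mathcal{V},\otimes,I)$ is a cocomplete and finitely complete symmetric monoidal closed category; $F:\mathrm{Set}\to\mathcal{V}$, $F(S)=\coprod_{s\in S}I$. $(\mathcal{W},\otimes_{\mathcal{W}},I_{\mathcal{W}})$ is a $\mathcal{V}$-enriched monoidal category (a pseudomonoid in the monoidal 2-category of $\mathcal{V}$-categories), tensored over $\mathcal{V}$ (tensoring $V\cdot W$), with cocomplete underlying category, $\otimes_{\mathcal{W}}$ preserving colimits in each variable, and such that the canonical morphism $(V_1\otimes V_2)\cdot(W_1\otimes_{\mathcal{W}}W_2)\to(V_1\cdot W_1)\otimes_{\mathcal{W}}(V_2\cdot W_2)$ is always an isomorphism. $\mathcal{W}\mathrm{Cat}$ is the category of small $\mathcal{W}$-categories, with compositions written $\mathcal{C}(A,B)\otimes\mathcal{C}(B,C)\to\mathcal{C}(A,C)$. A $\mathcal{V}$-functor $\pi:\mathcal{W}\to\mathcal{V}$ is tensor preserving if the canonical morphism $V\otimes\pi(W)\to\pi(V\cdot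 W)$ is an isomorphism for all $V\in\mathcal{V}$, $W\in\mathcal{W}$. Necklaces. $\mathrm{SSet}_{*,*}$ is the category of bipointed simplicial sets; $\Delta^n$ is bipointed by $0,n$; $K_{a,b}\vee L_{c,d}$ glues $b$ to $c$ and is bipointed by $a,d$. A necklace is $\Delta^{n_1}\vee\dots\vee\Delta^{n_k}$, $k\ge0$, $n_i>0$ ($\Delta^0$ if $k=0$), with beads $\Delta^{n_i}$; $\mathcal{N}ec$ is the full subcategory of necklaces, monoidal under $\vee$. Equivalently, necklaces are pairs $(T,p)$ with $\{0,p\}\subseteq T\subseteq[p]$ (with $\Delta^n=(\{0,n\},n)$), and maps $(T,p)\to(U,q)$ are order-preserving endpoint-preserving maps $f:[p]\to[q]$ ($f(0)=0,f(p)=q$) with $U\subseteq f(T)$. $\mathcal{N}ec_-$ is the wide subcategory of maps with $f:[p]\to[q]$ surjective and $f(T)=U$ (active surjective maps), and $\iota:\mathcal{N}ec_-\hookrightarrow\mathcal{N}ec$ is the inclusion. $K^{nd}_T(a,b)$ is the set of maps $T\to K_{a,b}$ in $\mathrm{SSet}_{*,*}$ that send every bead of $T$ to a non-degenerate simplex of $K$. The functor $L^D$. Let $\mathbf{\Delta}$ be the simplex category. Let $\Phi(D):\mathbf{\Delta}\to\mathcal{W}\mathrm{Cat}$ be the diagram where $\Phi(D)^n$ has object set $[n]$ and $\Phi(D)^n(i,j)=D(\Delta^{j-i})$ if $i\le j$ and initial if $i>j$, with composition $D(\Delta^{k-i})\otimes D(\Delta^{j-k})\simeq D(\Delta^{k-i}\vee\Delta^{j-k})\to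 D(\Delta^{j-i})$ induced by the necklace map with underlying map the identity, and identities $I_{\mathcal{W}}\simeq D(\Delta^0)$; a map $f:[m]\to[n]$ acts as $f$ on objects and by $D(f_{i,j})$ on hom-objects, $f_{i,j}(k)=f(k+i)-f(i)$. The nerve $N^D:\mathcal{W}\mathrm{Cat}\to\mathrm{SSet}$ generated by $D$ is (up to isomorphism) $N^D(\mathcal{C})_n=\mathcal{W}\mathrm{Cat}(\Phi(D)^n,\mathcal{C})$, and $L^D:\mathrm{SSet}\to\mathcal{W}\mathrm{Cat}$ is its left adjoint; the objects of $L^D(K)$ are the vertices of $K$. *)

theory Defs
  imports "HOL-Library.FuncSet"
begin

section \<open>Categories, functors, limits and colimits\<close>

text \<open>Arrows know their domain and codomain.  Composition is written in applicative order.\<close>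

record ('o, 'a) category =
  Obj :: "'o set"
  Arr :: "'a set"
  Dom :: "'a \<Rightarrow> 'o"
  Cod :: "'a \<Rightarrow> 'o"
  Idt :: "'o \<Rightarrow> 'a"
  Cmp :: "'a \<Rightarrow> 'a \<Rightarrow> 'a"  (infixr "\<bullet>\<index>" 70)

definition hom :: "('o, 'a, 'm) category_scheme \<Rightarrow> 'o \<Rightarrow> 'o \<Rightarrow> 'a set" where
  "hom C x y = {f \<in> Arr C. Dom C f = x \<and> Cod C f = y}"

locale category =
  fixes C :: "('o, 'a, 'm) category_scheme" (structure)
  assumes Dom_Obj: "f \<in> Arr C \<Longrightarrow> Dom C f \<in> Obj C"
    and Cod_Obj: "f \<in> Arr C \<Longrightarrow> Cod C f \<in> Obj C"
    and Idt_hom: "x \<in> Obj C \<Longrightarrow> Idt C x \<in> hom C x x"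
    and Cmp_hom: "\<lbrakk>f \<in> hom C x y; g \<in> hom C y z\<rbrakk> \<Longrightarrow> g \<bullet> f \<in> hom C x z"
    and Cmp_Idt_left: "f \<in> hom C x y \<Longrightarrow> Idt C y \<bullet> f = f"
    and Cmp_Idt_right: "f \<in> hom C x y \<Longrightarrow> f \<bullet> Idt C x = f"
    and Cmp_assoc: "\<lbrakk>f \<in> hom C w x; g \<in> hom C x y; h \<in> hom C y z\<rbrakk> \<Longrightarrow> (h \<bullet> g) \<bullet> f = h \<bullet> (g \<bullet> f)"

definition inverse_arrows :: "('o, 'a, 'm) category_scheme \<Rightarrow> 'a \<Rightarrow> 'a \<Rightarrow> bool" where
  "inverse_arrows C f g \<longleftrightarrow> f \<in> Arr C \<and> g \<in> hom C (Cod C f) (Dom C f) \<and>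
     g \<bullet>\<^bsub>C\<^esub> f = Idt C (Dom C f) \<and> f \<bullet>\<^bsub>C\<^esub> g = Idt C (Cod C f)"

definition is_iso :: "('o, 'a, 'm) category_scheme \<Rightarrow> 'a \<Rightarrow> bool" where
  "is_iso C f \<longleftrightarrow> (\<exists>g. inverse_arrows C f g)"

definition inv_arr :: "('o, 'a, 'm) category_scheme \<Rightarrow> 'a \<Rightarrow> 'a" where
  "inv_arr C f = (THE g. inverse_arrows C f g)"

definition isomorphic :: "('o, 'a, 'm) category_scheme \<Rightarrow> 'o \<Rightarrow> 'o \<Rightarrow> bool" where
  "isomorphic C x y \<longleftrightarrow> (\<exists>f \<in> hom C x y. is_iso C f)"

record ('o, 'a, 'p, 'b) func =
  FOb :: "'o \<Rightarrow> 'p"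
  FAr :: "'a \<Rightarrow> 'b"

locale cat_functor = C: category C + D: category D
  for C :: "('o, 'a, 'm) category_scheme" and D :: "('p, 'b, 'n) category_scheme" +
  fixes F :: "('o, 'a, 'p, 'b) func"
  assumes FOb_Obj: "x \<in> Obj C \<Longrightarrow> FOb F x \<in> Obj D"
    and FAr_hom: "f \<in> hom C x y \<Longrightarrow> FAr F f \<in> hom D (FOb F x) (FOb F y)"
    and FAr_Idt: "x \<in> Obj C \<Longrightarrow> FAr F (Idt C x) = Idt D (FOb F x)"
    and FAr_Cmp: "\<lbrakk>f \<in> hom C x y; g \<in> hom C y z\<rbrakk> \<Longrightarrow> FAr F (g \<bullet>\<^bsub>C\<^esub> f) = FAr F g \<bullet>\<^bsub>D\<^esub> FAr F f"

definition func_comp :: "('p, 'b, 'q, 'c) func \<Rightarrow> ('o, 'a, 'p, 'b) func \<Rightarrow> ('o, 'a, 'q, 'c) func" where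
  "func_comp G F = \<lparr>FOb = FOb G \<circ> FOb F, FAr = FAr G \<circ> FAr F\<rparr>"

locale nat_trans = F: cat_functor C D F + G: cat_functor C D G
  for C :: "('o, 'a, 'm) category_scheme" and D :: "('p, 'b, 'n) category_scheme"
    and F :: "('o, 'a, 'p, 'b) func" and G :: "('o, 'a, 'p, 'b) func" +
  fixes \<tau> :: "'o \<Rightarrow> 'b"
  assumes component_hom: "x \<in> Obj C \<Longrightarrow> \<tau> x \<in> hom D (FOb F x) (FOb G x)"
    and natural: "f \<in> hom C x y \<Longrightarrow> \<tau> y \<bullet>\<^bsub>D\<^esub> FAr F f = FAr G f \<bullet>\<^bsub>D\<^esub> \<tau> x"

definition naturally_isomorphic ::
  "('o, 'a, 'm) category_scheme \<Rightarrow> ('p, 'b, 'n) category_scheme \<Rightarrow>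
   ('o, 'a, 'p, 'b) func \<Rightarrow> ('o, 'a, 'p, 'b) func \<Rightarrow> bool" where
  "naturally_isomorphic C D F G \<longleftrightarrow> (\<exists>\<tau>. nat_trans C D F G \<tau> \<and> (\<forall>x \<in> Obj C. is_iso D (\<tau> x)))"

definition is_cocone ::
  "('j, 'k, 'n) category_scheme \<Rightarrow> ('o, 'a, 'm) category_scheme \<Rightarrow> ('j, 'k, 'o, 'a) func \<Rightarrow>
   'o \<Rightarrow> ('j \<Rightarrow> 'a) \<Rightarrow> bool" where
  "is_cocone J C F c \<iota> \<longleftrightarrow> c \<in> Obj C \<and> (\<forall>j \<in> Obj J. \<iota> j \<in> hom C (FOb F j) c) \<and>
     (\<forall>f \<in> Arr J. \<iota> (Cod J f) \<bullet>\<^bsub>C\<^esub> FAr F f = \<iota> (Dom J f))"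

definition is_colimit ::
  "('j, 'k, 'n) category_scheme \<Rightarrow> ('o, 'a, 'm) category_scheme \<Rightarrow> ('j, 'k, 'o, 'a) func \<Rightarrow>
   'o \<Rightarrow> ('j \<Rightarrow> 'a) \<Rightarrow> bool" where
  "is_colimit J C F c \<iota> \<longleftrightarrow> is_cocone J C F c \<iota> \<and>
     (\<forall>d \<kappa>. is_cocone J C F d \<kappa> \<longrightarrow> (\<exists>!h. h \<in> hom C c d \<and> (\<forall>j \<in> Obj J. h \<bullet>\<^bsub>C\<^esub> \<iota> j = \<kappa> j)))"

definition is_cone ::
  "('j, 'k, 'n) category_scheme \<Rightarrow> ('o, 'a, 'm) category_scheme \<Rightarrow> ('j, 'k, 'o, 'a) func \<Rightarrow>
   'o \<Rightarrow> ('j \<Rightarrow> 'a) \<Rightarrow> bool" where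
  "is_cone J C F c \<iota> \<longleftrightarrow> c \<in> Obj C \<and> (\<forall>j \<in> Obj J. \<iota> j \<in> hom C c (FOb F j)) \<and>
     (\<forall>f \<in> Arr J. FAr F f \<bullet>\<^bsub>C\<^esub> \<iota> (Dom J f) = \<iota> (Cod J f))"

definition is_limit ::
  "('j, 'k, 'n) category_scheme \<Rightarrow> ('o, 'a, 'm) category_scheme \<Rightarrow> ('j, 'k, 'o, 'a) func \<Rightarrow>
   'o \<Rightarrow> ('j \<Rightarrow> 'a) \<Rightarrow> bool" where
  "is_limit J C F c \<iota> \<longleftrightarrow> is_cone J C F c \<iota> \<and>
     (\<forall>d \<kappa>. is_cone J C F d \<kappa> \<longrightarrow> (\<exists>!h. h \<in> hom C d c \<and> (\<forall>j \<in> Obj J. \<iota> j \<bullet>\<^bsub>C\<^esub> h = \<kappa> j)))"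

text \<open>
  Smallness is measured by a type \<open>'u\<close>: small sets are sets of elements of \<open>'u\<close>, and small
  categories have their objects and arrows in \<open>'u\<close>.  Hom-sets of the ambient categories are not
  required to be small, so no inaccessibility of \<open>'u\<close> is needed.
\<close>

definition cocomplete :: "'u itself \<Rightarrow> ('o, 'a, 'm) category_scheme \<Rightarrow> bool" where
  "cocomplete U C \<longleftrightarrow> (\<forall>(J :: ('u, 'u) category) F.
     category J \<and> cat_functor J C F \<longrightarrow> (\<exists>c \<iota>. is_colimit J C F c \<iota>))"

definition preserves_colimits ::
  "'u itself \<Rightarrow> ('o, 'a, 'm) category_scheme \<Rightarrow> ('p, 'b, 'n) category_scheme \<Rightarrow>
   ('o, 'a, 'p, 'b) func \<Rightarrow> bool" where
  "preserves_colimits U C D G \<longleftrightarrow> (\<forall>(J :: ('u, 'u) category) F c \<iota>.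
     category J \<and> cat_functor J C F \<and> is_colimit J C F c \<iota> \<longrightarrow>
       is_colimit J D (func_comp G F) (FOb G c) (\<lambda>j. FAr G (\<iota> j)))"

definition finitely_complete :: "('o, 'a, 'm) category_scheme \<Rightarrow> bool" where
  "finitely_complete C \<longleftrightarrow> (\<forall>(J :: (nat, nat) category) F.
     category J \<and> finite (Obj J) \<and> finite (Arr J) \<and> cat_functor J C F \<longrightarrow> (\<exists>c \<iota>. is_limit J C F c \<iota>))"

definition is_initial :: "('o, 'a, 'm) category_scheme \<Rightarrow> 'o \<Rightarrow> bool" where
  "is_initial C z \<longleftrightarrow> z \<in> Obj C \<and> (\<forall>x \<in> Obj C. \<exists>!f. f \<in> hom C z x)"

definition initial_obj :: "('o, 'a, 'm) category_scheme \<Rightarrow> 'o" where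
  "initial_obj C = (SOME z. is_initial C z)"

definition is_coproduct ::
  "('o, 'a, 'm) category_scheme \<Rightarrow> 'i set \<Rightarrow> ('i \<Rightarrow> 'o) \<Rightarrow> 'o \<Rightarrow> ('i \<Rightarrow> 'a) \<Rightarrow> bool" where
  "is_coproduct C S X c \<iota> \<longleftrightarrow> c \<in> Obj C \<and> (\<forall>s \<in> S. \<iota> s \<in> hom C (X s) c) \<and>
     (\<forall>d \<kappa>. d \<in> Obj C \<and> (\<forall>s \<in> S. \<kappa> s \<in> hom C (X s) d) \<longrightarrow>
        (\<exists>!h. h \<in> hom C c d \<and> (\<forall>s \<in> S. h \<bullet>\<^bsub>C\<^esub> \<iota> s = \<kappa> s)))"

definition coproduct_obj :: "('o, 'a, 'm) category_scheme \<Rightarrow> 'i set \<Rightarrow> ('i \<Rightarrow> 'o) \<Rightarrow> 'o" where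
  "coproduct_obj C S X = (SOME c. \<exists>\<iota>. is_coproduct C S X c \<iota>)"

definition is_left_kan_extension ::
  "('o, 'a, 'm) category_scheme \<Rightarrow> ('p, 'b, 'n) category_scheme \<Rightarrow> ('q, 'c, 'l) category_scheme \<Rightarrow>
   ('o, 'a, 'p, 'b) func \<Rightarrow> ('o, 'a, 'q, 'c) func \<Rightarrow> ('p, 'b, 'q, 'c) func \<Rightarrow> ('o \<Rightarrow> 'c) \<Rightarrow> bool" where
  "is_left_kan_extension C D E I F L \<alpha> \<longleftrightarrow>
     cat_functor C D I \<and> cat_functor D E L \<and> nat_trans C E F (func_comp L I) \<alpha> \<and>
     (\<forall>G \<beta>. cat_functor D E G \<and> nat_trans C E F (func_comp G I) \<beta> \<longrightarrow>
        (\<exists>!\<gamma>. \<gamma> \<in> extensional (Obj D) \<and> nat_trans D E L G \<gamma> \<and>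
              (\<forall>x \<in> Obj C. \<beta> x = \<gamma> (FOb I x) \<bullet>\<^bsub>E\<^esub> \<alpha> x)))"


section \<open>Monoidal and symmetric monoidal closed categories\<close>

record ('o, 'a) monoidal = "('o, 'a) category" +
  TensO :: "'o \<Rightarrow> 'o \<Rightarrow> 'o"  (infixr "\<otimes>\<index>" 80)
  TensA :: "'a \<Rightarrow> 'a \<Rightarrow> 'a"  (infixr "\<odot>\<index>" 80)
  Unt :: 'o
  Asc :: "'o \<Rightarrow> 'o \<Rightarrow> 'o \<Rightarrow> 'a"
  LUn :: "'o \<Rightarrow> 'a"
  RUn :: "'o \<Rightarrow> 'a"

definition pentagon :: "('o, 'a, 'm) monoidal_scheme \<Rightarrow> bool" where
  "pentagon M \<longleftrightarrow> (\<forall>w \<in> Obj M. \<forall>x \<in> Obj M. \<forall>y \<in> Obj M. \<forall>z \<in> Obj M.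
     (Idt M w \<odot>\<^bsub>M\<^esub> Asc M x y z) \<bullet>\<^bsub>M\<^esub> Asc M w (x \<otimes>\<^bsub>M\<^esub> y) z \<bullet>\<^bsub>M\<^esub> (Asc M w x y \<odot>\<^bsub>M\<^esub> Idt M z)
     = Asc M w x (y \<otimes>\<^bsub>M\<^esub> z) \<bullet>\<^bsub>M\<^esub> Asc M (w \<otimes>\<^bsub>M\<^esub> x) y z)"

definition triangle :: "('o, 'a, 'm) monoidal_scheme \<Rightarrow> bool" where
  "triangle M \<longleftrightarrow> (\<forall>x \<in> Obj M. \<forall>y \<in> Obj M.
     (Idt M x \<odot>\<^bsub>M\<^esub> LUn M y) \<bullet>\<^bsub>M\<^esub> Asc M x (Unt M) y = RUn M x \<odot>\<^bsub>M\<^esub> Idt M y)"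

locale monoidal_category = category M for M :: "('o, 'a, 'm) monoidal_scheme" (structure) +
  assumes TensO_Obj: "\<lbrakk>x \<in> Obj M; y \<in> Obj M\<rbrakk> \<Longrightarrow> x \<otimes> y \<in> Obj M"
    and TensA_hom: "\<lbrakk>f \<in> hom M x x'; g \<in> hom M y y'\<rbrakk> \<Longrightarrow> f \<odot> g \<in> hom M (x \<otimes> y) (x' \<otimes> y')"
    and TensA_Idt: "\<lbrakk>x \<in> Obj M; y \<in> Obj M\<rbrakk> \<Longrightarrow> Idt M x \<odot> Idt M y = Idt M (x \<otimes> y)"
    and TensA_Cmp: "\<lbrakk>f \<in> hom M x x'; f' \<in> hom M x' x''; g \<in> hom M y y'; g' \<in> hom M y' y''\<rbrakk>
      \<Longrightarrow> (f' \<bullet> f) \<odot> (g' \<bullet> g) = (f' \<odot> g') \<bullet> (f \<odot> g)"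
    and Unt_Obj: "Unt M \<in> Obj M"
    and Asc_hom: "\<lbrakk>x \<in> Obj M; y \<in> Obj M; z \<in> Obj M\<rbrakk> \<Longrightarrow> Asc M x y z \<in> hom M ((x \<otimes> y) \<otimes> z) (x \<otimes> (y \<otimes> z))"
    and Asc_iso: "\<lbrakk>x \<in> Obj M; y \<in> Obj M; z \<in> Obj M\<rbrakk> \<Longrightarrow> is_iso M (Asc M x y z)"
    and Asc_natural: "\<lbrakk>f \<in> hom M x x'; g \<in> hom M y y'; h \<in> hom M z z'\<rbrakk>
      \<Longrightarrow> Asc M x' y' z' \<bullet> ((f \<odot> g) \<odot> h) = (f \<odot> (g \<odot> h)) \<bullet> Asc M x y z"
    and LUn_hom: "x \<in> Obj M \<Longrightarrow> LUn M x \<in> hom M (Unt M \<otimes> x) x"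
    and LUn_iso: "x \<in> Obj M \<Longrightarrow> is_iso M (LUn M x)"
    and LUn_natural: "f \<in> hom M x y \<Longrightarrow> LUn M y \<bullet> (Idt M (Unt M) \<odot> f) = f \<bullet> LUn M x"
    and RUn_hom: "x \<in> Obj M \<Longrightarrow> RUn M x \<in> hom M (x \<otimes> Unt M) x"
    and RUn_iso: "x \<in> Obj M \<Longrightarrow> is_iso M (RUn M x)"
    and RUn_natural: "f \<in> hom M x y \<Longrightarrow> RUn M y \<bullet> (f \<odot> Idt M (Unt M)) = f \<bullet> RUn M x"
    and pentagon: "pentagon M"
    and triangle: "triangle M"

locale strong_monoidal_functor =
  M: monoidal_category M + N: monoidal_category N + cat_functor M N F
  for M :: "('o, 'a, 'm) monoidal_scheme" and N :: "('p, 'b, 'n) monoidal_scheme"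
    and F :: "('o, 'a, 'p, 'b) func" +
  fixes \<mu> :: "'o \<Rightarrow> 'o \<Rightarrow> 'b" and \<epsilon> :: 'b
  assumes mult_hom: "\<lbrakk>x \<in> Obj M; y \<in> Obj M\<rbrakk>
      \<Longrightarrow> \<mu> x y \<in> hom N (FOb F x \<otimes>\<^bsub>N\<^esub> FOb F y) (FOb F (x \<otimes>\<^bsub>M\<^esub> y))"
    and mult_iso: "\<lbrakk>x \<in> Obj M; y \<in> Obj M\<rbrakk> \<Longrightarrow> is_iso N (\<mu> x y)"
    and mult_natural: "\<lbrakk>f \<in> hom M x x'; g \<in> hom M y y'\<rbrakk>
      \<Longrightarrow> \<mu> x' y' \<bullet>\<^bsub>N\<^esub> (FAr F f \<odot>\<^bsub>N\<^esub> FAr F g) = FAr F (f \<odot>\<^bsub>M\<^esub> g) \<bullet>\<^bsub>N\<^esub> \<mu> x y"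
    and unit_hom: "\<epsilon> \<in> hom N (Unt N) (FOb F (Unt M))"
    and unit_iso: "is_iso N \<epsilon>"
    and mult_assoc: "\<lbrakk>x \<in> Obj M; y \<in> Obj M; z \<in> Obj M\<rbrakk>
      \<Longrightarrow> FAr F (Asc M x y z) \<bullet>\<^bsub>N\<^esub> \<mu> (x \<otimes>\<^bsub>M\<^esub> y) z \<bullet>\<^bsub>N\<^esub> (\<mu> x y \<odot>\<^bsub>N\<^esub> Idt N (FOb F z))
        = \<mu> x (y \<otimes>\<^bsub>M\<^esub> z) \<bullet>\<^bsub>N\<^esub> (Idt N (FOb F x) \<odot>\<^bsub>N\<^esub> \<mu> y z) \<bullet>\<^bsub>N\<^esub> Asc N (FOb F x) (FOb F y) (FOb F z)"
    and unit_left: "x \<in> Obj M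
      \<Longrightarrow> FAr F (LUn M x) \<bullet>\<^bsub>N\<^esub> \<mu> (Unt M) x \<bullet>\<^bsub>N\<^esub> (\<epsilon> \<odot>\<^bsub>N\<^esub> Idt N (FOb F x)) = LUn N (FOb F x)"
    and unit_right: "x \<in> Obj M
      \<Longrightarrow> FAr F (RUn M x) \<bullet>\<^bsub>N\<^esub> \<mu> x (Unt M) \<bullet>\<^bsub>N\<^esub> (Idt N (FOb F x) \<odot>\<^bsub>N\<^esub> \<epsilon>) = RUn N (FOb F x)"

text \<open>\<open>IHom y z\<close> is the internal hom \<open>[y, z]\<close>, right adjoint to tensoring with \<open>y\<close> on the right.\<close>

record ('o, 'a) sym_closed = "('o, 'a) monoidal" +
  Swp :: "'o \<Rightarrow> 'o \<Rightarrow> 'a"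
  IHom :: "'o \<Rightarrow> 'o \<Rightarrow> 'o"
  Eval :: "'o \<Rightarrow> 'o \<Rightarrow> 'a"

locale sym_monoidal_closed_category = monoidal_category V
  for V :: "('o, 'a, 'm) sym_closed_scheme" (structure) +
  assumes Swp_hom: "\<lbrakk>x \<in> Obj V; y \<in> Obj V\<rbrakk> \<Longrightarrow> Swp V x y \<in> hom V (x \<otimes> y) (y \<otimes> x)"
    and Swp_natural: "\<lbrakk>f \<in> hom V x x'; g \<in> hom V y y'\<rbrakk>
      \<Longrightarrow> Swp V x' y' \<bullet> (f \<odot> g) = (g \<odot> f) \<bullet> Swp V x y"
    and Swp_Swp: "\<lbrakk>x \<in> Obj V; y \<in> Obj V\<rbrakk> \<Longrightarrow> Swp V y x \<bullet> Swp V x y = Idt V (x \<otimes> y)"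
    and hexagon: "\<lbrakk>x \<in> Obj V; y \<in> Obj V; z \<in> Obj V\<rbrakk>
      \<Longrightarrow> Asc V y z x \<bullet> Swp V x (y \<otimes> z) \<bullet> Asc V x y z
        = (Idt V y \<odot> Swp V x z) \<bullet> Asc V y x z \<bullet> (Swp V x y \<odot> Idt V z)"
    and IHom_Obj: "\<lbrakk>y \<in> Obj V; z \<in> Obj V\<rbrakk> \<Longrightarrow> IHom V y z \<in> Obj V"
    and Eval_hom: "\<lbrakk>y \<in> Obj V; z \<in> Obj V\<rbrakk> \<Longrightarrow> Eval V y z \<in> hom V (IHom V y z \<otimes> y) z"
    and Eval_universal: "\<lbrakk>x \<in> Obj V; y \<in> Obj V; z \<in> Obj V; f \<in> hom V (x \<otimes> y) z\<rbrakk>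
      \<Longrightarrow> \<exists>!g. g \<in> hom V x (IHom V y z) \<and> Eval V y z \<bullet> (g \<odot> Idt V y) = f"

definition transpose :: "('o, 'a, 'm) sym_closed_scheme \<Rightarrow> 'o \<Rightarrow> 'o \<Rightarrow> 'o \<Rightarrow> 'a \<Rightarrow> 'a" where
  "transpose V x y z f =
     (THE g. g \<in> hom V x (IHom V y z) \<and> Eval V y z \<bullet>\<^bsub>V\<^esub> (g \<odot>\<^bsub>V\<^esub> Idt V y) = f)"

text \<open>The copower \<open>F(S)\<close> of the unit.\<close>

definition free_obj :: "('o, 'a, 'm) monoidal_scheme \<Rightarrow> 'i set \<Rightarrow> 'o" where
  "free_obj V S = coproduct_obj V S (\<lambda>_. Unt V)"


section \<open>Enriched categories\<close>

text \<open>Composition is \<open>A(x,y) \<otimes> A(y,z) \<rightarrow> A(x,z)\<close>, in diagrammatic order.\<close>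

record ('k, 'o, 'a) ecat =
  EOb :: "'k set"
  EHom :: "'k \<Rightarrow> 'k \<Rightarrow> 'o"
  ECmp :: "'k \<Rightarrow> 'k \<Rightarrow> 'k \<Rightarrow> 'a"
  EId :: "'k \<Rightarrow> 'a"

locale enriched_category = M: monoidal_category M
  for M :: "('o, 'a, 'm) monoidal_scheme" (structure) +
  fixes A :: "('k, 'o, 'a, 'n) ecat_scheme"
  assumes EHom_Obj: "\<lbrakk>x \<in> EOb A; y \<in> EOb A\<rbrakk> \<Longrightarrow> EHom A x y \<in> Obj M"
    and ECmp_hom: "\<lbrakk>x \<in> EOb A; y \<in> EOb A; z \<in> EOb A\<rbrakk>
      \<Longrightarrow> ECmp A x y z \<in> hom M (EHom A x y \<otimes> EHom A y z) (EHom A x z)"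
    and EId_hom: "x \<in> EOb A \<Longrightarrow> EId A x \<in> hom M (Unt M) (EHom A x x)"
    and ECmp_assoc: "\<lbrakk>w \<in> EOb A; x \<in> EOb A; y \<in> EOb A; z \<in> EOb A\<rbrakk>
      \<Longrightarrow> ECmp A w y z \<bullet> (ECmp A w x y \<odot> Idt M (EHom A y z))
        = ECmp A w x z \<bullet> (Idt M (EHom A w x) \<odot> ECmp A x y z)
            \<bullet> Asc M (EHom A w x) (EHom A x y) (EHom A y z)"
    and EId_left: "\<lbrakk>x \<in> EOb A; y \<in> EOb A\<rbrakk>
      \<Longrightarrow> ECmp A x x y \<bullet> (EId A x \<odot> Idt M (EHom A x y)) = LUn M (EHom A x y)"
    and EId_right: "\<lbrakk>x \<in> EOb A; y \<in> EOb A\<rbrakk>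
      \<Longrightarrow> ECmp A x y y \<bullet> (Idt M (EHom A x y) \<odot> EId A y) = RUn M (EHom A x y)"

record ('k, 'l, 'a) efunc =
  EFO :: "'k \<Rightarrow> 'l"
  EFH :: "'k \<Rightarrow> 'k \<Rightarrow> 'a"

locale enriched_functor = A: enriched_category M A + B: enriched_category M B
  for M :: "('o, 'a, 'm) monoidal_scheme" (structure)
    and A :: "('k, 'o, 'a, 'n) ecat_scheme" and B :: "('l, 'o, 'a, 'p) ecat_scheme" +
  fixes F :: "('k, 'l, 'a) efunc"
  assumes EFO_EOb: "x \<in> EOb A \<Longrightarrow> EFO F x \<in> EOb B"
    and EFH_hom: "\<lbrakk>x \<in> EOb A; y \<in> EOb A\<rbrakk>
      \<Longrightarrow> EFH F x y \<in> hom M (EHom A x y) (EHom B (EFO F x) (EFO F y))"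
    and EFH_EId: "x \<in> EOb A \<Longrightarrow> EFH F x x \<bullet> EId A x = EId B (EFO F x)"
    and EFH_ECmp: "\<lbrakk>x \<in> EOb A; y \<in> EOb A; z \<in> EOb A\<rbrakk>
      \<Longrightarrow> EFH F x z \<bullet> ECmp A x y z
        = ECmp B (EFO F x) (EFO F y) (EFO F z) \<bullet> (EFH F x y \<odot> EFH F y z)"

definition efunc_id :: "('o, 'a, 'm) monoidal_scheme \<Rightarrow> ('k, 'o, 'a, 'n) ecat_scheme \<Rightarrow> ('k, 'k, 'a) efunc" where
  "efunc_id M A = \<lparr>EFO = (\<lambda>x. x), EFH = (\<lambda>x y. Idt M (EHom A x y))\<rparr>"

definition efunc_comp ::
  "('o, 'a, 'm) monoidal_scheme \<Rightarrow> ('l, 'r, 'a) efunc \<Rightarrow> ('k, 'l, 'a) efunc \<Rightarrow> ('k, 'r, 'a) efunc" where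
  "efunc_comp M G F = \<lparr>EFO = (\<lambda>x. EFO G (EFO F x)),
     EFH = (\<lambda>x y. EFH G (EFO F x) (EFO F y) \<bullet>\<^bsub>M\<^esub> EFH F x y)\<rparr>"

text \<open>
  To form sets of enriched functors, we normalise them to be \<open>undefined\<close> outside the objects of
  the domain, so that equality of records is equality of functors.
\<close>

definition efunc_restrict :: "'k set \<Rightarrow> ('k, 'l, 'a) efunc \<Rightarrow> ('k, 'l, 'a) efunc" where
  "efunc_restrict S F = \<lparr>EFO = (\<lambda>x \<in> S. EFO F x),
     EFH = (\<lambda>x y. if x \<in> S \<and> y \<in> S then EFH F x y else undefined)\<rparr>"

definition efunctors ::
  "('o, 'a, 'm) monoidal_scheme \<Rightarrow> ('k, 'o, 'a, 'n) ecat_scheme \<Rightarrow> ('l, 'o, 'a, 'p) ecat_scheme \<Rightarrow>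
   ('k, 'l, 'a) efunc set" where
  "efunctors M A B = {F. enriched_functor M A B F \<and> efunc_restrict (EOb A) F = F}"

text \<open>
  Arrows of the underlying category from \<open>x\<close> to \<open>y\<close> are the arrows \<open>f : I \<rightarrow> A(x,y)\<close>, tagged with
  \<open>x\<close> and \<open>y\<close>.
\<close>

definition underlying ::
  "('o, 'a, 'm) monoidal_scheme \<Rightarrow> ('k, 'o, 'a, 'n) ecat_scheme \<Rightarrow> ('k, 'k \<times> 'a \<times> 'k) category" where
  "underlying M A = \<lparr>
     Obj = EOb A,
     Arr = {(x, f, y). x \<in> EOb A \<and> y \<in> EOb A \<and> f \<in> hom M (Unt M) (EHom A x y)},
     Dom = (\<lambda>(x, f, y). x),
     Cod = (\<lambda>(x, f, y). y),
     Idt = (\<lambda>x. (x, EId A x, x)),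
     Cmp = (\<lambda>(y', g, z) (x, f, y). (x, ECmp A x y z \<bullet>\<^bsub>M\<^esub> (f \<odot>\<^bsub>M\<^esub> g) \<bullet>\<^bsub>M\<^esub> inv_arr M (LUn M (Unt M)), z))\<rparr>"

locale enriched_nat_iso = F: enriched_functor M A B F + G: enriched_functor M A B G
  for M :: "('o, 'a, 'm) monoidal_scheme" (structure)
    and A :: "('k, 'o, 'a, 'n) ecat_scheme" and B :: "('l, 'o, 'a, 'p) ecat_scheme"
    and F :: "('k, 'l, 'a) efunc" and G :: "('k, 'l, 'a) efunc" +
  fixes \<theta> :: "'k \<Rightarrow> 'a"
  assumes component_hom: "x \<in> EOb A \<Longrightarrow> \<theta> x \<in> hom M (Unt M) (EHom B (EFO F x) (EFO G x))"
    and natural: "\<lbrakk>x \<in> EOb A; y \<in> EOb A\<rbrakk>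
      \<Longrightarrow> ECmp B (EFO F x) (EFO F y) (EFO G y) \<bullet> (EFH F x y \<odot> \<theta> y) \<bullet> inv_arr M (RUn M (EHom A x y))
        = ECmp B (EFO F x) (EFO G x) (EFO G y) \<bullet> (\<theta> x \<odot> EFH G x y) \<bullet> inv_arr M (LUn M (EHom A x y))"
    and component_iso: "x \<in> EOb A \<Longrightarrow> is_iso (underlying M B) (EFO F x, \<theta> x, EFO G x)"

definition self_enriched :: "('o, 'a, 'm) sym_closed_scheme \<Rightarrow> ('o, 'o, 'a) ecat" where
  "self_enriched V = \<lparr>
     EOb = Obj V,
     EHom = IHom V,
     ECmp = (\<lambda>x y z. transpose V (IHom V x y \<otimes>\<^bsub>V\<^esub> IHom V y z) x z
       (Eval V y z \<bullet>\<^bsub>V\<^esub> (Idt V (IHom V y z) \<odot>\<^bsub>V\<^esub> Eval V x y) \<bullet>\<^bsub>V\<^esub> Asc V (IHom V y z) (IHom V x y) x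
          \<bullet>\<^bsub>V\<^esub> (Swp V (IHom V x y) (IHom V y z) \<odot>\<^bsub>V\<^esub> Idt V x))),
     EId = (\<lambda>x. transpose V (Unt V) x x (LUn V x))\<rparr>"

text \<open>The functor from the underlying category to \<open>V\<close> induced by a \<open>V\<close>-functor into \<open>V\<close>.\<close>

definition underlying_functor ::
  "('o, 'a, 'm) sym_closed_scheme \<Rightarrow> ('k, 'o, 'a) efunc \<Rightarrow> ('k, 'k \<times> 'a \<times> 'k, 'o, 'a) func" where
  "underlying_functor V P = \<lparr>
     FOb = EFO P,
     FAr = (\<lambda>(x, f, y). Eval V (EFO P x) (EFO P y) \<bullet>\<^bsub>V\<^esub> ((EFH P x y \<bullet>\<^bsub>V\<^esub> f) \<odot>\<^bsub>V\<^esub> Idt V (EFO P x))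
              \<bullet>\<^bsub>V\<^esub> inv_arr V (LUn V (EFO P x)))\<rparr>"


subsection \<open>Tensor products of \<open>V\<close>-categories\<close>

definition middle_four :: "('o, 'a, 'm) sym_closed_scheme \<Rightarrow> 'o \<Rightarrow> 'o \<Rightarrow> 'o \<Rightarrow> 'o \<Rightarrow> 'a" where
  "middle_four V a b c d = inv_arr V (Asc V a c (b \<otimes>\<^bsub>V\<^esub> d))
     \<bullet>\<^bsub>V\<^esub> (Idt V a \<odot>\<^bsub>V\<^esub> (Asc V c b d \<bullet>\<^bsub>V\<^esub> (Swp V b c \<odot>\<^bsub>V\<^esub> Idt V d) \<bullet>\<^bsub>V\<^esub> inv_arr V (Asc V b c d)))
     \<bullet>\<^bsub>V\<^esub> Asc V a b (c \<otimes>\<^bsub>V\<^esub> d)"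

definition ecat_prod ::
  "('o, 'a, 'm) sym_closed_scheme \<Rightarrow> ('k, 'o, 'a, 'n) ecat_scheme \<Rightarrow> ('l, 'o, 'a, 'p) ecat_scheme \<Rightarrow>
   ('k \<times> 'l, 'o, 'a) ecat" where
  "ecat_prod V A B = \<lparr>
     EOb = EOb A \<times> EOb B,
     EHom = (\<lambda>(x, y) (x', y'). EHom A x x' \<otimes>\<^bsub>V\<^esub> EHom B y y'),
     ECmp = (\<lambda>(x, y) (x', y') (x'', y''). (ECmp A x x' x'' \<odot>\<^bsub>V\<^esub> ECmp B y y' y'')
       \<bullet>\<^bsub>V\<^esub> middle_four V (EHom A x x') (EHom B y y') (EHom A x' x'') (EHom B y' y'')),
     EId = (\<lambda>(x, y). (EId A x \<odot>\<^bsub>V\<^esub> EId B y) \<bullet>\<^bsub>V\<^esub> inv_arr V (LUn V (Unt V)))\<rparr>"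

definition efunc_prod ::
  "('o, 'a, 'm) monoidal_scheme \<Rightarrow> ('k, 'l, 'a) efunc \<Rightarrow> ('k', 'l', 'a) efunc \<Rightarrow> ('k \<times> 'k', 'l \<times> 'l', 'a) efunc" where
  "efunc_prod V F G = \<lparr>EFO = (\<lambda>(x, y). (EFO F x, EFO G y)),
     EFH = (\<lambda>(x, y) (x', y'). EFH F x x' \<odot>\<^bsub>V\<^esub> EFH G y y')\<rparr>"

definition efunc_asc ::
  "('o, 'a, 'm) monoidal_scheme \<Rightarrow> ('k, 'o, 'a, 'n) ecat_scheme \<Rightarrow> ('l, 'o, 'a, 'p) ecat_scheme \<Rightarrow>
   ('r, 'o, 'a, 'q) ecat_scheme \<Rightarrow> (('k \<times> 'l) \<times> 'r, 'k \<times> 'l \<times> 'r, 'a) efunc" where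
  "efunc_asc V A B C = \<lparr>EFO = (\<lambda>((x, y), z). (x, y, z)),
     EFH = (\<lambda>((x, y), z) ((x', y'), z'). Asc V (EHom A x x') (EHom B y y') (EHom C z z'))\<rparr>"

text \<open>The \<open>V\<close>-functors \<open>x \<mapsto> (i, x)\<close> and \<open>x \<mapsto> (x, i)\<close>.\<close>

definition efunc_left ::
  "('o, 'a, 'm) monoidal_scheme \<Rightarrow> ('k, 'o, 'a, 'n) ecat_scheme \<Rightarrow> 'k \<Rightarrow> ('k, 'k \<times> 'k, 'a) efunc" where
  "efunc_left V A i = \<lparr>EFO = (\<lambda>x. (i, x)),
     EFH = (\<lambda>x y. (EId A i \<odot>\<^bsub>V\<^esub> Idt V (EHom A x y)) \<bullet>\<^bsub>V\<^esub> inv_arr V (LUn V (EHom A x y)))\<rparr>"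

definition efunc_right ::
  "('o, 'a, 'm) monoidal_scheme \<Rightarrow> ('k, 'o, 'a, 'n) ecat_scheme \<Rightarrow> 'k \<Rightarrow> ('k, 'k \<times> 'k, 'a) efunc" where
  "efunc_right V A i = \<lparr>EFO = (\<lambda>x. (x, i)),
     EFH = (\<lambda>x y. (Idt V (EHom A x y) \<odot>\<^bsub>V\<^esub> EId A i) \<bullet>\<^bsub>V\<^esub> inv_arr V (RUn V (EHom A x y)))\<rparr>"


subsection \<open>Monoidal \<open>V\<close>-categories tensored over \<open>V\<close>\<close>

text \<open>
  \<open>Copow v x\<close> is the tensoring \<open>v \<cdot> x\<close>; the structural isomorphism
  \<open>W(v \<cdot> x, y) \<cong> [v, W(x, y)]\<close>, \<open>V\<close>-natural in \<open>y\<close>, is given by its unit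
  \<open>CopowUnit v x : v \<rightarrow> W(x, v \<cdot> x)\<close>.
\<close>

record ('w, 'o, 'a) monoidal_ecat = "('w, 'o, 'a) ecat" +
  WTens :: "('w \<times> 'w, 'w, 'a) efunc"
  WUnt :: 'w
  WAsc :: "'w \<Rightarrow> 'w \<Rightarrow> 'w \<Rightarrow> 'a"
  WLUn :: "'w \<Rightarrow> 'a"
  WRUn :: "'w \<Rightarrow> 'a"
  Copow :: "'o \<Rightarrow> 'w \<Rightarrow> 'w"
  CopowUnit :: "'o \<Rightarrow> 'w \<Rightarrow> 'a"

definition underlying_monoidal ::
  "('o, 'a, 'm) monoidal_scheme \<Rightarrow> ('w, 'o, 'a, 'n) monoidal_ecat_scheme \<Rightarrow> ('w, 'w \<times> 'a \<times> 'w) monoidal" where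
  "underlying_monoidal V W = \<lparr>
     Obj = Obj (underlying V W),
     Arr = Arr (underlying V W),
     Dom = Dom (underlying V W),
     Cod = Cod (underlying V W),
     Idt = Idt (underlying V W),
     Cmp = Cmp (underlying V W),
     TensO = (\<lambda>x y. EFO (WTens W) (x, y)),
     TensA = (\<lambda>(x, f, x') (y, g, y'). (EFO (WTens W) (x, y),
       EFH (WTens W) (x, y) (x', y') \<bullet>\<^bsub>V\<^esub> (f \<odot>\<^bsub>V\<^esub> g) \<bullet>\<^bsub>V\<^esub> inv_arr V (LUn V (Unt V)),
       EFO (WTens W) (x', y'))),
     Unt = WUnt W,
     Asc = (\<lambda>x y z. (EFO (WTens W) (EFO (WTens W) (x, y), z), WAsc W x y z,
       EFO (WTens W) (x, EFO (WTens W) (y, z)))),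
     LUn = (\<lambda>x. (EFO (WTens W) (WUnt W, x), WLUn W x, x)),
     RUn = (\<lambda>x. (EFO (WTens W) (x, WUnt W), WRUn W x, x))\<rparr>"

text \<open>
  Pseudomonoids in the monoidal 2-category of \<open>V\<close>-categories.
\<close>

locale monoidal_enriched_category =
  V: sym_monoidal_closed_category V + W: enriched_category V W +
  tens: enriched_functor V "ecat_prod V W W" W "WTens W"
  for V :: "('o, 'a, 'm) sym_closed_scheme" and W :: "('w, 'o, 'a, 'n) monoidal_ecat_scheme" +
  assumes WUnt_EOb: "WUnt W \<in> EOb W"
    and WAsc_nat_iso: "enriched_nat_iso V (ecat_prod V (ecat_prod V W W) W) W
      (efunc_comp V (WTens W) (efunc_prod V (WTens W) (efunc_id V W)))
      (efunc_comp V (WTens W) (efunc_comp V (efunc_prod V (efunc_id V W) (WTens W)) (efunc_asc V W W W)))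
      (\<lambda>((x, y), z). WAsc W x y z)"
    and WLUn_nat_iso: "enriched_nat_iso V W W
      (efunc_comp V (WTens W) (efunc_left V W (WUnt W))) (efunc_id V W) (WLUn W)"
    and WRUn_nat_iso: "enriched_nat_iso V W W
      (efunc_comp V (WTens W) (efunc_right V W (WUnt W))) (efunc_id V W) (WRUn W)"
    and W_pentagon: "pentagon (underlying_monoidal V W)"
    and W_triangle: "triangle (underlying_monoidal V W)"

definition copow_comparison ::
  "('o, 'a, 'm) sym_closed_scheme \<Rightarrow> ('w, 'o, 'a, 'n) monoidal_ecat_scheme \<Rightarrow> 'o \<Rightarrow> 'w \<Rightarrow> 'w \<Rightarrow> 'a" where
  "copow_comparison V W v x y = transpose V (EHom W (Copow W v x) y) v (EHom W x y)
     (ECmp W x (Copow W v x) y \<bullet>\<^bsub>V\<^esub> (CopowUnit W v x \<odot>\<^bsub>V\<^esub> Idt V (EHom W (Copow W v x) y))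
        \<bullet>\<^bsub>V\<^esub> Swp V (EHom W (Copow W v x) y) v)"

text \<open>The arrow \<open>v \<cdot> x \<rightarrow> y\<close> of the underlying category corresponding to \<open>g : v \<rightarrow> W(x, y)\<close>.\<close>

definition copow_transpose ::
  "('o, 'a, 'm) sym_closed_scheme \<Rightarrow> ('w, 'o, 'a, 'n) monoidal_ecat_scheme \<Rightarrow>
   'o \<Rightarrow> 'w \<Rightarrow> 'w \<Rightarrow> 'a \<Rightarrow> 'w \<times> 'a \<times> 'w" where
  "copow_transpose V W v x y g = (Copow W v x,
     (THE h. h \<in> hom V (Unt V) (EHom W (Copow W v x) y) \<and>
        ECmp W x (Copow W v x) y \<bullet>\<^bsub>V\<^esub> (CopowUnit W v x \<odot>\<^bsub>V\<^esub> h) \<bullet>\<^bsub>V\<^esub> inv_arr V (RUn V v) = g), y)"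

text \<open>The canonical arrow \<open>(v \<otimes> v') \<cdot> (x \<otimes> x') \<rightarrow> (v \<cdot> x) \<otimes> (v' \<cdot> x')\<close>.\<close>

definition copow_interchange ::
  "('o, 'a, 'm) sym_closed_scheme \<Rightarrow> ('w, 'o, 'a, 'n) monoidal_ecat_scheme \<Rightarrow>
   'o \<Rightarrow> 'o \<Rightarrow> 'w \<Rightarrow> 'w \<Rightarrow> 'w \<times> 'a \<times> 'w" where
  "copow_interchange V W v v' x x' = copow_transpose V W (v \<otimes>\<^bsub>V\<^esub> v')
     (EFO (WTens W) (x, x')) (EFO (WTens W) (Copow W v x, Copow W v' x'))
     (EFH (WTens W) (x, x') (Copow W v x, Copow W v' x') \<bullet>\<^bsub>V\<^esub> (CopowUnit W v x \<odot>\<^bsub>V\<^esub> CopowUnit W v' x'))"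

locale enrichment_base =
  V: sym_monoidal_closed_category V + W: monoidal_enriched_category V W
  for V :: "('o, 'a, 'm) sym_closed_scheme" and W :: "('w, 'o, 'a, 'n) monoidal_ecat_scheme" +
  fixes U :: "'u itself"
  assumes infinite_universe: "infinite (UNIV :: 'u set)"
    and V_cocomplete: "cocomplete U V"
    and V_finitely_complete: "finitely_complete V"
    and Copow_EOb: "\<lbrakk>v \<in> Obj V; x \<in> EOb W\<rbrakk> \<Longrightarrow> Copow W v x \<in> EOb W"
    and CopowUnit_hom: "\<lbrakk>v \<in> Obj V; x \<in> EOb W\<rbrakk> \<Longrightarrow> CopowUnit W v x \<in> hom V v (EHom W x (Copow W v x))"
    and copow_comparison_iso: "\<lbrakk>v \<in> Obj V; x \<in> EOb W; y \<in> EOb W\<rbrakk> \<Longrightarrow> is_iso V (copow_comparison V W v x y)"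
    and W_cocomplete: "cocomplete U (underlying V W)"
    and tens_left_cocontinuous: "x \<in> EOb W \<Longrightarrow>
      preserves_colimits U (underlying V W) (underlying V W)
        \<lparr>FOb = (\<lambda>y. x \<otimes>\<^bsub>underlying_monoidal V W\<^esub> y),
         FAr = (\<lambda>f. Idt (underlying V W) x \<odot>\<^bsub>underlying_monoidal V W\<^esub> f)\<rparr>"
    and tens_right_cocontinuous: "x \<in> EOb W \<Longrightarrow>
      preserves_colimits U (underlying V W) (underlying V W)
        \<lparr>FOb = (\<lambda>y. y \<otimes>\<^bsub>underlying_monoidal V W\<^esub> x),
         FAr = (\<lambda>f. f \<odot>\<^bsub>underlying_monoidal V W\<^esub> Idt (underlying V W) x)\<rparr>"
    and copow_interchange_iso: "\<lbrakk>v \<in> Obj V; v' \<in> Obj V; x \<in> EOb W; x' \<in> EOb W\<rbrakk>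
      \<Longrightarrow> is_iso (underlying V W) (copow_interchange V W v v' x x')"

text \<open>The canonical arrow \<open>v \<otimes> P(x) \<rightarrow> P(v \<cdot> x)\<close> for a \<open>V\<close>-functor \<open>P\<close> into \<open>V\<close>.\<close>

definition copow_functor_comparison ::
  "('o, 'a, 'm) sym_closed_scheme \<Rightarrow> ('w, 'o, 'a, 'n) monoidal_ecat_scheme \<Rightarrow>
   ('w, 'o, 'a) efunc \<Rightarrow> 'o \<Rightarrow> 'w \<Rightarrow> 'a" where
  "copow_functor_comparison V W P v x = Eval V (EFO P x) (EFO P (Copow W v x))
     \<bullet>\<^bsub>V\<^esub> ((EFH P x (Copow W v x) \<bullet>\<^bsub>V\<^esub> CopowUnit W v x) \<odot>\<^bsub>V\<^esub> Idt V (EFO P x))"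

definition tensor_preserving ::
  "('o, 'a, 'm) sym_closed_scheme \<Rightarrow> ('w, 'o, 'a, 'n) monoidal_ecat_scheme \<Rightarrow> ('w, 'o, 'a) efunc \<Rightarrow> bool" where
  "tensor_preserving V W P \<longleftrightarrow>
     (\<forall>v \<in> Obj V. \<forall>x \<in> EOb W. is_iso V (copow_functor_comparison V W P v x))"


section \<open>Simplicial sets\<close>

text \<open>
  An arrow \<open>[m] \<rightarrow> [n]\<close> of the simplex category is a triple \<open>(m, f, n)\<close>.
\<close>

definition Delta :: "(nat, nat \<times> (nat \<Rightarrow> nat) \<times> nat) category" where
  "Delta = \<lparr>
     Obj = UNIV,
     Arr = {(m, f, n). f \<in> {0..m} \<rightarrow>\<^sub>E {0..n} \<and> mono_on {0..m} f},
     Dom = (\<lambda>(m, f, n). m),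
     Cod = (\<lambda>(m, f, n). n),
     Idt = (\<lambda>n. (n, \<lambda>i \<in> {0..n}. i, n)),
     Cmp = (\<lambda>(n', g, p) (m, f, n). (m, compose {0..m} g f, p))\<rparr>"

record 'x sset =
  Sim :: "nat \<Rightarrow> 'x set"
  Act :: "nat \<times> (nat \<Rightarrow> nat) \<times> nat \<Rightarrow> 'x \<Rightarrow> 'x"

locale simplicial_set =
  fixes K :: "'x sset"
  assumes Act_Sim: "\<lbrakk>\<phi> \<in> hom Delta m n; x \<in> Sim K n\<rbrakk> \<Longrightarrow> Act K \<phi> x \<in> Sim K m"
    and Act_Idt: "x \<in> Sim K n \<Longrightarrow> Act K (Idt Delta n) x = x"
    and Act_Cmp: "\<lbrakk>\<phi> \<in> hom Delta m n; \<psi> \<in> hom Delta n p; x \<in> Sim K p\<rbrakk>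
      \<Longrightarrow> Act K (\<psi> \<bullet>\<^bsub>Delta\<^esub> \<phi>) x = Act K \<phi> (Act K \<psi> x)"

definition simplicial_maps :: "'x sset \<Rightarrow> 'y sset \<Rightarrow> (nat \<Rightarrow> 'x \<Rightarrow> 'y) set" where
  "simplicial_maps K L = {g. (\<forall>n. g n \<in> Sim K n \<rightarrow>\<^sub>E Sim L n) \<and>
     (\<forall>m n. \<forall>\<phi> \<in> hom Delta m n. \<forall>x \<in> Sim K n. g m (Act K \<phi> x) = Act L \<phi> (g n x))}"

definition degenerate :: "'x sset \<Rightarrow> nat \<Rightarrow> 'x \<Rightarrow> bool" where
  "degenerate K n x \<longleftrightarrow> (\<exists>m f y. m < n \<and> (n, f, m) \<in> Arr Delta \<and> f ` {0..n} = {0..m} \<and>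
     y \<in> Sim K m \<and> x = Act K (n, f, m) y)"


section \<open>Necklaces\<close>

type_synonym necklace = "nat set \<times> nat"

definition is_necklace :: "necklace \<Rightarrow> bool" where
  "is_necklace = (\<lambda>(T, p). {0, p} \<subseteq> T \<and> T \<subseteq> {0..p})"

text \<open>The wedge \<open>T \<or> U\<close>, on objects and on underlying maps.\<close>

definition wedge :: "necklace \<Rightarrow> necklace \<Rightarrow> necklace" where
  "wedge = (\<lambda>(T, p) (U, q). (T \<union> (+) p ` U, p + q))"

definition wedge_map :: "nat \<Rightarrow> nat \<Rightarrow> (nat \<Rightarrow> nat) \<Rightarrow> nat \<Rightarrow> (nat \<Rightarrow> nat) \<Rightarrow> nat \<Rightarrow> nat" where
  "wedge_map p q f p' g = (\<lambda>i \<in> {0..p + q}. if i \<le> p then f i else p' + g (i - p))"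

definition nec_id :: "necklace \<Rightarrow> necklace \<times> (nat \<Rightarrow> nat) \<times> necklace" where
  "nec_id = (\<lambda>(T, p). ((T, p), \<lambda>i \<in> {0..p}. i, (T, p)))"

text \<open>This monoidal category is strict.\<close>

definition Nec :: "(necklace, necklace \<times> (nat \<Rightarrow> nat) \<times> necklace) monoidal" where
  "Nec = \<lparr>
     Obj = {N. is_necklace N},
     Arr = {((T, p), f, (U, q)). is_necklace (T, p) \<and> is_necklace (U, q) \<and>
        f \<in> {0..p} \<rightarrow>\<^sub>E {0..q} \<and> mono_on {0..p} f \<and> f 0 = 0 \<and> f p = q \<and> U \<subseteq> f ` T},
     Dom = (\<lambda>(N, f, N'). N),
     Cod = (\<lambda>(N, f, N'). N'),
     Idt = nec_id,
     Cmp = (\<lambda>(N', g, N'') ((T, p), f, N). ((T, p), compose {0..p} g f, N'')),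
     TensO = wedge,
     TensA = (\<lambda>((T, p), f, (T', p')) ((U, q), g, (U', q')).
        (wedge (T, p) (U, q), wedge_map p q f p' g, wedge (T', p') (U', q'))),
     Unt = ({0}, 0),
     Asc = (\<lambda>N N' N''. nec_id (wedge N (wedge N' N''))),
     LUn = nec_id,
     RUn = nec_id\<rparr>"

text \<open>The wide subcategory of active surjective maps, and its inclusion.\<close>

definition Nec_minus :: "(necklace, necklace \<times> (nat \<Rightarrow> nat) \<times> necklace) category" where
  "Nec_minus = \<lparr>
     Obj = Obj Nec,
     Arr = {((T, p), f, (U, q)). ((T, p), f, (U, q)) \<in> Arr Nec \<and> f ` {0..p} = {0..q} \<and> f ` T = U},
     Dom = Dom Nec,
     Cod = Cod Nec,
     Idt = Idt Nec,
     Cmp = Cmp Nec\<rparr>"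

definition Nec_incl ::
  "(necklace, necklace \<times> (nat \<Rightarrow> nat) \<times> necklace, necklace, necklace \<times> (nat \<Rightarrow> nat) \<times> necklace) func" where
  "Nec_incl = \<lparr>FOb = (\<lambda>N. N), FAr = (\<lambda>f. f)\<rparr>"

definition simplex :: "nat \<Rightarrow> necklace" where
  "simplex n = ({0, n}, n)"

text \<open>
  For \<open>(T, p)\<close> and consecutive joints \<open>s < t\<close> in \<open>T\<close>, the bead between \<open>s\<close> and \<open>t\<close> is the face of
  the \<open>p\<close>-simplex on the vertices \<open>s, \<dots>, t\<close>.  The wedge of the beads is the union of these
  faces: the simplices \<open>[n] \<rightarrow> [p]\<close> whose image lies in a single bead.  Allowing \<open>s = t\<close> only
  adds something for the necklace \<open>({0}, 0)\<close>, which has no beads.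
\<close>

definition adjacent_joints :: "nat set \<Rightarrow> nat \<Rightarrow> nat \<Rightarrow> bool" where
  "adjacent_joints T s t \<longleftrightarrow> s \<in> T \<and> t \<in> T \<and> T \<inter> {s<..<t} = {}"

definition necklace_sset :: "necklace \<Rightarrow> (nat \<Rightarrow> nat) sset" where
  "necklace_sset = (\<lambda>(T, p). \<lparr>
     Sim = (\<lambda>n. {\<alpha> \<in> {0..n} \<rightarrow>\<^sub>E {0..p}. mono_on {0..n} \<alpha> \<and>
        (\<exists>s t. s \<le> t \<and> adjacent_joints T s t \<and> \<alpha> ` {0..n} \<subseteq> {s..t})}),
     Act = (\<lambda>(m, f, n) \<alpha>. compose {0..m} \<alpha> f)\<rparr>)"

text \<open>\<open>nondegenerate_maps K N a b\<close> is \<open>K\<^sup>n\<^sup>d\<^sub>N(a, b)\<close>.\<close>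

definition nondegenerate_maps ::
  "'x sset \<Rightarrow> necklace \<Rightarrow> 'x \<Rightarrow> 'x \<Rightarrow> (nat \<Rightarrow> (nat \<Rightarrow> nat) \<Rightarrow> 'x) set" where
  "nondegenerate_maps K = (\<lambda>(T, p) a b. {g \<in> simplicial_maps (necklace_sset (T, p)) K.
     g 0 (\<lambda>i \<in> {0..0}. 0) = a \<and> g 0 (\<lambda>i \<in> {0..0}. p) = b \<and>
     (\<forall>s t. s < t \<and> adjacent_joints T s t \<longrightarrow>
        \<not> degenerate K (t - s) (g (t - s) (\<lambda>k \<in> {0..t - s}. s + k)))})"


section \<open>The nerve generated by a strong monoidal functor on necklaces, and its left adjoint\<close>

text \<open>
  Throughout, \<open>D\<close> is a functor from \<open>Nec\<close> to the monoidal category \<open>M\<close> with monoidal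
  structure \<open>\<mu>\<close>, \<open>\<epsilon>\<close>.  When \<open>i > j\<close> or \<open>j > k\<close>, the arrow picked by \<open>THE\<close> is the unique
  one out of an initial object.
\<close>

definition nerve_diagram ::
  "('o, 'a, 'm) monoidal_scheme \<Rightarrow> (necklace, necklace \<times> (nat \<Rightarrow> nat) \<times> necklace, 'o, 'a) func \<Rightarrow>
   (necklace \<Rightarrow> necklace \<Rightarrow> 'a) \<Rightarrow> 'a \<Rightarrow> nat \<Rightarrow> (nat, 'o, 'a) ecat" where
  "nerve_diagram M D \<mu> \<epsilon> n =
     (let H = (\<lambda>i j. if i \<le> j then FOb D (simplex (j - i)) else initial_obj M) in \<lparr>
     EOb = {0..n},
     EHom = H,
     ECmp = (\<lambda>i j k. if i \<le> j \<and> j \<le> k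
       then FAr D (wedge (simplex (j - i)) (simplex (k - j)), \<lambda>l \<in> {0..k - i}. l, simplex (k - i))
              \<bullet>\<^bsub>M\<^esub> \<mu> (simplex (j - i)) (simplex (k - j))
       else (THE h. h \<in> hom M (H i j \<otimes>\<^bsub>M\<^esub> H j k) (H i k))),
     EId = (\<lambda>i. \<epsilon>)\<rparr>)"

definition nerve_diagram_map ::
  "('o, 'a, 'm) monoidal_scheme \<Rightarrow> (necklace, necklace \<times> (nat \<Rightarrow> nat) \<times> necklace, 'o, 'a) func \<Rightarrow>
   (necklace \<Rightarrow> necklace \<Rightarrow> 'a) \<Rightarrow> 'a \<Rightarrow> nat \<times> (nat \<Rightarrow> nat) \<times> nat \<Rightarrow> (nat, nat, 'a) efunc" where
  "nerve_diagram_map M D \<mu> \<epsilon> = (\<lambda>(m, f, n). \<lparr>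
     EFO = f,
     EFH = (\<lambda>i j. if i \<le> j
       then FAr D (simplex (j - i), \<lambda>k \<in> {0..j - i}. f (k + i) - f i, simplex (f j - f i))
       else (THE h. h \<in> hom M (EHom (nerve_diagram M D \<mu> \<epsilon> m) i j)
                              (EHom (nerve_diagram M D \<mu> \<epsilon> n) (f i) (f j))))\<rparr>)"

definition nerve ::
  "('o, 'a, 'm) monoidal_scheme \<Rightarrow> (necklace, necklace \<times> (nat \<Rightarrow> nat) \<times> necklace, 'o, 'a) func \<Rightarrow>
   (necklace \<Rightarrow> necklace \<Rightarrow> 'a) \<Rightarrow> 'a \<Rightarrow> ('k, 'o, 'a, 'n) ecat_scheme \<Rightarrow> (nat, 'k, 'a) efunc sset" where
  "nerve M D \<mu> \<epsilon> C = \<lparr>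
     Sim = (\<lambda>n. efunctors M (nerve_diagram M D \<mu> \<epsilon> n) C),
     Act = (\<lambda>(m, f, n) G. efunc_restrict {0..m} (efunc_comp M G (nerve_diagram_map M D \<mu> \<epsilon> (m, f, n))))\<rparr>"

text \<open>
  \<open>L\<close> is the value at \<open>K\<close> of the left adjoint of the nerve, with component \<open>\<eta>\<close> of the unit at
  \<open>K\<close>: every simplicial map from \<open>K\<close> to the nerve of a small \<open>M\<close>-category factors uniquely
  through the universal arrow \<open>\<eta>\<close>.  The left adjoint is normalised so that the objects of \<open>L\<close> are the
  vertices of \<open>K\<close>, the vertex \<open>x\<close> being the object picked out by \<open>\<eta> x\<close>.
\<close>

definition nerve_left_adjoint_at ::
  "('o, 'a, 'm) monoidal_scheme \<Rightarrow> (necklace, necklace \<times> (nat \<Rightarrow> nat) \<times> necklace, 'o, 'a) func \<Rightarrow>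
   (necklace \<Rightarrow> necklace \<Rightarrow> 'a) \<Rightarrow> 'a \<Rightarrow> 'u sset \<Rightarrow> ('u, 'o, 'a) ecat \<Rightarrow>
   (nat \<Rightarrow> 'u \<Rightarrow> (nat, 'u, 'a) efunc) \<Rightarrow> bool" where
  "nerve_left_adjoint_at M D \<mu> \<epsilon> K L \<eta> \<longleftrightarrow>
     enriched_category M L \<and> EOb L = Sim K 0 \<and>
     \<eta> \<in> simplicial_maps K (nerve M D \<mu> \<epsilon> L) \<and>
     (\<forall>x \<in> Sim K 0. EFO (\<eta> 0 x) 0 = x) \<and>
     (\<forall>(C :: ('u, 'o, 'a) ecat) g.
        enriched_category M C \<and> g \<in> simplicial_maps K (nerve M D \<mu> \<epsilon> C) \<longrightarrow>
        (\<exists>!G. G \<in> efunctors M L C \<and>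
           (\<forall>n. \<forall>x \<in> Sim K n. g n x = efunc_restrict {0..n} (efunc_comp M G (\<eta> n x)))))"

end

theory Submission
  imports Defs
begin

text \<open>
  The hom-object \<open>L(a, b)\<close> is the colimit of \<open>D(T)\<close> over all necklaces \<open>T \<rightarrow> K\<^sub>a\<^sub>,\<^sub>b\<close>: these
  colimits form an enriched category \<open>Free\<close> because \<open>D\<close> is strong monoidal and the tensor product
  preserves colimits, and the universal property of \<open>L\<close> produces mutually inverse functors between
  \<open>L\<close> and \<open>Free\<close>.  The one towards \<open>L\<close> sends a necklace to the composite of its beads.

  Applying \<open>\<pi>\<close> leaves a colimit of \<open>\<pi>D\<close>, the left Kan extension of \<open>D'\<close>.  Every necklace map factors
  uniquely as an active surjection followed by an injection, so this Kan extension is, at \<open>T\<close>, the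
  coproduct of \<open>D'(U)\<close> over injective maps \<open>U \<rightarrow> T\<close>.  By the Eilenberg--Zilber lemma every necklace in
  \<open>K\<close> factors uniquely through an active surjection onto a nondegenerate one, so a cocone amounts to
  an arbitrary family of arrows out of \<open>D'(U)\<close>, one for each nondegenerate necklace \<open>U \<rightarrow> K\<^sub>a\<^sub>,\<^sub>b\<close>.
\<close>


section \<open>Arrows, isomorphisms and uniqueness out of colimits\<close>

text \<open>\<open>Free\<close> can be compared with \<open>L\<close> because its objects are the
  vertices of \<open>K\<close>: it is one of the enriched categories with objects in
  \<open>'u\<close> over which the universal property ranges. The colimits defining it are indexed
  by categories of necklaces whose types have nothing to do with \<open>'u\<close>, so these have to
  be coded there. A bead of \<open>L\<close> is accessible only through the unit
  \<open>\<eta>\<close>, as a hom component of a functor out of \<Phi>(n). The composite of a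
  necklace is therefore built by recursion on its beads, whereas a necklace map may cut a necklace
  at any joint and may merge several beads into one. Naturality of the composite is reduced to maps
  between simplices, where it is naturality of \<open>\<eta>\<close>; to the map that merges two
  beads, where it is functoriality for composition; and to composites and wedges of maps already
  treated. Both factorisations have to be unique, not merely available: the arrows attached to an
  injective map, or to a degenerate necklace, are defined through them and would otherwise depend on
  choices.\<close>

lemma hom_iff: "f \<in> hom C x y \<longleftrightarrow> f \<in> Arr C \<and> Dom C f = x \<and> Cod C f = y"
  by (simp add: hom_def)

context category
begin

lemma Cmp_closed [simp]:
  assumes "f \<in> Arr C" "g \<in> Arr C" "Dom C g = Cod C f"
  shows "g \<bullet> f \<in> Arr C" "Dom C (g \<bullet> f) = Dom C f" "Cod C (g \<bullet> f) = Cod C g"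
  using Cmp_hom[of f "Dom C f" "Cod C f" g "Cod C g"] assms by (auto simp: hom_iff)

lemma Idt_closed [simp]:
  assumes "x \<in> Obj C"
  shows "Idt C x \<in> Arr C" "Dom C (Idt C x) = x" "Cod C (Idt C x) = x"
  using Idt_hom[OF assms] by (auto simp: hom_iff)

lemma Obj_closed [simp]: "f \<in> Arr C \<Longrightarrow> Dom C f \<in> Obj C" "f \<in> Arr C \<Longrightarrow> Cod C f \<in> Obj C"
  by (simp_all add: Dom_Obj Cod_Obj)

lemma Idt_Cmp [simp]: "f \<in> Arr C \<Longrightarrow> Cod C f = x \<Longrightarrow> Idt C x \<bullet> f = f"
  using Cmp_Idt_left[of f "Dom C f" x] by (simp add: hom_iff)

lemma Cmp_Idt [simp]: "f \<in> Arr C \<Longrightarrow> Dom C f = x \<Longrightarrow> f \<bullet> Idt C x = f"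
  using Cmp_Idt_right[of f x "Cod C f"] by (simp add: hom_iff)

lemma assoc:
  "f \<in> Arr C \<Longrightarrow> g \<in> Arr C \<Longrightarrow> h \<in> Arr C \<Longrightarrow> Dom C g = Cod C f \<Longrightarrow> Dom C h = Cod C g
    \<Longrightarrow> (h \<bullet> g) \<bullet> f = h \<bullet> (g \<bullet> f)"
  using Cmp_assoc[of f "Dom C f" "Cod C f" g "Cod C g" h "Cod C h"] by (simp add: hom_iff)

lemma hom_Obj: "f \<in> hom C x y \<Longrightarrow> x \<in> Obj C" "f \<in> hom C x y \<Longrightarrow> y \<in> Obj C"
  by (auto simp: hom_iff)

lemma inverse_arrows_unique:
  assumes "inverse_arrows C f g" "inverse_arrows C f h"
  shows "g = h"
proof -
  have t: "f \<in> Arr C" "g \<in> Arr C" "Dom C g = Cod C f" "Cod C g = Dom C f"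
    "h \<in> Arr C" "Dom C h = Cod C f" "Cod C h = Dom C f"
    "g \<bullet> f = Idt C (Dom C f)" "f \<bullet> h = Idt C (Cod C f)"
    using assms by (auto simp: inverse_arrows_def hom_iff)
  have "g = g \<bullet> (f \<bullet> h)" using t by simp
  also have "\<dots> = (g \<bullet> f) \<bullet> h" using t(1-7) by (simp add: assoc)
  also have "\<dots> = h" using t by simp
  finally show ?thesis .
qed

lemma inverse_inv_arr: "is_iso C f \<Longrightarrow> inverse_arrows C f (inv_arr C f)"
  unfolding is_iso_def inv_arr_def by (metis inverse_arrows_unique theI)

lemma inv_arr_closed [simp]:
  assumes "is_iso C f"
  shows "f \<in> Arr C" "inv_arr C f \<in> Arr C" "Dom C (inv_arr C f) = Cod C f" "Cod C (inv_arr C f) =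
    Dom C f"
    "inv_arr C f \<bullet> f = Idt C (Dom C f)" "f \<bullet> inv_arr C f = Idt C (Cod C f)"
  using inverse_inv_arr[OF assms] by (auto simp: inverse_arrows_def hom_iff)

lemma inv_arr_cancel [simp]:
  assumes "is_iso C f" "k \<in> Arr C"
  shows "Cod C k = Dom C f \<Longrightarrow> inv_arr C f \<bullet> (f \<bullet> k) = k"
    "Cod C k = Cod C f \<Longrightarrow> f \<bullet> (inv_arr C f \<bullet> k) = k"
  using assms by (simp_all add: assoc[symmetric])

lemma is_isoI:
  assumes "f \<in> hom C x y" "g \<in> hom C y x" "g \<bullet> f = Idt C x" "f \<bullet> g = Idt C y"
  shows "is_iso C f"
  using assms unfolding is_iso_def inverse_arrows_def hom_iff by auto

lemma is_iso_inv_arr: "is_iso C f \<Longrightarrow> is_iso C (inv_arr C f)"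
  by (rule is_isoI[of _ "Cod C f" "Dom C f" f]) (auto simp: hom_iff)

lemma is_iso_Idt [simp]: "x \<in> Obj C \<Longrightarrow> is_iso C (Idt C x)"
  by (rule is_isoI[of _ x x "Idt C x"]) (auto simp: hom_iff)

lemma iso_epi:
  assumes "is_iso C e" "f \<in> Arr C" "g \<in> Arr C" "Dom C f = Cod C e" "Dom C g = Cod C e"
    and "f \<bullet> e = g \<bullet> e"
  shows "f = g"
proof -
  have "(f \<bullet> e) \<bullet> inv_arr C e = (g \<bullet> e) \<bullet> inv_arr C e" using assms by simp
  then show ?thesis using assms(1-5) by (simp add: assoc)
qed

lemma initial_unique:
  assumes "is_initial C z" "f \<in> hom C z x" "g \<in> hom C z x"
  shows "f = g"
proof -
  have "x \<in> Obj C" using assms(2) by (auto simp: hom_iff)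
  then show ?thesis using assms unfolding is_initial_def by blast
qed

lemma initial_the: "is_initial C z \<Longrightarrow> x \<in> Obj C \<Longrightarrow> (THE f. f \<in> hom C z x) \<in> hom C z x"
  unfolding is_initial_def by (metis (no_types, lifting) theI)

section \<open>Coproducts of families of objects\<close>

lemma is_coproduct_ext:
  assumes "is_coproduct C S X c \<iota>" "h \<in> hom C c d" "h' \<in> hom C c d"
    and "\<And>s. s \<in> S \<Longrightarrow> h \<bullet> \<iota> s = h' \<bullet> \<iota> s"
  shows "h = h'"
proof -
  have d: "d \<in> Obj C" using assms(2) by (auto simp: hom_iff)
  have i: "\<iota> s \<in> hom C (X s) c" if "s \<in> S" for s using assms(1) that unfolding is_coproduct_def by blast
  have "\<forall>s \<in> S. h \<bullet> \<iota> s \<in> hom C (X s) d" using i assms(2) by (auto simp: hom_iff)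
  with d have "\<exists>!k. k \<in> hom C c d \<and> (\<forall>s \<in> S. k \<bullet> \<iota> s = h \<bullet> \<iota> s)"
    using assms(1)[unfolded is_coproduct_def]
      by (elim conjE allE[of _ d] allE[of _ "\<lambda>s. h \<bullet> \<iota> s"]) blast
  then show ?thesis using assms(2-4) by (metis (no_types, lifting))
qed

lemma is_coproduct_factor:
  assumes "is_coproduct C S X c \<iota>" "d \<in> Obj C" "\<And>s. s \<in> S \<Longrightarrow> \<kappa> s \<in> hom C (X s) d"
  shows "\<exists>h. h \<in> hom C c d \<and> (\<forall>s \<in> S. h \<bullet> \<iota> s = \<kappa> s)"
  using assms unfolding is_coproduct_def by blast

lemma is_coproduct_hom:
  assumes "is_coproduct C S X c \<iota>"
  shows "c \<in> Obj C" "s \<in> S \<Longrightarrow> \<iota> s \<in> hom C (X s) c"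
  using assms unfolding is_coproduct_def by blast+

lemma is_coproductI:
  assumes "c \<in> Obj C" "\<And>s. s \<in> S \<Longrightarrow> \<iota> s \<in> hom C (X s) c"
    and "\<And>d \<kappa>. d \<in> Obj C \<Longrightarrow> (\<And>s. s \<in> S \<Longrightarrow> \<kappa> s \<in> hom C (X s) d) \<Longrightarrow>
      \<exists>h. h \<in> hom C c d \<and> (\<forall>s \<in> S. h \<bullet> \<iota> s = \<kappa> s)"
    and "\<And>d h h'. h \<in> hom C c d \<Longrightarrow> h' \<in> hom C c d \<Longrightarrow> (\<And>s. s \<in> S \<Longrightarrow> h \<bullet> \<iota> s = h' \<bullet> \<iota> s) \<Longrightarrow> h = h'"
  shows "is_coproduct C S X c \<iota>"
  unfolding is_coproduct_def
proof (intro conjI allI impI ballI)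
  fix d \<kappa> assume A: "d \<in> Obj C \<and> (\<forall>s \<in> S. \<kappa> s \<in> hom C (X s) d)"
  then obtain h where "h \<in> hom C c d" "\<forall>s \<in> S. h \<bullet> \<iota> s = \<kappa> s" using assms(3)[of d \<kappa>] by blast
  then show "\<exists>!h. h \<in> hom C c d \<and> (\<forall>s \<in> S. h \<bullet> \<iota> s = \<kappa> s)"
    using assms(4)[of _ d] by (intro ex1I[of _ h]) auto
qed (use assms in auto)

text \<open>The index sets may have different types and are matched along a bijection. In the end
  this exchanges necklaces with a simplicial map for necklaces with a family of simplices.\<close>

lemma is_coproduct_iso:
  assumes c: "is_coproduct C S X c \<iota>" and d: "is_coproduct C S' X' d \<kappa>"
    and e: "bij_betw e S S'" "\<And>s. s \<in> S \<Longrightarrow> X' (e s) = X s"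
  shows "isomorphic C c d"
proof -
  define e' where "e' = inv_into S e"
  have e': "e' s \<in> S" "e (e' s) = s" if "s \<in> S'" for s
    using e(1) that unfolding e'_def by (auto simp: bij_betw_def f_inv_into_f inv_into_into)
  have e's: "e' (e s) = s" "e s \<in> S'" if "s \<in> S" for s
    using e(1) that unfolding e'_def by (auto simp: bij_betw_def)
  note ch = is_coproduct_hom[OF c] and dh = is_coproduct_hom[OF d]
  obtain h where h: "h \<in> hom C c d" "\<And>s. s \<in> S \<Longrightarrow> h \<bullet> \<iota> s = \<kappa> (e s)"
    using is_coproduct_factor[OF c dh(1), of "\<lambda>s. \<kappa> (e s)"] dh(2) e's(2) e(2) by metis
  have X: "X (e' s) = X' s" if "s \<in> S'" for s using e(2)[of "e' s"] e'[OF that] by simp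
  obtain k where k: "k \<in> hom C d c" "\<And>s. s \<in> S' \<Longrightarrow> k \<bullet> \<kappa> s = \<iota> (e' s)"
    using is_coproduct_factor[OF d ch(1), of "\<lambda>s. \<iota> (e' s)"] ch(2)[OF e'(1)] X by metis
  have "k \<bullet> h = Idt C c"
  proof (rule is_coproduct_ext[OF c])
    fix s assume s: "s \<in> S"
    have "(k \<bullet> h) \<bullet> \<iota> s = k \<bullet> (h \<bullet> \<iota> s)" using h k ch(2)[OF s] by (intro assoc) (auto simp: hom_iff)
    also have "\<dots> = \<iota> s" using h(2)[OF s] k(2)[of "e s"] e's[OF s] by simp
    finally show "(k \<bullet> h) \<bullet> \<iota> s = Idt C c \<bullet> \<iota> s" using ch(2)[OF s] by (simp add: hom_iff)
  qed (use h k ch in \<open>auto simp: hom_iff\<close>)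
  moreover have "h \<bullet> k = Idt C d"
  proof (rule is_coproduct_ext[OF d])
    fix s assume s: "s \<in> S'"
    have "(h \<bullet> k) \<bullet> \<kappa> s = h \<bullet> (k \<bullet> \<kappa> s)" using h k dh(2)[OF s] by (intro assoc) (auto simp: hom_iff)
    also have "\<dots> = \<kappa> s" using k(2)[OF s] h(2)[of "e' s"] e'[OF s] by simp
    finally show "(h \<bullet> k) \<bullet> \<kappa> s = Idt C d \<bullet> \<kappa> s" using dh(2)[OF s] by (simp add: hom_iff)
  qed (use h k dh in \<open>auto simp: hom_iff\<close>)
  ultimately show ?thesis unfolding isomorphic_def using is_isoI[OF h(1) k(1)] h(1) by blast
qed

end

section \<open>Functors, natural transformations and colimit cocones\<close>

declare (in cat_functor) FOb_Obj [simp]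

lemma (in cat_functor) FAr_closed [simp]:
  assumes "f \<in> Arr C"
  shows "FAr F f \<in> Arr D" "Dom D (FAr F f) = FOb F (Dom C f)" "Cod D (FAr F f) = FOb F (Cod C f)"
  using FAr_hom[of f "Dom C f" "Cod C f"] assms by (auto simp: hom_iff)

lemma (in cat_functor) FAr_Cmp_Arr:
  "f \<in> Arr C \<Longrightarrow> g \<in> Arr C \<Longrightarrow> Dom C g = Cod C f \<Longrightarrow> FAr F (g \<bullet>\<^bsub>C\<^esub> f) = FAr F g \<bullet>\<^bsub>D\<^esub> FAr F f"
  using FAr_Cmp[of f "Dom C f" "Cod C f" g "Cod C g"] by (simp add: hom_iff)


lemma (in nat_trans) component_closed [simp]:
  assumes "x \<in> Obj C"
  shows "\<tau> x \<in> Arr D" "Dom D (\<tau> x) = FOb F x" "Cod D (\<tau> x) = FOb G x"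
  using component_hom[OF assms] by (auto simp: hom_iff)

lemma (in nat_trans) natural_Arr:
  "f \<in> Arr C \<Longrightarrow> \<tau> (Cod C f) \<bullet>\<^bsub>D\<^esub> FAr F f = FAr G f \<bullet>\<^bsub>D\<^esub> \<tau> (Dom C f)"
  using natural[of f "Dom C f" "Cod C f"] by (simp add: hom_iff)

lemma func_comp_simps [simp]:
  "FOb (func_comp G F) x = FOb G (FOb F x)" "FAr (func_comp G F) f = FAr G (FAr F f)"
  by (simp_all add: func_comp_def)

lemma cat_functor_comp:
  assumes "cat_functor C D F" "cat_functor D E G"
  shows "cat_functor C E (func_comp G F)"
proof -
  interpret F: cat_functor C D F by fact
  interpret G: cat_functor D E G by fact
  show ?thesis
    by unfold_locales (auto simp: hom_iff F.FAr_Idt G.FAr_Idt F.FAr_Cmp_Arr G.FAr_Cmp_Arr)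
qed

lemma is_colimit_hom:
  assumes "is_colimit J C F c \<iota>"
  shows "c \<in> Obj C" "j \<in> Obj J \<Longrightarrow> \<iota> j \<in> hom C (FOb F j) c"
    "f \<in> Arr J \<Longrightarrow> \<iota> (Cod J f) \<bullet>\<^bsub>C\<^esub> FAr F f = \<iota> (Dom J f)"
  using assms unfolding is_colimit_def is_cocone_def by blast+

lemma is_colimit_factor:
  assumes "is_colimit J C F c \<iota>" "d \<in> Obj C" "\<And>j. j \<in> Obj J \<Longrightarrow> \<kappa> j \<in> hom C (FOb F j) d"
    "\<And>f. f \<in> Arr J \<Longrightarrow> \<kappa> (Cod J f) \<bullet>\<^bsub>C\<^esub> FAr F f = \<kappa> (Dom J f)"
  shows "\<exists>h. h \<in> hom C c d \<and> (\<forall>j \<in> Obj J. h \<bullet>\<^bsub>C\<^esub> \<iota> j = \<kappa> j)"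
proof -
  have "is_cocone J C F d \<kappa>" using assms(2-4) unfolding is_cocone_def by blast
  then show ?thesis using assms(1) unfolding is_colimit_def by blast
qed

lemma is_colimit_ext:
  assumes F: "cat_functor J C F" and c: "is_colimit J C F c \<iota>"
    and h: "h \<in> hom C c d" "h' \<in> hom C c d"
    and eq: "\<And>j. j \<in> Obj J \<Longrightarrow> h \<bullet>\<^bsub>C\<^esub> \<iota> j = h' \<bullet>\<^bsub>C\<^esub> \<iota> j"
  shows "h = h'"
proof -
  interpret F: cat_functor J C F by fact
  note ch = is_colimit_hom[OF c]
  have chA: "\<iota> j \<in> Arr C" "Dom C (\<iota> j) = FOb F j" "Cod C (\<iota> j) = c" if "j \<in> Obj J" for j
    using ch(2)[OF that] by (auto simp: hom_iff)
  have "is_cocone J C F d (\<lambda>j. h \<bullet>\<^bsub>C\<^esub> \<iota> j)"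
    unfolding is_cocone_def
  proof (intro conjI ballI)
    fix f assume f: "f \<in> Arr J"
    show "(h \<bullet>\<^bsub>C\<^esub> \<iota> (Cod J f)) \<bullet>\<^bsub>C\<^esub> FAr F f = h \<bullet>\<^bsub>C\<^esub> \<iota> (Dom J f)"
      using h f ch(3)[OF f] by (simp add: F.D.assoc hom_iff chA)
  qed (use h chA in \<open>auto simp: hom_iff\<close>)
  then have "\<exists>!k. k \<in> hom C c d \<and> (\<forall>j \<in> Obj J. k \<bullet>\<^bsub>C\<^esub> \<iota> j = h \<bullet>\<^bsub>C\<^esub> \<iota> j)"
    using c unfolding is_colimit_def by blast
  then show ?thesis using h eq by (metis (no_types, lifting))
qed

lemma is_colimitI:
  assumes "c \<in> Obj C" "\<And>j. j \<in> Obj J \<Longrightarrow> \<iota> j \<in> hom C (FOb F j) c"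
    "\<And>f. f \<in> Arr J \<Longrightarrow> \<iota> (Cod J f) \<bullet>\<^bsub>C\<^esub> FAr F f = \<iota> (Dom J f)"
    and "\<And>d \<kappa>. d \<in> Obj C \<Longrightarrow> (\<And>j. j \<in> Obj J \<Longrightarrow> \<kappa> j \<in> hom C (FOb F j) d) \<Longrightarrow>
      (\<And>f. f \<in> Arr J \<Longrightarrow> \<kappa> (Cod J f) \<bullet>\<^bsub>C\<^esub> FAr F f = \<kappa> (Dom J f)) \<Longrightarrow>
      \<exists>!h. h \<in> hom C c d \<and> (\<forall>j \<in> Obj J. h \<bullet>\<^bsub>C\<^esub> \<iota> j = \<kappa> j)"
  shows "is_colimit J C F c \<iota>"
  unfolding is_colimit_def is_cocone_def
  using assms by blast

text \<open>This moves the universal cocone from the chosen colimit \<open>FHom\<close> to the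
  hom-object of \<open>L\<close>, where its legs become the composites of beads.\<close>

lemma is_colimit_iso:
  assumes F: "cat_functor J C F" and c: "is_colimit J C F c \<iota>"
    and h: "h \<in> hom C c d" "h' \<in> hom C d c" "h' \<bullet>\<^bsub>C\<^esub> h = Idt C c" "h \<bullet>\<^bsub>C\<^esub> h' = Idt C d"
    and \<kappa>: "\<And>j. j \<in> Obj J \<Longrightarrow> \<kappa> j = h \<bullet>\<^bsub>C\<^esub> \<iota> j"
  shows "is_colimit J C F d \<kappa>"
proof -
  interpret F: cat_functor J C F by fact
  note ch = is_colimit_hom[OF c]
  have t [simp]: "h \<in> Arr C" "Dom C h = c" "Cod C h = d" "h' \<in> Arr C" "Dom C h' = d" "Cod C h' = c"
    using h by (auto simp: hom_iff)
  have chA [simp]: "\<iota> j \<in> Arr C" "Dom C (\<iota> j) = FOb F j" "Cod C (\<iota> j) = c" if "j \<in> Obj J" for j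
    using ch(2)[OF that] by (auto simp: hom_iff)
  have hh: "h' \<bullet>\<^bsub>C\<^esub> (h \<bullet>\<^bsub>C\<^esub> k) = k" if "k \<in> Arr C" "Cod C k = c" for k
    using that h(3) by (simp add: F.D.assoc[symmetric])
  show ?thesis
  proof (rule is_colimitI)
    show "d \<in> Obj C" using h F.D.hom_Obj by blast
    show "\<kappa> j \<in> hom C (FOb F j) d" if "j \<in> Obj J" for j using that \<kappa> by (simp add: hom_iff)
    show "\<kappa> (Cod J f) \<bullet>\<^bsub>C\<^esub> FAr F f = \<kappa> (Dom J f)" if "f \<in> Arr J" for f
      using that by (simp add: F.D.assoc ch \<kappa>)
    fix e \<kappa>' assume e: "e \<in> Obj C" "\<And>j. j \<in> Obj J \<Longrightarrow> \<kappa>' j \<in> hom C (FOb F j) e"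
      "\<And>f. f \<in> Arr J \<Longrightarrow> \<kappa>' (Cod J f) \<bullet>\<^bsub>C\<^esub> FAr F f = \<kappa>' (Dom J f)"
    obtain k where k: "k \<in> hom C c e" "\<forall>j\<in>Obj J. k \<bullet>\<^bsub>C\<^esub> \<iota> j = \<kappa>' j"
      using is_colimit_factor[OF c e] by blast
    show "\<exists>!h. h \<in> hom C d e \<and> (\<forall>j\<in>Obj J. h \<bullet>\<^bsub>C\<^esub> \<kappa> j = \<kappa>' j)"
    proof (rule ex1I[of _ "k \<bullet>\<^bsub>C\<^esub> h'"])
      show "k \<bullet>\<^bsub>C\<^esub> h' \<in> hom C d e \<and> (\<forall>j\<in>Obj J. (k \<bullet>\<^bsub>C\<^esub> h') \<bullet>\<^bsub>C\<^esub> \<kappa> j = \<kappa>' j)"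
        using k \<kappa> by (auto simp: hom_iff F.D.assoc hh)
      fix l assume l: "l \<in> hom C d e \<and> (\<forall>j\<in>Obj J. l \<bullet>\<^bsub>C\<^esub> \<kappa> j = \<kappa>' j)"
      have "l \<bullet>\<^bsub>C\<^esub> h = k"
      proof (rule is_colimit_ext[OF F c _ k(1)])
        show "l \<bullet>\<^bsub>C\<^esub> h \<in> hom C c e" using l by (auto simp: hom_iff)
        show "(l \<bullet>\<^bsub>C\<^esub> h) \<bullet>\<^bsub>C\<^esub> \<iota> j = k \<bullet>\<^bsub>C\<^esub> \<iota> j" if "j \<in> Obj J" for j
        proof -
          have "l \<bullet>\<^bsub>C\<^esub> (h \<bullet>\<^bsub>C\<^esub> \<iota> j) = \<kappa>' j" using l \<kappa>[OF that] that by metis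
          then show ?thesis using that l k(2) by (simp add: F.D.assoc hom_iff)
        qed
      qed
      then have "(l \<bullet>\<^bsub>C\<^esub> h) \<bullet>\<^bsub>C\<^esub> h' = k \<bullet>\<^bsub>C\<^esub> h'" by simp
      then show "l = k \<bullet>\<^bsub>C\<^esub> h'" using l h(4) by (simp add: F.D.assoc hom_iff)
    qed
  qed
qed


section \<open>Small indexing categories\<close>

text \<open>An injection into \<open>'u\<close> rather than membership in it, so that sets of
  necklaces, of necklace maps and of families count as small whatever their types.\<close>

definition small :: "'u itself \<Rightarrow> 'x set \<Rightarrow> bool" where
  "small U S \<longleftrightarrow> (\<exists>e :: 'x \<Rightarrow> 'u. inj_on e S)"

lemma small_inj:
  assumes "small U T" "inj_on f S" "f ` S \<subseteq> T"
  shows "small U S"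
  using assms unfolding small_def by (meson comp_inj_on inj_on_subset)

text \<open>An infinite type absorbs its own square and contains the natural numbers. A list is
  folded up by a pairing injection and stored together with its length, because the fold alone does
  not reveal where the list ends.\<close>

lemma small_lists:
  assumes inf: "infinite (UNIV :: 'u set)"
  shows "small (U :: 'u itself) (UNIV :: 'u list set)"
proof -
  obtain pr :: "'u \<times> 'u \<Rightarrow> 'u" where pr: "inj pr"
    using ordIso_imp_ordLeq[OF card_of_Times_same_infinite[OF inf]]
    unfolding card_of_ordLeq[symmetric] by auto
  obtain nu :: "nat \<Rightarrow> 'u" where nu: "inj nu"
    using inf unfolding infinite_iff_countable_subset by auto
  define enc where "enc = (\<lambda>xs. foldr (\<lambda>x c. pr (x, c)) xs (nu 0))"
  have enc: "length xs = length ys \<Longrightarrow> enc xs = enc ys \<Longrightarrow> xs = ys" for xs ys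
    unfolding enc_def by (induction rule: list_induct2) (use pr in \<open>auto dest: injD\<close>)
  have "inj (\<lambda>xs. pr (nu (length xs), enc xs))"
    by (rule injI) (use enc pr nu in \<open>simp add: inj_eq\<close>)
  then show ?thesis unfolding small_def by blast
qed

lemma small_nat: "infinite (UNIV :: 'u set) \<Longrightarrow> small (U :: 'u itself) (S :: nat set)"
  unfolding small_def infinite_iff_countable_subset by (meson inj_on_subset subset_UNIV)

lemma small_Times:
  assumes inf: "infinite (UNIV :: 'u set)" and "small (U :: 'u itself) S" "small U T"
  shows "small U (S \<times> T)"
proof -
  obtain e where e: "inj_on (e :: _ \<Rightarrow> 'u) S" using assms(2) unfolding small_def by blast
  obtain e' where e': "inj_on (e' :: _ \<Rightarrow> 'u) T" using assms(3) unfolding small_def by blast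
  show ?thesis
    by (rule small_inj[OF small_lists[OF inf], of "\<lambda>(x, y). [e x, e' y]"])
      (use e e' in \<open>auto intro!: inj_onI dest: inj_onD\<close>)
qed

text \<open>Cocompleteness and preservation of colimits speak only of index categories inside
  \<open>'u\<close>, so a category such as that of the necklaces in \<open>K\<close> has to be
  copied there along injections of its objects and arrows; \<open>d\<close> and \<open>d'\<close>
  decode.\<close>

definition transported ::
  "('j, 'k, 'n) category_scheme \<Rightarrow> ('j \<Rightarrow> 'u) \<Rightarrow> ('k \<Rightarrow> 'v) \<Rightarrow> ('u, 'v) category" where
  "transported J e e' = (let d' = inv_into (Arr J) e'; d = inv_into (Obj J) e in \<lparr>
     Obj = e ` Obj J, Arr = e' ` Arr J, Dom = e \<circ> Dom J \<circ> d', Cod = e \<circ> Cod J \<circ> d',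
     Idt = e' \<circ> Idt J \<circ> d, Cmp = (\<lambda>g f. e' (d' g \<bullet>\<^bsub>J\<^esub> d' f))\<rparr>)"

locale index_transport = F: cat_functor J C F
  for J :: "('j, 'k, 'n) category_scheme" and C :: "('o, 'a, 'm) category_scheme" and F +
  fixes e :: "'j \<Rightarrow> 'u" and e' :: "'k \<Rightarrow> 'v"
  assumes e: "inj_on e (Obj J)" and e': "inj_on e' (Arr J)"
begin

definition "F' = \<lparr>FOb = FOb F \<circ> inv_into (Obj J) e, FAr = FAr F \<circ> inv_into (Arr J) e'\<rparr>"

lemma sel [simp]:
  "Obj (transported J e e') = e ` Obj J" "Arr (transported J e e') = e' ` Arr J"
  "f \<in> Arr J \<Longrightarrow> Dom (transported J e e') (e' f) = e (Dom J f)"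
  "f \<in> Arr J \<Longrightarrow> Cod (transported J e e') (e' f) = e (Cod J f)"
  "x \<in> Obj J \<Longrightarrow> Idt (transported J e e') (e x) = e' (Idt J x)"
  "f \<in> Arr J \<Longrightarrow> g \<in> Arr J \<Longrightarrow> Cmp (transported J e e') (e' g) (e' f) = e' (g \<bullet>\<^bsub>J\<^esub> f)"
  "x \<in> Obj J \<Longrightarrow> FOb F' (e x) = FOb F x" "f \<in> Arr J \<Longrightarrow> FAr F' (e' f) = FAr F f"
  using e e' by (simp_all add: transported_def Let_def F'_def)

lemma e_eq [simp]: "x \<in> Obj J \<Longrightarrow> y \<in> Obj J \<Longrightarrow> e x = e y \<longleftrightarrow> x = y"
  using e by (auto dest: inj_onD)

sublocale T: category "transported J e e'"
  by unfold_locales (auto simp: hom_iff F.C.assoc)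

sublocale F': cat_functor "transported J e e'" C F'
  by unfold_locales (auto simp: hom_iff F.FAr_Idt F.FAr_Cmp_Arr)

lemma is_cocone_iff: "is_cocone (transported J e e') C F' c \<iota> \<longleftrightarrow> is_cocone J C F c (\<iota> \<circ> e)"
  unfolding is_cocone_def by simp

lemma is_colimit_iff: "is_colimit (transported J e e') C F' c \<iota> \<longleftrightarrow> is_colimit J C F c (\<iota> \<circ> e)"
proof
  assume A: "is_colimit (transported J e e') C F' c \<iota>"
  show "is_colimit J C F c (\<iota> \<circ> e)"
    unfolding is_colimit_def
  proof (intro conjI allI impI)
    show "is_cocone J C F c (\<iota> \<circ> e)" using A is_cocone_iff unfolding is_colimit_def by blast
    fix d \<kappa> assume k: "is_cocone J C F d \<kappa>"
    define \<kappa>' where "\<kappa>' = \<kappa> \<circ> inv_into (Obj J) e"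
    have k': "\<kappa>' (e x) = \<kappa> x" if "x \<in> Obj J" for x using that e by (simp add: \<kappa>'_def)
    have "is_cocone J C F d (\<kappa>' \<circ> e)" using k k' unfolding is_cocone_def by simp
    then have "is_cocone (transported J e e') C F' d \<kappa>'" by (simp add: is_cocone_iff)
    then have "\<exists>!h. h \<in> hom C c d \<and> (\<forall>j\<in>Obj (transported J e e'). h \<bullet>\<^bsub>C\<^esub> \<iota> j = \<kappa>' j)"
      using A unfolding is_colimit_def by blast
    then show "\<exists>!h. h \<in> hom C c d \<and> (\<forall>j\<in>Obj J. h \<bullet>\<^bsub>C\<^esub> (\<iota> \<circ> e) j = \<kappa> j)" by (simp add: k')
  qed
next
  assume A: "is_colimit J C F c (\<iota> \<circ> e)"
  show "is_colimit (transported J e e') C F' c \<iota>"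
    unfolding is_colimit_def is_cocone_iff
  proof (intro conjI allI impI)
    fix d \<kappa> assume "is_cocone J C F d (\<kappa> \<circ> e)"
    then have "\<exists>!h. h \<in> hom C c d \<and> (\<forall>j\<in>Obj J. h \<bullet>\<^bsub>C\<^esub> (\<iota> \<circ> e) j = (\<kappa> \<circ> e) j)"
      using A unfolding is_colimit_def by blast
    then show "\<exists>!h. h \<in> hom C c d \<and> (\<forall>j\<in>Obj (transported J e e'). h \<bullet>\<^bsub>C\<^esub> \<iota> j = \<kappa> j)" by simp
  qed (use A in \<open>simp add: is_colimit_def\<close>)
qed

end

lemma cocomplete_small:
  assumes "cocomplete (U :: 'u itself) C" "cat_functor J C F" "small U (Obj J)" "small U (Arr J)"
  shows "\<exists>c \<iota>. is_colimit J C F c \<iota>"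
proof -
  obtain e where e: "inj_on (e :: _ \<Rightarrow> 'u) (Obj J)" using assms(3) unfolding small_def by blast
  obtain e' where e': "inj_on (e' :: _ \<Rightarrow> 'u) (Arr J)" using assms(4) unfolding small_def by blast
  interpret F: cat_functor J C F by fact
  interpret index_transport J C F e e' by unfold_locales (use e e' in auto)
  show ?thesis using assms(1) T.category_axioms F'.cat_functor_axioms is_colimit_iff
    unfolding cocomplete_def by blast
qed

lemma preserves_small:
  assumes pr: "preserves_colimits (U :: 'u itself) C D G" and F: "cat_functor J C F"
    and GF: "cat_functor J D (func_comp G F)"
    and sm: "small U (Obj J)" "small U (Arr J)" and c: "is_colimit J C F c \<iota>"
  shows "is_colimit J D (func_comp G F) (FOb G c) (\<lambda>j. FAr G (\<iota> j))"
proof -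
  obtain e where e: "inj_on (e :: _ \<Rightarrow> 'u) (Obj J)" using sm(1) unfolding small_def by blast
  obtain e' where e': "inj_on (e' :: _ \<Rightarrow> 'u) (Arr J)" using sm(2) unfolding small_def by blast
  interpret F: cat_functor J C F by fact
  interpret GF: cat_functor J D "func_comp G F" by fact
  interpret tF: index_transport J C F e e' by unfold_locales (use e e' in auto)
  interpret tGF: index_transport J D "func_comp G F" e e' by unfold_locales (use e e' in auto)
  define d where "d = inv_into (Obj J) e"
  have d: "d (e x) = x" if "x \<in> Obj J" for x using that e by (simp add: d_def)
  have "is_colimit J C F c ((\<lambda>j. \<iota> (d j)) \<circ> e)"
    using c d unfolding is_colimit_def is_cocone_def by simp
  then have "is_colimit (transported J e e') C tF.F' c (\<lambda>j. \<iota> (d j))" by (simp add: tF.is_colimit_iff)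
  then have "is_colimit (transported J e e') D (func_comp G tF.F') (FOb G c) (\<lambda>j. FAr G (\<iota> (d j)))"
    using pr tF.T.category_axioms tF.F'.cat_functor_axioms unfolding preserves_colimits_def by blast
  \<comment> \<open>Renaming and then applying \<open>G\<close> is the same functor as applying
    \<open>G\<close> and then renaming, so the preserved colimit can be read back over
    \<open>J\<close>.\<close>
  moreover have "func_comp G tF.F' = tGF.F'"
    unfolding tF.F'_def tGF.F'_def by (simp add: func_comp_def comp_assoc)
  ultimately have "is_colimit J D (func_comp G F) (FOb G c) ((\<lambda>j. FAr G (\<iota> (d j))) \<circ> e)"
    by (simp add: tGF.is_colimit_iff)
  then show ?thesis using d unfolding is_colimit_def is_cocone_def by simp
qed

section \<open>Coproducts and initial objects as colimits over discrete categories\<close>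

definition discrete :: "'x set \<Rightarrow> ('x, 'x) category" where
  "discrete S = \<lparr>Obj = S, Arr = S, Dom = \<lambda>x. x, Cod = \<lambda>x. x, Idt = \<lambda>x. x, Cmp = \<lambda>g f. f\<rparr>"

lemma category_discrete: "category (discrete S)"
  by unfold_locales (auto simp: discrete_def hom_def)

lemma coproduct_exists:
  assumes "category C" "cocomplete (U :: 'u itself) C" "small U S" "\<And>s. s \<in> S \<Longrightarrow> X s \<in> Obj C"
  shows "\<exists>c \<iota>. is_coproduct C S X c \<iota>"
proof -
  interpret C: category C by fact
  interpret D: category "discrete S" by (rule category_discrete)
  let ?F = "\<lparr>FOb = X, FAr = \<lambda>s. Idt C (X s)\<rparr>"
  interpret F: cat_functor "discrete S" C ?F
    by unfold_locales (use assms(4) in \<open>auto simp: discrete_def hom_iff\<close>)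
  have sm: "small U (Obj (discrete S))" "small U (Arr (discrete S))"
    using assms(3) by (auto simp: discrete_def)
  obtain c \<iota> where c: "is_colimit (discrete S) C ?F c \<iota>"
    using cocomplete_small[OF assms(2) F.cat_functor_axioms sm] by blast
  have "is_coproduct C S X c \<iota>"
  proof (rule C.is_coproductI)
    note ch = is_colimit_hom[OF c]
    show "c \<in> Obj C" by (rule ch)
    show "\<iota> s \<in> hom C (X s) c" if "s \<in> S" for s using ch(2)[of s] that by (simp add: discrete_def)
    show "\<exists>h. h \<in> hom C c d \<and> (\<forall>s\<in>S. h \<bullet>\<^bsub>C\<^esub> \<iota> s = \<kappa> s)"
      if "d \<in> Obj C" "\<And>s. s \<in> S \<Longrightarrow> \<kappa> s \<in> hom C (X s) d" for d \<kappa>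
      using is_colimit_factor[OF c that(1), of \<kappa>] that(2) by (auto simp: discrete_def hom_iff)
    show "h = h'" if "h \<in> hom C c d" "h' \<in> hom C c d" "\<And>s. s \<in> S \<Longrightarrow> h \<bullet>\<^bsub>C\<^esub> \<iota> s = h' \<bullet>\<^bsub>C\<^esub> \<iota> s" for d h h'
      using is_colimit_ext[OF F.cat_functor_axioms c that(1,2)] that(3) by (auto simp: discrete_def)
  qed
  then show ?thesis by blast
qed

lemma coproduct_obj:
  assumes "category C" "cocomplete (U :: 'u itself) C" "small U S" "\<And>s. s \<in> S \<Longrightarrow> X s \<in> Obj C"
  shows "\<exists>\<iota>. is_coproduct C S X (coproduct_obj C S X) \<iota>"
  unfolding coproduct_obj_def by (rule someI_ex) (rule coproduct_exists[OF assms])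

lemma initial_obj:
  assumes "category C" "cocomplete (U :: 'u itself) C"
  shows "is_initial C (initial_obj C)"
proof -
  \<comment> \<open>An initial object is a coproduct of the empty family.\<close>
  have "\<exists>c \<iota>. is_coproduct C ({} :: nat set) undefined c \<iota>"
    by (rule coproduct_exists[OF assms]) (auto simp: small_def)
  then have "\<exists>z. z \<in> Obj C \<and> (\<forall>d. d \<in> Obj C \<longrightarrow> (\<exists>!h. h \<in> hom C z d))"
    unfolding is_coproduct_def by simp
  then have "\<exists>z. is_initial C z" unfolding is_initial_def by blast
  then show ?thesis unfolding initial_obj_def by (rule someI_ex)
qed

text \<open>An initial object is a colimit of the empty diagram. Applied to tensoring, this takes
  care of the hom-objects of \<Phi>(n) whose source lies above their target.\<close>

lemma preserves_initial:
  assumes "preserves_colimits (U :: 'u itself) C D G" "category C" "category D" "is_initial C z"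
  shows "is_initial D (FOb G z)"
proof -
  interpret C: category C by fact
  interpret D: category D by fact
  interpret J: category "discrete ({} :: nat set)" by (rule category_discrete)
  let ?J = "discrete ({} :: nat set)"
  have [simp]: "Obj ?J = {}" "Arr ?J = {}" by (simp_all add: discrete_def)
  have F: "cat_functor ?J C \<lparr>FOb = undefined, FAr = undefined\<rparr>"
    by unfold_locales (auto simp: hom_iff)
  interpret GF: cat_functor ?J D "func_comp G \<lparr>FOb = undefined, FAr = undefined\<rparr>"
    by unfold_locales (auto simp: hom_iff)
  have "is_colimit ?J C \<lparr>FOb = undefined, FAr = undefined\<rparr> z undefined"
    using assms(4) by (auto simp: is_colimit_def is_cocone_def is_initial_def)
  then have "is_colimit ?J D (func_comp G \<lparr>FOb = undefined, FAr =
    undefined\<rparr>) (FOb G z) (\<lambda>j. FAr G (undefined j))"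
    using preserves_small[OF assms(1) F GF.cat_functor_axioms] by (simp add: small_def)
  then show ?thesis by (auto simp: is_colimit_def is_cocone_def is_initial_def)
qed

section \<open>Monotone maps and the Eilenberg--Zilber lemma\<close>

lemma mono_on_initial_iff:
  fixes f :: "nat \<Rightarrow> nat"
  shows "mono_on {0..p} f \<longleftrightarrow> (\<forall>i j. i \<le> j \<longrightarrow> j \<le> p \<longrightarrow> f i \<le> f j)"
  by (fastforce simp: mono_on_def)

lemma mono_surj_ends:
  fixes e :: "nat \<Rightarrow> nat"
  assumes "mono_on {0..p} e" "e ` {0..p} = {0..z}"
  shows "e 0 = 0" "e p = z"
proof -
  obtain i where i: "i \<le> p" "e i = 0" using assms(2) by (metis atLeastAtMost_iff imageE le0)
  then show "e 0 = 0" using mono_onD[OF assms(1), of 0 i] by simp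
  obtain j where j: "j \<le> p" "e j = z" using assms(2) by (metis atLeastAtMost_iff imageE le0 order_refl)
  have "e p \<in> {0..z}" using assms(2) by auto
  then show "e p = z" using mono_onD[OF assms(1), of j p] j by simp
qed

text \<open>The image factorisation of the simplex category, built by adding one point at a time:
  the last value either repeats the previous one, and the quotient stays at its top
  \<open>z\<close>, or is larger and receives the new top \<open>Suc z\<close>.\<close>

lemma mono_factor:
  fixes f :: "nat \<Rightarrow> nat"
  assumes "mono_on {0..p} f"
  shows "\<exists>(z :: nat) e u. mono_on {0..p} e \<and> e ` {0..p} =
    {0..z} \<and> strict_mono_on {0..z} u \<and> (\<forall>i \<le> p. u (e i) = f i)"
  using assms
proof (induction p)
  case 0
  show ?case
    by (rule exI[of _ 0], rule exI[of _ "\<lambda>_. 0"], rule exI[of _ "\<lambda>_. f 0"]) (auto intro!: mono_onI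
      strict_mono_onI)
next
  case (Suc p)
  have "mono_on {0..p} f" using mono_onD[OF Suc.prems] by (intro mono_onI) auto
  then obtain z :: nat and e u where e: "mono_on {0..p} e" "e ` {0..p} =
    {0..z}" and u: "strict_mono_on {0..z} u"
    and ue: "\<And>i. i \<le> p \<Longrightarrow> u (e i) = f i" using Suc.IH by blast
  note ends = mono_surj_ends[OF e]
  have le: "f p \<le> f (Suc p)" using mono_onD[OF Suc.prems, of p "Suc p"] by simp
  have ez: "e i \<le> z" if "i \<le> p" for i using e(2) that by (metis atLeastAtMost_iff image_eqI le0)
  have S: "{0..Suc p} = insert (Suc p) {0..p}" by auto
  show ?case
  proof (cases "f (Suc p) = f p")
    case True
    let ?e = "e(Suc p := z)"
    have "mono_on {0..Suc p} ?e" using e(1) ez by (auto simp: mono_on_initial_iff)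
    moreover have "?e ` {0..Suc p} = {0..z}"
    proof -
      have "?e ` {0..Suc p} = insert z (e ` {0..p})" unfolding S by auto
      then show ?thesis using e(2) by auto
    qed
    moreover have "\<forall>i\<le>Suc p. u (?e i) = f i" using ue[of p] ue ends True by (auto simp: le_Suc_eq)
    ultimately show ?thesis using u by blast
  next
    case False
    let ?e = "e(Suc p := Suc z)" and ?u = "u(Suc z := f (Suc p))"
    have uz: "u i < f (Suc p)" if "i \<le> z" for i
    proof -
      have "u i \<le> u z" using strict_mono_on_leD[OF u, of i z] that by simp
      then show ?thesis using ue[of p] ends le False by simp
    qed
    have "mono_on {0..Suc p} ?e" using e(1) ez by (auto simp: mono_on_initial_iff le_Suc_eq)
    moreover have "?e ` {0..Suc p} = {0..Suc z}"
    proof -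
      have "?e ` {0..Suc p} = insert (Suc z) (e ` {0..p})" unfolding S by auto
      then show ?thesis using e(2) by auto
    qed
    moreover have "strict_mono_on {0..Suc z} ?u"
      using strict_mono_onD[OF u] uz by (intro strict_mono_onI) (auto simp: le_Suc_eq)
    moreover have "\<forall>i\<le>Suc p. ?u (?e i) = f i"
    proof -
      have "e i \<noteq> Suc z" if "i \<le> p" for i using ez[OF that] by simp
      then show ?thesis using ue by (auto simp: le_Suc_eq)
    qed
    ultimately show ?thesis by blast
  qed
qed

text \<open>A monotone surjection onto an initial segment moves by 0 or 1 at each step, so it is
  recovered from the pairs of consecutive points that it identifies.\<close>

lemma mono_surj_unique:
  fixes e e' :: "nat \<Rightarrow> nat"
  assumes e: "mono_on {0..p} e" "e ` {0..p} = {0..z}" and e': "mono_on {0..p} e'" "e' ` {0..p} =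
    {0..z'}"
    and eq: "\<And>i j. i \<le> p \<Longrightarrow> j \<le> p \<Longrightarrow> e i = e j \<longleftrightarrow> e' i = e' j"
  shows "i \<le> p \<Longrightarrow> e i = e' i"
proof (induction i)
  case 0
  show ?case using mono_surj_ends[OF e] mono_surj_ends[OF e'] by simp
next
  case (Suc i)
  \<comment> \<open>A larger jump would skip the value \<open>Suc (g i)\<close>, against
    surjectivity.\<close>
  have step: "g (Suc i) = g i \<or> g (Suc i) = Suc (g i)"
    if g: "mono_on {0..p} g" "g ` {0..p} = {0..y}" for g :: "nat \<Rightarrow> nat" and y
  proof (rule ccontr)
    assume A: "\<not> ?thesis"
    moreover have "g i \<le> g (Suc i)" using mono_onD[OF g(1), of i "Suc i"] Suc.prems by simp
    ultimately have gt: "Suc (g i) < g (Suc i)" by simp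
    moreover have "g (Suc i) \<le> y" using g(2) Suc.prems by (metis atLeastAtMost_iff image_eqI le0)
    ultimately have "Suc (g i) \<in> g ` {0..p}" using g(2) by simp
    then obtain j where j: "j \<le> p" "g j = Suc (g i)" by (metis atLeastAtMost_iff imageE)
    show False
    proof (cases "j \<le> i")
      case True
      then show False using mono_onD[OF g(1), of j i] j Suc.prems by simp
    next
      case False
      then show False using mono_onD[OF g(1), of "Suc i" j] j gt by simp
    qed
  qed
  show ?case
    using step[OF e] step[OF e'] Suc eq[of "Suc i" i] by auto
qed

lemma mono_inj_self:
  fixes h :: "nat \<Rightarrow> nat"
  assumes "mono_on {0..m} h" "inj_on h {0..m}" "h ` {0..m} \<subseteq> {0..m}" "i \<le> m"
  shows "h i = i"
proof -
  have "h ` {0..m} = {0..m}" using assms by (simp add: endo_inj_surj)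
  then show ?thesis
    using mono_surj_unique[of m h m "\<lambda>i. i" m i] assms by (auto simp: mono_on_def inj_on_eq_iff)
qed

text \<open>Any section of a monotone surjection is monotone. Routing it through a prescribed point
  \<open>i\<close> is what lets the uniqueness half of the Eilenberg-Zilber lemma compare two
  surjections point by point.\<close>

lemma mono_surj_section:
  fixes f :: "nat \<Rightarrow> nat"
  assumes f: "mono_on {0..n} f" "f ` {0..n} = {0..m}" and i: "i \<le> n"
  shows "\<exists>d. mono_on {0..m} d \<and> (\<forall>k \<le> m. d k \<le> n \<and> f (d k) = k) \<and> d (f i) = i"
proof -
  define d where "d k = (if k = f i then i else (SOME j. j \<le> n \<and> f j = k))" for k
  have d: "d k \<le> n \<and> f (d k) = k" if "k \<le> m" for k
  proof (cases "k = f i")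
    case False
    have "k \<in> f ` {0..n}" using f(2) that by simp
    then have "\<exists>j. j \<le> n \<and> f j = k" by auto
    from someI_ex[OF this] show ?thesis using False by (simp add: d_def)
  qed (use i in \<open>simp add: d_def\<close>)
  have "mono_on {0..m} d"
  proof (rule mono_onI)
    fix k l assume A: "k \<in> {0..m}" "l \<in> {0..m}" "k \<le> l"
    show "d k \<le> d l"
    proof (rule ccontr)
      assume B: "\<not> d k \<le> d l"
      then have "f (d l) \<le> f (d k)" using mono_onD[OF f(1), of "d l" "d k"] d[of k] d[of l] A by simp
      then have "k = l" using d[of k] d[of l] A by simp
      then show False using B by simp
    qed
  qed
  moreover have "d (f i) = i" by (simp add: d_def)
  ultimately show ?thesis using d by blast
qed

section \<open>Arrows of the simplex category and degenerate simplices\<close>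

definition darr :: "nat \<Rightarrow> (nat \<Rightarrow> nat) \<Rightarrow> nat \<Rightarrow> bool" where
  "darr m f n \<longleftrightarrow> f \<in> {0..m} \<rightarrow>\<^sub>E {0..n} \<and> mono_on {0..m} f"

lemma darrI:
  "(\<And>i. i \<le> m \<Longrightarrow> f i \<le> n) \<Longrightarrow> (\<And>i j. i \<le> j \<Longrightarrow> j \<le> m \<Longrightarrow> f i \<le> f j) \<Longrightarrow>
    (\<And>i. \<not> i \<le> m \<Longrightarrow> f i = undefined) \<Longrightarrow> darr m f n"
  unfolding darr_def by (auto intro!: mono_onI simp: PiE_def Pi_def extensional_def)

lemma darrD:
  assumes "darr m f n"
  shows "i \<le> m \<Longrightarrow> f i \<le> n" "i \<le> j \<Longrightarrow> j \<le> m \<Longrightarrow> f i \<le> f j" "\<not> i \<le> m \<Longrightarrow> f i = undefined"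
    "mono_on {0..m} f"
  using assms mono_onD[of "{0..m}" f i j] unfolding darr_def
  by (auto simp: PiE_def Pi_def extensional_def)

lemma hom_Delta: "\<phi> \<in> hom Delta m n \<longleftrightarrow> (\<exists>f. \<phi> = (m, f, n) \<and> darr m f n)"
  by (auto simp: hom_def Delta_def darr_def)

lemma darr_hom: "darr m f n \<Longrightarrow> (m, f, n) \<in> hom Delta m n"
  by (simp add: hom_Delta)

lemma Cmp_Delta: "(n, g, p) \<bullet>\<^bsub>Delta\<^esub> (m, f, n') = (m, compose {0..m} g f, p)"
  by (simp add: Delta_def)

lemma darr_compose: "darr m f n \<Longrightarrow> darr n g p \<Longrightarrow> darr m (compose {0..m} g f) p"
  by (rule darrI) (auto simp: compose_def dest: darrD)

lemma degenerate_iff: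
  "degenerate K n x \<longleftrightarrow> (\<exists>m f y. m < n \<and> darr n f m \<and> f ` {0..n} = {0..m} \<and> y \<in> Sim K m \<and> x =
   Act K (n, f, m) y)"
  unfolding degenerate_def darr_def by (simp add: Delta_def)

context simplicial_set
begin

lemma act_closed [simp]: "darr m f n \<Longrightarrow> x \<in> Sim K n \<Longrightarrow> Act K (m, f, n) x \<in> Sim K m"
  by (rule Act_Sim[OF darr_hom])

lemma act_comp:
  "darr m f n \<Longrightarrow> darr n g p \<Longrightarrow> x \<in> Sim K p \<Longrightarrow>
    Act K (m, f, n) (Act K (n, g, p) x) = Act K (m, compose {0..m} g f, p) x"
  using Act_Cmp[OF darr_hom darr_hom] by (simp add: Cmp_Delta)

lemma act_ident: "x \<in> Sim K n \<Longrightarrow> (\<And>i. i \<le> n \<Longrightarrow> f i = i) \<Longrightarrow> (\<And>i. \<not> i \<le> n \<Longrightarrow> f i = undefined) \<Longrightarrow>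
  Act K (n, f, n) x = x"
proof -
  assume A: "x \<in> Sim K n" "\<And>i. i \<le> n \<Longrightarrow> f i = i" "\<And>i. \<not> i \<le> n \<Longrightarrow> f i = undefined"
  have "f = (\<lambda>i\<in>{0..n}. i)" using A(2,3) by (auto simp: fun_eq_iff)
  then show ?thesis using Act_Idt[OF A(1)] by (simp add: Delta_def)
qed

text \<open>A degenerate simplex comes from a strictly lower dimension, so descent on the dimension
  ends at a nondegenerate one; the surjections met on the way compose.\<close>

lemma Eilenberg_Zilber_exists:
  "z \<in> Sim K n \<Longrightarrow> \<exists>m f y. darr n f m \<and> f ` {0..n} = {0..m} \<and> y \<in> Sim K m \<and> \<not> degenerate K m y \<and> z =
   Act K (n, f, m) y"
proof (induction n arbitrary: z rule: less_induct)
  case (less n)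
  show ?case
  proof (cases "degenerate K n z")
    case False
    have "darr n (\<lambda>i\<in>{0..n}. i) n" by (rule darrI) auto
    moreover have "z = Act K (n, (\<lambda>i\<in>{0..n}. i), n) z" using act_ident[OF less.prems] by simp
    ultimately show ?thesis using False less.prems by (metis image_restrict_eq image_ident)
  next
    case True
    then obtain m f y where 1: "m < n" "darr n f m" "f ` {0..n} = {0..m}" "y \<in> Sim K m" "z =
      Act K (n, f, m) y"
      unfolding degenerate_iff by blast
    obtain l g w where 2: "darr m g l" "g ` {0..m} = {0..l}" "w \<in> Sim K l" "\<not> degenerate K l w" "y =
      Act K (m, g, l) w"
      using less.IH[OF 1(1,4)] by blast
    have "compose {0..n} g f ` {0..n} = {0..l}"
      using 1(3) 2(2) by (metis (no_types, lifting) compose_eq image_cong image_image)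
    moreover have "z = Act K (n, compose {0..n} g f, l) w" using 1 2 by (simp add: act_comp)
    ultimately show ?thesis using darr_compose[OF 1(2) 2(1)] 2(3,4) by blast
  qed
qed

text \<open>Split \<open>h\<close> into a surjection \<open>e\<close> followed by an injection. If
  \<open>h\<close> were not injective, \<open>e\<close> would lower the dimension and exhibit
  \<open>Act K (m, h, m') y\<close> as degenerate.\<close>

lemma nondegenerate_act_inj:
  assumes h: "darr m h m'" and y: "y \<in> Sim K m'" "\<not> degenerate K m (Act K (m, h, m') y)"
  shows "inj_on h {0..m}"
proof -
  obtain z :: nat and e u where f: "mono_on {0..m} e" "e ` {0..m} =
    {0..z}" "strict_mono_on {0..z} u" "\<forall>i \<le> m. u (e i) = h i"
    using mono_factor[OF darrD(4)[OF h]] by blast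
  have ez: "e i \<le> z" if "i \<le> m" for i using f(2) that by (metis atLeastAtMost_iff image_eqI le0)
  have uz: "u k \<le> m'" if "k \<le> z" for k
  proof -
    have "k \<in> e ` {0..m}" using f(2) that by simp
    then show ?thesis using f(4) darrD(1)[OF h] by auto
  qed
  let ?e = "restrict e {0..m}" and ?u = "restrict u {0..z}"
  have de: "darr m ?e z" using ez f(1) by (intro darrI) (auto simp: mono_on_initial_iff)
  have du: "darr z ?u m'" using uz strict_mono_on_leD[OF f(3)] by (intro darrI) auto
  have "compose {0..m} ?u ?e = h"
    using f(4) ez darrD(3)[OF h] by (intro ext) (simp add: compose_def)
  then have "Act K (m, h, m') y = Act K (m, ?e, z) (Act K (z, ?u, m') y)"
    using act_comp[OF de du y(1)] by simp
  moreover have "?e ` {0..m} = {0..z}" using f(2) by simp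
  ultimately have "\<not> z < m" using y(2) act_closed[OF du y(1)] de unfolding degenerate_iff by blast
  then have "card {0..m} \<le> card (e ` {0..m})" using f(2) by simp
  then have "inj_on e {0..m}" by (meson card_image_le eq_card_imp_inj_on finite_atLeastAtMost
    le_antisym)
  moreover have "inj_on u (e ` {0..m})" using f(2,3) by (simp add: strict_mono_on_imp_inj_on)
  ultimately have "inj_on (u \<circ> e) {0..m}" by (rule comp_inj_on)
  then show ?thesis using f(4) by (simp add: inj_on_def)
qed

text \<open>A section \<open>d\<close> of \<open>f\<close> turns the equation into one saying that
  \<open>y\<close> is the pullback of \<open>y'\<close> along \<open>f'\<close> after
  \<open>d\<close>. That map must then be injective, so \<open>m\<close> is at most
  \<open>m'\<close>, and by symmetry they agree. An injective monotone self-map is the identity,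
  hence \<open>y\<close> and \<open>y'\<close> agree, and choosing \<open>d\<close> through a given
  point \<open>i\<close> yields \<open>f' i = f i\<close>.\<close>

lemma Eilenberg_Zilber_unique:
  assumes f: "darr n f m" "f ` {0..n} = {0..m}" "y \<in> Sim K m" "\<not> degenerate K m y"
    and f': "darr n f' m'" "f' ` {0..n} = {0..m'}" "y' \<in> Sim K m'" "\<not> degenerate K m' y'"
    and eq: "Act K (n, f, m) y = Act K (n, f', m') y'"
  shows "m = m' \<and> f = f' \<and> y = y'"
proof -
  have inj: "\<exists>d. darr m d n \<and> d (f i) = i \<and> inj_on (compose {0..m} f' d) {0..m} \<and> y =
    Act K (m, compose {0..m} f' d, m') y'"
    if f: "darr n f m" "f ` {0..n} = {0..m}" "y \<in> Sim K m" "\<not> degenerate K m y"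
    and f': "darr n f' m'" "f' ` {0..n} = {0..m'}" "y' \<in> Sim K m'" "\<not> degenerate K m' y'"
    and eq: "Act K (n, f, m) y = Act K (n, f', m') y'" and i: "i \<le> n" for f m y f' m' y' i
  proof -
    obtain d0 where d0: "mono_on {0..m} d0" "\<And>k. k \<le> m \<Longrightarrow> d0 k \<le> n" "\<And>k. k \<le> m \<Longrightarrow>
      f (d0 k) = k" "d0 (f i) = i"
      using mono_surj_section[OF darrD(4)[OF f(1)] f(2) i] by blast
    let ?d = "restrict d0 {0..m}"
    have d: "darr m ?d n" using d0(2) mono_onD[OF d0(1)] by (intro darrI) auto
    have "y = Act K (m, compose {0..m} f ?d, m) y"
      by (rule act_ident[OF f(3), symmetric]) (auto simp: compose_def d0)
    also have "\<dots> = Act K (m, ?d, n) (Act K (n, f, m) y)" using d f by (simp add: act_comp)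
    also have "\<dots> = Act K (m, compose {0..m} f' ?d, m') y'" unfolding eq
      using d f' by (simp add: act_comp)
    finally have y: "y = Act K (m, compose {0..m} f' ?d, m') y'" .
    moreover have "inj_on (compose {0..m} f' ?d) {0..m}"
      using nondegenerate_act_inj[OF darr_compose[OF d f'(1)] f'(3)] f(4) y by simp
    moreover have "?d (f i) = i" using d0(4) darrD(1)[OF f(1) i] by simp
    ultimately show ?thesis using d by blast
  qed
  have le: "m \<le> m'" if "darr m d n" "darr n f' m'" "inj_on (compose {0..m} f' d) {0..m}" for d m n f' m'
  proof -
    have "compose {0..m} f' d ` {0..m} \<subseteq> {0..m'}" using darrD(1)[OF darr_compose[OF that(1,2)]] by auto
    then show ?thesis using card_inj_on_le[OF that(3), of "{0..m'}"] by simp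
  qed
  have "m \<le> m'" using inj[OF f f' eq, of 0] le f'(1) by blast
  moreover have "m' \<le> m" using inj[OF f' f eq[symmetric], of 0] le f(1) by blast
  ultimately have m: "m = m'" by simp
  have key: "f i = f' i \<and> y = y'" if i: "i \<le> n" for i
  proof -
    obtain d where d: "darr m d n" "d (f i) = i" "inj_on (compose {0..m} f' d) {0..m}" "y =
      Act K (m, compose {0..m} f' d, m') y'"
      using inj[OF f f' eq i] by blast
    have dc: "darr m (compose {0..m} f' d) m" using darr_compose[OF d(1) f'(1)] m by simp
    have idc: "compose {0..m} f' d k = k" if "k \<le> m" for k
    proof (rule mono_inj_self[OF darrD(4)[OF dc] d(3) _ that])
      show "compose {0..m} f' d ` {0..m} \<subseteq> {0..m}" using darrD(1)[OF dc] by (intro image_subsetI) simp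
    qed
    have "Act K (m, compose {0..m} f' d, m) y' = y'"
      by (rule act_ident) (use idc darrD(3)[OF dc] f'(3) m in simp_all)
    then have "y = y'" using d(4) m by metis
    moreover have "f' i = f i" using idc[of "f i"] darrD(1)[OF f(1) i] d(2) by (simp add: compose_def)
    ultimately show ?thesis by simp
  qed
  have "f i = f' i" for i using key[of i] darrD(3)[OF f(1), of i] darrD(3)[OF f'(1), of i]
    by (cases "i \<le> n") simp_all
  then show ?thesis using m key[of 0] by auto
qed

end

section \<open>Necklaces and their maps\<close>

lemma Nec_sel [simp]:
  "Obj Nec = {N. is_necklace N}" "Dom Nec (N, f, N') = N" "Cod Nec (N, f, N') = N'"
  "Idt Nec N = (N, \<lambda>i \<in> {0..snd N}. i, N)"
  "(M', g, N') \<bullet>\<^bsub>Nec\<^esub> (N, f, M) = (N, compose {0..snd N} g f, N')"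
  "N \<otimes>\<^bsub>Nec\<^esub> N' = wedge N N'"
  "(N, f, M) \<odot>\<^bsub>Nec\<^esub> (N', g, M') = (wedge N N', wedge_map (snd N) (snd N') f (snd M) g, wedge M M')"
  "Unt Nec = simplex 0" "LUn Nec N = Idt Nec N" "RUn Nec N = Idt Nec N"
  "Asc Nec N N' N'' = Idt Nec (wedge N (wedge N' N''))"
  by (cases N; cases N'; cases M; cases M'; simp add: Nec_def nec_id_def simplex_def)+

lemma Nec_minus_sel [simp]:
  "Obj Nec_minus = {N. is_necklace N}" "Dom Nec_minus = Dom Nec" "Cod Nec_minus = Cod Nec"
  "Idt Nec_minus = Idt Nec" "Cmp Nec_minus = Cmp Nec"
  by (simp_all add: Nec_minus_def)

lemma Nec_incl_sel [simp]: "FOb Nec_incl N = N" "FAr Nec_incl f = f"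
  by (simp_all add: Nec_incl_def)

lemma is_necklace_iff: "is_necklace N \<longleftrightarrow> 0 \<in> fst N \<and> snd N \<in> fst N \<and> (\<forall>t \<in> fst N. t \<le> snd N)"
  by (cases N) (auto simp: is_necklace_def)

lemma fst_wedge: "fst (wedge N M) = fst N \<union> (+) (snd N) ` fst M"
  and snd_wedge [simp]: "snd (wedge N M) = snd N + snd M"
  by (cases N; cases M; simp add: wedge_def)+

lemma fst_simplex: "fst (simplex n) = {0, n}" and snd_simplex [simp]: "snd (simplex n) = n"
  by (simp_all add: simplex_def)

lemma is_necklace_simplex [simp]: "is_necklace (simplex n)"
  by (simp add: is_necklace_iff fst_simplex)

lemma is_necklace_wedge [simp]: "is_necklace N \<Longrightarrow> is_necklace M \<Longrightarrow> is_necklace (wedge N M)"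
  by (auto simp: is_necklace_iff fst_wedge)

lemma wedge_assoc: "wedge (wedge N M) L = wedge N (wedge M L)"
  by (cases N; cases M; cases L) (auto simp: wedge_def image_iff add.assoc)

lemma wedge_unit_left [simp]: "is_necklace N \<Longrightarrow> wedge (simplex 0) N = N"
  by (cases N) (auto simp: wedge_def simplex_def is_necklace_def)

lemma wedge_unit_right [simp]: "is_necklace N \<Longrightarrow> wedge N (simplex 0) = N"
  by (cases N) (auto simp: wedge_def simplex_def is_necklace_def)

lemma Arr_Nec:
  "(N, f, M) \<in> Arr Nec \<longleftrightarrow> is_necklace N \<and> is_necklace M \<and> darr (snd N) f (snd M) \<and>
    f 0 = 0 \<and> f (snd N) = snd M \<and> fst M \<subseteq> f ` fst N"
  by (cases N; cases M) (auto simp: Nec_def darr_def)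

lemma Arr_NecD:
  assumes "(N, f, M) \<in> Arr Nec"
  shows "is_necklace N" "is_necklace M" "darr (snd N) f (snd M)" "f 0 = 0" "f (snd N) =
    snd M" "fst M \<subseteq> f ` fst N"
  using assms by (simp_all add: Arr_Nec)

lemma Arr_Nec_minus:
  "(N, f, M) \<in> Arr Nec_minus \<longleftrightarrow> (N, f, M) \<in> Arr Nec \<and> f ` {0..snd N} = {0..snd M} \<and> f ` fst N = fst M"
  by (cases N; cases M) (auto simp: Nec_minus_def)

lemma Nec_minusD [simp]: "e \<in> Arr Nec_minus \<Longrightarrow> e \<in> Arr Nec"
  by (auto simp: Nec_minus_def)

text \<open>The necklace map that forgets the middle joint. Under \<open>D\<close>, preceded by
  \<open>\<mu>\<close>, it becomes the composition of \<Phi>(n).\<close>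

definition join :: "nat \<Rightarrow> nat \<Rightarrow> necklace \<times> (nat \<Rightarrow> nat) \<times> necklace" where
  "join i j = (wedge (simplex i) (simplex j), \<lambda>l \<in> {0..i + j}. l, simplex (i + j))"

lemma join_Arr [simp]: "join i j \<in> Arr Nec"
  by (auto simp: join_def Arr_Nec fst_wedge fst_simplex intro!: darrI)

section \<open>Cutting necklaces and necklace maps at a joint\<close>

definition front :: "necklace \<Rightarrow> nat \<Rightarrow> necklace" where
  "front N r = (fst N \<inter> {0..r}, r)"

definition rear :: "necklace \<Rightarrow> nat \<Rightarrow> necklace" where
  "rear N r = ((\<lambda>t. t - r) ` (fst N \<inter> {r..}), snd N - r)"

lemma split_sel [simp]: "snd (front N r) = r" "snd (rear N r) = snd N - r"
  by (simp_all add: front_def rear_def)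

lemma split_necklace:
  assumes "is_necklace N" "r \<in> fst N"
  shows "is_necklace (front N r)" "is_necklace (rear N r)" "wedge (front N r) (rear N r) =
    N" "r \<le> snd N"
proof -
  have r: "0 \<in> fst N" "snd N \<in> fst N" "\<And>t. t \<in> fst N \<Longrightarrow> t \<le> snd N" "r \<le> snd N"
    using assms by (auto simp: is_necklace_iff)
  show "is_necklace (front N r)" using r assms(2) by (auto simp: is_necklace_iff front_def)
  have "0 \<in> fst (rear N r)" unfolding rear_def fst_conv
    by (rule image_eqI[of _ _ r]) (use assms(2) in auto)
  then show "is_necklace (rear N r)" using r by (auto simp: is_necklace_iff rear_def diff_le_mono)
  have "(+) r ` (\<lambda>t. t - r) ` (fst N \<inter> {r..}) = fst N \<inter> {r..}" by (force simp: image_image)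
  then have "fst (wedge (front N r) (rear N r)) = fst N" by (auto simp: fst_wedge front_def rear_def)
  then show "wedge (front N r) (rear N r) = N" using r by (simp add: prod_eq_iff)
qed (use assms in \<open>auto simp: is_necklace_iff\<close>)

text \<open>Strong induction on the length, cutting at any interior joint; a necklace without one is
  a simplex, the point being \<open>simplex 0\<close>. Both parts of the wedge are arbitrary, which
  suits statements that treat the two sides alike.\<close>

lemma necklace_induct [consumes 1, case_names simplex wedge]:
  assumes "is_necklace N" and "\<And>n. Q (simplex n)"
    and "\<And>N M. is_necklace N \<Longrightarrow> is_necklace M \<Longrightarrow> Q N \<Longrightarrow> Q M \<Longrightarrow> Q (wedge N M)"
  shows "Q N"
  using assms(1)
proof (induction "snd N" arbitrary: N rule: less_induct)
  case less
  show ?case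
  proof (cases "\<exists>r \<in> fst N. 0 < r \<and> r < snd N")
    case True
    then obtain r where r: "r \<in> fst N" "0 < r" "r < snd N" by blast
    note s = split_necklace[OF less.prems r(1)]
    have "Q (wedge (front N r) (rear N r))" using r s less.hyps by (intro assms(3)) auto
    then show ?thesis using s by simp
  next
    case False
    then have "fst N = {0, snd N}" using less.prems by (force simp: is_necklace_iff)
    then have "N = simplex (snd N)" by (simp add: simplex_def prod_eq_iff)
    then show ?thesis using assms(2) by metis
  qed
qed

lemma wedge_map_apply:
  assumes "darr p f p'" "f p = p'" "g 0 = 0"
  shows "i \<le> p \<Longrightarrow> wedge_map p q f p' g i = f i"
    "p \<le> i \<Longrightarrow> i \<le> p + q \<Longrightarrow> wedge_map p q f p' g i = p' + g (i - p)"
  using assms by (auto simp: wedge_map_def)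

lemma wedge_map_split:
  assumes f: "darr p f q" "f 0 = 0" "f p = q" and r: "r \<le> p"
  shows "darr r (restrict f {0..r}) (f r)"
    "darr (p - r) (\<lambda>k \<in> {0..p - r}. f (k + r) - f r) (q - f r)"
    "f = wedge_map r (p - r) (restrict f {0..r}) (f r) (\<lambda>k \<in> {0..p - r}. f (k + r) - f r)"
proof -
  show "darr r (restrict f {0..r}) (f r)" by (rule darrI) (use r darrD[OF f(1)] in auto)
  show "darr (p - r) (\<lambda>k \<in> {0..p - r}. f (k + r) - f r) (q - f r)"
    by (rule darrI) (use r darrD(1,2)[OF f(1)] in \<open>auto intro!: diff_le_mono\<close>)
  show "f = wedge_map r (p - r) (restrict f {0..r}) (f r) (\<lambda>k \<in> {0..p - r}. f (k + r) - f r)"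
  proof
    fix i show "f i = wedge_map r (p - r) (restrict f {0..r}) (f r) (\<lambda>k \<in> {0..p - r}. f (k + r) - f r)
      i"
      using r darrD(3)[OF f(1), of i] darrD(2)[OF f(1), of r i] by (auto simp: wedge_map_def)
  qed
qed

text \<open>The condition that target joints are images of joints survives the cut: a joint on one
  side that is hit from the other side must, by monotonicity, be the cut point itself, and that
  point is hit by \<open>r\<close>.\<close>

lemma Nec_split:
  assumes f: "(N, f, M) \<in> Arr Nec" and r: "r \<in> fst N" "f r \<in> fst M"
  shows "\<exists>f1 f2. (front N r, f1, front M (f r)) \<in> Arr Nec \<and> (rear N r, f2, rear M (f r)) \<in> Arr Nec \<and>
    (N, f, M) = (front N r, f1, front M (f r)) \<odot>\<^bsub>Nec\<^esub> (rear N r, f2, rear M (f r))"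
proof -
  note fD = Arr_NecD[OF f]
  note sN = split_necklace[OF fD(1) r(1)] and sM = split_necklace[OF fD(2) r(2)]
  note w = wedge_map_split[OF fD(3-5) sN(4)]
  let ?f1 = "restrict f {0..r}" and ?f2 = "\<lambda>k \<in> {0..snd N - r}. f (k + r) - f r"
  have le: "t \<le> snd N" if "t \<in> fst N" for t using fD(1) that by (auto simp: is_necklace_iff)
  have "fst (front M (f r)) \<subseteq> ?f1 ` fst (front N r)"
  proof
    fix u assume "u \<in> fst (front M (f r))"
    then have u: "u \<in> fst M" "u \<le> f r" by (auto simp: front_def)
    then obtain t where t: "t \<in> fst N" "u = f t" using fD(6) by blast
    show "u \<in> ?f1 ` fst (front N r)"
    proof (cases "t \<le> r")
      case True then show ?thesis using t by (auto simp: front_def)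
    next
      case False
      then have "u = f r" using darrD(2)[OF fD(3), of r t] le[OF t(1)] t u by simp
      then show ?thesis using r by (auto simp: front_def)
    qed
  qed
  then have 1: "(front N r, ?f1, front M (f r)) \<in> Arr Nec" using sN sM w fD by (simp add: Arr_Nec)
  have "fst (rear M (f r)) \<subseteq> ?f2 ` fst (rear N r)"
  proof
    fix v assume "v \<in> fst (rear M (f r))"
    then obtain u where u: "u \<in> fst M" "f r \<le> u" "v = u - f r" by (auto simp: rear_def)
    then obtain t where t: "t \<in> fst N" "u = f t" using fD(6) by blast
    show "v \<in> ?f2 ` fst (rear N r)"
    proof (cases "r \<le> t")
      case True
      then have "v = ?f2 (t - r)" "t - r \<in> fst (rear N r)"
        using t u le[OF t(1)] by (auto simp: rear_def)
      then show ?thesis by blast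
    next
      case False
      then have "u = f r" using darrD(2)[OF fD(3), of t r] sN(4) t u by simp
      then have "v = ?f2 0" "0 \<in> fst (rear N r)" using u r by (auto simp: rear_def image_iff)
      then show ?thesis by blast
    qed
  qed
  then have 2: "(rear N r, ?f2, rear M (f r)) \<in> Arr Nec" using sN sM w fD by (simp add: Arr_Nec)
  show ?thesis
    by (rule exI[of _ ?f1], rule exI[of _ ?f2]) (use 1 2 w(3) sN(3) sM(3) in simp)
qed

lemma front_wedge:
  assumes "is_necklace N" "is_necklace M"
  shows "front (wedge N M) (snd N) = N" "rear (wedge N M) (snd N) = M"
proof -
  have "fst (front (wedge N M) (snd N)) = fst N"
    using assms by (auto simp: front_def fst_wedge is_necklace_iff)
  then show "front (wedge N M) (snd N) = N" by (simp add: prod_eq_iff)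
  have "fst (rear (wedge N M) (snd N)) = fst M"
  proof
    show "fst (rear (wedge N M) (snd N)) \<subseteq> fst M"
      using assms by (auto simp: rear_def fst_wedge is_necklace_iff)
    show "fst M \<subseteq> fst (rear (wedge N M) (snd N))"
    proof
      fix t assume "t \<in> fst M"
      then show "t \<in> fst (rear (wedge N M) (snd N))"
        unfolding rear_def fst_conv by (intro image_eqI[of _ _ "snd N + t"]) (auto simp: fst_wedge)
    qed
  qed
  then show "rear (wedge N M) (snd N) = M" by (simp add: prod_eq_iff)
qed

text \<open>The gluing point of \<open>A\<close> and \<open>B\<close> is a joint of the target, so
  some joint of \<open>N\<close> lies over it and the map can be cut there.\<close>

lemma Nec_split_wedge:
  assumes f: "(N, f, wedge A B) \<in> Arr Nec" and AB: "is_necklace A" "is_necklace B"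
  shows "\<exists>N1 N2 f1 f2. N = wedge N1 N2 \<and> (N1, f1, A) \<in> Arr Nec \<and> (N2, f2, B) \<in> Arr Nec \<and>
    (N, f, wedge A B) = (N1, f1, A) \<odot>\<^bsub>Nec\<^esub> (N2, f2, B)"
proof -
  have A: "snd A \<in> fst (wedge A B)" using AB by (simp add: fst_wedge is_necklace_iff)
  then obtain r where r: "r \<in> fst N" "f r = snd A" using subsetD[OF Arr_NecD(6)[OF f]] by fastforce
  show ?thesis
    using Nec_split[OF f r(1)] A r split_necklace(3)[OF Arr_NecD(1)[OF f] r(1)] front_wedge[OF AB]
      by metis
qed

text \<open>Into a simplex the middle joint need not go to a joint, so the map need not be a wedge
  of maps. It becomes one once the joint \<open>f (snd N)\<close> is inserted into the target, and
  \<open>join\<close> forgets that joint again.\<close>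

lemma Nec_split_join:
  assumes f: "(wedge N M, f, simplex q) \<in> Arr Nec" and NM: "is_necklace N" "is_necklace M"
  shows "\<exists>f1 f2 i j. q = i + j \<and> (N, f1, simplex i) \<in> Arr Nec \<and> (M, f2, simplex j) \<in> Arr Nec \<and>
    (wedge N M, f, simplex q) = join i j \<bullet>\<^bsub>Nec\<^esub> ((N, f1, simplex i) \<odot>\<^bsub>Nec\<^esub> (M, f2, simplex j))"
proof -
  note fD = Arr_NecD[OF f]
  let ?p = "snd N" and ?r = "snd M"
  let ?i = "f ?p"
  have i: "?i \<le> q" using darrD(1)[OF fD(3), of ?p] by simp
  note w = wedge_map_split[OF fD(3-5), of ?p]
  let ?f1 = "restrict f {0..?p}" and ?f2 = "\<lambda>k \<in> {0..?r}. f (k + ?p) - f ?p"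
  have 1: "(N, ?f1, simplex ?i) \<in> Arr Nec"
  proof -
    have "0 \<in> ?f1 ` fst N" by (rule image_eqI[of _ _ 0]) (use NM fD in \<open>auto simp: is_necklace_iff\<close>)
    moreover have "?i \<in> ?f1 ` fst N" by (rule image_eqI[of _ _ ?p]) (use NM in \<open>auto simp:
      is_necklace_iff\<close>)
    ultimately show ?thesis using NM(1) w(1) fD(4) by (simp add: Arr_Nec fst_simplex)
  qed
  have 2: "(M, ?f2, simplex (q - ?i)) \<in> Arr Nec"
  proof -
    have q: "f (snd M + snd N) = q" "f (snd N + snd M) = q" using fD(5) by (simp_all add: add.commute)
    have "0 \<in> ?f2 ` fst M" by (rule image_eqI[of _ _ 0]) (use NM in \<open>auto simp: is_necklace_iff\<close>)
    moreover have "q - ?i \<in> ?f2 ` fst M"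
      by (rule image_eqI[of _ _ ?r]) (use NM q in \<open>auto simp: is_necklace_iff\<close>)
    ultimately show ?thesis using NM(2) w(2) q by (simp add: Arr_Nec fst_simplex)
  qed
  have "(wedge N M, f, simplex q) = join ?i (q - ?i) \<bullet>\<^bsub>Nec\<^esub> ((N, ?f1, simplex ?i) \<odot>\<^bsub>Nec\<^esub> (M, ?f2,
    simplex (q - ?i)))"
  proof -
    have w3: "f = wedge_map ?p ?r ?f1 ?i ?f2" using w(3) by simp
    have "compose {0..?p + ?r} (\<lambda>l \<in> {0..q}. l) f = f"
      using darrD(1,3)[OF fD(3)] by (auto simp: compose_def fun_eq_iff)
    then show ?thesis using i w3[symmetric] by (simp add: join_def)
  qed
  then show ?thesis using 1 2 i by (intro exI[of _ ?f1] exI[of _ ?f2] exI[of _ ?i] exI[of _ "q - ?i"])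
    simp
qed

text \<open>The middle necklace gets exactly the images of the joints of \<open>N\<close> as its
  joints. This makes \<open>e\<close> active, and the joints of \<open>M\<close> are hit by joints
  under \<open>u\<close> because they are hit under \<open>u\<close> after \<open>e\<close>.\<close>

lemma Nec_factor:
  assumes f: "(N, f, M) \<in> Arr Nec"
  shows "\<exists>Z e u. (N, e, Z) \<in> Arr Nec_minus \<and> (Z, u, M) \<in> Arr Nec \<and> inj_on u {0..snd Z} \<and>
    (N, f, M) = (Z, u, M) \<bullet>\<^bsub>Nec\<^esub> (N, e, Z)"
proof -
  note fD = Arr_NecD[OF f]
  obtain z :: nat and e u where e: "mono_on {0..snd N} e" "e ` {0..snd N} = {0..z}"
    and u: "strict_mono_on {0..z} u" and ue: "\<forall>i \<le> snd N. u (e i) = f i"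
    using mono_factor[OF darrD(4)[OF fD(3)]] by blast
  note ends = mono_surj_ends[OF e]
  have ez: "e i \<le> z" if "i \<le> snd N" for i using e(2) that by (metis atLeastAtMost_iff image_eqI le0)
  have uz: "u k \<le> snd M" if "k \<le> z" for k
  proof -
    have "k \<in> e ` {0..snd N}" using e(2) that by simp
    then show ?thesis using ue darrD(1)[OF fD(3)] by auto
  qed
  let ?e = "restrict e {0..snd N}" and ?u = "restrict u {0..z}" and ?Z = "(e ` fst N, z)"
  have NN: "0 \<in> fst N" "snd N \<in> fst N" "\<And>t. t \<in> fst N \<Longrightarrow> t \<le> snd N"
    using fD(1) by (auto simp: is_necklace_iff)
  have eN: "?e ` fst N = e ` fst N" using NN(3) by (intro image_cong) auto
  have Z: "is_necklace ?Z" using NN ez ends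
    by (auto simp: is_necklace_iff intro: image_eqI[of _ _ 0] image_eqI[of _ _ "snd N"])
  have de: "darr (snd N) ?e z" using ez e(1) by (intro darrI) (auto simp: mono_on_initial_iff)
  have du: "darr z ?u (snd M)" using uz strict_mono_on_leD[OF u] by (intro darrI) auto
  have "(N, ?e, ?Z) \<in> Arr Nec_minus" using fD(1) Z de ends e(2) eN by (simp add: Arr_Nec_minus Arr_Nec)
  moreover have "(?Z, ?u, M) \<in> Arr Nec"
  proof -
    have "?u ` e ` fst N = f ` fst N" unfolding image_image
      by (rule image_cong) (use ue NN(3) ez in auto)
    then show ?thesis using Z fD ends ue du ez[of 0] by (auto simp: Arr_Nec)
  qed
  moreover have "inj_on ?u {0..z}" using strict_mono_on_imp_inj_on[OF u] by (simp add: inj_on_def)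
  moreover have "compose {0..snd N} ?u ?e = f"
    using ue ez darrD(3)[OF fD(3)] by (intro ext) (simp add: compose_def)
  ultimately show ?thesis by (intro exI[of _ ?Z] exI[of _ ?e] exI[of _ ?u]) simp
qed

text \<open>Injectivity of \<open>u\<close> and \<open>u'\<close> makes \<open>e\<close> and
  \<open>e'\<close> identify the same points, which determines a monotone surjection; activity then
  fixes the joints of the middle necklace. This uniqueness is why the Kan extension is a plain
  coproduct.\<close>

lemma Nec_factor_unique:
  assumes e: "(N, e, Z) \<in> Arr Nec_minus" and u: "(Z, u, M) \<in> Arr Nec" "inj_on u {0..snd Z}"
    and e': "(N, e', Z') \<in> Arr Nec_minus" and u': "(Z', u', M) \<in> Arr Nec" "inj_on u' {0..snd Z'}"
    and eq: "(Z, u, M) \<bullet>\<^bsub>Nec\<^esub> (N, e, Z) = (Z', u', M) \<bullet>\<^bsub>Nec\<^esub> (N, e', Z')"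
  shows "Z = Z'" "e = e'" "u = u'"
proof -
  note eD = Arr_NecD[OF Nec_minusD[OF e]] and e'D = Arr_NecD[OF Nec_minusD[OF e']]
  note uD = Arr_NecD[OF u(1)] and u'D = Arr_NecD[OF u'(1)]
  have sur: "e ` {0..snd N} = {0..snd Z}" "e' ` {0..snd N} = {0..snd Z'}" "e ` fst N =
    fst Z" "e' ` fst N = fst Z'"
    using e e' by (simp_all add: Arr_Nec_minus)
  have ue: "u (e i) = u' (e' i)" if "i \<le> snd N" for i
  proof -
    have "compose {0..snd N} u e = compose {0..snd N} u' e'" using eq by simp
    from fun_cong[OF this, of i] show ?thesis using that by (simp add: compose_def)
  qed
  have "e i = e' i" if "i \<le> snd N" for i
  proof (rule mono_surj_unique[OF darrD(4)[OF eD(3)] sur(1) darrD(4)[OF e'D(3)] sur(2) _ that])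
    fix i j assume ij: "i \<le> snd N" "j \<le> snd N"
    have "e i = e j \<longleftrightarrow> u (e i) = u (e j)"
      using u(2) darrD(1)[OF eD(3)] ij by (auto simp: inj_on_eq_iff)
    also have "\<dots> \<longleftrightarrow> e' i = e' j"
      using u'(2) darrD(1)[OF e'D(3)] ij ue by (auto simp: inj_on_eq_iff)
    finally show "e i = e j \<longleftrightarrow> e' i = e' j" .
  qed
  then have "e i = e' i" for i using darrD(3)[OF eD(3), of i] darrD(3)[OF e'D(3), of i]
    by (cases "i \<le> snd N") auto
  then show ee: "e = e'" by blast
  then have "fst Z = fst Z'" "snd Z = snd Z'" using sur eD(5) e'D(5) by simp_all
  then show Z: "Z = Z'" by (simp add: prod_eq_iff)
  have "u k = u' k" for k
  proof (cases "k \<le> snd Z")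
    case True
    then have "k \<in> e ` {0..snd N}" using sur by simp
    then show ?thesis using ue ee by auto
  qed (use Z darrD(3)[OF uD(3), of k] darrD(3)[OF u'D(3), of k] in auto)
  then show "u = u'" by blast
qed


section \<open>Necklaces in a simplicial set\<close>

text \<open>
  A map from a necklace to \<open>K\<close> is recorded by its values \<open>x s t\<close> on the faces \<open>[s, t]\<close> that are
  contained in a single bead; this includes the vertices \<open>x t t\<close>.
\<close>

definition bead :: "necklace \<Rightarrow> nat \<Rightarrow> nat \<Rightarrow> bool" where
  "bead N s t \<longleftrightarrow> s \<le> t \<and> t \<le> snd N \<and> fst N \<inter> {s<..<t} = {}"

definition face :: "'x sset \<Rightarrow> nat \<Rightarrow> nat \<Rightarrow> nat \<Rightarrow> 'x \<Rightarrow> 'x" where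
  "face K n s t z = Act K (t - s, \<lambda>k \<in> {0..t - s}. k + s, n) z"

text \<open>The restriction of \<open>f\<close> to the interval from \<open>s\<close> to
  \<open>t\<close>, shifted so that both source and target start at 0. These are the maps through
  which the simplex category acts on the hom-objects of \<Phi>(n).\<close>

definition seg :: "(nat \<Rightarrow> nat) \<Rightarrow> nat \<Rightarrow> nat \<Rightarrow> nat \<Rightarrow> nat" where
  "seg f s t = (\<lambda>k \<in> {0..t - s}. f (k + s) - f s)"

text \<open>The value \<open>undefined\<close> off the beads makes equality of functions the same as
  equality of the maps they represent.\<close>

definition fams :: "'x sset \<Rightarrow> necklace \<Rightarrow> (nat \<Rightarrow> nat \<Rightarrow> 'x) set" where
  "fams K N = {x. (\<forall>s t. bead N s t \<longrightarrow> x s t \<in> Sim K (t - s)) \<and>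
     (\<forall>s t s' t'. bead N s t \<longrightarrow> s \<le> s' \<longrightarrow> s' \<le> t' \<longrightarrow> t' \<le> t \<longrightarrow>
        x s' t' = face K (t - s) (s' - s) (t' - s) (x s t)) \<and>
     (\<forall>s t. \<not> bead N s t \<longrightarrow> x s t = undefined)}"

definition pull :: "'x sset \<Rightarrow> necklace \<times> (nat \<Rightarrow> nat) \<times> necklace \<Rightarrow> (nat \<Rightarrow> nat \<Rightarrow> 'x) \<Rightarrow> nat \<Rightarrow> nat \<Rightarrow> 'x"
  where
  "pull K = (\<lambda>(N, f, M) x s t.
     if bead N s t then Act K (t - s, seg f s t, f t - f s) (x (f s) (f t)) else undefined)"

definition sfam :: "'x sset \<Rightarrow> nat \<Rightarrow> 'x \<Rightarrow> nat \<Rightarrow> nat \<Rightarrow> 'x" where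
  "sfam K n z = (\<lambda>s t. if s \<le> t \<and> t \<le> n then face K n s t z else undefined)"

text \<open>The gluing vertex belongs to both parts. The test gives it the value of
  \<open>x\<close>, which is also that of \<open>y\<close> whenever the two families can be
  glued.\<close>

definition wfam :: "necklace \<Rightarrow> (nat \<Rightarrow> nat \<Rightarrow> 'x) \<Rightarrow> necklace \<Rightarrow> (nat \<Rightarrow> nat \<Rightarrow> 'x) \<Rightarrow> nat \<Rightarrow> nat \<Rightarrow> 'x" where
  "wfam N x M y = (\<lambda>s t. if bead (wedge N M) s t
     then (if t \<le> snd N then x s t else y (s - snd N) (t - snd N)) else undefined)"

definition lfam :: "necklace \<Rightarrow> (nat \<Rightarrow> nat \<Rightarrow> 'x) \<Rightarrow> nat \<Rightarrow> nat \<Rightarrow> 'x" where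
  "lfam N x = (\<lambda>s t. if bead N s t then x s t else undefined)"

definition rfam :: "necklace \<Rightarrow> necklace \<Rightarrow> (nat \<Rightarrow> nat \<Rightarrow> 'x) \<Rightarrow> nat \<Rightarrow> nat \<Rightarrow> 'x" where
  "rfam N M x = (\<lambda>s t. if bead M s t then x (s + snd N) (t + snd N) else undefined)"

definition nondeg :: "'x sset \<Rightarrow> necklace \<Rightarrow> (nat \<Rightarrow> nat \<Rightarrow> 'x) \<Rightarrow> bool" where
  "nondeg K N x \<longleftrightarrow> (\<forall>s t. s < t \<and> adjacent_joints (fst N) s t \<longrightarrow> \<not> degenerate K (t - s) (x s t))"

lemma bead_simplex [simp]: "bead (simplex n) s t \<longleftrightarrow> s \<le> t \<and> t \<le> n"
  by (auto simp: bead_def fst_simplex)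

lemma bead_point [simp]: "bead N t t \<longleftrightarrow> t \<le> snd N"
  by (auto simp: bead_def)

lemma bead_sub: "bead N s t \<Longrightarrow> s \<le> s' \<Longrightarrow> s' \<le> t' \<Longrightarrow> t' \<le> t \<Longrightarrow> bead N s' t'"
  by (fastforce simp: bead_def)

text \<open>The gluing point is a joint of the wedge, so a bead cannot pass over it. The two
  alternatives overlap at that vertex.\<close>

lemma bead_wedge:
  assumes "is_necklace N" "is_necklace M"
  shows "bead (wedge N M) s t \<longleftrightarrow> (t \<le> snd N \<and> bead N s t) \<or> (snd N \<le> s \<and> bead M (s - snd N) (t - snd N) \<and>
    s \<le> t)"
proof (cases "t \<le> snd N")
  case True
  then show ?thesis using assms by (fastforce simp: bead_def fst_wedge is_necklace_iff)
next
  case t: False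
  show ?thesis
  proof (cases "snd N \<le> s")
    case False
    then have "snd N \<in> fst (wedge N M) \<inter> {s<..<t}"
      using t assms by (simp add: fst_wedge is_necklace_iff)
    then show ?thesis using False t by (auto simp: bead_def)
  next
    case True
    have "fst (wedge N M) \<inter> {s<..<t} = {} \<longleftrightarrow> fst M \<inter> {s - snd N<..<t - snd N} = {}"
    proof -
      have "fst (wedge N M) \<inter> {s<..<t} = (+) (snd N) ` (fst M \<inter> {s - snd N<..<t - snd N})"
      proof
        have "t \<le> snd N" if "t \<in> fst N" for t using assms(1) that by (simp add: is_necklace_iff)
        then show "fst (wedge N M) \<inter> {s<..<t} \<subseteq> (+) (snd N) ` (fst M \<inter> {s - snd N<..<t - snd N})"
          using True by (fastforce simp: fst_wedge)
        show "(+) (snd N) ` (fst M \<inter> {s - snd N<..<t - snd N}) \<subseteq> fst (wedge N M) \<inter> {s<..<t}"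
          using True by (auto simp: fst_wedge)
      qed
      then show ?thesis by simp
    qed
    then show ?thesis using t True by (auto simp: bead_def)
  qed
qed

lemma bead_wedge_left: "is_necklace N \<Longrightarrow> is_necklace M \<Longrightarrow> bead N s t \<Longrightarrow> bead (wedge N M) s t"
  by (simp add: bead_wedge) (simp add: bead_def)

lemma bead_wedge_right:
  "is_necklace N \<Longrightarrow> is_necklace M \<Longrightarrow> bead M s t \<Longrightarrow> bead (wedge N M) (s + snd N) (t + snd N)"
  by (simp add: bead_wedge) (simp add: bead_def)

lemma bead_wedge_le: "bead (wedge N M) s t \<Longrightarrow> t \<le> snd N \<Longrightarrow> bead N s t"
  by (fastforce simp: bead_def fst_wedge)

lemma bead_wedge_gt:
  "is_necklace N \<Longrightarrow> is_necklace M \<Longrightarrow> bead (wedge N M) s t \<Longrightarrow> \<not> t \<le> snd N \<Longrightarrow>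
    snd N \<le> s \<and> bead M (s - snd N) (t - snd N)"
  by (simp add: bead_wedge)

text \<open>A joint of \<open>M\<close> strictly inside the image would be the image of a joint of
  \<open>N\<close>, which by monotonicity would lie strictly between \<open>s\<close> and
  \<open>t\<close>. So the condition on joints in the definition of necklace maps is what allows
  families to be pulled back.\<close>

lemma bead_map:
  assumes f: "(N, f, M) \<in> Arr Nec" and b: "bead N s t"
  shows "bead M (f s) (f t)"
proof -
  note fD = Arr_NecD[OF f]
  have st: "s \<le> t" "t \<le> snd N" using b by (auto simp: bead_def)
  have "fst M \<inter> {f s<..<f t} = {}"
  proof (rule ccontr)
    assume "\<not> ?thesis"
    then obtain u where u: "u \<in> fst M" "f s < u" "u < f t" by auto
    then obtain r where r: "r \<in> fst N" "u = f r" using fD(6) by blast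
    have "r \<le> snd N" using r fD(1) by (simp add: is_necklace_iff)
    then have "s < r" "r < t" using u r st darrD(2)[OF fD(3), of r s] darrD(2)[OF fD(3), of t r]
      by (force simp: not_less)+
    then show False using b r by (auto simp: bead_def)
  qed
  then show ?thesis using darrD(1,2)[OF fD(3)] st by (simp add: bead_def)
qed

lemma darr_face: "s \<le> t \<Longrightarrow> t \<le> n \<Longrightarrow> darr (t - s) (\<lambda>k \<in> {0..t - s}. k + s) n"
  by (rule darrI) auto

lemma darr_seg: "darr p f q \<Longrightarrow> s \<le> t \<Longrightarrow> t \<le> p \<Longrightarrow> darr (t - s) (seg f s t) (f t - f s)"
  unfolding seg_def
proof (rule darrI)
  fix i assume "darr p f q" "s \<le> t" "t \<le> p" "i \<le> t - s"
  then show "(\<lambda>k\<in>{0..t - s}. f (k + s) - f s) i \<le> f t - f s"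
    using darrD(2)[of p f q "i + s" t] by (simp add: diff_le_mono)
next
  fix i j assume "darr p f q" "s \<le> t" "t \<le> p" "i \<le> j" "j \<le> t - s"
  then show "(\<lambda>k\<in>{0..t - s}. f (k + s) - f s) i \<le> (\<lambda>k\<in>{0..t - s}. f (k + s) - f s) j"
    using darrD(2)[of p f q "i + s" "j + s"] by (simp add: diff_le_mono)
qed simp

lemma famsD:
  assumes "x \<in> fams K N"
  shows "bead N s t \<Longrightarrow> x s t \<in> Sim K (t - s)" "\<not> bead N s t \<Longrightarrow> x s t = undefined"
    "bead N s t \<Longrightarrow> s \<le> s' \<Longrightarrow> s' \<le> t' \<Longrightarrow> t' \<le> t \<Longrightarrow> x s' t' = face K (t - s) (s' - s) (t' - s) (x s t)"
  using assms unfolding fams_def by blast+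

lemma fams_eqI:
  assumes "x \<in> fams K N" "y \<in> fams K N" "\<And>s t. bead N s t \<Longrightarrow> x s t = y s t"
  shows "x = y"
proof (intro ext)
  fix s t show "x s t = y s t" using assms famsD(2)[OF assms(1), of s t] famsD(2)[OF assms(2), of s t]
    by metis
qed

context simplicial_set
begin

section \<open>Pulling families back along necklace maps\<close>

lemma face_closed [simp]: "s \<le> t \<Longrightarrow> t \<le> n \<Longrightarrow> z \<in> Sim K n \<Longrightarrow> face K n s t z \<in> Sim K (t - s)"
  unfolding face_def by (rule act_closed[OF darr_face])

lemma face_face:
  assumes "s \<le> s'" "s' \<le> t'" "t' \<le> t" "t \<le> n" "z \<in> Sim K n"
  shows "face K (t - s) (s' - s) (t' - s) (face K n s t z) = face K n s' t' z"
proof -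
  have 1: "darr (t' - s') (\<lambda>k\<in>{0..t' - s'}. k + (s' - s)) (t - s)" by (rule darrI) (use assms in auto)
  have 2: "t' - s - (s' - s) = t' - s'" using assms by simp
  have 3: "compose {0..t' - s'} (\<lambda>k\<in>{0..t - s}. k + s) (\<lambda>k\<in>{0..t' - s'}. k + (s' - s)) =
    (\<lambda>k\<in>{0..t' - s'}. k + s')"
    using assms by (auto simp: compose_def fun_eq_iff)
  show ?thesis
    unfolding face_def 2 using act_comp[OF 1 darr_face[of s t n] assms(5)] assms 3 by simp
qed

lemma face_all [simp]: "z \<in> Sim K n \<Longrightarrow> face K n 0 n z = z"
  unfolding face_def by (simp, rule act_ident) auto

text \<open>Compatibility with faces holds because the two ways of mapping the interval from
  \<open>s'\<close> to \<open>t'\<close> into the one from \<open>f s\<close> to \<open>f t\<close>,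
  namely applying \<open>f\<close> before or after enlarging the interval, are the same monotone
  map.\<close>

lemma pull_fams:
  assumes f: "(N, f, M) \<in> Arr Nec" and x: "x \<in> fams K M"
  shows "pull K (N, f, M) x \<in> fams K N"
proof -
  note fD = Arr_NecD[OF f] and xD = famsD[OF x]
  have m: "f i \<le> f j" if "i \<le> j" "j \<le> snd N" for i j using darrD(2)[OF fD(3)] that by blast
  show ?thesis
    unfolding fams_def mem_Collect_eq
  proof (intro conjI allI impI)
    fix s t assume b: "bead N s t"
    then have st: "s \<le> t" "t \<le> snd N" by (auto simp: bead_def)
    note b' = bead_map[OF f b]
    show "pull K (N, f, M) x s t \<in> Sim K (t - s)"
      using b xD(1)[OF b'] act_closed[OF darr_seg[OF fD(3) st]] by (simp add: pull_def)
    fix s' t' assume l: "s \<le> s'" "s' \<le> t'" "t' \<le> t"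
    have t': "t' \<le> snd N" using l st by simp
    have "pull K (N, f, M) x s' t' = Act K (t' - s', seg f s' t', f t' - f s') (x (f s') (f t'))"
      using bead_sub[OF b l] by (simp add: pull_def)
    also have "x (f s') (f t') = face K (f t - f s) (f s' - f s) (f t' - f s) (x (f s) (f t))"
      by (rule xD(3)[OF b']) (use m l st in auto)
    also have "Act K (t' - s', seg f s' t', f t' - f s') \<dots> =
      Act K (t' - s', compose {0..t' - s'} (\<lambda>k\<in>{0..f t' - f s'}. k + (f s' - f s)) (seg f s' t'), f t -
        f s) (x (f s) (f t))"
    proof -
      have e: "f t' - f s - (f s' - f s) = f t' - f s'" using m l st by simp
      have d: "darr (f t' - f s') (\<lambda>k\<in>{0..f t' - f s'}. k + (f s' - f s)) (f t - f s)"
        using darr_face[of "f s' - f s" "f t' - f s"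
          "f t - f s"] e m[of s s'] m[of s' t'] m[of t' t] l st by (simp add: diff_le_mono)
      show ?thesis
        unfolding face_def e by (rule act_comp[OF darr_seg[OF fD(3) l(2) t'] d xD(1)[OF b']])
    qed
    also have "compose {0..t' - s'} (\<lambda>k\<in>{0..f t' - f s'}. k + (f s' - f s)) (seg f s' t') =
      compose {0..t' - s'} (seg f s t) (\<lambda>k\<in>{0..t' - s'}. k + (s' - s))"
    proof
      fix k
      show "compose {0..t' - s'} (\<lambda>k\<in>{0..f t' - f s'}. k + (f s' - f s)) (seg f s' t') k =
        compose {0..t' - s'} (seg f s t) (\<lambda>k\<in>{0..t' - s'}. k + (s' - s)) k"
      proof (cases "k \<le> t' - s'")
        case True
        then have k: "k + s' \<le> t'" "k + s' \<le> snd N" "k + (s' - s) \<le> t - s" using l t' by auto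
        show ?thesis using True m[of s' "k + s'"] m[of "k + s'" t'] m[of s s'] k l st
          by (auto simp: compose_def seg_def diff_le_mono)
      qed (simp add: compose_def)
    qed
    also have "Act K (t' - s', \<dots>, f t - f s) (x (f s) (f t)) =
      Act K (t' - s', (\<lambda>k\<in>{0..t' - s'}. k + (s' - s)), t - s) (Act K (t - s, seg f s t, f t - f s) (x (f
        s) (f t)))"
    proof -
      have "darr (t' - s') (\<lambda>k\<in>{0..t' - s'}. k + (s' - s)) (t - s)" by (rule darrI) (use l in auto)
      from act_comp[OF this darr_seg[OF fD(3) st] xD(1)[OF b']] show ?thesis by simp
    qed
    also have "\<dots> = face K (t - s) (s' - s) (t' - s) (pull K (N, f, M) x s t)"
      using b l by (simp add: face_def pull_def)
    finally show "pull K (N, f, M) x s' t' =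
      face K (t - s) (s' - s) (t' - s) (pull K (N, f, M) x s t)" .
  qed (simp add: pull_def)
qed

lemma pull_Idt:
  assumes "x \<in> fams K N"
  shows "pull K (N, \<lambda>i \<in> {0..snd N}. i, N) x = x"
proof (intro ext)
  fix s t
  show "pull K (N, \<lambda>i \<in> {0..snd N}. i, N) x s t = x s t"
  proof (cases "bead N s t")
    case True
    then have "s \<le> t" "t \<le> snd N" by (auto simp: bead_def)
    then show ?thesis using True famsD(1)[OF assms True] act_ident[of "x s t" "t - s"
      "seg (\<lambda>i \<in> {0..snd N}. i) s t"]
      by (auto simp: pull_def seg_def)
  qed (simp add: pull_def famsD(2)[OF assms])
qed

lemma pull_Cmp:
  assumes f: "(N, f, M) \<in> Arr Nec" and g: "(M, g, L) \<in> Arr Nec" and x: "x \<in> fams K L"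
  shows "pull K (N, compose {0..snd N} g f, L) x = pull K (N, f, M) (pull K (M, g, L) x)"
proof (intro ext)
  fix s t
  note fD = Arr_NecD[OF f] and gD = Arr_NecD[OF g]
  show "pull K (N, compose {0..snd N} g f, L) x s t = pull K (N, f, M) (pull K (M, g, L) x) s t"
  proof (cases "bead N s t")
    case b: True
    then have st: "s \<le> t" "t \<le> snd N" by (auto simp: bead_def)
    have m: "f i \<le> f j" if "i \<le> j" "j \<le> snd N" for i j using darrD(2)[OF fD(3)] that by blast
    have ft: "f s \<le> f t" "f t \<le> snd M" using m st darrD(1)[OF fD(3)] by auto
    note b' = bead_map[OF f b]
    note b'' = bead_map[OF g b']
    have s: "compose {0..t - s} (seg g (f s) (f t)) (seg f s t) = seg (compose {0..snd N} g f) s t"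
    proof
      fix k show "compose {0..t - s} (seg g (f s) (f t)) (seg f s t) k =
        seg (compose {0..snd N} g f) s t k"
        using m[of s "k + s"] m[of "k + s" t] st by (auto simp: compose_def seg_def diff_le_mono)
    qed
    show ?thesis
      using act_comp[OF darr_seg[OF fD(3) st] darr_seg[OF gD(3) ft] famsD(1)[OF x b'']] b b' st
      by (simp add: pull_def s) (simp add: compose_def)
  qed (simp add: pull_def)
qed

text \<open>Necklace maps preserve the two end points, and the only arrow from [0] to itself acts
  trivially on vertices. Hence pulling back never leaves the fibre over a pair \<open>a\<close>,
  \<open>b\<close>.\<close>

lemma pull_ends:
  assumes f: "(N, f, M) \<in> Arr Nec" and x: "x \<in> fams K M"
  shows "pull K (N, f, M) x 0 0 = x 0 0" "pull K (N, f, M) x (snd N) (snd N) = x (snd M) (snd M)"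
proof -
  note fD = Arr_NecD[OF f]
  have "x t t \<in> Sim K 0" if "t \<le> snd M" for t using famsD(1)[OF x, of t t] that by simp
  moreover have "Act K (0, seg f t t, 0) z = z" if "z \<in> Sim K 0" for t z
    by (rule act_ident[OF that]) (auto simp: seg_def)
  ultimately show "pull K (N, f, M) x 0 0 = x 0 0" "pull K (N, f, M) x (snd N) (snd N) =
    x (snd M) (snd M)"
    using fD by (auto simp: pull_def)
qed

lemma sfam_fams: "z \<in> Sim K n \<Longrightarrow> sfam K n z \<in> fams K (simplex n)"
  unfolding fams_def by (auto simp: sfam_def face_face)

lemma sfam_top [simp]: "z \<in> Sim K n \<Longrightarrow> sfam K n z 0 n = z"
  by (simp add: sfam_def)

lemma fams_simplex: "x \<in> fams K (simplex n) \<Longrightarrow> x = sfam K n (x 0 n)"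
proof -
  assume x: "x \<in> fams K (simplex n)"
  have z: "x 0 n \<in> Sim K n" using famsD(1)[OF x, of 0 n] by simp
  show ?thesis
  proof (rule fams_eqI[OF x sfam_fams[OF z]])
    fix s t assume "bead (simplex n) s t"
    then have st: "s \<le> t" "t \<le> n" by simp_all
    have "x s t = face K (n - 0) (s - 0) (t - 0) (x 0 n)" by (rule famsD(3)[OF x]) (use st in simp_all)
    then show "x s t = sfam K n (x 0 n) s t" using st by (simp add: sfam_def)
  qed
qed

lemma pull_sfam:
  assumes f: "(simplex m, f, simplex n) \<in> Arr Nec" and z: "z \<in> Sim K n"
  shows "pull K (simplex m, f, simplex n) (sfam K n z) = sfam K m (Act K (m, f, n) z)"
proof -
  let ?x = "pull K (simplex m, f, simplex n) (sfam K n z)"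
  note fD = Arr_NecD[OF f]
  have "seg f 0 m = f"
  proof
    fix k show "seg f 0 m k = f k" using fD(4) darrD(3)[OF fD(3), of k] by (auto simp: seg_def)
  qed
  then have "?x 0 m = Act K (m, f, n) z" using fD z by (simp add: pull_def)
  then show ?thesis using fams_simplex[OF pull_fams[OF f sfam_fams[OF z]]] by simp
qed

section \<open>Gluing families along a wedge and cutting them again\<close>

lemma wfam_fams:
  assumes N: "is_necklace N" "is_necklace M" and x: "x \<in> fams K N" and y: "y \<in> fams K M"
    and xy: "x (snd N) (snd N) = y 0 0"
  shows "wfam N x M y \<in> fams K (wedge N M)"
proof -
  note b = bead_wedge[OF N]
  have val: "wfam N x M y s t = (if snd N \<le> s then y (s - snd N) (t - snd N) else x s t)" if "bead
    (wedge N M) s t" for s t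
  proof -
    have "s \<le> t" using that by (simp add: bead_def)
    then have "s = snd N" "t = snd N" if "snd N \<le> s" "t \<le> snd N" using that by simp_all
    then show ?thesis using that xy bead_wedge_gt[OF N that] by (auto simp: wfam_def)
  qed
  show ?thesis
    unfolding fams_def mem_Collect_eq
  proof (intro conjI allI impI)
    fix s t assume B: "bead (wedge N M) s t"
    then show "wfam N x M y s t \<in> Sim K (t - s)"
      using famsD(1)[OF x, of s t] famsD(1)[OF y, of "s - snd N" "t - snd N"] b
      by (auto simp: wfam_def bead_def split: if_splits)
    fix s' t' assume l: "s \<le> s'" "s' \<le> t'" "t' \<le> t"
    note B' = bead_sub[OF B l]
    show "wfam N x M y s' t' = face K (t - s) (s' - s) (t' - s) (wfam N x M y s t)"
    proof (cases "t \<le> snd N")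
      case True
      then have "bead N s t" by (rule bead_wedge_le[OF B])
      then show ?thesis using True B B' l famsD(3)[OF x, of s t s' t'] by (simp add: wfam_def)
    next
      case False
      then have "snd N \<le> s" "bead M (s - snd N) (t - snd N)" using B b by auto
      then show ?thesis using B B' l famsD(3)[OF y, of "s - snd N" "t - snd N" "s' - snd N"
        "t' - snd N"]
        by (simp add: val)
    qed
  qed (simp add: wfam_def)
qed

lemma wfam_ends:
  assumes N: "is_necklace N" "is_necklace M" and xy: "x (snd N) (snd N) = y 0 0"
  shows "wfam N x M y 0 0 = x 0 0" "wfam N x M y (snd N + snd M) (snd N + snd M) = y (snd M) (snd M)"
  using xy by (auto simp: wfam_def)

text \<open>Together with \<open>parts_wfam\<close> this is the universal property of the wedge as a
  pushout: families on it are pairs of families that agree at the gluing vertex.\<close>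

lemma wfam_parts:
  assumes N: "is_necklace N" "is_necklace M" and x: "x \<in> fams K (wedge N M)"
  shows "lfam N x \<in> fams K N" "rfam N M x \<in> fams K M" "lfam N x (snd N) (snd N) = rfam N M x 0 0"
    "wfam N (lfam N x) M (rfam N M x) = x"
proof -
  note b = bead_wedge[OF N]
  have B1: "bead (wedge N M) s t" if "bead N s t" for s t using that by (rule bead_wedge_left[OF N])
  have B2: "bead (wedge N M) (s + snd N) (t + snd N)" if "bead M s t" for s t
    using that by (rule bead_wedge_right[OF N])
  show "lfam N x \<in> fams K N"
    unfolding fams_def mem_Collect_eq lfam_def using famsD[OF x] B1 bead_sub by (auto simp: bead_sub)
  show "rfam N M x \<in> fams K M"
    unfolding fams_def mem_Collect_eq
  proof (intro conjI allI impI)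
    fix s t assume B: "bead M s t"
    show "rfam N M x s t \<in> Sim K (t - s)" using famsD(1)[OF x B2[OF B]] B by (simp add: rfam_def)
    fix s' t' assume l: "s \<le> s'" "s' \<le> t'" "t' \<le> t"
    show "rfam N M x s' t' = face K (t - s) (s' - s) (t' - s) (rfam N M x s t)"
      using famsD(3)[OF x B2[OF B], of "s' + snd N" "t' + snd N"] B l bead_sub[OF B l]
        by (simp add: rfam_def)
  qed (simp add: rfam_def)
  show "lfam N x (snd N) (snd N) = rfam N M x 0 0" by (simp add: lfam_def rfam_def)
  show "wfam N (lfam N x) M (rfam N M x) = x"
  proof (intro ext)
    fix s t
    show "wfam N (lfam N x) M (rfam N M x) s t = x s t"
    proof (cases "bead (wedge N M) s t")
      case True
      show ?thesis
      proof (cases "t \<le> snd N")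
        case t: True
        then have "bead N s t" using True by (fastforce simp: bead_def fst_wedge)
        then show ?thesis using t True by (simp add: wfam_def lfam_def)
      next
        case False
        then have "snd N \<le> s" "bead M (s - snd N) (t - snd N)" using True b by auto
        then show ?thesis using False True by (simp add: wfam_def rfam_def)
      qed
    qed (simp add: wfam_def famsD(2)[OF x])
  qed
qed

lemma parts_wfam:
  assumes N: "is_necklace N" "is_necklace M" and x: "x \<in> fams K N" and y: "y \<in> fams K M"
    and xy: "x (snd N) (snd N) = y 0 0"
  shows "lfam N (wfam N x M y) = x" "rfam N M (wfam N x M y) = y"
proof -
  note b = bead_wedge[OF N] and w = wfam_fams[OF assms]
  show "lfam N (wfam N x M y) = x"
    by (rule fams_eqI[OF wfam_parts(1)[OF N w] x])
      (use bead_wedge_left[OF N] in \<open>auto simp: lfam_def wfam_def bead_def[of N]\<close>)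
  show "rfam N M (wfam N x M y) = y"
  proof (rule fams_eqI[OF wfam_parts(2)[OF N w] y])
    fix s t assume B: "bead M s t"
    then have "bead (wedge N M) (s + snd N) (t + snd N)" by (rule bead_wedge_right[OF N])
    then show "rfam N M (wfam N x M y) s t = y s t"
      using B xy by (auto simp: rfam_def wfam_def bead_def)
  qed
qed

lemma wfam_inj:
  assumes N: "is_necklace N" "is_necklace M" and x: "x \<in> fams K N" "x' \<in> fams K N" and y: "y \<in> fams K M"
    "y' \<in> fams K M"
    and xy: "x (snd N) (snd N) = y 0 0" "x' (snd N) (snd N) = y' 0 0"
    and eq: "wfam N x M y = wfam N x' M y'"
  shows "x = x'" "y = y'"
  using parts_wfam[OF N x(1) y(1) xy(1)] parts_wfam[OF N x(2) y(2) xy(2)] eq by auto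

lemma wfam_assoc:
  assumes "is_necklace N" "is_necklace M" "is_necklace L" "x (snd N) (snd N) =
    y 0 0" "y (snd M) (snd M) = z 0 0"
  shows "wfam (wedge N M) (wfam N x M y) L z = wfam N x (wedge M L) (wfam M y L z)"
proof (intro ext)
  fix s t
  show "wfam (wedge N M) (wfam N x M y) L z s t = wfam N x (wedge M L) (wfam M y L z) s t"
  proof (cases "bead (wedge N (wedge M L)) s t")
    case True
    have NM: "is_necklace (wedge N M)" "is_necklace (wedge M L)" using assms by auto
    have 1: "bead (wedge N M) s t \<longleftrightarrow> t \<le> snd N + snd M" if "\<not> t \<le> snd N \<or> True"
      using True bead_wedge[OF NM(1) assms(3), of s t]
        by (auto simp: wedge_assoc bead_def is_necklace_iff)
    have 2: "bead (wedge M L) (s - snd N) (t - snd N)" if "\<not> t \<le> snd N"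
      using True bead_wedge[OF assms(1) NM(2), of s t] that by auto
    show ?thesis using True 1 2 by (auto simp: wfam_def wedge_assoc)
  qed (simp add: wfam_def wedge_assoc)
qed

lemma wfam_unit_left:
  assumes "is_necklace N" "y \<in> fams K N" "x 0 0 = y 0 0"
  shows "wfam (simplex 0) x N y = y"
proof (intro ext)
  fix s t show "wfam (simplex 0) x N y s t = y s t"
    using assms famsD(2)[OF assms(2), of s t] by (auto simp: wfam_def bead_def)
qed

lemma wfam_unit_right:
  assumes "is_necklace N" "x \<in> fams K N"
  shows "wfam N x (simplex 0) y = x"
proof (intro ext)
  fix s t show "wfam N x (simplex 0) y s t = x s t"
    using assms famsD(2)[OF assms(2), of s t] by (auto simp: wfam_def bead_def)
qed

text \<open>Each bead of the source wedge lies on one side of the gluing point, where the wedge of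
  the two maps is one of them up to a shift.\<close>

lemma pull_wfam:
  assumes f: "(N, f, M) \<in> Arr Nec" and g: "(N', g, M') \<in> Arr Nec"
    and xy: "x (snd M) (snd M) = y 0 0"
  shows "pull K ((N, f, M) \<odot>\<^bsub>Nec\<^esub> (N', g, M')) (wfam M x M' y) =
    wfam N (pull K (N, f, M) x) N' (pull K (N', g, M') y)"
proof (intro ext)
  fix s t
  note fD = Arr_NecD[OF f] and gD = Arr_NecD[OF g]
  let ?h = "wedge_map (snd N) (snd N') f (snd M) g"
  have h: "i \<le> snd N \<Longrightarrow> ?h i = f i" "snd N \<le> i \<Longrightarrow> i \<le> snd N + snd N' \<Longrightarrow> ?h i = snd M + g (i - snd N)" for i
    using wedge_map_apply[OF fD(3) fD(5), where g=g and q="snd N'"] gD(4) by simp_all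
  note b = bead_wedge[OF fD(1) gD(1)] and b' = bead_wedge[OF fD(2) gD(2)]
  show "pull K ((N, f, M) \<odot>\<^bsub>Nec\<^esub> (N', g, M')) (wfam M x M' y) s t =
    wfam N (pull K (N, f, M) x) N' (pull K (N', g, M') y) s t"
  proof (cases "bead (wedge N N') s t")
    case B: True
    then have st: "s \<le> t" by (simp add: bead_def)
    show ?thesis
    proof (cases "t \<le> snd N")
      case True
      then have BN: "bead N s t" using B by (fastforce simp: bead_def fst_wedge)
      have "seg ?h s t = seg f s t" using True st by (auto simp: seg_def h intro!: restrict_ext)
      moreover have "bead (wedge M M') (f s) (f t)" "f t \<le> snd M"
        using bead_map[OF f BN] b' by (auto simp: bead_def)
      ultimately show ?thesis using B BN True st h by (simp add: pull_def wfam_def)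
    next
      case False
      then have BN: "snd N \<le> s" "bead N' (s - snd N) (t - snd N)" using B b by auto
      have t: "t \<le> snd N + snd N'" using B by (simp add: bead_def)
      have "seg ?h s t = seg g (s - snd N) (t - snd N)"
        using BN st t by (auto simp: seg_def h intro!: restrict_ext)
      moreover have "bead (wedge M M') (snd M + g (s - snd N)) (snd M + g (t - snd N))"
        using bead_wedge_right[OF fD(2) gD(2) bead_map[OF g BN(2)]] by (simp add: add.commute)
      moreover have "g (s - snd N) \<le> g (t - snd N)" using bead_map[OF g BN(2)] by (simp add: bead_def)
      ultimately show ?thesis using B BN False st t h xy by (auto simp: pull_def wfam_def)
    qed
  qed (simp add: pull_def wfam_def)
qed

text \<open>Forgetting the middle joint restricts a simplex to its front face of dimension
  \<open>i\<close> and its back face of dimension \<open>j\<close>; on every bead both sides are the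
  same face of \<open>z\<close>.\<close>

lemma pull_join:
  assumes z: "z \<in> Sim K (i + j)"
  shows "pull K (join i j) (sfam K (i + j) z) =
    wfam (simplex i) (sfam K i (face K (i + j) 0 i z)) (simplex j) (sfam K j (face K (i + j) i (i + j)
      z))"
proof (intro ext)
  fix s t
  let ?N = "wedge (simplex i) (simplex j)"
  note b = bead_wedge[of "simplex i" "simplex j" s t]
  show "pull K (join i j) (sfam K (i + j) z) s t =
    wfam (simplex i) (sfam K i (face K (i + j) 0 i z)) (simplex j) (sfam K j (face K (i + j) i (i + j)
      z)) s t"
  proof (cases "bead ?N s t")
    case B: True
    then have st: "s \<le> t" "t \<le> i + j" by (auto simp: bead_def)
    have "Act K (t - s, seg (\<lambda>l\<in>{0..i + j}. l) s t, t - s) (face K (i + j) s t z) =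
      face K (i + j) s t z"
      by (rule act_ident) (use st z in \<open>auto simp: seg_def\<close>)
    then have "pull K (join i j) (sfam K (i + j) z) s t = face K (i + j) s t z"
      using B st by (simp add: pull_def join_def sfam_def)
    also have "\<dots> = wfam (simplex i) (sfam K i (face K (i + j) 0 i z)) (simplex j) (sfam K j (face K (i +
      j) i (i + j) z)) s t"
    proof (cases "t \<le> i")
      case True
      then show ?thesis using B st z face_face[of 0 s t i "i + j" z] by (simp add: wfam_def sfam_def)
    next
      case False
      then have "i \<le> s" using B b by auto
      moreover have "s - i \<le> t - i" "t - i \<le> j" using st by (simp_all add: diff_le_mono)
      ultimately show ?thesis using False B st z face_face[of i s t "i + j" "i + j" z]
        by (simp add: wfam_def sfam_def)
    qed
    finally show ?thesis .
  qed (simp add: pull_def join_def wfam_def)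
qed

end


section \<open>Nondegenerate necklaces\<close>

lemma mem_wedge:
  "is_necklace N \<Longrightarrow> is_necklace M \<Longrightarrow>
    i \<in> fst (wedge N M) \<longleftrightarrow> (i \<le> snd N \<and> i \<in> fst N) \<or> (snd N \<le> i \<and> i - snd N \<in> fst M)"
  by (auto simp: fst_wedge is_necklace_iff image_iff intro: le_add_diff_inverse[symmetric])

lemma adjacent_bead:
  "is_necklace N \<Longrightarrow> s \<le> t \<Longrightarrow> adjacent_joints (fst N) s t \<longleftrightarrow> s \<in> fst N \<and> t \<in> fst N \<and> bead N s t"
  by (auto simp: adjacent_joints_def bead_def is_necklace_iff)

lemma nondeg_iff:
  assumes "is_necklace N"
  shows "nondeg K N x \<longleftrightarrow> (\<forall>s t. s < t \<longrightarrow> s \<in> fst N \<longrightarrow> t \<in> fst N \<longrightarrow> bead N s t \<longrightarrow>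
    \<not> degenerate K (t - s) (x s t))"
  unfolding nondeg_def using adjacent_bead[OF assms] by (meson less_imp_le)

lemma nondeg_wfam:
  assumes N: "is_necklace N" "is_necklace M"
  shows "nondeg K (wedge N M) (wfam N x M y) \<longleftrightarrow> nondeg K N x \<and> nondeg K M y"
proof -
  have W: "is_necklace (wedge N M)" using N by simp
  show ?thesis
    unfolding nondeg_iff[OF W] nondeg_iff[OF N(1)] nondeg_iff[OF N(2)]
  proof (intro iffI conjI allI impI)
    assume A: "\<forall>s t. s < t \<longrightarrow> s \<in> fst (wedge N M) \<longrightarrow> t \<in> fst (wedge N M) \<longrightarrow> bead (wedge N M) s t \<longrightarrow>
      \<not> degenerate K (t - s) (wfam N x M y s t)"
    show "\<not> degenerate K (t - s) (x s t)" if "s < t" "s \<in> fst N" "t \<in> fst N" "bead N s t" for s t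
    proof -
      have "t \<le> snd N" using that by (simp add: bead_def)
      moreover have "s \<in> fst (wedge N M)" "t \<in> fst (wedge N M)"
        using that \<open>t \<le> snd N\<close> mem_wedge[OF N, of s] mem_wedge[OF N, of t] by simp_all
      ultimately show ?thesis using A[rule_format, of s t] that bead_wedge_left[OF N that(4)]
        by (simp add: wfam_def)
    qed
    show "\<not> degenerate K (t - s) (y s t)" if "s < t" "s \<in> fst M" "t \<in> fst M" "bead M s t" for s t
      using A[rule_format, of "s + snd N" "t + snd N"] that bead_wedge_right[OF N that(4)]
        mem_wedge[OF N, of "s + snd N"] mem_wedge[OF N, of "t + snd N"]
      by (simp add: wfam_def)
  next
    fix s t
    assume A: "(\<forall>s t. s < t \<longrightarrow> s \<in> fst N \<longrightarrow> t \<in> fst N \<longrightarrow> bead N s t \<longrightarrow> \<not> degenerate K (t - s) (x s t)) \<and>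
       (\<forall>s t. s < t \<longrightarrow> s \<in> fst M \<longrightarrow> t \<in> fst M \<longrightarrow> bead M s t \<longrightarrow> \<not> degenerate K (t - s) (y s t))"
      and B: "s < t" "s \<in> fst (wedge N M)" "t \<in> fst (wedge N M)" "bead (wedge N M) s t"
    show "\<not> degenerate K (t - s) (wfam N x M y s t)"
    proof (cases "t \<le> snd N")
      case True
      then have "s \<in> fst N" "t \<in> fst N"
        using B mem_wedge[OF N, of s] mem_wedge[OF N, of t] N by (auto simp: is_necklace_iff)
      then show ?thesis using A B True bead_wedge_le[OF B(4) True] by (simp add: wfam_def)
    next
      case False
      note g = bead_wedge_gt[OF N B(4) False]
      then have "s - snd N \<in> fst M" "t - snd N \<in> fst M"
        using B False mem_wedge[OF N, of s] mem_wedge[OF N, of t] N by (auto simp: is_necklace_iff)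
      moreover have "s - snd N < t - snd N" using g B(1) by (simp add: diff_less_mono)
      ultimately show ?thesis using A[THEN conjunct2, rule_format, of "s - snd N" "t - snd N"] g B False
        by (simp add: wfam_def)
    qed
  qed
qed

lemma wedge_map_image:
  assumes f: "(N, f, M) \<in> Arr Nec" and g: "(N', g, M') \<in> Arr Nec"
  defines "h \<equiv> wedge_map (snd N) (snd N') f (snd M) g"
  shows "h ` {0..snd N + snd N'} = f ` {0..snd N} \<union> (+) (snd M) ` g ` {0..snd N'}"
    "h ` fst (wedge N N') = f ` fst N \<union> (+) (snd M) ` g ` fst N'"
proof -
  note fD = Arr_NecD[OF f] and gD = Arr_NecD[OF g]
  have h: "i \<le> snd N \<Longrightarrow> h i = f i" "i \<le> snd N' \<Longrightarrow> h (snd N + i) = snd M + g i" for i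
    using wedge_map_apply[OF fD(3) fD(5), where g=g and q="snd N'"] gD(4) by (simp_all add: h_def)
  have "{0..snd N + snd N'} = {0..snd N} \<union> (+) (snd N) ` {0..snd N'}" by (auto simp: image_iff)
  moreover have "h ` {0..snd N} = f ` {0..snd N}" by (rule image_cong) (use h in auto)
  moreover have "h ` (+) (snd N) ` {0..snd N'} = (+) (snd M) ` g ` {0..snd N'}"
    unfolding image_image by (rule image_cong) (use h in auto)
  ultimately show "h ` {0..snd N + snd N'} = f ` {0..snd N} \<union> (+) (snd M) ` g ` {0..snd N'}"
    by (simp only: image_Un)
  have 1: "h ` fst N = f ` fst N" by (rule image_cong) (use fD(1) h in \<open>auto simp: is_necklace_iff\<close>)
  have 2: "h ` (+) (snd N) ` fst N' = (+) (snd M) ` g ` fst N'"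
    unfolding image_image by (rule image_cong) (use gD(1) h in \<open>auto simp: is_necklace_iff\<close>)
  show "h ` fst (wedge N N') = f ` fst N \<union> (+) (snd M) ` g ` fst N'"
    unfolding fst_wedge image_Un 1 2 ..
qed

lemma Nec_tens:
  assumes f: "(N, f, M) \<in> Arr Nec" and g: "(N', g, M') \<in> Arr Nec"
  shows "(N, f, M) \<odot>\<^bsub>Nec\<^esub> (N', g, M') \<in> Arr Nec"
proof -
  note fD = Arr_NecD[OF f] and gD = Arr_NecD[OF g]
  let ?h = "wedge_map (snd N) (snd N') f (snd M) g"
  have fl: "i \<le> snd N \<Longrightarrow> f i \<le> snd M" for i using darrD(1)[OF fD(3)] .
  have "darr (snd N + snd N') ?h (snd M + snd M')"
  proof (rule darrI)
    show "?h i \<le> snd M + snd M'" if "i \<le> snd N + snd N'" for i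
      using that fl[of i] darrD(1)[OF gD(3), of "i - snd N"] by (auto simp: wedge_map_def)
    show "?h i \<le> ?h j" if "i \<le> j" "j \<le> snd N + snd N'" for i j
      using that fl[of i] darrD(2)[OF gD(3), of "i - snd N" "j - snd N"] darrD(2)[OF fD(3), of i j]
      by (auto simp: wedge_map_def)
  qed (simp add: wedge_map_def)
  moreover have "fst (wedge M M') \<subseteq> ?h ` fst (wedge N N')"
    unfolding wedge_map_image[OF f g] using fD gD by (auto simp: fst_wedge)
  moreover have "?h 0 = 0" "?h (snd N + snd N') = snd M + snd M'"
    using fD gD by (auto simp: wedge_map_def)
  ultimately show ?thesis using fD gD by (simp add: Arr_Nec)
qed

text \<open>Two sets glued at one point are determined by their union, so surjectivity and activity
  can be tested on each side separately. The passage from the wedge to its parts is what allows a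
  factorisation to be cut.\<close>

lemma Nec_minus_tens:
  assumes f: "(N, f, M) \<in> Arr Nec" and g: "(N', g, M') \<in> Arr Nec"
  shows "(N, f, M) \<odot>\<^bsub>Nec\<^esub> (N', g, M') \<in> Arr Nec_minus \<longleftrightarrow>
    (N, f, M) \<in> Arr Nec_minus \<and> (N', g, M') \<in> Arr Nec_minus"
proof -
  note fD = Arr_NecD[OF f] and gD = Arr_NecD[OF g]
  note im = wedge_map_image[OF f g]
  have S: "{0..snd M + snd M'} = {0..snd M} \<union> (+) (snd M) ` {0..snd M'}" by (auto simp: image_iff)
  \<comment> \<open>The shared point \<open>q\<close> lies in \<open>A\<close> and \<open>C\<close>,
    and 0 lies in \<open>B\<close> and \<open>D\<close>; otherwise a point at \<open>q\<close> could
    not be attributed to a side.\<close>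
  have key: "A \<union> (+) q ` B = C \<union> (+) q ` D \<longleftrightarrow> A = C \<and> B = D"
    if "\<forall>a \<in> A. a \<le> q" "\<forall>a \<in> C. a \<le> q" "q \<in> A" "q \<in> C" "0 \<in> B" "0 \<in> D" for A B C D :: "nat set" and q
  proof
    assume eq: "A \<union> (+) q ` B = C \<union> (+) q ` D"
    have 1: "A \<subseteq> C" if "A \<union> (+) q ` B = C \<union> (+) q ` D" "\<forall>a \<in> A. a \<le> q" "q \<in> C" for A B C D :: "nat set"
    proof
      fix a assume a: "a \<in> A"
      then have "a \<le> q" "a \<in> C \<union> (+) q ` D" using that by auto
      then show "a \<in> C" using that(3) by auto
    qed
    have 2: "B \<subseteq> D" if "A \<union> (+) q ` B = C \<union> (+) q ` D" "\<forall>a \<in> C. a \<le> q" "0 \<in> D" for A B C D :: "nat set"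
    proof
      fix a assume a: "a \<in> B"
      then have "q + a \<in> C \<union> (+) q ` D" using that(1) by auto
      then show "a \<in> D" using that(2,3) by auto
    qed
    show "A = C \<and> B = D"
      using 1[of A B C D] 1[of C D A B] 2[of A B C D] 2[of C D A B] eq that by auto
  qed auto
  have a: "f ` {0..snd N} \<union> (+) (snd M) ` g ` {0..snd N'} = {0..snd M} \<union> (+) (snd M) ` {0..snd M'} \<longleftrightarrow>
    f ` {0..snd N} = {0..snd M} \<and> g ` {0..snd N'} = {0..snd M'}"
    by (rule key) (use fD gD darrD(1)[OF fD(3)] in \<open>auto intro: image_eqI[of _ _ "snd N"] image_eqI[of _
      _ 0]\<close>)
  have b: "f ` fst N \<union> (+) (snd M) ` g ` fst N' = fst M \<union> (+) (snd M) ` fst M' \<longleftrightarrow>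
    f ` fst N = fst M \<and> g ` fst N' = fst M'"
    by (rule key) (use fD gD darrD(1)[OF fD(3)] in
      \<open>auto simp: is_necklace_iff intro: image_eqI[of _ _ "snd N"] image_eqI[of _ _ 0]\<close>)
  show ?thesis
    unfolding Nec_sel(7) Arr_Nec_minus snd_wedge im S a unfolding fst_wedge b
    using Nec_tens[OF f g, unfolded Nec_sel(7)] f g by (simp only: simp_thms conj_ac)
qed

context simplicial_set
begin

text \<open>On a simplex this is the Eilenberg-Zilber lemma, the surjection being active since it
  preserves the ends. On a wedge the two factorisations are glued; their end vertices agree because
  pulling back does not change end vertices.\<close>

lemma nondeg_factor_exists:
  "is_necklace N \<Longrightarrow> x \<in> fams K N \<Longrightarrow>
    \<exists>M e y. (N, e, M) \<in> Arr Nec_minus \<and> y \<in> fams K M \<and> nondeg K M y \<and> x = pull K (N, e, M) y"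
proof (induction N arbitrary: x rule: necklace_induct)
  case (simplex n)
  have z: "x 0 n \<in> Sim K n" using famsD(1)[OF simplex, of 0 n] by simp
  obtain m f y where f: "darr n f m" "f ` {0..n} = {0..m}" "y \<in> Sim K m" "\<not> degenerate K m y" "x 0 n =
    Act K (n, f, m) y"
    using Eilenberg_Zilber_exists[OF z] by blast
  have e: "(simplex n, f, simplex m) \<in> Arr Nec_minus"
    using f mono_surj_ends[OF darrD(4)[OF f(1)] f(2)] by (simp add: Arr_Nec_minus Arr_Nec fst_simplex)
  have "x = pull K (simplex n, f, simplex m) (sfam K m y)"
    using fams_simplex[OF simplex] pull_sfam[OF Nec_minusD[OF e] f(3)] f(5) by simp
  moreover have "nondeg K (simplex m) (sfam K m y)"
    using f(3,4) by (auto simp: nondeg_def adjacent_joints_def fst_simplex)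
  ultimately show ?case using e sfam_fams[OF f(3)] by blast
next
  case (wedge N M)
  note p = wfam_parts[OF wedge.hyps wedge.prems]
  obtain N' e y where 1: "(N, e, N') \<in> Arr Nec_minus" "y \<in> fams K N'" "nondeg K N' y" "lfam N x =
    pull K (N, e, N') y"
    using wedge.IH(1)[OF p(1)] by blast
  obtain M' f z where 2: "(M, f, M') \<in> Arr Nec_minus" "z \<in> fams K M'" "nondeg K M' z" "rfam N M x =
    pull K (M, f, M') z"
    using wedge.IH(2)[OF p(2)] by blast
  note eD = Arr_NecD[OF Nec_minusD[OF 1(1)]] and fD = Arr_NecD[OF Nec_minusD[OF 2(1)]]
  have yz: "y (snd N') (snd N') = z 0 0"
    using pull_ends(2)[OF Nec_minusD[OF 1(1)] 1(2)] pull_ends(1)[OF Nec_minusD[OF 2(1)] 2(2)] p(3) 1(4)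
      2(4) by simp
  have "x = pull K ((N, e, N') \<odot>\<^bsub>Nec\<^esub> (M, f, M')) (wfam N' y M' z)"
    using pull_wfam[where x=y and y=z, OF Nec_minusD[OF 1(1)] Nec_minusD[OF 2(1)] yz] p(4) 1(4) 2(4)
      by simp
  moreover have "(N, e, N') \<odot>\<^bsub>Nec\<^esub> (M, f, M') \<in> Arr Nec_minus"
    using Nec_minus_tens[OF Nec_minusD[OF 1(1)] Nec_minusD[OF 2(1)]] 1(1) 2(1) by blast
  moreover have "wfam N' y M' z \<in> fams K (wedge N' M')" "nondeg K (wedge N' M') (wfam N' y M' z)"
    using wfam_fams[OF eD(2) fD(2) 1(2) 2(2) yz] nondeg_wfam[OF eD(2) fD(2)] 1(3) 2(3) by auto
  ultimately show ?case unfolding Nec_sel by blast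
qed

text \<open>An active surjection out of a simplex leaves only the two ends as target joints, so its
  target is a simplex and Eilenberg-Zilber applies. Out of a wedge, activity sends the gluing joint
  to a joint, and there the target, the map and the family are cut.\<close>

lemma nondeg_factor_unique:
  "is_necklace N \<Longrightarrow> (N, e, M) \<in> Arr Nec_minus \<Longrightarrow> y \<in> fams K M \<Longrightarrow> nondeg K M y \<Longrightarrow>
    (N, e', M') \<in> Arr Nec_minus \<Longrightarrow> y' \<in> fams K M' \<Longrightarrow> nondeg K M' y' \<Longrightarrow>
    pull K (N, e, M) y = pull K (N, e', M') y' \<Longrightarrow> M = M' \<and> e = e' \<and> y = y'"
proof (induction N arbitrary: e M y e' M' y' rule: necklace_induct)
  case (simplex n)
  have key: "M = simplex (snd M) \<and> y = sfam K (snd M) (y 0 (snd M)) \<and> y 0 (snd M) \<in> Sim K (snd M) \<and>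
      \<not> degenerate K (snd M) (y 0 (snd M)) \<and> darr n e (snd M) \<and> e ` {0..n} = {0..snd M} \<and>
      pull K (simplex n, e, M) y 0 n = Act K (n, e, snd M) (y 0 (snd M))"
    if "(simplex n, e, M) \<in> Arr Nec_minus" "y \<in> fams K M" "nondeg K M y" for e M y
  proof -
    note eD = Arr_NecD[OF Nec_minusD[OF that(1)]]
    have "fst M = {0, snd M}" using that(1) eD by (auto simp: Arr_Nec_minus fst_simplex)
    then have M: "M = simplex (snd M)" by (simp add: simplex_def prod_eq_iff)
    then have y: "y = sfam K (snd M) (y 0 (snd M))" using fams_simplex that(2) by metis
    have z: "y 0 (snd M) \<in> Sim K (snd M)"
      using famsD(1)[OF that(2), of 0 "snd M"] M by (metis bead_simplex diff_zero le0 order_refl)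
    have A: "adjacent_joints (fst M) 0 (snd M)"
      using \<open>fst M = {0, snd M}\<close> by (auto simp: adjacent_joints_def)
    have "\<not> degenerate K (snd M) (y 0 (snd M))"
    \<comment> \<open>A point has no beads, so \<open>nondeg\<close> says nothing about it; but a
      vertex is never degenerate, there being no smaller dimension.\<close>
    proof (cases "snd M = 0")
      case False
      then show ?thesis using that(3)[unfolded nondeg_def, rule_format, of 0 "snd M"] A by simp
    qed (simp add: degenerate_iff)
    moreover have "pull K (simplex n, e, M) y 0 n = Act K (n, e, snd M) (y 0 (snd M))"
    proof -
      have "(simplex n, e, simplex (snd M)) \<in> Arr Nec" using Nec_minusD[OF that(1)] M by metis
      then have "pull K (simplex n, e, simplex (snd M)) (sfam K (snd M) (y 0 (snd M))) =
        sfam K n (Act K (n, e, snd M) (y 0 (snd M)))"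
        using pull_sfam z by blast
      then have "pull K (simplex n, e, M) y = sfam K n (Act K (n, e, snd M) (y 0 (snd M)))"
        using M y by metis
      then show ?thesis using act_closed z eD(3) by simp
    qed
    ultimately show ?thesis using M y z eD(3) that(1) by (simp add: Arr_Nec_minus)
  qed
  note k = key[OF simplex(1-3)] and k' = key[OF simplex(4-6)]
  have "snd M = snd M' \<and> e = e' \<and> y 0 (snd M) = y' 0 (snd M')"
  proof (rule Eilenberg_Zilber_unique[where n=n])
    have "Act K (n, e, snd M) (y 0 (snd M)) = pull K (simplex n, e, M) y 0 n" using k by metis
    also have "\<dots> = Act K (n, e', snd M') (y' 0 (snd M'))" unfolding simplex(7) using k' by metis
    finally show "Act K (n, e, snd M) (y 0 (snd M)) = Act K (n, e', snd M') (y' 0 (snd M'))" .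
  qed (use k k' in blast)+
  then show ?case using k k' by metis
next
  case (wedge N1 N2)
  let ?r = "snd N1"
  have r: "?r \<in> fst (wedge N1 N2)" using wedge.hyps by (simp add: mem_wedge is_necklace_iff)
  have key: "\<exists>M1 M2 e1 e2 y1 y2. M = wedge M1 M2 \<and> (N1, e1, M1) \<in> Arr Nec_minus \<and>
    (N2, e2, M2) \<in> Arr Nec_minus \<and>
      (wedge N1 N2, e, M) = (N1, e1, M1) \<odot>\<^bsub>Nec\<^esub> (N2, e2, M2) \<and> y1 \<in> fams K M1 \<and> y2 \<in> fams K M2 \<and>
      y1 (snd M1) (snd M1) = y2 0 0 \<and> y = wfam M1 y1 M2 y2 \<and> nondeg K M1 y1 \<and> nondeg K M2 y2 \<and>
      pull K (wedge N1 N2, e, M) y = wfam N1 (pull K (N1, e1, M1) y1) N2 (pull K (N2, e2, M2) y2)"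
    if e: "(wedge N1 N2, e, M) \<in> Arr Nec_minus" and y: "y \<in> fams K M" "nondeg K M y" for e M y
  proof -
    have er: "e ?r \<in> fst M" using e r by (auto simp: Arr_Nec_minus)
    let ?M1 = "front M (e ?r)" and ?M2 = "rear M (e ?r)"
    obtain e1 e2 where s: "(N1, e1, ?M1) \<in> Arr Nec" "(N2, e2, ?M2) \<in> Arr Nec"
      "(wedge N1 N2, e, M) = (N1, e1, ?M1) \<odot>\<^bsub>Nec\<^esub> (N2, e2, ?M2)"
      using Nec_split[OF Nec_minusD[OF e] r er] front_wedge[OF wedge.hyps] by auto
    note M = split_necklace[OF Arr_NecD(2)[OF Nec_minusD[OF e]] er]
    have y': "y \<in> fams K (wedge ?M1 ?M2)" using y M by simp
    note p = wfam_parts[OF M(1,2) y']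
    have m: "(N1, e1, ?M1) \<in> Arr Nec_minus" "(N2, e2, ?M2) \<in> Arr Nec_minus"
      using Nec_minus_tens[OF s(1,2)] s(3) e by auto
    have nd: "nondeg K ?M1 (lfam ?M1 y)" "nondeg K ?M2 (rfam ?M1 ?M2 y)"
      using nondeg_wfam[OF M(1,2), of K "lfam ?M1 y" "rfam ?M1 ?M2 y"] p(4) M(3) y(2) by auto
    have "pull K (wedge N1 N2, e, M) y =
      wfam N1 (pull K (N1, e1, ?M1) (lfam ?M1 y)) N2 (pull K (N2, e2, ?M2) (rfam ?M1 ?M2 y))"
      using pull_wfam[where x="lfam ?M1 y" and y="rfam ?M1 ?M2 y", OF s(1,2) p(3)] s(3) p(4) by simp
    then show ?thesis using M(3) m s(3) p nd
      by (intro exI[of _ ?M1] exI[of _ ?M2] exI[of _ e1] exI[of _ e2]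
      exI[of _ "lfam ?M1 y"] exI[of _ "rfam ?M1 ?M2 y"]) auto
  qed
  obtain M1 M2 e1 e2 y1 y2 where k: "M =
    wedge M1 M2" "(N1, e1, M1) \<in> Arr Nec_minus" "(N2, e2, M2) \<in> Arr Nec_minus"
      "(wedge N1 N2, e, M) = (N1, e1, M1) \<odot>\<^bsub>Nec\<^esub> (N2, e2, M2)" "y1 \<in> fams K M1" "y2 \<in> fams K M2"
      "y1 (snd M1) (snd M1) = y2 0 0" "y = wfam M1 y1 M2 y2" "nondeg K M1 y1" "nondeg K M2 y2"
      "pull K (wedge N1 N2, e, M) y = wfam N1 (pull K (N1, e1, M1) y1) N2 (pull K (N2, e2, M2) y2)"
    using key[OF wedge.prems(1-3)] by blast
  obtain M1' M2' e1' e2' y1' y2' where k': "M' =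
    wedge M1' M2'" "(N1, e1', M1') \<in> Arr Nec_minus" "(N2, e2', M2') \<in> Arr Nec_minus"
      "(wedge N1 N2, e', M') = (N1, e1', M1') \<odot>\<^bsub>Nec\<^esub> (N2, e2', M2')" "y1' \<in> fams K M1'"
       "y2' \<in> fams K M2'"
      "y1' (snd M1') (snd M1') = y2' 0 0" "y' =
       wfam M1' y1' M2' y2'" "nondeg K M1' y1'" "nondeg K M2' y2'"
      "pull K (wedge N1 N2, e', M') y' = wfam N1 (pull K (N1, e1', M1') y1') N2 (pull K (N2, e2', M2')
       y2')"
    using key[OF wedge.prems(4-6)] by blast
  note m = Nec_minusD[OF k(2)] Nec_minusD[OF k(3)] and m' = Nec_minusD[OF k'(2)] Nec_minusD[OF k'(3)]
  have eq: "wfam N1 (pull K (N1, e1, M1) y1) N2 (pull K (N2, e2, M2) y2) =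
    wfam N1 (pull K (N1, e1', M1') y1') N2 (pull K (N2, e2', M2') y2')"
    using wedge.prems(7) k(11) k'(11) by simp
  have j: "pull K (N1, e1, M1) y1 (snd N1) (snd N1) = pull K (N2, e2, M2) y2 0 0"
    using pull_ends(2)[OF m(1) k(5)] pull_ends(1)[OF m(2) k(6)] k(7) by simp
  have j': "pull K (N1, e1', M1') y1' (snd N1) (snd N1) = pull K (N2, e2', M2') y2' 0 0"
    using pull_ends(2)[OF m'(1) k'(5)] pull_ends(1)[OF m'(2) k'(6)] k'(7) by simp
  note i = wfam_inj[OF wedge.hyps pull_fams[OF m(1) k(5)] pull_fams[OF m'(1) k'(5)] pull_fams[OF m(2)
    k(6)]
    pull_fams[OF m'(2) k'(6)] j j' eq]
  have "M1 = M1' \<and> e1 = e1' \<and> y1 = y1'"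
    by (rule wedge.IH(1)[OF k(2,5,9) k'(2,5,9) i(1)])
  moreover have "M2 = M2' \<and> e2 = e2' \<and> y2 = y2'"
    by (rule wedge.IH(2)[OF k(3,6,10) k'(3,6,10) i(2)])
  ultimately show ?case using k(1,4,8) k'(1,4,8) by simp
qed

end


subsection \<open>Comparison with simplicial maps out of a necklace\<close>

text \<open>The interval from \<open>s\<close> to \<open>t\<close> as a simplex of the necklace,
  with the summands in the order used by \<open>nondegenerate_maps\<close>.\<close>

definition ivl :: "nat \<Rightarrow> nat \<Rightarrow> nat \<Rightarrow> nat" where
  "ivl s t = (\<lambda>k \<in> {0..t - s}. s + k)"

text \<open>The last joint up to \<open>s\<close> and the first joint from \<open>t\<close> on
  enclose the interval and have no joint between them. They coincide when the interval is a single
  joint.\<close>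

lemma bead_adjacent:
  assumes "is_necklace N" "bead N s t"
  shows "\<exists>s' t'. s' \<le> t' \<and> adjacent_joints (fst N) s' t' \<and> s' \<le> s \<and> t \<le> t'"
proof -
  have N: "0 \<in> fst N" "snd N \<in> fst N" "\<And>t. t \<in> fst N \<Longrightarrow> t \<le> snd N" and st: "s \<le> t" "t \<le> snd N"
    using assms by (auto simp: is_necklace_iff bead_def)
  have fin: "finite (fst N)" using N(3) by (meson finite_nat_set_iff_bounded_le)
  let ?A = "{r \<in> fst N. r \<le> s}" and ?B = "{r \<in> fst N. t \<le> r}"
  have A: "Max ?A \<in> ?A" by (rule Max_in) (use fin N in auto)
  have B: "Min ?B \<in> ?B" by (rule Min_in) (use fin N st in auto)
  have "fst N \<inter> {Max ?A<..<Min ?B} = {}"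
  proof (rule ccontr)
    assume "\<not> ?thesis"
    then obtain r where r: "r \<in> fst N" "Max ?A < r" "r < Min ?B" by auto
    have "r \<le> Max ?A" if "r \<le> s" by (rule Max_ge) (use r fin that in auto)
    moreover have "Min ?B \<le> r" if "t \<le> r" by (rule Min_le) (use r fin that in auto)
    ultimately have "s < r" "r < t" using r by (meson not_less)+
    then show False using r assms(2) by (auto simp: bead_def)
  qed
  then show ?thesis using A B st by (intro exI[of _ "Max ?A"] exI[of _ "Min ?B"]) (auto simp:
    adjacent_joints_def)
qed

text \<open>By monotonicity the image of a simplex lies in one bead as soon as its two extreme
  vertices do.\<close>

lemma Sim_necklace:
  assumes N: "is_necklace N"
  shows "\<alpha> \<in> Sim (necklace_sset N) n \<longleftrightarrow> darr n \<alpha> (snd N) \<and> bead N (\<alpha> 0) (\<alpha> n)"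
proof -
  obtain T p where Np: "N = (T, p)" by (cases N)
  have "\<alpha> \<in> Sim (necklace_sset N) n \<longleftrightarrow>
    darr n \<alpha> p \<and> (\<exists>s t. s \<le> t \<and> adjacent_joints T s t \<and> \<alpha> ` {0..n} \<subseteq> {s..t})"
    by (simp add: Np necklace_sset_def darr_def)
  also have "\<dots> \<longleftrightarrow> darr n \<alpha> p \<and> bead N (\<alpha> 0) (\<alpha> n)"
  proof (intro conj_cong refl iffI)
    assume d: "darr n \<alpha> p"
    note m = darrD(2)[OF d]
    {
      assume "\<exists>s t. s \<le> t \<and> adjacent_joints T s t \<and> \<alpha> ` {0..n} \<subseteq> {s..t}"
      then obtain s t where st: "adjacent_joints T s t" "\<alpha> ` {0..n} \<subseteq> {s..t}" by blast
      have "\<alpha> 0 \<in> {s..t}" "\<alpha> n \<in> {s..t}" by (rule subsetD[OF st(2)], simp)+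
      then have "s \<le> \<alpha> 0" "\<alpha> n \<le> t" by simp_all
      then show "bead N (\<alpha> 0) (\<alpha> n)"
        using st(1) darrD(1)[OF d, of n] m[of 0 n] by (fastforce simp: bead_def Np adjacent_joints_def)
    next
      assume "bead N (\<alpha> 0) (\<alpha> n)"
      then obtain s t where st: "s \<le> t" "adjacent_joints T s t" "s \<le> \<alpha> 0" "\<alpha> n \<le> t"
        using bead_adjacent[OF N, of "\<alpha> 0" "\<alpha> n"] Np by auto
      have "\<alpha> ` {0..n} \<subseteq> {s..t}"
      proof
        fix u assume "u \<in> \<alpha> ` {0..n}"
        then obtain i where "i \<le> n" "u = \<alpha> i" by auto
        then show "u \<in> {s..t}" using m[of 0 i] m[of i n] st by simp
      qed
      then show "\<exists>s t. s \<le> t \<and> adjacent_joints T s t \<and> \<alpha> ` {0..n} \<subseteq> {s..t}" using st by blast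
    }
  qed
  finally show ?thesis by (simp add: Np)
qed

lemma Act_necklace: "Act (necklace_sset N) (m, f, n) \<alpha> = compose {0..m} \<alpha> f"
  by (cases N) (simp add: necklace_sset_def)

lemma ivl_Sim: "is_necklace N \<Longrightarrow> bead N s t \<Longrightarrow> ivl s t \<in> Sim (necklace_sset N) (t - s)"
  unfolding Sim_necklace by (auto simp: ivl_def bead_def intro!: darrI)

definition of_map :: "necklace \<Rightarrow> (nat \<Rightarrow> (nat \<Rightarrow> nat) \<Rightarrow> 'x) \<Rightarrow> nat \<Rightarrow> nat \<Rightarrow> 'x" where
  "of_map N g = (\<lambda>s t. if bead N s t then g (t - s) (ivl s t) else undefined)"

text \<open>A simplex \<alpha> of the necklace is a shift of \<alpha> followed by the inclusion of
  the interval from \<open>\<alpha> 0\<close> to \<open>\<alpha> n\<close>, so its image is forced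
  by the value of the family on that interval.\<close>

definition to_map :: "'x sset \<Rightarrow> necklace \<Rightarrow> (nat \<Rightarrow> nat \<Rightarrow> 'x) \<Rightarrow> nat \<Rightarrow> (nat \<Rightarrow> nat) \<Rightarrow> 'x" where
  "to_map K N x = (\<lambda>n. \<lambda>\<alpha> \<in> Sim (necklace_sset N) n. Act K (n, seg \<alpha> 0 n, \<alpha> n - \<alpha> 0) (x (\<alpha> 0) (\<alpha> n)))"

context simplicial_set
begin

lemma simplicial_map_act:
  "g \<in> simplicial_maps L K \<Longrightarrow> darr m f n \<Longrightarrow> x \<in> Sim L n \<Longrightarrow>
   g m (Act L (m, f, n) x) = Act K (m, f, n) (g n x)"
  unfolding simplicial_maps_def by (auto dest: darr_hom)

lemma simplicial_map_closed: "g \<in> simplicial_maps L K \<Longrightarrow> x \<in> Sim L n \<Longrightarrow> g n x \<in> Sim K n"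
  unfolding simplicial_maps_def by auto

lemma of_map_fams:
  assumes N: "is_necklace N" and g: "g \<in> simplicial_maps (necklace_sset N) K"
  shows "of_map N g \<in> fams K N"
  unfolding fams_def mem_Collect_eq
proof (intro conjI allI impI)
  fix s t assume B: "bead N s t"
  then have st: "s \<le> t" by (simp add: bead_def)
  show "of_map N g s t \<in> Sim K (t - s)"
    using B simplicial_map_closed[OF g ivl_Sim[OF N B]] by (simp add: of_map_def)
  fix s' t' assume l: "s \<le> s'" "s' \<le> t'" "t' \<le> t"
  have e: "t' - s - (s' - s) = t' - s'" using l by simp
  have c: "compose {0..t' - s'} (ivl s t) (\<lambda>k\<in>{0..t' - s'}. k + (s' - s)) = ivl s' t'"
    using l by (auto simp: compose_def ivl_def fun_eq_iff)
  have d: "darr (t' - s') (\<lambda>k\<in>{0..t' - s'}. k + (s' - s)) (t - s)" by (rule darrI) (use l in auto)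
  show "of_map N g s' t' = face K (t - s) (s' - s) (t' - s) (of_map N g s t)"
    unfolding face_def e using simplicial_map_act[OF g d ivl_Sim[OF N B]] B bead_sub[OF B l]
    by (simp add: of_map_def Act_necklace c)
qed (simp add: of_map_def)

text \<open>The map is applied to the factorisation of \<alpha> through its interval. A simplicial
  map is thus determined by its values on intervals, which makes \<open>of_map\<close>
  injective.\<close>

lemma of_map_apply:
  assumes N: "is_necklace N" and g: "g \<in> simplicial_maps (necklace_sset N) K" and \<alpha>: "\<alpha> \<in> Sim
    (necklace_sset N) n"
  shows "g n \<alpha> = Act K (n, seg \<alpha> 0 n, \<alpha> n - \<alpha> 0) (of_map N g (\<alpha> 0) (\<alpha> n))"
proof -
  have a: "darr n \<alpha> (snd N)" "bead N (\<alpha> 0) (\<alpha> n)" using \<alpha> by (simp_all add: Sim_necklace[OF N])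
  have d: "darr n (seg \<alpha> 0 n) (\<alpha> n - \<alpha> 0)" using darr_seg[OF a(1), of 0 n] darrD(1)[OF a(1)]
    by (intro darrI) (auto simp: seg_def darrD(2)[OF a(1)] diff_le_mono)
  have "compose {0..n} (ivl (\<alpha> 0) (\<alpha> n)) (seg \<alpha> 0 n) = \<alpha>"
  proof
    fix k show "compose {0..n} (ivl (\<alpha> 0) (\<alpha> n)) (seg \<alpha> 0 n) k = \<alpha> k"
      using darrD(2)[OF a(1), of 0 k] darrD(2)[OF a(1), of k n] darrD(3)[OF a(1), of k]
      by (cases "k \<le> n") (auto simp: compose_def ivl_def seg_def diff_le_mono)
  qed
  then show ?thesis
    using simplicial_map_act[OF g d ivl_Sim[OF N a(2)]] a(2) by (simp add: Act_necklace of_map_def)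
qed

lemma to_map_simplicial:
  assumes N: "is_necklace N" and x: "x \<in> fams K N"
  shows "to_map K N x \<in> simplicial_maps (necklace_sset N) K"
  unfolding simplicial_maps_def mem_Collect_eq
proof (intro conjI allI ballI)
  have seg: "darr n (seg \<alpha> 0 n) (\<alpha> n - \<alpha> 0)" if "darr n \<alpha> (snd N)" for n \<alpha>
    using darrD(2)[OF that] by (intro darrI) (auto simp: seg_def diff_le_mono)
  show "to_map K N x n \<in> Sim (necklace_sset N) n \<rightarrow>\<^sub>E Sim K n" for n
    unfolding to_map_def by (auto simp: Sim_necklace[OF N] intro!: act_closed seg famsD(1)[OF x])
  fix m n \<phi> \<alpha> assume \<phi>: "\<phi> \<in> hom Delta m n" and \<alpha>: "\<alpha> \<in> Sim (necklace_sset N) n"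
  obtain f where f: "\<phi> = (m, f, n)" "darr m f n" using \<phi> by (auto simp: hom_Delta)
  have a: "darr n \<alpha> (snd N)" "bead N (\<alpha> 0) (\<alpha> n)" using \<alpha> by (simp_all add: Sim_necklace[OF N])
  let ?\<beta> = "compose {0..m} \<alpha> f"
  have b: "darr m ?\<beta> (snd N)" using darr_compose[OF f(2) a(1)] .
  have be: "?\<beta> 0 = \<alpha> (f 0)" "?\<beta> m = \<alpha> (f m)" by (simp_all add: compose_def)
  have l: "\<alpha> 0 \<le> ?\<beta> 0" "?\<beta> 0 \<le> ?\<beta> m" "?\<beta> m \<le> \<alpha> n"
    using darrD(2)[OF a(1)] darrD(1,2)[OF f(2)] be by simp_all
  have b2: "bead N (?\<beta> 0) (?\<beta> m)" by (rule bead_sub[OF a(2) l])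
  have e: "?\<beta> m - \<alpha> 0 - (?\<beta> 0 - \<alpha> 0) = ?\<beta> m - ?\<beta> 0" using l by simp
  have dd: "darr (?\<beta> m - ?\<beta> 0) (\<lambda>k\<in>{0..?\<beta> m - ?\<beta> 0}. k + (?\<beta> 0 - \<alpha> 0)) (\<alpha> n - \<alpha> 0)"
    by (rule darrI) (use l in auto)
  \<comment> \<open>Both sides send \<open>k\<close> to \<open>\<alpha> (f k) - \<alpha> 0\<close>:
    on the left the shift by \<open>\<alpha> 0\<close> is done in two stages, on the right at
    once.\<close>
  have c: "compose {0..m} (\<lambda>k\<in>{0..?\<beta> m - ?\<beta> 0}. k + (?\<beta> 0 - \<alpha> 0)) (seg ?\<beta> 0 m) =
    compose {0..m} (seg \<alpha> 0 n) f"
  proof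
    fix k
    show "compose {0..m} (\<lambda>k\<in>{0..?\<beta> m - ?\<beta> 0}. k + (?\<beta> 0 - \<alpha> 0)) (seg ?\<beta> 0 m) k =
      compose {0..m} (seg \<alpha> 0 n) f k"
    proof (cases "k \<le> m")
      case True
      then have "?\<beta> 0 \<le> ?\<beta> k" "?\<beta> k \<le> ?\<beta> m" "?\<beta> k = \<alpha> (f k)" "f k \<le> n"
        using darrD(2)[OF b] darrD(1)[OF f(2)] by (simp_all add: compose_def)
      then show ?thesis using True l by (simp add: compose_def[of _ "seg \<alpha> 0 n"] compose_def[of _
        "restrict _ _"] seg_def diff_le_mono)
    qed (simp add: compose_def)
  qed
  have "to_map K N x m ?\<beta> = Act K (m, seg ?\<beta> 0 m, ?\<beta> m - ?\<beta> 0) (x (?\<beta> 0) (?\<beta> m))"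
    using b b2 by (simp add: to_map_def Sim_necklace[OF N])
  also have "x (?\<beta> 0) (?\<beta> m) = face K (\<alpha> n - \<alpha> 0) (?\<beta> 0 - \<alpha> 0) (?\<beta> m - \<alpha> 0) (x (\<alpha> 0) (\<alpha> n))"
    by (rule famsD(3)[OF x a(2) l])
  also have "Act K (m, seg ?\<beta> 0 m, ?\<beta> m - ?\<beta> 0) \<dots> =
    Act K (m, compose {0..m} (\<lambda>k\<in>{0..?\<beta> m - ?\<beta> 0}. k + (?\<beta> 0 - \<alpha> 0)) (seg ?\<beta> 0 m), \<alpha> n - \<alpha> 0) (x (\<alpha> 0)
      (\<alpha> n))"
    unfolding face_def e by (rule act_comp[OF seg[OF b] dd famsD(1)[OF x a(2)]])
  also have "\<dots> = Act K (m, f, n) (Act K (n, seg \<alpha> 0 n, \<alpha> n - \<alpha> 0) (x (\<alpha> 0) (\<alpha> n)))"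
    unfolding c by (rule act_comp[OF f(2) seg[OF a(1)] famsD(1)[OF x a(2)], symmetric])
  also have "\<dots> = Act K \<phi> (to_map K N x n \<alpha>)" using \<alpha> f(1) by (simp add: to_map_def)
  finally show "to_map K N x m (Act (necklace_sset N) \<phi> \<alpha>) = Act K \<phi> (to_map K N x n \<alpha>)"
    by (simp add: f(1) Act_necklace)
qed

lemma of_to_map:
  assumes N: "is_necklace N" and x: "x \<in> fams K N"
  shows "of_map N (to_map K N x) = x"
proof (rule fams_eqI[OF of_map_fams[OF N to_map_simplicial[OF N x]] x])
  fix s t assume B: "bead N s t"
  then have st: "s \<le> t" by (simp add: bead_def)
  have v: "ivl s t 0 = s" "ivl s t (t - s) = t" using st by (simp_all add: ivl_def)
  have "Act K (t - s, seg (ivl s t) 0 (t - s), t - s) (x s t) = x s t"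
    by (rule act_ident[OF famsD(1)[OF x B]]) (auto simp: seg_def ivl_def)
  then show "of_map N (to_map K N x) s t = x s t"
    using B ivl_Sim[OF N B] by (simp add: of_map_def to_map_def v)
qed

lemma nondegenerate_maps_bij:
  assumes N: "is_necklace N"
  shows "bij_betw (of_map N) (nondegenerate_maps K N a b)
    {x \<in> fams K N. nondeg K N x \<and> x 0 0 = a \<and> x (snd N) (snd N) = b}"
proof -
  obtain T p where Np: "N = (T, p)" by (cases N)
  have pt: "(\<lambda>i\<in>{0}. c) = ivl c c" for c :: nat by (auto simp: ivl_def)
  have maps: "g \<in> nondegenerate_maps K N a b \<longleftrightarrow>
    g \<in> simplicial_maps (necklace_sset N) K \<and> nondeg K N (of_map N g) \<and>
    of_map N g 0 0 = a \<and> of_map N g (snd N) (snd N) = b" for g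
  proof -
    have "degenerate K (t - s) (g (t - s) (\<lambda>k\<in>{0..t - s}. s + k)) \<longleftrightarrow>
      degenerate K (t - s) (of_map N g s t)"
      if "s < t" "adjacent_joints T s t" for s t
      using adjacent_bead[OF N, of s t] that by (simp add: of_map_def ivl_def Np)
    then show ?thesis
      unfolding nondegenerate_maps_def by (auto simp: Np nondeg_def of_map_def pt)
  qed
  show ?thesis
  proof (rule bij_betw_imageI)
    show "inj_on (of_map N) (nondegenerate_maps K N a b)"
    proof (rule inj_onI)
      fix g h assume "g \<in> nondegenerate_maps K N a b"
        "h \<in> nondegenerate_maps K N a b" and eq: "of_map N g = of_map N h"
      then have gh: "g \<in> simplicial_maps (necklace_sset N) K" "h \<in> simplicial_maps (necklace_sset N) K"
        using maps by auto
      show "g = h"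
      proof (intro ext)
        fix n \<alpha>
        show "g n \<alpha> = h n \<alpha>"
        proof (cases "\<alpha> \<in> Sim (necklace_sset N) n")
          case True
          then show ?thesis using of_map_apply[OF N gh(1)] of_map_apply[OF N gh(2)] eq by simp
        next
          case False
          then show ?thesis using gh unfolding simplicial_maps_def
            by (auto simp: PiE_def extensional_def)
        qed
      qed
    qed
    show "of_map N ` nondegenerate_maps K N a b = {x \<in> fams K N. nondeg K N x \<and> x 0 0 =
      a \<and> x (snd N) (snd N) = b}"
    proof (intro set_eqI iffI)
      fix x assume "x \<in> {x \<in> fams K N. nondeg K N x \<and> x 0 0 = a \<and> x (snd N) (snd N) = b}"
      then have x: "x \<in> fams K N" "nondeg K N x" "x 0 0 = a" "x (snd N) (snd N) = b" by auto
      have "to_map K N x \<in> nondegenerate_maps K N a b"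
        using maps to_map_simplicial[OF N x(1)] of_to_map[OF N x(1)] x by simp
      then show "x \<in> of_map N ` nondegenerate_maps K N a b" using of_to_map[OF N x(1)] by force
    qed (use maps of_map_fams[OF N] in auto)
  qed
qed

end


subsection \<open>Smallness\<close>

lemma small_nat_lists:
  assumes inf: "infinite (UNIV :: 'u set)"
  shows "small (U :: 'u itself) (UNIV :: nat list set)"
proof -
  obtain nu :: "nat \<Rightarrow> 'u" where nu: "inj nu" using inf unfolding infinite_iff_countable_subset by auto
  show ?thesis by (rule small_inj[OF small_lists[OF inf], of "map nu"]) (use nu in auto)
qed

lemma small_necklaces:
  assumes inf: "infinite (UNIV :: 'u set)"
  shows "small (U :: 'u itself) {N. is_necklace N}"
proof (rule small_inj[OF small_Times[OF inf small_nat_lists[OF inf] small_nat[OF inf]], of "\<lambda>N.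
  (sorted_list_of_set (fst N), snd N)" _ UNIV])
  show "inj_on (\<lambda>N. (sorted_list_of_set (fst N), snd N)) {N :: necklace. is_necklace N}"
  proof (rule inj_onI)
    fix N M :: necklace
    assume A: "N \<in> {N. is_necklace N}" "M \<in> {N. is_necklace N}"
      "(sorted_list_of_set (fst N), snd N) = (sorted_list_of_set (fst M), snd M)"
    have fin: "finite (fst N)" if "is_necklace N" for N
      using that by (auto simp: is_necklace_iff finite_nat_set_iff_bounded_le)
    have "fst N = fst M" using A fin by (metis Pair_inject mem_Collect_eq set_sorted_list_of_set)
    then show "N = M" using A by (simp add: prod_eq_iff)
  qed
qed auto

lemma small_Arr_Nec:
  assumes inf: "infinite (UNIV :: 'u set)"
  shows "small (U :: 'u itself) (Arr Nec)"
proof (rule small_inj[OF small_Times[OF inf small_necklaces[OF inf] small_Times[OF inf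
  small_nat_lists[OF inf] small_necklaces[OF inf]]],
    of "\<lambda>(N, f, M). (N, map f [0..<Suc (snd N)], M)"])
  show "inj_on (\<lambda>(N, f, M). (N, map f [0..<Suc (snd N)], M)) (Arr Nec)"
  proof (rule inj_onI)
    fix X Y :: "necklace \<times> (nat \<Rightarrow> nat) \<times> necklace"
    assume A: "X \<in> Arr Nec" "Y \<in> Arr Nec"
      and e: "(\<lambda>(N, f, M). (N, map f [0..<Suc (snd N)], M)) X =
        (\<lambda>(N, f, M). (N, map f [0..<Suc (snd N)], M)) Y"
    obtain N f M where X: "X = (N, f, M)" by (cases X)
    obtain N' f' M' where Y: "Y = (N', f', M')" by (cases Y)
    have N: "N' = N" "M' = M" using e X Y by auto
    have d: "darr (snd N) f (snd M)" "darr (snd N) f' (snd M)" using A X Y N by (auto dest: Arr_NecD(3))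
    have "f i = f' i" for i
      using e X Y N darrD(3)[OF d(1), of i] darrD(3)[OF d(2), of i]
      by (cases "i \<le> snd N") (auto simp: map_eq_conv simp del: upt_Suc)
    then show "X = Y" using X Y N by auto
  qed
qed (auto dest: Arr_NecD)

text \<open>A family is coded by the list of its values on the whole square of pairs of vertices,
  entries off the beads included. The list has its entries in \<open>'u\<close>, the type of the
  simplices of \<open>K\<close>.\<close>

lemma small_fams:
  fixes K :: "'u sset"
  assumes inf: "infinite (UNIV :: 'u set)"
  shows "small (U :: 'u itself) {(N, x). is_necklace N \<and> x \<in> fams K N}"
proof (rule small_inj[OF small_Times[OF inf small_necklaces[OF inf] small_lists[OF inf]],
    of "\<lambda>(N, x). (N, map (\<lambda>(s, t). x s t) (List.product [0..<Suc (snd N)] [0..<Suc (snd N)]))"])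
  let ?code = "\<lambda>(N, x). (N :: necklace, map (\<lambda>(s, t). x s t :: 'u) (List.product [0..<Suc (snd N)]
    [0..<Suc (snd N)]))"
  show "inj_on ?code {(N, x). is_necklace N \<and> x \<in> fams K N}"
  proof (rule inj_onI)
    fix X Y assume A: "X \<in> {(N, x). is_necklace N \<and> x \<in> fams K N}" "Y \<in> {(N, x). is_necklace N \<and>
      x \<in> fams K N}"
      and e: "?code X = ?code Y"
    obtain N x where X: "X = (N, x)" by (cases X)
    obtain N' x' where Y: "Y = (N', x')" by (cases Y)
    have N: "N' = N" using e X Y by auto
    have m: "x s t = x' s t" if "s \<le> snd N" "t \<le> snd N" for s t
      using e X Y that N by (auto simp: map_eq_conv simp del: upt_Suc)
    have "x = x'"
      by (rule fams_eqI[of x K N]) (use A X Y N m in \<open>auto simp: bead_def\<close>)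
    then show "X = Y" using X Y N by simp
  qed
qed auto

section \<open>The category of necklaces in a simplicial set\<close>

definition efams :: "'x sset \<Rightarrow> 'x \<Rightarrow> 'x \<Rightarrow> necklace \<Rightarrow> (nat \<Rightarrow> nat \<Rightarrow> 'x) set" where
  "efams K a b N = {x \<in> fams K N. x 0 0 = a \<and> x (snd N) (snd N) = b}"

text \<open>The category of elements of the presheaf that sends a necklace to its families from
  \<open>a\<close> to \<open>b\<close>. An arrow keeps the necklace map and the family on its
  target; the family on its source is then forced to be the pullback.\<close>

definition elts :: "'x sset \<Rightarrow> 'x \<Rightarrow> 'x \<Rightarrow>
    (necklace \<times> (nat \<Rightarrow> nat \<Rightarrow> 'x), (necklace \<times> (nat \<Rightarrow> nat) \<times> necklace) \<times> (nat \<Rightarrow> nat \<Rightarrow> 'x)) category"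
      where
  "elts K a b = \<lparr>
     Obj = {(N, x). is_necklace N \<and> x \<in> efams K a b N},
     Arr = {(f, y). f \<in> Arr Nec \<and> y \<in> efams K a b (Cod Nec f)},
     Dom = (\<lambda>(f, y). (Dom Nec f, pull K f y)),
     Cod = (\<lambda>(f, y). (Cod Nec f, y)),
     Idt = (\<lambda>(N, y). (Idt Nec N, y)),
     Cmp = (\<lambda>(g, z) (f, y). (g \<bullet>\<^bsub>Nec\<^esub> f, z))\<rparr>"

definition on_elts ::
  "(necklace, necklace \<times> (nat \<Rightarrow> nat) \<times> necklace, 'o, 'a) func \<Rightarrow>
   (necklace \<times> (nat \<Rightarrow> nat \<Rightarrow> 'x), (necklace \<times> (nat \<Rightarrow> nat) \<times> necklace) \<times> (nat \<Rightarrow> nat \<Rightarrow> 'x), 'o, 'a) func"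
     where
  "on_elts F = \<lparr>FOb = (\<lambda>(N, x). FOb F N), FAr = (\<lambda>(f, y). FAr F f)\<rparr>"

lemma elts_sel [simp]:
  "Obj (elts K a b) = {(N, x). is_necklace N \<and> x \<in> efams K a b N}"
  "Arr (elts K a b) = {(f, y). f \<in> Arr Nec \<and> y \<in> efams K a b (Cod Nec f)}"
  "Dom (elts K a b) (f, y) = (Dom Nec f, pull K f y)" "Cod (elts K a b) (f, y) = (Cod Nec f, y)"
  "Idt (elts K a b) (N, y) = (Idt Nec N, y)" "(g, z) \<bullet>\<^bsub>elts K a b\<^esub> (f, y) = (g \<bullet>\<^bsub>Nec\<^esub> f, z)"
  "FOb (on_elts F) (N, x) = FOb F N" "FAr (on_elts F) (f, y) = FAr F f"
  by (simp_all add: elts_def on_elts_def)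

lemma func_comp_on_elts: "func_comp G (on_elts F) = on_elts (func_comp G F)"
  by (auto simp: func_comp_def on_elts_def fun_eq_iff)

lemma efams_fams: "x \<in> efams K a b N \<Longrightarrow> x \<in> fams K N"
  by (simp add: efams_def)

lemma efamsI: "x \<in> fams K N \<Longrightarrow> x \<in> efams K (x 0 0) (x (snd N) (snd N)) N"
  by (simp add: efams_def)

context simplicial_set
begin

lemma pull_efams: "(N, f, M) \<in> Arr Nec \<Longrightarrow> y \<in> efams K a b M \<Longrightarrow> pull K (N, f, M) y \<in> efams K a b N"
  by (simp add: efams_def pull_fams pull_ends)

lemma category_elts:
  assumes "category Nec"
  shows "category (elts K a b)"
proof -
  interpret N: category Nec by fact
  have pc: "pull K (g \<bullet>\<^bsub>Nec\<^esub> f) y = pull K f (pull K g y)"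
    if "f \<in> Arr Nec" "g \<in> Arr Nec" "Dom Nec g = Cod Nec f" "y \<in> efams K a b (Cod Nec g)" for f g y
    using that by (cases f rule: prod_cases3; cases g rule: prod_cases3) (simp add: pull_Cmp efams_fams)
  have pe: "pull K f y \<in> efams K a b (Dom Nec f)" if "f \<in> Arr Nec" "y \<in> efams K a b (Cod Nec f)" for f y
    using that by (cases f) (auto intro: pull_efams)
  have nO: "is_necklace (Dom Nec f)" "is_necklace (Cod Nec f)" if "f \<in> Arr Nec" for f
    using N.Obj_closed[OF that] by auto
  have pi: "pull K (Idt Nec N) y = y" if "y \<in> efams K a b N" for N y
    using pull_Idt[OF efams_fams[OF that]] by simp
  show ?thesis
  proof
    fix f assume "f \<in> Arr (elts K a b)"
    then show "Dom (elts K a b) f \<in> Obj (elts K a b)" "Cod (elts K a b) f \<in> Obj (elts K a b)"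
      using pe nO by auto
  next
    fix x assume "x \<in> Obj (elts K a b)"
    then obtain N y where x: "x = (N, y)" "N \<in> Obj Nec" "y \<in> efams K a b N" by auto
    then show "Idt (elts K a b) x \<in> hom (elts K a b) x x"
      using N.Idt_closed[OF x(2)] pi[OF x(3)] by (simp add: hom_iff del: Nec_sel)
  next
    fix f g x y z assume "f \<in> hom (elts K a b) x y" "g \<in> hom (elts K a b) y z"
    then show "g \<bullet>\<^bsub>elts K a b\<^esub> f \<in> hom (elts K a b) x z"
      by (cases f; cases g) (auto simp: hom_iff pc simp del: Nec_sel)
  next
    fix f x y assume f: "f \<in> hom (elts K a b) x y"
    then show "Idt (elts K a b) y \<bullet>\<^bsub>elts K a b\<^esub> f = f" "f \<bullet>\<^bsub>elts K a b\<^esub> Idt (elts K a b) x = f"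
      by (cases f; auto simp: hom_iff simp del: Nec_sel)+
  next
    fix f g h w x y z
    assume "f \<in> hom (elts K a b) w x" "g \<in> hom (elts K a b) x y" "h \<in> hom (elts K a b) y z"
    then show "(h \<bullet>\<^bsub>elts K a b\<^esub> g) \<bullet>\<^bsub>elts K a b\<^esub> f = h \<bullet>\<^bsub>elts K a b\<^esub> (g \<bullet>\<^bsub>elts K a b\<^esub> f)"
      by (cases f; cases g; cases h) (auto simp: hom_iff N.assoc simp del: Nec_sel)
  qed
qed

lemma on_elts_functor:
  assumes "cat_functor Nec C F"
  shows "cat_functor (elts K a b) C (on_elts F)"
proof -
  interpret F: cat_functor Nec C F by fact
  interpret E: category "elts K a b" by (rule category_elts) unfold_locales
  show ?thesis
  proof
    fix x assume "x \<in> Obj (elts K a b)"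
    then obtain N y where x: "x = (N, y)" "N \<in> Obj Nec" by auto
    then show "FOb (on_elts F) x \<in> Obj C" "FAr (on_elts F) (Idt (elts K a b) x) =
      Idt C (FOb (on_elts F) x)"
      using F.FAr_Idt[OF x(2)] F.FOb_Obj[OF x(2)] by (simp_all del: Nec_sel)
  next
    fix f x y assume "f \<in> hom (elts K a b) x y"
    then show "FAr (on_elts F) f \<in> hom C (FOb (on_elts F) x) (FOb (on_elts F) y)"
      by (cases f) (auto simp: hom_iff simp del: Nec_sel)
  next
    fix f g x y z assume "f \<in> hom (elts K a b) x y" "g \<in> hom (elts K a b) y z"
    then show "FAr (on_elts F) (g \<bullet>\<^bsub>elts K a b\<^esub> f) = FAr (on_elts F) g \<bullet>\<^bsub>C\<^esub> FAr (on_elts F) f"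
      by (cases f; cases g) (auto simp: hom_iff F.FAr_Cmp_Arr simp del: Nec_sel)
  qed
qed

end

lemma small_elts:
  fixes K :: "'u sset"
  assumes inf: "infinite (UNIV :: 'u set)"
  shows "small (U :: 'u itself) (Obj (elts K a b))" "small U (Arr (elts K a b))"
proof -
  show "small U (Obj (elts K a b))"
    by (rule small_inj[OF small_fams[OF inf, of U K], of "\<lambda>p. p"]) (auto dest: efams_fams)
  show "small U (Arr (elts K a b))"
  proof (rule small_inj[OF small_Times[OF inf small_Arr_Nec[OF inf, of U] small_fams[OF inf, of U K]],
    of "\<lambda>(f, y). (f, Cod Nec f, y)"])
    show "inj_on (\<lambda>(f, y). (f, Cod Nec f, y)) (Arr (elts K a b))" by (auto intro: inj_onI)
    show "(\<lambda>(f, y). (f, Cod Nec f, y)) ` Arr (elts K a b) \<subseteq> Arr Nec \<times> {(N, x). is_necklace N \<and>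
      x \<in> fams K N}"
      by (auto dest: efams_fams Arr_NecD)
  qed
qed

definition elts_colimit ::
  "('o, 'a, 'm) category_scheme \<Rightarrow> (necklace, necklace \<times> (nat \<Rightarrow> nat) \<times> necklace, 'o, 'a) func \<Rightarrow> 'x sset \<Rightarrow>
   'x \<Rightarrow> 'x \<Rightarrow> 'o \<Rightarrow> (necklace \<Rightarrow> (nat \<Rightarrow> nat \<Rightarrow> 'x) \<Rightarrow> 'a) \<Rightarrow> bool" where
  "elts_colimit C F K a b c \<iota> \<longleftrightarrow> is_colimit (elts K a b) C (on_elts F) c (\<lambda>(N, x). \<iota> N x)"

lemma elts_colimit_hom:
  assumes "elts_colimit C F K a b c \<iota>"
  shows "c \<in> Obj C" "is_necklace N \<Longrightarrow> x \<in> efams K a b N \<Longrightarrow> \<iota> N x \<in> hom C (FOb F N) c"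
    "(N, f, M) \<in> Arr Nec \<Longrightarrow> y \<in> efams K a b M \<Longrightarrow> \<iota> M y \<bullet>\<^bsub>C\<^esub> FAr F (N, f, M) = \<iota> N (pull K (N, f, M) y)"
  using is_colimit_hom(1)[OF assms[unfolded elts_colimit_def]]
    is_colimit_hom(2)[OF assms[unfolded elts_colimit_def], of "(N, x)"]
    is_colimit_hom(3)[OF assms[unfolded elts_colimit_def], of "((N, f, M), y)"] by auto


section \<open>Monoidal categories whose tensor product preserves colimits\<close>

context monoidal_category
begin

lemma tens_closed [simp]:
  assumes "f \<in> Arr M" "g \<in> Arr M"
  shows "f \<odot> g \<in> Arr M" "Dom M (f \<odot> g) = Dom M f \<otimes> Dom M g" "Cod M (f \<odot> g) = Cod M f \<otimes> Cod M g"
  using TensA_hom[of f "Dom M f" "Cod M f" g "Dom M g" "Cod M g"] assms by (auto simp: hom_iff)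

lemma tens_Obj [simp]: "x \<in> Obj M \<Longrightarrow> y \<in> Obj M \<Longrightarrow> x \<otimes> y \<in> Obj M"
  by (rule TensO_Obj)

lemma Unt_Obj' [simp]: "Unt M \<in> Obj M"
  by (rule Unt_Obj)

lemma tens_Cmp:
  "f \<in> Arr M \<Longrightarrow> f' \<in> Arr M \<Longrightarrow> g \<in> Arr M \<Longrightarrow> g' \<in> Arr M \<Longrightarrow> Dom M f' = Cod M f \<Longrightarrow> Dom M g' = Cod M g \<Longrightarrow>
    (f' \<odot> g') \<bullet> (f \<odot> g) = (f' \<bullet> f) \<odot> (g' \<bullet> g)"
  using TensA_Cmp[of f "Dom M f" "Cod M f" f' "Cod M f'" g "Dom M g" "Cod M g" g' "Cod M g'"]
  by (simp add: hom_iff)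

lemma tens_Idt [simp]: "x \<in> Obj M \<Longrightarrow> y \<in> Obj M \<Longrightarrow> Idt M x \<odot> Idt M y = Idt M (x \<otimes> y)"
  by (rule TensA_Idt)

lemma Asc_closed [simp]:
  assumes "x \<in> Obj M" "y \<in> Obj M" "z \<in> Obj M"
  shows "Asc M x y z \<in> Arr M" "Dom M (Asc M x y z) = (x \<otimes> y) \<otimes> z" "Cod M (Asc M x y z) = x \<otimes> (y \<otimes> z)"
  using Asc_hom[OF assms] by (auto simp: hom_iff)

lemma Asc_nat:
  "f \<in> Arr M \<Longrightarrow> g \<in> Arr M \<Longrightarrow> h \<in> Arr M \<Longrightarrow>
    Asc M (Cod M f) (Cod M g) (Cod M h) \<bullet> ((f \<odot> g) \<odot> h) =
      (f \<odot> (g \<odot> h)) \<bullet> Asc M (Dom M f) (Dom M g) (Dom M h)"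
  by (rule Asc_natural) (auto simp: hom_iff)

lemma LUn_closed [simp]:
  assumes "x \<in> Obj M"
  shows "LUn M x \<in> Arr M" "Dom M (LUn M x) = Unt M \<otimes> x" "Cod M (LUn M x) = x"
    "RUn M x \<in> Arr M" "Dom M (RUn M x) = x \<otimes> Unt M" "Cod M (RUn M x) = x"
  using LUn_hom[OF assms] RUn_hom[OF assms] by (auto simp: hom_iff)

lemma tens_iso:
  assumes "is_iso M f" "is_iso M g"
  shows "is_iso M (f \<odot> g)"
  by (rule is_isoI[of _ "Dom M f \<otimes> Dom M g" "Cod M f \<otimes> Cod M g" "inv_arr M f \<odot> inv_arr M g"])
    (use assms in \<open>auto simp: hom_iff tens_Cmp\<close>)

definition tensL :: "'o \<Rightarrow> ('o, 'a, 'o, 'a) func" where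
  "tensL x = \<lparr>FOb = (\<lambda>y. x \<otimes> y), FAr = (\<lambda>f. Idt M x \<odot> f)\<rparr>"

definition tensR :: "'o \<Rightarrow> ('o, 'a, 'o, 'a) func" where
  "tensR x = \<lparr>FOb = (\<lambda>y. y \<otimes> x), FAr = (\<lambda>f. f \<odot> Idt M x)\<rparr>"

lemma tens_sel [simp]:
  "FOb (tensL x) y = x \<otimes> y" "FAr (tensL x) f = Idt M x \<odot> f"
  "FOb (tensR x) y = y \<otimes> x" "FAr (tensR x) f = f \<odot> Idt M x"
  by (simp_all add: tensL_def tensR_def)

lemma tensL_functor: "x \<in> Obj M \<Longrightarrow> cat_functor M M (tensL x)"
  by unfold_locales (auto simp: hom_iff tens_Cmp)

lemma tensR_functor: "x \<in> Obj M \<Longrightarrow> cat_functor M M (tensR x)"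
  by unfold_locales (auto simp: hom_iff tens_Cmp)

end

text \<open>The intended instance is the underlying monoidal category of \<open>W\<close>; the
  description of \<open>L\<close> takes place at this level, without mention of
  \<open>V\<close>.\<close>

locale cocomplete_monoidal = monoidal_category M
  for M :: "('o, 'a, 'm) monoidal_scheme" (structure) and U :: "'u itself" +
  assumes infinite_universe: "infinite (UNIV :: 'u set)"
    and cocomplete: "cocomplete U M"
    and tensL_cocontinuous: "x \<in> Obj M \<Longrightarrow> preserves_colimits U M M (tensL x)"
    and tensR_cocontinuous: "x \<in> Obj M \<Longrightarrow> preserves_colimits U M M (tensR x)"
begin

lemma tensL_colimit:
  assumes F: "cat_functor J M F" and sm: "small U (Obj J)"
    "small U (Arr J)" and c: "is_colimit J M F c \<iota>" and x: "x \<in> Obj M"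
  shows "is_colimit J M (func_comp (tensL x) F) (x \<otimes> c) (\<lambda>j. Idt M x \<odot> \<iota> j)"
  using preserves_small[OF tensL_cocontinuous[OF x] F cat_functor_comp[OF F tensL_functor[OF x]] sm c]
    by simp

lemma tensR_colimit:
  assumes F: "cat_functor J M F" and sm: "small U (Obj J)"
    "small U (Arr J)" and c: "is_colimit J M F c \<iota>" and x: "x \<in> Obj M"
  shows "is_colimit J M (func_comp (tensR x) F) (c \<otimes> x) (\<lambda>j. \<iota> j \<odot> Idt M x)"
  using preserves_small[OF tensR_cocontinuous[OF x] F cat_functor_comp[OF F tensR_functor[OF x]] sm c]
    by simp

lemma initial: "is_initial M (initial_obj M)"
  by (rule initial_obj[OF category_axioms cocomplete])

lemma tens_initial:
  assumes "x \<in> Obj M" "is_initial M z"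
  shows "is_initial M (x \<otimes> z)" "is_initial M (z \<otimes> x)"
  using preserves_initial[OF tensL_cocontinuous[OF assms(1)] category_axioms category_axioms assms(2)]
    preserves_initial[OF tensR_cocontinuous[OF assms(1)] category_axioms category_axioms assms(2)]
      by simp_all

end

section \<open>Enriched functors, their composition and their normal form\<close>

context enriched_category
begin

lemma enriched_closed [simp]:
  "x \<in> EOb A \<Longrightarrow> y \<in> EOb A \<Longrightarrow> EHom A x y \<in> Obj M"
  "x \<in> EOb A \<Longrightarrow> y \<in> EOb A \<Longrightarrow> z \<in> EOb A \<Longrightarrow> ECmp A x y z \<in> Arr M"
  "x \<in> EOb A \<Longrightarrow> y \<in> EOb A \<Longrightarrow> z \<in> EOb A \<Longrightarrow> Dom M (ECmp A x y z) = EHom A x y \<otimes> EHom A y z"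
  "x \<in> EOb A \<Longrightarrow> y \<in> EOb A \<Longrightarrow> z \<in> EOb A \<Longrightarrow> Cod M (ECmp A x y z) = EHom A x z"
  "x \<in> EOb A \<Longrightarrow> EId A x \<in> Arr M" "x \<in> EOb A \<Longrightarrow> Dom M (EId A x) = Unt M" "x \<in> EOb A \<Longrightarrow>
   Cod M (EId A x) = EHom A x x"
  using EHom_Obj[of x y] ECmp_hom[of x y z] EId_hom[of x] by (auto simp: hom_iff)

end

context enriched_functor
begin

lemma EFH_closed [simp]:
  assumes "x \<in> EOb A" "y \<in> EOb A"
  shows "EFH F x y \<in> Arr M" "Dom M (EFH F x y) = EHom A x y" "Cod M (EFH F x y) =
    EHom B (EFO F x) (EFO F y)"
  using EFH_hom[OF assms] by (auto simp: hom_iff)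

lemma EFO_closed [simp]: "x \<in> EOb A \<Longrightarrow> EFO F x \<in> EOb B"
  by (rule EFO_EOb)

end

lemma efunc_comp_sel [simp]:
  "EFO (efunc_comp M G F) x = EFO G (EFO F x)"
  "EFH (efunc_comp M G F) x y = EFH G (EFO F x) (EFO F y) \<bullet>\<^bsub>M\<^esub> EFH F x y"
  by (simp_all add: efunc_comp_def)

lemma efunc_restrict_sel [simp]:
  "x \<in> S \<Longrightarrow> EFO (efunc_restrict S F) x = EFO F x"
  "x \<in> S \<Longrightarrow> y \<in> S \<Longrightarrow> EFH (efunc_restrict S F) x y = EFH F x y"
  by (simp_all add: efunc_restrict_def)

lemma efunc_restrict_eqI:
  assumes "\<And>x. x \<in> S \<Longrightarrow> EFO F x = EFO G x" "\<And>x y. x \<in> S \<Longrightarrow> y \<in> S \<Longrightarrow> EFH F x y = EFH G x y"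
  shows "efunc_restrict S F = efunc_restrict S G"
  using assms by (auto simp: efunc_restrict_def fun_eq_iff)

lemma efunc_restrict_idem [simp]: "efunc_restrict S (efunc_restrict S F) = efunc_restrict S F"
  by (rule efunc_restrict_eqI) auto

lemma enriched_functor_cong:
  assumes F: "enriched_functor M A B F"
    and "\<And>x. x \<in> EOb A \<Longrightarrow> EFO G x = EFO F x" "\<And>x y. x \<in> EOb A \<Longrightarrow> y \<in> EOb A \<Longrightarrow> EFH G x y = EFH F x y"
  shows "enriched_functor M A B G"
proof -
  interpret F: enriched_functor M A B F by fact
  show ?thesis by unfold_locales (auto simp: assms hom_iff F.EFH_EId F.EFH_ECmp)
qed

lemma efunc_restrict_efunctors:
  assumes "enriched_functor M A B F"
  shows "efunc_restrict (EOb A) F \<in> efunctors M A B"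
  unfolding efunctors_def using enriched_functor_cong[OF assms, of "efunc_restrict (EOb A) F"] by simp

lemma enriched_functor_comp:
  assumes "enriched_functor M A B F" "enriched_functor M B C G"
  shows "enriched_functor M A C (efunc_comp M G F)"
proof -
  interpret F: enriched_functor M A B F by fact
  interpret G: enriched_functor M B C G by fact
  note M = F.A.M.assoc F.A.M.tens_Cmp
  show ?thesis
  proof
    fix x assume x: "x \<in> EOb A"
    show "EFH (efunc_comp M G F) x x \<bullet>\<^bsub>M\<^esub> EId A x = EId C (EFO (efunc_comp M G F) x)"
      using x by (simp add: M F.EFH_EId G.EFH_EId)
  next
    fix x y z assume [simp]: "x \<in> EOb A" "y \<in> EOb A" "z \<in> EOb A"
    let ?F = "EFO F"
    have "EFH (efunc_comp M G F) x z \<bullet>\<^bsub>M\<^esub> ECmp A x y z =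
      EFH G (?F x) (?F z) \<bullet>\<^bsub>M\<^esub> (ECmp B (?F x) (?F y) (?F z) \<bullet>\<^bsub>M\<^esub> (EFH F x y \<odot>\<^bsub>M\<^esub> EFH F y z))"
      by (simp add: M F.EFH_ECmp)
    also have "\<dots> = (ECmp C (EFO G (?F x)) (EFO G (?F y)) (EFO G (?F z)) \<bullet>\<^bsub>M\<^esub> (EFH G (?F x) (?F y) \<odot>\<^bsub>M\<^esub>
      EFH G (?F y) (?F z))) \<bullet>\<^bsub>M\<^esub> (EFH F x y \<odot>\<^bsub>M\<^esub> EFH F y z)"
      by (simp add: F.A.M.assoc[symmetric] G.EFH_ECmp)
    finally show "EFH (efunc_comp M G F) x z \<bullet>\<^bsub>M\<^esub> ECmp A x y z =
      ECmp C (EFO (efunc_comp M G F) x) (EFO (efunc_comp M G F) y) (EFO (efunc_comp M G F) z) \<bullet>\<^bsub>M\<^esub> (EFH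
        (efunc_comp M G F) x y \<odot>\<^bsub>M\<^esub> EFH (efunc_comp M G F) y z)"
      by (simp add: M)
  qed (auto simp: hom_iff)
qed

lemma enriched_functor_id:
  assumes "enriched_category M A"
  shows "enriched_functor M A A (efunc_id M A)"
proof -
  interpret A: enriched_category M A by fact
  show ?thesis by unfold_locales (auto simp: efunc_id_def hom_iff)
qed


section \<open>The category freely generated by a simplicial set\<close>

locale realization =
  cocomplete_monoidal M U + D: strong_monoidal_functor Nec M D \<mu> \<epsilon> + simplicial_set K
  for M :: "('o, 'a, 'm) monoidal_scheme" (structure)
    and D :: "(necklace, necklace \<times> (nat \<Rightarrow> nat) \<times> necklace, 'o, 'a) func"
    and \<mu> \<epsilon> and K :: "'u sset" and U :: "'u itself"
begin

lemma D_Arr [simp]: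
  assumes "(N, f, N') \<in> Arr Nec"
  shows "FAr D (N, f, N') \<in> Arr M" "Dom M (FAr D (N, f, N')) = FOb D N" "Cod M (FAr D (N, f, N')) =
    FOb D N'"
  using D.FAr_closed[OF assms] by simp_all

lemma D_Idt [simp]: "is_necklace N \<Longrightarrow> FAr D (N, \<lambda>i \<in> {0..snd N}. i, N) = Idt M (FOb D N)"
  using D.FAr_Idt[of N] by simp

lemma mu [simp]:
  assumes "is_necklace N" "is_necklace N'"
  shows "\<mu> N N' \<in> Arr M" "Dom M (\<mu> N N') = FOb D N \<otimes> FOb D N'" "Cod M (\<mu> N N') = FOb D (wedge N N')"
    "is_iso M (\<mu> N N')"
  using D.mult_hom[of N N'] D.mult_iso[of N N'] assms by (auto simp: hom_iff)

lemma eps [simp]: "\<epsilon> \<in> Arr M" "Dom M \<epsilon> = Unt M" "Cod M \<epsilon> = FOb D (simplex 0)" "is_iso M \<epsilon>"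
  using D.unit_hom D.unit_iso by (auto simp: hom_iff)

lemma mu_natural:
  assumes f: "(N, f, N') \<in> Arr Nec" and g: "(L, g, L') \<in> Arr Nec"
  shows "\<mu> N' L' \<bullet> (FAr D (N, f, N') \<odot> FAr D (L, g, L')) =
    FAr D ((N, f, N') \<odot>\<^bsub>Nec\<^esub> (L, g, L')) \<bullet> \<mu> N L"
  using D.mult_natural[of "(N, f, N')" N N' "(L, g, L')" L L'] f g by (simp add: hom_iff)

lemma mu_assoc:
  assumes [simp]: "is_necklace N" "is_necklace N'" "is_necklace N''"
  shows "\<mu> (wedge N N') N'' \<bullet> (\<mu> N N' \<odot> Idt M (FOb D N'')) =
    \<mu> N (wedge N' N'') \<bullet> (Idt M (FOb D N) \<odot> \<mu> N' N'') \<bullet> Asc M (FOb D N) (FOb D N') (FOb D N'')"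
proof -
  have "FAr D (Asc Nec N N' N'') = Idt M (FOb D (wedge N (wedge N' N'')))"
    using D.FAr_Idt[of "wedge N (wedge N' N'')"] by simp
  then show ?thesis
    using D.mult_assoc[of N N' N''] by (simp add: wedge_assoc)
qed

lemma mu_unit_left: "is_necklace N \<Longrightarrow> \<mu> (simplex 0) N \<bullet> (\<epsilon> \<odot> Idt M (FOb D N)) = LUn M (FOb D N)"
  using D.unit_left[of N] by simp

lemma mu_unit_right: "is_necklace N \<Longrightarrow> \<mu> N (simplex 0) \<bullet> (Idt M (FOb D N) \<odot> \<epsilon>) = RUn M (FOb D N)"
  using D.unit_right[of N] by simp

lemma elts_functor: "cat_functor (elts K a b) M (on_elts D)"
  by (rule on_elts_functor) unfold_locales

lemmas small_elts' = small_elts[OF infinite_universe, where U = U and K = K]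

section \<open>Hom-objects as colimits over necklaces\<close>

definition FHom :: "'u \<Rightarrow> 'u \<Rightarrow> 'o" where
  "FHom a b = (SOME c. \<exists>\<iota>. elts_colimit M D K a b c \<iota>)"

definition inj_at :: "'u \<Rightarrow> 'u \<Rightarrow> necklace \<Rightarrow> (nat \<Rightarrow> nat \<Rightarrow> 'u) \<Rightarrow> 'a" where
  "inj_at a b = (SOME \<iota>. elts_colimit M D K a b (FHom a b) \<iota>)"

text \<open>The legs of all these colimits at once: the end points are read off the family, so a leg
  does not have to carry \<open>a\<close> and \<open>b\<close>.\<close>

definition leg :: "necklace \<Rightarrow> (nat \<Rightarrow> nat \<Rightarrow> 'u) \<Rightarrow> 'a" where
  "leg N x = inj_at (x 0 0) (x (snd N) (snd N)) N x"

lemma FHom_colimit: "elts_colimit M D K a b (FHom a b) leg"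
proof -
  obtain c \<iota> where "is_colimit (elts K a b) M (on_elts D) c \<iota>"
    using cocomplete_small[OF cocomplete elts_functor small_elts'] by blast
  then have "elts_colimit M D K a b c (\<lambda>N x. \<iota> (N, x))"
    unfolding elts_colimit_def by simp
  then have "\<exists>c \<iota>. elts_colimit M D K a b c \<iota>" by blast
  then have "\<exists>\<iota>. elts_colimit M D K a b (FHom a b) \<iota>" unfolding FHom_def by (rule someI_ex)
  then have "elts_colimit M D K a b (FHom a b) (inj_at a b)" unfolding inj_at_def by (rule someI_ex)
  moreover have "leg N x = inj_at a b N x" if "x \<in> efams K a b N" for N x
    using that by (simp add: leg_def efams_def)
  ultimately show ?thesis
    unfolding elts_colimit_def is_colimit_def is_cocone_def by (auto simp: pull_efams)
qed

lemma FHom_Obj [simp]: "FHom a b \<in> Obj M"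
  by (rule elts_colimit_hom(1)[OF FHom_colimit])

lemma leg_closed [simp]:
  assumes "is_necklace N" "x \<in> fams K N"
  shows "leg N x \<in> Arr M" "Dom M (leg N x) = FOb D N" "Cod M (leg N x) =
    FHom (x 0 0) (x (snd N) (snd N))"
  using elts_colimit_hom(2)[OF FHom_colimit assms(1) efamsI[OF assms(2)]] by (auto simp: hom_iff)

lemma leg_natural:
  "(N, f, N') \<in> Arr Nec \<Longrightarrow> y \<in> fams K N' \<Longrightarrow> leg N' y \<bullet> FAr D (N, f, N') = leg N (pull K (N, f, N') y)"
  using elts_colimit_hom(3)[OF FHom_colimit, of N f N' y "y 0 0" "y (snd N') (snd N')"] efamsI by blast

lemma FHom_ext:
  assumes "h \<in> hom M (FHom a b) d" "h' \<in> hom M (FHom a b) d"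
    and "\<And>N x. is_necklace N \<Longrightarrow> x \<in> efams K a b N \<Longrightarrow> h \<bullet> leg N x = h' \<bullet> leg N x"
  shows "h = h'"
  by (rule is_colimit_ext[OF elts_functor FHom_colimit[unfolded elts_colimit_def] assms(1,2)]) (use
    assms(3) in auto)

lemma FHom_factor:
  assumes "d \<in> Obj M" "\<And>N x. is_necklace N \<Longrightarrow> x \<in> efams K a b N \<Longrightarrow> \<kappa> N x \<in> hom M (FOb D N) d"
    and "\<And>N f N' y. (N, f, N') \<in> Arr Nec \<Longrightarrow> y \<in> efams K a b N' \<Longrightarrow>
      \<kappa> N' y \<bullet> FAr D (N, f, N') = \<kappa> N (pull K (N, f, N') y)"
  shows "\<exists>h. h \<in> hom M (FHom a b) d \<and> (\<forall>N x. is_necklace N \<longrightarrow> x \<in> efams K a b N \<longrightarrow> h \<bullet> leg N x = \<kappa> N x)"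
proof -
  have "\<exists>h. h \<in> hom M (FHom a b) d \<and> (\<forall>j \<in> Obj (elts K a b). h \<bullet> (case j of (N, x) \<Rightarrow> leg N x) =
    (case j of (N, x) \<Rightarrow> \<kappa> N x))"
    by (rule is_colimit_factor[OF FHom_colimit[unfolded elts_colimit_def] assms(1)]) (use assms(2,3) in
      auto)
  then show ?thesis by fastforce
qed

text \<open>Tensoring with a fixed object preserves the colimit, so arrows out of the result are
  still tested on legs. The variants that follow treat the other side and iterated tensor
  products.\<close>

lemma FHom_tensR_ext:
  assumes "X \<in> Obj M" "h \<in> hom M (FHom a b \<otimes> X) d" "h' \<in> hom M (FHom a b \<otimes> X) d"
    and "\<And>N x. is_necklace N \<Longrightarrow> x \<in> efams K a b N \<Longrightarrow> h \<bullet> (leg N x \<odot> Idt M X) = h' \<bullet> (leg N x \<odot> Idt M X)"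
  shows "h = h'"
  by (rule is_colimit_ext[OF cat_functor_comp[OF elts_functor tensR_functor[OF assms(1)]]
      tensR_colimit[OF elts_functor small_elts' FHom_colimit[unfolded elts_colimit_def] assms(1)]
        assms(2,3)])
    (use assms(4) in auto)

lemma FHom_tensL_ext:
  assumes "X \<in> Obj M" "h \<in> hom M (X \<otimes> FHom a b) d" "h' \<in> hom M (X \<otimes> FHom a b) d"
    and "\<And>N x. is_necklace N \<Longrightarrow> x \<in> efams K a b N \<Longrightarrow> h \<bullet> (Idt M X \<odot> leg N x) = h' \<bullet> (Idt M X \<odot> leg N x)"
  shows "h = h'"
  by (rule is_colimit_ext[OF cat_functor_comp[OF elts_functor tensL_functor[OF assms(1)]]
      tensL_colimit[OF elts_functor small_elts' FHom_colimit[unfolded elts_colimit_def] assms(1)]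
        assms(2,3)])
    (use assms(4) in auto)

lemma FHom_tensR_tensR_ext:
  assumes "X \<in> Obj M" "Y \<in> Obj M" "h \<in> hom M ((FHom a b \<otimes> X) \<otimes> Y) d" "h' \<in> hom M ((FHom a b \<otimes> X) \<otimes> Y) d"
    and "\<And>N x. is_necklace N \<Longrightarrow> x \<in> efams K a b N \<Longrightarrow>
      h \<bullet> ((leg N x \<odot> Idt M X) \<odot> Idt M Y) = h' \<bullet> ((leg N x \<odot> Idt M X) \<odot> Idt M Y)"
  shows "h = h'"
proof -
  note F = cat_functor_comp[OF elts_functor tensR_functor[OF assms(1)]]
  show ?thesis
    by (rule is_colimit_ext[OF cat_functor_comp[OF F tensR_functor[OF assms(2)]]
        tensR_colimit[OF F small_elts' tensR_colimit[OF elts_functor small_elts'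
          FHom_colimit[unfolded elts_colimit_def] assms(1)] assms(2)] assms(3,4)])
      (use assms(5) in auto)
qed

lemma FHom_tensL_tensR_ext:
  assumes "X \<in> Obj M" "Y \<in> Obj M" "h \<in> hom M ((X \<otimes> FHom a b) \<otimes> Y) d" "h' \<in> hom M ((X \<otimes> FHom a b) \<otimes> Y) d"
    and "\<And>N x. is_necklace N \<Longrightarrow> x \<in> efams K a b N \<Longrightarrow>
      h \<bullet> ((Idt M X \<odot> leg N x) \<odot> Idt M Y) = h' \<bullet> ((Idt M X \<odot> leg N x) \<odot> Idt M Y)"
  shows "h = h'"
proof -
  note F = cat_functor_comp[OF elts_functor tensL_functor[OF assms(1)]]
  show ?thesis
    by (rule is_colimit_ext[OF cat_functor_comp[OF F tensR_functor[OF assms(2)]]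
        tensR_colimit[OF F small_elts' tensL_colimit[OF elts_functor small_elts'
          FHom_colimit[unfolded elts_colimit_def] assms(1)] assms(2)] assms(3,4)])
      (use assms(5) in auto)
qed

lemma FHom_tensR_factor:
  assumes "X \<in> Obj M" "d \<in> Obj M"
    and "\<And>N x. is_necklace N \<Longrightarrow> x \<in> efams K a b N \<Longrightarrow> \<kappa> N x \<in> hom M (FOb D N \<otimes> X) d"
    and "\<And>N f N' y. (N, f, N') \<in> Arr Nec \<Longrightarrow> y \<in> efams K a b N' \<Longrightarrow>
      \<kappa> N' y \<bullet> (FAr D (N, f, N') \<odot> Idt M X) = \<kappa> N (pull K (N, f, N') y)"
  shows "\<exists>h. h \<in> hom M (FHom a b \<otimes> X) d \<and> (\<forall>N x. is_necklace N \<longrightarrow> x \<in> efams K a b N \<longrightarrow>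
    h \<bullet> (leg N x \<odot> Idt M X) = \<kappa> N x)"
proof -
  have "\<exists>h. h \<in> hom M (FHom a b \<otimes> X) d \<and>
    (\<forall>j \<in> Obj (elts K a b). h \<bullet> ((case j of (N, x) \<Rightarrow> leg N x) \<odot> Idt M X) = (case j of (N, x) \<Rightarrow> \<kappa> N x))"
    by (rule is_colimit_factor[OF tensR_colimit[OF elts_functor small_elts' FHom_colimit[unfolded
      elts_colimit_def] assms(1)] assms(2)])
      (use assms(3,4) in auto)
  then show ?thesis by fastforce
qed

lemma FHom_tensL_factor:
  assumes "X \<in> Obj M" "d \<in> Obj M"
    and "\<And>N x. is_necklace N \<Longrightarrow> x \<in> efams K a b N \<Longrightarrow> \<kappa> N x \<in> hom M (X \<otimes> FOb D N) d"
    and "\<And>N f N' y. (N, f, N') \<in> Arr Nec \<Longrightarrow> y \<in> efams K a b N' \<Longrightarrow>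
      \<kappa> N' y \<bullet> (Idt M X \<odot> FAr D (N, f, N')) = \<kappa> N (pull K (N, f, N') y)"
  shows "\<exists>h. h \<in> hom M (X \<otimes> FHom a b) d \<and> (\<forall>N x. is_necklace N \<longrightarrow> x \<in> efams K a b N \<longrightarrow>
    h \<bullet> (Idt M X \<odot> leg N x) = \<kappa> N x)"
proof -
  have "\<exists>h. h \<in> hom M (X \<otimes> FHom a b) d \<and>
    (\<forall>j \<in> Obj (elts K a b). h \<bullet> (Idt M X \<odot> (case j of (N, x) \<Rightarrow> leg N x)) = (case j of (N, x) \<Rightarrow> \<kappa> N x))"
    by (rule is_colimit_factor[OF tensL_colimit[OF elts_functor small_elts' FHom_colimit[unfolded
      elts_colimit_def] assms(1)] assms(2)])
      (use assms(3,4) in auto)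
  then show ?thesis by fastforce
qed

lemma efamsD:
  assumes "x \<in> efams K a b N"
  shows "x \<in> fams K N" "x 0 0 = a" "x (snd N) (snd N) = b"
  using assms by (auto simp: efams_def)

lemma wfam_efams:
  assumes "is_necklace N" "is_necklace N'" "x \<in> efams K a b N" "y \<in> efams K b c N'"
  shows "wfam N x N' y \<in> efams K a c (wedge N N')"
  using assms wfam_fams[OF assms(1,2), of x y] wfam_ends[OF assms(1,2), of x y] by (simp add: efams_def)

text \<open>Cocontinuity in one variable at a time suffices: testing against the legs on the right
  leaves a tensor product with a fixed object, which is then tested against the legs on the
  left.\<close>

lemma FHom_tens_ext:
  assumes h: "h \<in> hom M (FHom a b \<otimes> FHom b' c) d" "h' \<in> hom M (FHom a b \<otimes> FHom b' c) d"
    and eq: "\<And>N x N' y. is_necklace N \<Longrightarrow> x \<in> efams K a b N \<Longrightarrow> is_necklace N' \<Longrightarrow> y \<in> efams K b' c N' \<Longrightarrow>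
      h \<bullet> (leg N x \<odot> leg N' y) = h' \<bullet> (leg N x \<odot> leg N' y)"
  shows "h = h'"
proof (rule FHom_tensL_ext[OF _ h])
  fix N' y assume y: "is_necklace N'" "y \<in> efams K b' c N'"
  note [simp] = y(1) efamsD[OF y(2)]
  show "h \<bullet> (Idt M (FHom a b) \<odot> leg N' y) = h' \<bullet> (Idt M (FHom a b) \<odot> leg N' y)"
  proof (rule FHom_tensR_ext)
    fix N x assume x: "is_necklace N" "x \<in> efams K a b N"
    note [simp] = x(1) efamsD[OF x(2)]
    show "(h \<bullet> (Idt M (FHom a b) \<odot> leg N' y)) \<bullet> (leg N x \<odot> Idt M (FOb D N')) =
      (h' \<bullet> (Idt M (FHom a b) \<odot> leg N' y)) \<bullet> (leg N x \<odot> Idt M (FOb D N'))"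
      using h eq[OF x y] by (simp add: hom_iff assoc tens_Cmp)
  qed (use h in \<open>auto simp: hom_iff\<close>)
qed simp

lemma FHom_tens3_ext:
  assumes h: "h \<in> hom M ((FHom a b \<otimes> FHom b' c) \<otimes> FHom c' e) d"
    "h' \<in> hom M ((FHom a b \<otimes> FHom b' c) \<otimes> FHom c' e) d"
    and eq: "\<And>N x N' y N'' z. is_necklace N \<Longrightarrow> x \<in> efams K a b N \<Longrightarrow> is_necklace N' \<Longrightarrow> y \<in> efams K b' c N' \<Longrightarrow>
      is_necklace N'' \<Longrightarrow> z \<in> efams K c' e N'' \<Longrightarrow>
      h \<bullet> ((leg N x \<odot> leg N' y) \<odot> leg N'' z) = h' \<bullet> ((leg N x \<odot> leg N' y) \<odot> leg N'' z)"
  shows "h = h'"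
proof (rule FHom_tensL_ext[OF _ h])
  fix N'' z assume z: "is_necklace N''" "z \<in> efams K c' e N''"
  note [simp] = z(1) efamsD[OF z(2)]
  let ?X = "FHom a b \<otimes> FHom b' c"
  show "h \<bullet> (Idt M ?X \<odot> leg N'' z) = h' \<bullet> (Idt M ?X \<odot> leg N'' z)"
  proof (rule FHom_tensR_tensR_ext)
    fix N x assume x: "is_necklace N" "x \<in> efams K a b N"
    note [simp] = x(1) efamsD[OF x(2)]
    show "(h \<bullet> (Idt M ?X \<odot> leg N'' z)) \<bullet> ((leg N x \<odot> Idt M (FHom b' c)) \<odot> Idt M (FOb D N'')) =
      (h' \<bullet> (Idt M ?X \<odot> leg N'' z)) \<bullet> ((leg N x \<odot> Idt M (FHom b' c)) \<odot> Idt M (FOb D N''))"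
    proof (rule FHom_tensL_tensR_ext)
      fix N' y assume y: "is_necklace N'" "y \<in> efams K b' c N'"
      note [simp] = y(1) efamsD[OF y(2)]
      show "((h \<bullet> (Idt M ?X \<odot> leg N'' z)) \<bullet> ((leg N x \<odot> Idt M (FHom b' c)) \<odot> Idt M (FOb D N''))) \<bullet>
        ((Idt M (FOb D N) \<odot> leg N' y) \<odot> Idt M (FOb D N'')) =
        ((h' \<bullet> (Idt M ?X \<odot> leg N'' z)) \<bullet> ((leg N x \<odot> Idt M (FHom b' c)) \<odot> Idt M (FOb D N''))) \<bullet>
          ((Idt M (FOb D N) \<odot> leg N' y) \<odot> Idt M (FOb D N''))"
        using h eq[OF x y z] by (simp add: hom_iff assoc tens_Cmp)
    qed (use h in \<open>auto simp: hom_iff\<close>)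
  qed (use h in \<open>auto simp: hom_iff\<close>)
qed simp

text \<open>The arrows to be factored are natural in both necklaces, because \<open>\<mu>\<close> is
  natural and pulling back respects wedges. For a fixed necklace on the right they factor through
  the colimit on the left; uniqueness of these factors makes them natural in the right-hand
  variable, so they factor once more.\<close>

lemma FCmp_exists:
  "\<exists>m. m \<in> hom M (FHom a b \<otimes> FHom b c) (FHom a c) \<and>
    (\<forall>N x N' y. is_necklace N \<longrightarrow> x \<in> efams K a b N \<longrightarrow> is_necklace N' \<longrightarrow> y \<in> efams K b c N' \<longrightarrow>
      m \<bullet> (leg N x \<odot> leg N' y) = leg (wedge N N') (wfam N x N' y) \<bullet> \<mu> N N')"
proof -
  let ?k = "\<lambda>N' y N x. leg (wedge N N') (wfam N x N' y) \<bullet> \<mu> N N'"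
  have k: "?k N' y N x \<in> hom M (FOb D N \<otimes> FOb D N') (FHom a c)"
    if "is_necklace N" "is_necklace N'" "x \<in> efams K a b N" "y \<in> efams K b c N'" for N N' x y
    using efamsD[OF wfam_efams[OF that], unfolded snd_wedge] that by (simp add: hom_iff)
  have kn: "?k L' z L w \<bullet> (FAr D (N, f, L) \<odot> FAr D (N', g, L')) =
    ?k N' (pull K (N', g, L') z) N (pull K (N, f, L) w)"
    if f: "(N, f, L) \<in> Arr Nec" and g: "(N', g, L') \<in> Arr Nec" and w: "w \<in> efams K a b L" and z: "z \<in>
      efams K b c L'"
    for N f L N' g L' w z
  proof -
    note fD = Arr_NecD[OF f] and gD = Arr_NecD[OF g] and wD = efamsD[OF w] and zD = efamsD[OF z]
    note [simp] = fD(1,2) gD(1,2) efamsD[OF wfam_efams[OF fD(2) gD(2) w z], unfolded snd_wedge]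
    have fg: "(N, f, L) \<odot>\<^bsub>Nec\<^esub> (N', g, L') \<in> Arr Nec" by (rule Nec_tens[OF f g])
    have "?k L' z L w \<bullet> (FAr D (N, f, L) \<odot> FAr D (N', g, L')) =
      leg (wedge L L') (wfam L w L' z) \<bullet> (FAr D ((N, f, L) \<odot>\<^bsub>Nec\<^esub> (N', g, L')) \<bullet> \<mu> N N')"
      using f g by (simp add: assoc mu_natural[OF f g, symmetric] del: Nec_sel(7))
    also have "\<dots> = leg (wedge N N') (pull K ((N, f, L) \<odot>\<^bsub>Nec\<^esub> (N', g, L')) (wfam L w L' z)) \<bullet> \<mu> N N'"
      using fg by (simp add: assoc[symmetric] leg_natural)
    also have "pull K ((N, f, L) \<odot>\<^bsub>Nec\<^esub> (N', g, L')) (wfam L w L' z) =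
      wfam N (pull K (N, f, L) w) N' (pull K (N', g, L') z)"
      using pull_wfam[where x=w and y=z, OF f g] wD zD by simp
    finally show ?thesis .
  qed
  \<comment> \<open>Naturality in one variable is the joint naturality \<open>kn\<close> with an
    identity in the other slot.\<close>
  have ident: "(N, \<lambda>i \<in> {0..snd N}. i, N) \<in> Arr Nec" if "is_necklace N" for N
    using that D.M.Idt_closed(1)[of N] by simp
  have "\<forall>N' y. is_necklace N' \<and> y \<in> efams K b c N' \<longrightarrow> (\<exists>h. h \<in> hom M (FHom a b \<otimes> FOb D N') (FHom a c) \<and>
      (\<forall>N x. is_necklace N \<longrightarrow> x \<in> efams K a b N \<longrightarrow> h \<bullet> (leg N x \<odot> Idt M (FOb D N')) = ?k N' y N x))"
  proof (intro allI impI, elim conjE)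
    fix N' y assume y: "is_necklace N'" "y \<in> efams K b c N'"
    show "\<exists>h. h \<in> hom M (FHom a b \<otimes> FOb D N') (FHom a c) \<and>
      (\<forall>N x. is_necklace N \<longrightarrow> x \<in> efams K a b N \<longrightarrow> h \<bullet> (leg N x \<odot> Idt M (FOb D N')) = ?k N' y N x)"
    proof (rule FHom_tensR_factor)
      fix N f L w assume f: "(N, f, L) \<in> Arr Nec" and w: "w \<in> efams K a b L"
      show "?k N' y L w \<bullet> (FAr D (N, f, L) \<odot> Idt M (FOb D N')) = ?k N' y N (pull K (N, f, L) w)"
        using kn[OF f ident[OF y(1)] w y(2)] y pull_Idt[OF efamsD(1)[OF y(2)]] by simp
    qed (use y k in auto)
  qed
  then obtain h where h: "\<And>N' y. is_necklace N' \<Longrightarrow> y \<in> efams K b c N' \<Longrightarrow>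
    h N' y \<in> hom M (FHom a b \<otimes> FOb D N') (FHom a c)"
    "\<And>N' y N x. is_necklace N' \<Longrightarrow> y \<in> efams K b c N' \<Longrightarrow> is_necklace N \<Longrightarrow> x \<in> efams K a b N \<Longrightarrow>
      h N' y \<bullet> (leg N x \<odot> Idt M (FOb D N')) = ?k N' y N x"
    by metis
  have "\<exists>m. m \<in> hom M (FHom a b \<otimes> FHom b c) (FHom a c) \<and>
    (\<forall>N' y. is_necklace N' \<longrightarrow> y \<in> efams K b c N' \<longrightarrow> m \<bullet> (Idt M (FHom a b) \<odot> leg N' y) = h N' y)"
  proof (rule FHom_tensL_factor)
    fix N' g L' z assume g: "(N', g, L') \<in> Arr Nec" and z: "z \<in> efams K b c L'"
    note gD = Arr_NecD[OF g]
    note z' = pull_efams[OF g z]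
    note [simp] = gD(1,2) g
    have hz: "h L' z \<in> Arr M" "Dom M (h L' z) = FHom a b \<otimes> FOb D L'" "Cod M (h L' z) = FHom a c"
      using h(1)[OF gD(2) z] by (auto simp: hom_iff)
    show "h L' z \<bullet> (Idt M (FHom a b) \<odot> FAr D (N', g, L')) = h N' (pull K (N', g, L') z)"
    proof (rule FHom_tensR_ext[OF _ _ h(1)[OF gD(1) z']])
      fix N x assume x: "is_necklace N" "x \<in> efams K a b N"
      note [simp] = x(1) efamsD[OF x(2)]
      have "(h L' z \<bullet> (Idt M (FHom a b) \<odot> FAr D (N', g, L'))) \<bullet> (leg N x \<odot> Idt M (FOb D N')) =
        (h L' z \<bullet> (leg N x \<odot> Idt M (FOb D L'))) \<bullet> (Idt M (FOb D N) \<odot> FAr D (N', g, L'))"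
        using hz by (simp add: assoc tens_Cmp)
      also have "\<dots> = ?k N' (pull K (N', g, L') z) N x"
        using kn[OF ident[OF x(1)] g x(2) z] h(2)[OF gD(2) z x] pull_Idt[OF efamsD(1)[OF x(2)]] by simp
      also have "\<dots> = h N' (pull K (N', g, L') z) \<bullet> (leg N x \<odot> Idt M (FOb D N'))"
        using h(2)[OF gD(1) z' x] by simp
      finally show "(h L' z \<bullet> (Idt M (FHom a b) \<odot> FAr D (N', g, L'))) \<bullet> (leg N x \<odot> Idt M (FOb D N')) =
        h N' (pull K (N', g, L') z) \<bullet> (leg N x \<odot> Idt M (FOb D N'))" .
    qed (use hz in \<open>auto simp: hom_iff\<close>)
  qed (use h(1) in auto)
  then obtain m where m: "m \<in> hom M (FHom a b \<otimes> FHom b c) (FHom a c)"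
    "\<And>N' y. is_necklace N' \<Longrightarrow> y \<in> efams K b c N' \<Longrightarrow> m \<bullet> (Idt M (FHom a b) \<odot> leg N' y) = h N' y" by blast
  have "m \<bullet> (leg N x \<odot> leg N' y) = ?k N' y N x"
    if x: "is_necklace N" "x \<in> efams K a b N" and y: "is_necklace N'" "y \<in> efams K b c N'" for N x N' y
  proof -
    note [simp] = x(1) efamsD[OF x(2)] y(1) efamsD[OF y(2)]
    have "m \<bullet> (leg N x \<odot> leg N' y) = (m \<bullet> (Idt M (FHom a b) \<odot> leg N' y)) \<bullet> (leg N x \<odot> Idt M (FOb D N'))"
      using m(1) by (simp add: hom_iff assoc tens_Cmp)
    then show ?thesis using m(2)[OF y] h(2)[OF y x] by simp
  qed
  then show ?thesis using m(1) by blast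
qed

definition FCmp :: "'u \<Rightarrow> 'u \<Rightarrow> 'u \<Rightarrow> 'a" where
  "FCmp a b c = (SOME m. m \<in> hom M (FHom a b \<otimes> FHom b c) (FHom a c) \<and>
    (\<forall>N x N' y. is_necklace N \<longrightarrow> x \<in> efams K a b N \<longrightarrow> is_necklace N' \<longrightarrow> y \<in> efams K b c N' \<longrightarrow>
      m \<bullet> (leg N x \<odot> leg N' y) = leg (wedge N N') (wfam N x N' y) \<bullet> \<mu> N N'))"

lemma FCmp_closed [simp]:
  "FCmp a b c \<in> Arr M" "Dom M (FCmp a b c) = FHom a b \<otimes> FHom b c" "Cod M (FCmp a b c) = FHom a c"
  using someI_ex[OF FCmp_exists[of a b c], folded FCmp_def] by (auto simp: hom_iff)

lemma FCmp_legs: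
  "is_necklace N \<Longrightarrow> x \<in> efams K a b N \<Longrightarrow> is_necklace N' \<Longrightarrow> y \<in> efams K b c N' \<Longrightarrow>
    FCmp a b c \<bullet> (leg N x \<odot> leg N' y) = leg (wedge N N') (wfam N x N' y) \<bullet> \<mu> N N'"
  using someI_ex[OF FCmp_exists[of a b c], folded FCmp_def] by blast

text \<open>The identity at \<open>a\<close> comes from the necklace without beads placed at
  \<open>a\<close>; \<open>\<epsilon>\<close> identifies the monoidal unit with the value of
  \<open>D\<close> there.\<close>

definition Free :: "('u, 'o, 'a) ecat" where
  "Free = \<lparr>EOb = Sim K 0, EHom = FHom, ECmp = FCmp, EId = (\<lambda>a. leg (simplex 0) (sfam K 0 a) \<bullet> \<epsilon>)\<rparr>"

lemma Free_sel [simp]: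
  "EOb Free = Sim K 0" "EHom Free = FHom" "ECmp Free = FCmp" "EId Free a =
   leg (simplex 0) (sfam K 0 a) \<bullet> \<epsilon>"
  by (simp_all add: Free_def)

lemma point_efams: "a \<in> Sim K 0 \<Longrightarrow> sfam K 0 a \<in> efams K a a (simplex 0)"
  using sfam_fams[of a 0] by (simp add: efams_def)

text \<open>Every axiom is tested on legs. Associativity becomes the associativity constraint of
  \<open>D\<close> together with associativity of gluing; since the wedge is strictly associative,
  the two outer legs are literally the same. The unit laws reduce to the unit constraints of
  \<open>D\<close> in the same way.\<close>

lemma enriched_Free: "enriched_category M Free"
proof
  fix a b c assume "a \<in> EOb Free" "b \<in> EOb Free" "c \<in> EOb Free"
  show "EHom Free a b \<in> Obj M" by simp
  show "ECmp Free a b c \<in> hom M (EHom Free a b \<otimes> EHom Free b c) (EHom Free a c)" by (simp add: hom_iff)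
next
  fix a assume "a \<in> EOb Free"
  then have a: "a \<in> Sim K 0" by simp
  show "EId Free a \<in> hom M (Unt M) (EHom Free a a)"
    using efamsD[OF point_efams[OF a]] by (simp add: hom_iff)
next
  fix a b c d
  have "FCmp a c d \<bullet> (FCmp a b c \<odot> Idt M (FHom c d)) =
    FCmp a b d \<bullet> (Idt M (FHom a b) \<odot> FCmp b c d) \<bullet> Asc M (FHom a b) (FHom b c) (FHom c d)"
  proof (rule FHom_tens3_ext)
    fix N x N' y N'' z
    assume A: "is_necklace N" "x \<in> efams K a b N" "is_necklace N'" "y \<in> efams K b c N'"
      "is_necklace N''" "z \<in> efams K c d N''"
    note [simp] = A(1,3,5) efamsD[OF A(2)] efamsD[OF A(4)] efamsD[OF A(6)]
    note xy = wfam_efams[OF A(1,3,2,4)] and yz = wfam_efams[OF A(3,5,4,6)]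
    note [simp] = efamsD[OF xy, unfolded snd_wedge] efamsD[OF yz, unfolded snd_wedge]
    have xyz: "wfam N x (wedge N' N'') (wfam N' y N'' z) \<in> efams K a d (wedge N (wedge N' N''))"
      by (rule wfam_efams[OF _ _ A(2) yz]) simp_all
    note [simp] = efamsD[OF xyz, unfolded snd_wedge]
    have "(FCmp a c d \<bullet> (FCmp a b c \<odot> Idt M (FHom c d))) \<bullet> ((leg N x \<odot> leg N' y) \<odot> leg N'' z) =
      FCmp a c d \<bullet> ((leg (wedge N N') (wfam N x N' y) \<bullet> \<mu> N N') \<odot> leg N'' z)"
      by (simp add: assoc tens_Cmp FCmp_legs[OF A(1-4)])
    also have "\<dots> = (FCmp a c d \<bullet> (leg (wedge N N') (wfam N x N' y) \<odot> leg N'' z)) \<bullet>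
      (\<mu> N N' \<odot> Idt M (FOb D N''))"
      by (simp add: assoc tens_Cmp)
    also have "\<dots> = leg (wedge N (wedge N' N'')) (wfam N x (wedge N' N'') (wfam N' y N'' z)) \<bullet>
      (\<mu> (wedge N N') N'' \<bullet> (\<mu> N N' \<odot> Idt M (FOb D N'')))"
      by (simp add: FCmp_legs[OF _ xy _ A(6)] assoc wedge_assoc wfam_assoc)
    finally have L: "(FCmp a c d \<bullet> (FCmp a b c \<odot> Idt M (FHom c d))) \<bullet>
      ((leg N x \<odot> leg N' y) \<odot> leg N'' z) =
      leg (wedge N (wedge N' N'')) (wfam N x (wedge N' N'') (wfam N' y N'' z)) \<bullet> (\<mu> (wedge N N') N'' \<bullet>
        (\<mu> N N' \<odot> Idt M (FOb D N'')))" .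
    have "(FCmp a b d \<bullet> (Idt M (FHom a b) \<odot> FCmp b c d) \<bullet> Asc M (FHom a b) (FHom b c) (FHom c d)) \<bullet>
      ((leg N x \<odot> leg N' y) \<odot> leg N'' z)
      = FCmp a b d \<bullet> (Idt M (FHom a b) \<odot> FCmp b c d) \<bullet> ((leg N x \<odot> (leg N' y \<odot> leg N'' z)) \<bullet>
        Asc M (FOb D N) (FOb D N') (FOb D N''))"
      using Asc_nat[of "leg N x" "leg N' y" "leg N'' z"] by (simp add: assoc)
    also have "\<dots> = FCmp a b d \<bullet> (leg N x \<odot> (leg (wedge N' N'') (wfam N' y N'' z) \<bullet> \<mu> N' N'')) \<bullet>
      Asc M (FOb D N) (FOb D N') (FOb D N'')"
      by (simp add: assoc[symmetric]) (simp add: assoc tens_Cmp FCmp_legs[OF A(3-6)])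
    also have "\<dots> = (FCmp a b d \<bullet> (leg N x \<odot> leg (wedge N' N'') (wfam N' y N'' z))) \<bullet>
      (Idt M (FOb D N) \<odot> \<mu> N' N'') \<bullet> Asc M (FOb D N) (FOb D N') (FOb D N'')"
      by (simp add: assoc[symmetric]) (simp add: assoc tens_Cmp)
    also have "\<dots> = leg (wedge N (wedge N' N'')) (wfam N x (wedge N' N'') (wfam N' y N'' z)) \<bullet>
      (\<mu> N (wedge N' N'') \<bullet> (Idt M (FOb D N) \<odot> \<mu> N' N'') \<bullet> Asc M (FOb D N) (FOb D N') (FOb D N''))"
      by (simp add: FCmp_legs[OF A(1,2) _ yz] assoc)
    finally show "(FCmp a c d \<bullet> (FCmp a b c \<odot> Idt M (FHom c d))) \<bullet> ((leg N x \<odot> leg N' y) \<odot> leg N'' z) =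
      (FCmp a b d \<bullet> (Idt M (FHom a b) \<odot> FCmp b c d) \<bullet> Asc M (FHom a b) (FHom b c) (FHom c d)) \<bullet>
        ((leg N x \<odot> leg N' y) \<odot> leg N'' z)"
      unfolding L mu_assoc[OF A(1,3,5)] by simp
  qed (auto simp: hom_iff)
  then show "ECmp Free a c d \<bullet> (ECmp Free a b c \<odot> Idt M (EHom Free c d)) =
    ECmp Free a b d \<bullet> (Idt M (EHom Free a b) \<odot> ECmp Free b c d) \<bullet>
      Asc M (EHom Free a b) (EHom Free b c) (EHom Free c d)" by simp
next
  fix a b assume "a \<in> EOb Free" "b \<in> EOb Free"
  then have a: "a \<in> Sim K 0" and b: "b \<in> Sim K 0" by auto
  note pa = point_efams[OF a] and pb = point_efams[OF b]
  note [simp] = efamsD[OF pa] efamsD[OF pb]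
  have "FCmp a a b \<bullet> ((leg (simplex 0) (sfam K 0 a) \<bullet> \<epsilon>) \<odot> Idt M (FHom a b)) = LUn M (FHom a b)"
  proof (rule FHom_tensL_ext[of "Unt M"])
    fix N x assume x: "is_necklace N" "x \<in> efams K a b N"
    note [simp] = x(1) efamsD[OF x(2)]
    have "(FCmp a a b \<bullet> ((leg (simplex 0) (sfam K 0 a) \<bullet> \<epsilon>) \<odot> Idt M (FHom a b))) \<bullet>
      (Idt M (Unt M) \<odot> leg N x) =
      (FCmp a a b \<bullet> (leg (simplex 0) (sfam K 0 a) \<odot> leg N x)) \<bullet> (\<epsilon> \<odot> Idt M (FOb D N))"
      by (simp add: assoc tens_Cmp)
    also have "\<dots> = leg N x \<bullet> (\<mu> (simplex 0) N \<bullet> (\<epsilon> \<odot> Idt M (FOb D N)))"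
      by (simp add: FCmp_legs[OF _ pa x] wfam_unit_left[OF x(1), of x] assoc)
    also have "\<dots> = LUn M (FHom a b) \<bullet> (Idt M (Unt M) \<odot> leg N x)"
      using LUn_natural[of "leg N x" "FOb D N" "FHom a b"] by (simp add: mu_unit_left hom_iff)
    finally show "(FCmp a a b \<bullet> ((leg (simplex 0) (sfam K 0 a) \<bullet> \<epsilon>) \<odot> Idt M (FHom a b))) \<bullet>
      (Idt M (Unt M) \<odot> leg N x) =
      LUn M (FHom a b) \<bullet> (Idt M (Unt M) \<odot> leg N x)" .
  qed (auto simp: hom_iff)
  then show "ECmp Free a a b \<bullet> (EId Free a \<odot> Idt M (EHom Free a b)) = LUn M (EHom Free a b)" by simp
  have "FCmp a b b \<bullet> (Idt M (FHom a b) \<odot> (leg (simplex 0) (sfam K 0 b) \<bullet> \<epsilon>)) = RUn M (FHom a b)"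
  proof (rule FHom_tensR_ext[of "Unt M"])
    fix N x assume x: "is_necklace N" "x \<in> efams K a b N"
    note [simp] = x(1) efamsD[OF x(2)]
    have "(FCmp a b b \<bullet> (Idt M (FHom a b) \<odot> (leg (simplex 0) (sfam K 0 b) \<bullet> \<epsilon>))) \<bullet>
      (leg N x \<odot> Idt M (Unt M)) =
      (FCmp a b b \<bullet> (leg N x \<odot> leg (simplex 0) (sfam K 0 b))) \<bullet> (Idt M (FOb D N) \<odot> \<epsilon>)"
      by (simp add: assoc tens_Cmp)
    also have "\<dots> = leg N x \<bullet> (\<mu> N (simplex 0) \<bullet> (Idt M (FOb D N) \<odot> \<epsilon>))"
      by (simp add: FCmp_legs[OF x _ pb] wfam_unit_right[OF x(1), of x] assoc)
    also have "\<dots> = RUn M (FHom a b) \<bullet> (leg N x \<odot> Idt M (Unt M))"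
      using RUn_natural[of "leg N x" "FOb D N" "FHom a b"] by (simp add: mu_unit_right hom_iff)
    finally show "(FCmp a b b \<bullet> (Idt M (FHom a b) \<odot> (leg (simplex 0) (sfam K 0 b) \<bullet> \<epsilon>))) \<bullet>
      (leg N x \<odot> Idt M (Unt M)) =
      RUn M (FHom a b) \<bullet> (leg N x \<odot> Idt M (Unt M))" .
  qed (auto simp: hom_iff)
  then show "ECmp Free a b b \<bullet> (Idt M (EHom Free a b) \<odot> EId Free b) = RUn M (EHom Free a b)" by simp
qed

end

text \<open>The first bead is peeled off at the least positive joint, matching the recursion of
  \<open>composite\<close>. The remainder is never a point, so the recursive branch is the one that
  applies to the wedge.\<close>

lemma necklace_induct_first [consumes 1, case_names simplex wedge]:
  assumes "is_necklace N" and simplex: "\<And>n. Q (simplex n)"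
    and wedge: "\<And>r M. 0 < r \<Longrightarrow> is_necklace M \<Longrightarrow> 0 < snd M \<Longrightarrow> Q M \<Longrightarrow> Q (wedge (simplex r) M)"
  shows "Q N"
  using assms(1)
proof (induction "snd N" arbitrary: N rule: less_induct)
  case less
  show ?case
  proof (cases "\<exists>r \<in> fst N. 0 < r \<and> r < snd N")
    case True
    define r where "r = (LEAST r. r \<in> fst N \<and> 0 < r)"
    have r: "r \<in> fst N" "0 < r" "r < snd N"
      using LeastI_ex[of "\<lambda>r. r \<in> fst N \<and> 0 < r"] Least_le[of "\<lambda>r. r \<in> fst N \<and> 0 < r"] True
      unfolding r_def by (auto intro: le_less_trans)
    have "fst (front N r) = {0, r}"
      using Least_le[of "\<lambda>r. r \<in> fst N \<and> 0 < r"] r less.prems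
      unfolding front_def by (fastforce simp: r_def is_necklace_iff)
    then have "front N r = simplex r" by (simp add: simplex_def prod_eq_iff)
    then have "N = wedge (simplex r) (rear N r)" using split_necklace(3)[OF less.prems r(1)] by simp
    moreover have "Q (wedge (simplex r) (rear N r))"
      using split_necklace[OF less.prems r(1)] r less.hyps by (intro wedge) auto
    ultimately show ?thesis by simp
  next
    case False
    then have "fst N = {0, snd N}" using less.prems by (force simp: is_necklace_iff)
    then have "N = simplex (snd N)" by (simp add: simplex_def prod_eq_iff)
    then show ?thesis using simplex by metis
  qed
qed

lemma necklace_point: "is_necklace N \<Longrightarrow> snd N = 0 \<Longrightarrow> N = simplex 0"
  by (auto simp: is_necklace_iff simplex_def prod_eq_iff)

section \<open>The left adjoint of the nerve\<close>

lemma nerve_diagram_sel [simp]: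
  "EOb (nerve_diagram M D \<mu> \<epsilon> n) = {0..n}"
  "i \<le> j \<Longrightarrow> EHom (nerve_diagram M D \<mu> \<epsilon> n) i j = FOb D (simplex (j - i))"
  "\<not> i \<le> j \<Longrightarrow> EHom (nerve_diagram M D \<mu> \<epsilon> n) i j = initial_obj M"
  "i \<le> j \<Longrightarrow> j \<le> k \<Longrightarrow> ECmp (nerve_diagram M D \<mu> \<epsilon> n) i j k =
   FAr D (join (j - i) (k - j)) \<bullet>\<^bsub>M\<^esub> \<mu> (simplex (j - i)) (simplex (k - j))"
  "EId (nerve_diagram M D \<mu> \<epsilon> n) i = \<epsilon>"
  by (simp_all add: nerve_diagram_def Let_def join_def)

lemma nerve_diagram_map_sel [simp]:
  "EFO (nerve_diagram_map M D \<mu> \<epsilon> (m, f, n)) i = f i"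
  "i \<le> j \<Longrightarrow> EFH (nerve_diagram_map M D \<mu> \<epsilon> (m, f, n)) i j =
   FAr D (simplex (j - i), seg f i j, simplex (f j - f i))"
  by (simp_all add: nerve_diagram_map_def seg_def)

text \<open>Both sides pull \<open>z\<close> back along the same monotone map, which is
  \<open>f\<close> restricted to the interval from \<open>i\<close> to \<open>j\<close>.\<close>

lemma (in simplicial_set) face_act:
  assumes f: "darr m f n" and ij: "i \<le> j" "j \<le> m" and z: "z \<in> Sim K n"
  shows "face K m i j (Act K (m, f, n) z) =
    Act K (j - i, seg f i j, f j - f i) (face K n (f i) (f j) z)"
proof -
  have fl: "f i \<le> f j" "f j \<le> n" using darrD(1,2)[OF f] ij by auto
  have "compose {0..j - i} f (\<lambda>k\<in>{0..j - i}. k + i) =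
    compose {0..j - i} (\<lambda>k\<in>{0..f j - f i}. k + f i) (seg f i j)"
  proof
    fix k show "compose {0..j - i} f (\<lambda>k\<in>{0..j - i}. k + i) k =
      compose {0..j - i} (\<lambda>k\<in>{0..f j - f i}. k + f i) (seg f i j) k"
      using darrD(2)[OF f, of i "k + i"] darrD(2)[OF f, of "k + i" j] ij
        by (auto simp: compose_def seg_def diff_le_mono)
  qed
  then show ?thesis
    unfolding face_def using act_comp[OF darr_face[OF ij] f z] act_comp[OF darr_seg[OF f ij]
      darr_face[OF fl] z] by simp
qed

lemma seg_Nec:
  assumes f: "darr m f n" and ij: "i \<le> j" "j \<le> m"
  shows "(simplex (j - i), seg f i j, simplex (f j - f i)) \<in> Arr Nec"
  using darr_seg[OF f ij] ij darrD(2)[OF f] by (simp add: Arr_Nec fst_simplex) (auto simp: seg_def)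

locale nerve_adjoint = realization M D \<mu> \<epsilon> K U
  for M :: "('o, 'a, 'm) monoidal_scheme" (structure)
    and D :: "(necklace, necklace \<times> (nat \<Rightarrow> nat) \<times> necklace, 'o, 'a) func"
    and \<mu> \<epsilon> and K :: "'u sset" and U :: "'u itself" +
  fixes L :: "('u, 'o, 'a) ecat" and \<eta>
  assumes adj: "nerve_left_adjoint_at M D \<mu> \<epsilon> K L \<eta>"
begin

section \<open>The unit of the adjunction and the arrows it assigns to beads\<close>

abbreviation "\<Phi> \<equiv> nerve_diagram M D \<mu> \<epsilon>"

sublocale L: enriched_category M L
  using adj unfolding nerve_left_adjoint_at_def by blast

lemma EOb_L [simp]: "EOb L = Sim K 0"
  using adj unfolding nerve_left_adjoint_at_def by blast

lemma eta_maps: "\<eta> \<in> simplicial_maps K (nerve M D \<mu> \<epsilon> L)"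
  using adj unfolding nerve_left_adjoint_at_def by blast

lemma eta_point: "x \<in> Sim K 0 \<Longrightarrow> EFO (\<eta> 0 x) 0 = x"
  using adj unfolding nerve_left_adjoint_at_def by blast

lemma eta_functor: "z \<in> Sim K n \<Longrightarrow> enriched_functor M (\<Phi> n) L (\<eta> n z)"
  and eta_restrict: "z \<in> Sim K n \<Longrightarrow> efunc_restrict {0..n} (\<eta> n z) = \<eta> n z"
  using eta_maps unfolding simplicial_maps_def nerve_def efunctors_def by (auto simp: PiE_def Pi_def)

lemma eta_act:
  assumes "darr m f n" "z \<in> Sim K n"
  shows "\<eta> m (Act K (m, f, n) z) = efunc_restrict {0..m} (efunc_comp M (\<eta> n z) (nerve_diagram_map M D \<mu>
    \<epsilon> (m, f, n)))"
proof -
  have "\<eta> m (Act K (m, f, n) z) = Act (nerve M D \<mu> \<epsilon> L) (m, f, n) (\<eta> n z)"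
    using eta_maps darr_hom[OF assms(1)] assms(2) unfolding simplicial_maps_def by blast
  then show ?thesis by (simp add: nerve_def)
qed

text \<open>Naturality along the inclusion of the vertex \<open>i\<close> reduces this to dimension
  0, where the normalisation of \<open>\<eta>\<close> applies.\<close>

lemma eta_EFO:
  assumes i: "i \<le> n" and z: "z \<in> Sim K n"
  shows "EFO (\<eta> n z) i = face K n i i z"
proof -
  have d: "darr 0 (\<lambda>k\<in>{0..0}. k + i) n" by (rule darrI) (use i in auto)
  have "face K n i i z \<in> Sim K 0" using face_closed[of i i n z] i z by simp
  then have "face K n i i z = EFO (\<eta> 0 (face K n i i z)) 0" by (simp add: eta_point)
  also have "\<dots> = EFO (\<eta> n z) i" using eta_act[OF d z] by (simp add: face_def)
  finally show ?thesis by simp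
qed

text \<open>The contribution of a single bead: an arrow from the value of \<open>D\<close> at the
  n-simplex to the hom-object of \<open>L\<close> between the first and last vertices of
  \<open>z\<close>. By naturality of \<open>\<eta>\<close> the other increasing components are the
  arrows of this kind for the faces of \<open>z\<close>, which is \<open>eta_EFH\<close>.\<close>

definition bead_arr :: "nat \<Rightarrow> 'u \<Rightarrow> 'a" where
  "bead_arr n z = EFH (\<eta> n z) 0 n"

lemma eta_EFH:
  assumes ij: "i \<le> j" "j \<le> n" and z: "z \<in> Sim K n"
  shows "EFH (\<eta> n z) i j = bead_arr (j - i) (face K n i j z)"
proof -
  interpret E: enriched_functor M "\<Phi> n" L "\<eta> n z" by (rule eta_functor[OF z])
  let ?f = "\<lambda>k\<in>{0..j - i}. k + i"
  have d: "darr (j - i) ?f n" by (rule darr_face[OF ij])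
  have "seg ?f 0 (j - i) = (\<lambda>k\<in>{0..snd (simplex (j - i))}. k)" by (auto simp: seg_def fun_eq_iff)
  then have "EFH (\<eta> (j - i) (face K n i j z)) 0 (j - i) =
    EFH (\<eta> n z) i j \<bullet> Idt M (FOb D (simplex (j - i)))"
    using eta_act[OF d z] ij D_Idt[of "simplex (j - i)"] by (simp add: face_def)
  then show ?thesis using ij by (simp add: bead_arr_def)
qed

lemma vertex_closed [simp]: "i \<le> n \<Longrightarrow> z \<in> Sim K n \<Longrightarrow> face K n i i z \<in> Sim K 0"
  using face_closed[of i i n z] by simp

lemma bead_arr_closed [simp]:
  assumes z: "z \<in> Sim K n"
  shows "bead_arr n z \<in> Arr M" "Dom M (bead_arr n z) = FOb D (simplex n)"
    "Cod M (bead_arr n z) = EHom L (face K n 0 0 z) (face K n n n z)"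
proof -
  interpret E: enriched_functor M "\<Phi> n" L "\<eta> n z" by (rule eta_functor[OF z])
  show "bead_arr n z \<in> Arr M" "Dom M (bead_arr n z) = FOb D (simplex n)"
    "Cod M (bead_arr n z) = EHom L (face K n 0 0 z) (face K n n n z)"
    using eta_EFO[of 0 n z] eta_EFO[of n n z] z by (simp_all add: bead_arr_def)
qed

lemma bead_arr_act:
  assumes f: "(simplex m, f, simplex n) \<in> Arr Nec" and z: "z \<in> Sim K n"
  shows "bead_arr m (Act K (m, f, n) z) = bead_arr n z \<bullet> FAr D (simplex m, f, simplex n)"
proof -
  note fD = Arr_NecD[OF f]
  have "seg f 0 m = f"
  proof
    fix k show "seg f 0 m k = f k" using fD(4) darrD(3)[OF fD(3), of k] by (auto simp: seg_def)
  qed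
  then show ?thesis using eta_act[of m f n z] fD z by (simp add: bead_arr_def)
qed

text \<open>This is the composition law of the functor \<open>\<eta> (i + j) z\<close> at the
  indices \<open>0\<close>, \<open>i\<close> and \<open>i + j\<close>: the left side contains the
  composition of the diagram, the right side that of \<open>L\<close>.\<close>

lemma bead_arr_join:
  assumes z: "z \<in> Sim K (i + j)"
  shows "bead_arr (i + j) z \<bullet> (FAr D (join i j) \<bullet> \<mu> (simplex i) (simplex j)) =
    ECmp L (face K (i + j) 0 0 z) (face K (i + j) i i z) (face K (i + j) (i + j) (i + j) z) \<bullet>
      (bead_arr i (face K (i + j) 0 i z) \<odot> bead_arr j (face K (i + j) i (i + j) z))"
proof -
  interpret E: enriched_functor M "\<Phi> (i + j)" L "\<eta> (i + j) z" by (rule eta_functor[OF z])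
  show ?thesis
    using E.EFH_ECmp[of 0 i "i + j"] eta_EFO[OF _ z] eta_EFH[of 0 i, OF _ _ z] eta_EFH[of i "i + j", OF
      _ _ z]
    by (simp add: bead_arr_def)
qed

lemma bead_arr_point:
  assumes a: "a \<in> Sim K 0"
  shows "bead_arr 0 a \<bullet> \<epsilon> = EId L a"
proof -
  interpret E: enriched_functor M "\<Phi> 0" L "\<eta> 0 a" by (rule eta_functor[OF a])
  show ?thesis using E.EFH_EId[of 0] eta_point[OF a] by (simp add: bead_arr_def)
qed

text \<open>The first bead is composed with the composite of the rest. Composition in
  \<open>L\<close> starts from a tensor product while the source is \<open>D\<close> of the whole
  necklace, hence the inverse of \<open>\<mu>\<close>. The recursion stops at a simplex, the point
  included.\<close>

function composite :: "necklace \<Rightarrow> (nat \<Rightarrow> nat \<Rightarrow> 'u) \<Rightarrow> 'a" where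
  "composite N x = (if \<exists>r \<in> fst N. 0 < r \<and> r < snd N
     then (let r = (LEAST r. r \<in> fst N \<and> 0 < r) in
       ECmp L (x 0 0) (x r r) (x (snd N) (snd N)) \<bullet>
         (bead_arr r (x 0 r) \<odot> composite (rear N r) (rfam (front N r) (rear N r) x)) \<bullet>
         inv_arr M (\<mu> (simplex r) (rear N r)))
     else bead_arr (snd N) (x 0 (snd N)))"
  by auto
termination
proof (relation "measure (\<lambda>(N, x). snd N)")
  fix N :: necklace and x :: "nat \<Rightarrow> nat \<Rightarrow> 'u" and r
  assume A: "\<exists>r \<in> fst N. 0 < r \<and> r < snd N" "r = (LEAST r. r \<in> fst N \<and> 0 < r)"
  then have "0 < r" using LeastI_ex[of "\<lambda>r. r \<in> fst N \<and> 0 < r"] by auto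
  then show "((rear N r, rfam (front N r) (rear N r) x), N, x) \<in> measure (\<lambda>(N, x). snd N)"
    using A by auto
qed simp

declare composite.simps [simp del]

lemma composite_simplex: "composite (simplex n) x = bead_arr n (x 0 n)"
  by (subst composite.simps) (simp add: fst_simplex)

lemma composite_first:
  assumes r: "0 < r" and N: "is_necklace N"
    "0 < snd N" and u: "u \<in> fams K (simplex r)" and y: "y \<in> fams K N"
    and uy: "u r r = y 0 0"
  shows "composite (wedge (simplex r) N) (wfam (simplex r) u N y) =
    ECmp L (u 0 0) (y 0 0) (y (snd N) (snd N)) \<bullet> (bead_arr r (u 0 r) \<odot> composite N y) \<bullet>
      inv_arr M (\<mu> (simplex r) N)"
proof -
  let ?N = "wedge (simplex r) N" and ?x = "wfam (simplex r) u N y"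
  have uy': "u (snd (simplex r)) (snd (simplex r)) = y 0 0" using uy by simp
  have ex: "\<exists>s \<in> fst ?N. 0 < s \<and> s < snd ?N"
    using r N by (intro bexI[of _ r]) (auto simp: fst_wedge fst_simplex)
  have least: "(LEAST s. s \<in> fst ?N \<and> 0 < s) = r"
    by (rule Least_equality) (use r in \<open>auto simp: fst_wedge fst_simplex\<close>)
  have rear: "rear ?N r = N" "front ?N r = simplex r" using front_wedge[of "simplex r" N] N by auto
  have parts: "rfam (simplex r) N ?x = y" by (rule parts_wfam(2)[OF _ N(1) u y uy']) simp
  have vals: "?x 0 0 = u 0 0" "?x r r = y 0 0" "?x (r + snd N) (r + snd N) =
    y (snd N) (snd N)" "?x 0 r = u 0 r"
    using uy bead_wedge[of "simplex r" N] N(1) by (auto simp: wfam_def)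
  show ?thesis
    by (subst composite.simps) (use ex in \<open>simp add: Let_def least rear parts vals\<close>)
qed

section \<open>Composites of beads respect wedges\<close>

lemma composite_closed [simp]:
  "is_necklace N \<Longrightarrow> x \<in> fams K N \<Longrightarrow> composite N x \<in> hom M (FOb D N) (EHom L (x 0 0) (x (snd N) (snd N)))"
proof (induction N arbitrary: x rule: necklace_induct_first)
  case (simplex n)
  have z: "x 0 n \<in> Sim K n" using famsD(1)[OF simplex, of 0 n] by simp
  have "x 0 0 = face K n 0 0 (x 0 n)" "x n n = face K n n n (x 0 n)"
    using famsD(3)[OF simplex, of 0 n 0 0] famsD(3)[OF simplex, of 0 n n n] by simp_all
  then show ?case using z by (simp add: composite_simplex hom_iff)
next
  case (wedge r N)
  note p = wfam_parts[OF is_necklace_simplex wedge.hyps(2) wedge.prems]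
  let ?u = "lfam (simplex r) x" and ?y = "rfam (simplex r) N x"
  have uy: "?u r r = ?y 0 0" using p(3) by simp
  have z: "?u 0 r \<in> Sim K r" using famsD(1)[OF p(1), of 0 r] by simp
  have e: "face K r 0 0 (?u 0 r) = ?u 0 0" "face K r r r (?u 0 r) = ?y 0 0"
    using famsD(3)[OF p(1), of 0 r 0 0] famsD(3)[OF p(1), of 0 r r r] uy by simp_all
  have v: "?u 0 0 \<in> Sim K 0" "?y 0 0 \<in> Sim K 0" "?y (snd N) (snd N) \<in> Sim K 0"
    using famsD(1)[OF p(1), of 0 0] famsD(1)[OF p(2), of 0 0] famsD(1)[OF p(2), of "snd N" "snd N"]
      by simp_all
  have ends: "x 0 0 = ?u 0 0" "x (r + snd N) (r + snd N) = ?y (snd N) (snd N)"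
    using wfam_ends[of "simplex r" N ?u ?y] p(3,4) wedge.hyps by simp_all
  have "composite (wedge (simplex r) N) x = ECmp L (?u 0 0) (?y 0 0) (?y (snd N) (snd N)) \<bullet>
    (bead_arr r (?u 0 r) \<odot> composite N ?y) \<bullet> inv_arr M (\<mu> (simplex r) N)"
    using composite_first[OF wedge.hyps(1-3) p(1,2) uy] p(4) by simp
  then show ?case using wedge.IH[OF p(2)] z v e wedge.hyps(2) ends by (simp add: hom_iff)
qed

lemma composite_typed [simp]:
  assumes "is_necklace N" "x \<in> fams K N"
  shows "composite N x \<in> Arr M" "Dom M (composite N x) = FOb D N"
    "Cod M (composite N x) = EHom L (x 0 0) (x (snd N) (snd N))"
  using composite_closed[OF assms] by (auto simp: hom_iff)

lemma fams_vertex: "x \<in> fams K N \<Longrightarrow> t \<le> snd N \<Longrightarrow> x t t \<in> Sim K 0"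
  using famsD(1)[of x K N t t] by simp

lemma composite_point:
  assumes "x \<in> fams K (simplex 0)"
  shows "composite (simplex 0) x \<bullet> \<epsilon> = EId L (x 0 0)"
  using famsD(1)[OF assms, of 0 0] by (simp add: composite_simplex bead_arr_point)

text \<open>\<open>composite\<close> cuts only at the first interior joint, so a cut elsewhere costs
  an induction on the left part: the induction hypothesis cuts what follows the first bead, and
  associativity of \<open>L\<close> rebrackets. As \<open>\<mu>\<close> and
  \<open>\<epsilon>\<close> are isomorphisms, equations may be tested after composing with
  them.\<close>

lemma composite_wfam:
  "is_necklace N \<Longrightarrow> is_necklace M' \<Longrightarrow> x \<in> fams K N \<Longrightarrow> y \<in> fams K M' \<Longrightarrow> x (snd N) (snd N) = y 0 0 \<Longrightarrow>
    composite (wedge N M') (wfam N x M' y) \<bullet> \<mu> N M' =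
      ECmp L (x 0 0) (y 0 0) (y (snd M') (snd M')) \<bullet> (composite N x \<odot> composite M' y)"
proof (induction N arbitrary: x rule: necklace_induct_first)
  case (simplex n)
  note M' = simplex(1) and x = simplex(2) and y = simplex(3) and xy = simplex(4)
  have v [simp]: "x 0 0 \<in> Sim K 0" "x n n \<in> Sim K 0" "y 0 0 \<in> Sim K 0" "y (snd M') (snd M') \<in> Sim K 0"
    using fams_vertex[OF x] fams_vertex[OF y] by simp_all
  note [simp] = M' x y
  have xy': "x n n = y 0 0" using xy by simp
  show ?case
  proof (cases "0 < n \<and> 0 < snd M'")
    case True
    then have "composite (wedge (simplex n) M') (wfam (simplex n) x M' y) \<bullet> \<mu> (simplex n) M' =
      (ECmp L (x 0 0) (y 0 0) (y (snd M') (snd M')) \<bullet> (bead_arr n (x 0 n) \<odot> composite M' y) \<bullet>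
        inv_arr M (\<mu> (simplex n) M')) \<bullet> \<mu> (simplex n) M'"
      using composite_first[OF _ M' _ x y xy'] by simp
    also have "\<dots> = ECmp L (x 0 0) (y 0 0) (y (snd M') (snd M')) \<bullet>
      (composite (simplex n) x \<odot> composite M' y)"
      using composite_typed[OF is_necklace_simplex x] xy'
        by (simp add: composite_simplex[symmetric] assoc)
    finally show ?thesis .
  next
    case False
    \<comment> \<open>When one side is a point the recursion does not cut at the gluing vertex, and
      the claim is a unit law of \<open>L\<close> instead.\<close>
    then consider "n = 0" | "snd M' = 0" by auto
    then show ?thesis
    proof cases
      case 1
      have x0: "x \<in> fams K (simplex 0)" using x 1 by simp
      have "(composite M' y \<bullet> \<mu> (simplex 0) M') \<bullet> (\<epsilon> \<odot> Idt M (FOb D M')) =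
        composite M' y \<bullet> LUn M (FOb D M')"
        by (simp add: assoc mu_unit_left)
      also have "\<dots> = LUn M (EHom L (y 0 0) (y (snd M') (snd M'))) \<bullet> (Idt M (Unt M) \<odot> composite M' y)"
        using LUn_natural[of "composite M' y" "FOb D M'"] by (simp add: hom_iff)
      also have "\<dots> = (ECmp L (y 0 0) (y 0 0) (y (snd M') (snd M')) \<bullet>
        (EId L (y 0 0) \<odot> Idt M (EHom L (y 0 0) (y (snd M') (snd M'))))) \<bullet>
          (Idt M (Unt M) \<odot> composite M' y)"
        by (simp add: L.EId_left)
      also have "\<dots> = ECmp L (y 0 0) (y 0 0) (y (snd M') (snd M')) \<bullet> ((composite (simplex 0) x \<bullet>
        \<epsilon>) \<odot> composite M' y)"
        using composite_point[OF x0] 1 xy' by (simp add: assoc tens_Cmp)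
      also have "\<dots> = (ECmp L (y 0 0) (y 0 0) (y (snd M') (snd M')) \<bullet>
        (composite (simplex 0) x \<odot> composite M' y)) \<bullet> (\<epsilon> \<odot> Idt M (FOb D M'))"
        using x0 1 xy' by (simp add: assoc tens_Cmp)
      finally have "composite M' y \<bullet> \<mu> (simplex 0) M' =
        ECmp L (y 0 0) (y 0 0) (y (snd M') (snd M')) \<bullet> (composite (simplex 0) x \<odot> composite M' y)"
        by (rule iso_epi[OF tens_iso[of \<epsilon> "Idt M (FOb D M')"], rotated 6]) (use x0 1 xy' in simp_all)
      then show ?thesis using 1 xy' wfam_unit_left[OF M' y, of x] by simp
    next
      case 2
      then have m: "M' = simplex 0" by (rule necklace_point[OF M'])
      have y0: "y \<in> fams K (simplex 0)" using y m by simp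
      let ?N = "simplex n"
      have "(composite ?N x \<bullet> \<mu> ?N (simplex 0)) \<bullet> (Idt M (FOb D ?N) \<odot> \<epsilon>) =
        composite ?N x \<bullet> RUn M (FOb D ?N)"
        by (simp add: assoc mu_unit_right)
      also have "\<dots> = RUn M (EHom L (x 0 0) (y 0 0)) \<bullet> (composite ?N x \<odot> Idt M (Unt M))"
        using RUn_natural[of "composite ?N x" "FOb D ?N"] xy' by (simp add: hom_iff)
      also have "\<dots> = (ECmp L (x 0 0) (y 0 0) (y 0 0) \<bullet>
        (Idt M (EHom L (x 0 0) (y 0 0)) \<odot> EId L (y 0 0))) \<bullet> (composite ?N x \<odot> Idt M (Unt M))"
        by (simp add: L.EId_right)
      also have "\<dots> = ECmp L (x 0 0) (y 0 0) (y 0 0) \<bullet> (composite ?N x \<odot> (composite (simplex 0) y \<bullet> \<epsilon>))"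
        using composite_point[OF y0] xy' by (simp add: assoc tens_Cmp)
      also have "\<dots> = (ECmp L (x 0 0) (y 0 0) (y 0 0) \<bullet> (composite ?N x \<odot> composite (simplex 0) y)) \<bullet>
        (Idt M (FOb D ?N) \<odot> \<epsilon>)"
        using y0 xy' by (simp add: assoc tens_Cmp)
      finally have "composite ?N x \<bullet> \<mu> ?N (simplex 0) =
        ECmp L (x 0 0) (y 0 0) (y 0 0) \<bullet> (composite ?N x \<odot> composite (simplex 0) y)"
        by (rule iso_epi[OF tens_iso[of "Idt M (FOb D ?N)" \<epsilon>], rotated 6]) (use y0 xy' in simp_all)
      then show ?thesis using m wfam_unit_right[OF is_necklace_simplex x, of y] by simp
    qed
  qed
next
  case (wedge r N)
  note N = wedge.hyps(2) and M' = wedge.prems(1) and y = wedge.prems(3)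
  let ?s = "simplex r"
  note p = wfam_parts[OF is_necklace_simplex N wedge.prems(2)]
  define u where "u = lfam ?s x"
  define w where "w = rfam ?s N x"
  have u: "u \<in> fams K ?s" and w: "w \<in> fams K N" and uw: "u r r = w 0 0" and x: "x = wfam ?s u N w"
    using p by (simp_all add: u_def w_def)
  have ends: "x 0 0 = u 0 0" "x (r + snd N) (r + snd N) = w (snd N) (snd N)"
    using wfam_ends[of ?s N u w] uw N by (simp_all add: x)
  have wy: "w (snd N) (snd N) = y 0 0" using wedge.prems(4) ends(2) by simp
  note wyF = wfam_fams[OF N M' w y wy]
  note wyE = wfam_ends[where x=w and y=y, OF N M' wy]
  have u_wy: "u r r = wfam N w M' y 0 0" using uw wyE(1) by simp
  have z [simp]: "u 0 r \<in> Sim K r" using famsD(1)[OF u, of 0 r] by simp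
  have e [simp]: "face K r 0 0 (u 0 r) = u 0 0" "face K r r r (u 0 r) = w 0 0"
    using famsD(3)[OF u, of 0 r 0 0] famsD(3)[OF u, of 0 r r r] uw by simp_all
  have v [simp]: "u 0 0 \<in> Sim K 0" "w 0 0 \<in> Sim K 0" "y 0 0 \<in> Sim K 0" "y (snd M') (snd M') \<in> Sim K 0"
    using fams_vertex[OF u] fams_vertex[OF w] fams_vertex[OF y] by simp_all
  note [simp] = N M' w y wy wyF wyE wedge.prems(2)
  have pos: "0 < snd (wedge N M')" using wedge.hyps(3) by simp
  let ?c = "w 0 0" and ?d = "y 0 0" and ?e = "y (snd M') (snd M')" and ?\<beta> = "bead_arr r (u 0 r)"
  let ?C = "composite (wedge ?s (wedge N M')) (wfam ?s u (wedge N M') (wfam N w M' y))"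
  let ?A = "Asc M (FOb D ?s) (FOb D N) (FOb D M')"
  have CF: "wfam ?s u (wedge N M') (wfam N w M' y) \<in> fams K (wedge ?s (wedge N M'))"
    by (rule wfam_fams[OF _ _ u wyF]) (use u_wy in simp_all)
  have C: "?C \<bullet> \<mu> ?s (wedge N M') = ECmp L (u 0 0) ?c ?e \<bullet>
    (?\<beta> \<odot> composite (wedge N M') (wfam N w M' y))"
    using composite_first[OF wedge.hyps(1) _ pos u wyF u_wy] by (simp add: assoc)
  have ends3: "wfam ?s u (wedge N M') (wfam N w M' y) 0 0 = u 0 0"
    "wfam ?s u (wedge N M') (wfam N w M' y) (r + (snd N + snd M')) (r + (snd N + snd M')) = ?e"
    using wfam_ends[of ?s "wedge N M'" u "wfam N w M' y"] u_wy by simp_all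
  note [simp] = CF ends3
  \<comment> \<open>The two sides are compared after precomposition with \<open>\<mu> ?s N\<close>
    tensored with an identity. Coherence of \<open>\<mu>\<close> turns the left one into a cut after
    the first bead, where the recursion equation applies.\<close>
  have "(?C \<bullet> \<mu> (wedge ?s N) M') \<bullet> (\<mu> ?s N \<odot> Idt M (FOb D M')) =
    ?C \<bullet> (\<mu> ?s (wedge N M') \<bullet> (Idt M (FOb D ?s) \<odot> \<mu> N M') \<bullet> ?A)"
    using mu_assoc[of ?s N M'] by (simp add: assoc wedge_assoc)
  also have "\<dots> = (?C \<bullet> \<mu> ?s (wedge N M')) \<bullet> (Idt M (FOb D ?s) \<odot> \<mu> N M') \<bullet> ?A"
    by (simp add: assoc)
  also have "\<dots> = ECmp L (u 0 0) ?c ?e \<bullet> (?\<beta> \<odot> (composite (wedge N M') (wfam N w M' y) \<bullet> \<mu> N M')) \<bullet> ?A"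
    unfolding C by (simp add: assoc[symmetric]) (simp add: assoc tens_Cmp)
  also have "composite (wedge N M') (wfam N w M' y) \<bullet> \<mu> N M' =
    ECmp L ?c ?d ?e \<bullet> (composite N w \<odot> composite M' y)"
    by (rule wedge.IH[OF M' w y wy])
  also have "ECmp L (u 0 0) ?c ?e \<bullet> (?\<beta> \<odot> (ECmp L ?c ?d ?e \<bullet> (composite N w \<odot> composite M' y))) \<bullet> ?A =
    ECmp L (u 0 0) ?c ?e \<bullet> (Idt M (EHom L (u 0 0) ?c) \<odot> ECmp L ?c ?d ?e) \<bullet>
      ((?\<beta> \<odot> (composite N w \<odot> composite M' y)) \<bullet> ?A)"
    by (simp add: assoc[symmetric]) (simp add: assoc tens_Cmp)
  also have "(?\<beta> \<odot> (composite N w \<odot> composite M' y)) \<bullet> ?A =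
    Asc M (EHom L (u 0 0) ?c) (EHom L ?c ?d) (EHom L ?d ?e) \<bullet> ((?\<beta> \<odot> composite N w) \<odot> composite M' y)"
    using Asc_nat[of ?\<beta> "composite N w" "composite M' y"] by simp
  also have "ECmp L (u 0 0) ?c ?e \<bullet> (Idt M (EHom L (u 0 0) ?c) \<odot> ECmp L ?c ?d ?e) \<bullet> \<dots> =
    (ECmp L (u 0 0) ?d ?e \<bullet> (ECmp L (u 0 0) ?c ?d \<odot> Idt M (EHom L ?d ?e))) \<bullet>
      ((?\<beta> \<odot> composite N w) \<odot> composite M' y)"
    using L.ECmp_assoc[of "u 0 0" ?c ?d ?e] by (simp add: assoc)
  also have "\<dots> = ECmp L (u 0 0) ?d ?e \<bullet> ((ECmp L (u 0 0) ?c ?d \<bullet>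
    (?\<beta> \<odot> composite N w)) \<odot> composite M' y)"
    by (simp add: assoc tens_Cmp)
  also have "ECmp L (u 0 0) ?c ?d \<bullet> (?\<beta> \<odot> composite N w) = composite (wedge ?s N) x \<bullet> \<mu> ?s N"
    using composite_first[OF wedge.hyps(1) N wedge.hyps(3) u w uw] by (simp add: x assoc)
  also have "ECmp L (u 0 0) ?d ?e \<bullet> ((composite (wedge ?s N) x \<bullet> \<mu> ?s N) \<odot> composite M' y) =
    (ECmp L (u 0 0) ?d ?e \<bullet> (composite (wedge ?s N) x \<odot> composite M' y)) \<bullet> (\<mu> ?s N \<odot> Idt M (FOb D M'))"
    using ends by (simp add: assoc tens_Cmp)
  finally have "?C \<bullet> \<mu> (wedge ?s N) M' =
    ECmp L (u 0 0) ?d ?e \<bullet> (composite (wedge ?s N) x \<odot> composite M' y)"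
    by (rule iso_epi[OF tens_iso[of "\<mu> ?s N" "Idt M (FOb D M')"], rotated 6])
      (use ends in \<open>simp_all add: wedge_assoc\<close>)
  moreover have "wfam (wedge ?s N) x M' y = wfam ?s u (wedge N M') (wfam N w M' y)"
    unfolding x using wfam_assoc[of ?s N M' u w y] uw wy by simp
  ultimately show ?case using ends by (simp add: wedge_assoc)
qed

section \<open>Naturality of the composite in necklace maps\<close>

lemma composite_Cmp:
  assumes f: "(N, f, N') \<in> Arr Nec" and g: "(N', g, N'') \<in> Arr Nec"
    and "\<And>y. y \<in> fams K N' \<Longrightarrow> composite N' y \<bullet> FAr D (N, f, N') = composite N (pull K (N, f, N') y)"
    and "\<And>y. y \<in> fams K N'' \<Longrightarrow> composite N'' y \<bullet> FAr D (N', g, N'') =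
      composite N' (pull K (N', g, N'') y)"
    and y: "y \<in> fams K N''"
  shows "composite N'' y \<bullet> FAr D ((N', g, N'') \<bullet>\<^bsub>Nec\<^esub> (N, f, N')) =
    composite N (pull K ((N', g, N'') \<bullet>\<^bsub>Nec\<^esub> (N, f, N')) y)"
proof -
  note [simp] = Arr_NecD(1,2)[OF f] Arr_NecD(1,2)[OF g] f g y
  have "FAr D ((N', g, N'') \<bullet>\<^bsub>Nec\<^esub> (N, f, N')) = FAr D (N', g, N'') \<bullet> FAr D (N, f, N')"
    using D.FAr_Cmp_Arr[OF f g] by simp
  then have "composite N'' y \<bullet> FAr D ((N', g, N'') \<bullet>\<^bsub>Nec\<^esub> (N, f, N')) =
    composite N (pull K (N, f, N') (pull K (N', g, N'') y))"
    using assms(3)[OF pull_fams[OF g y]] assms(4)[OF y] by (simp add: assoc[symmetric] del: Nec_sel(5))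
  then show ?thesis using pull_Cmp[OF f g y] by simp
qed

text \<open>Multiplicativity of the composite separates the two maps once the equation is
  precomposed with the isomorphism \<open>\<mu>\<close>.\<close>

lemma composite_tens:
  assumes f: "(N, f, N') \<in> Arr Nec" and g: "(L1, g, L') \<in> Arr Nec"
    and "\<And>y. y \<in> fams K N' \<Longrightarrow> composite N' y \<bullet> FAr D (N, f, N') = composite N (pull K (N, f, N') y)"
    and "\<And>y. y \<in> fams K L' \<Longrightarrow> composite L' y \<bullet> FAr D (L1, g, L') = composite L1 (pull K (L1, g, L') y)"
    and y: "y \<in> fams K (wedge N' L')"
  shows "composite (wedge N' L') y \<bullet> FAr D ((N, f, N') \<odot>\<^bsub>Nec\<^esub> (L1, g, L')) =
    composite (wedge N L1) (pull K ((N, f, N') \<odot>\<^bsub>Nec\<^esub> (L1, g, L')) y)"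
proof -
  note fD = Arr_NecD(1,2)[OF f] and gD = Arr_NecD(1,2)[OF g]
  note p = wfam_parts[OF fD(2) gD(2) y]
  define u where "u = lfam N' y"
  define w where "w = rfam N' L' y"
  have u: "u \<in> fams K N'" and w: "w \<in> fams K L'" and uw: "u (snd N') (snd N') =
    w 0 0" and yy: "wfam N' u L' w = y"
    using p by (simp_all add: u_def w_def)
  note fg = Nec_tens[OF f g]
  have pull: "pull K ((N, f, N') \<odot>\<^bsub>Nec\<^esub> (L1, g, L')) y =
    wfam N (pull K (N, f, N') u) L1 (pull K (L1, g, L') w)"
    using pull_wfam[where x=u and y=w, OF f g uw] yy by simp
  have pe: "pull K (N, f, N') u (snd N) (snd N) = pull K (L1, g, L') w 0 0"
    using pull_ends(2)[OF f u] pull_ends(1)[OF g w] uw by simp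
  note pu = pull_fams[OF f u] and pw = pull_fams[OF g w]
  note [simp] = fD gD f g u w y pu pw
  have ends: "y 0 0 = u 0 0" "y (snd N' + snd L') (snd N' + snd L') = w (snd L') (snd L')"
    using wfam_ends[where x=u and y=w, OF fD(2) gD(2) uw] yy by simp_all
  have v [simp]: "u 0 0 \<in> Sim K 0" "w 0 0 \<in> Sim K 0" "w (snd L') (snd L') \<in> Sim K 0"
    using fams_vertex[OF u] fams_vertex[OF w] by simp_all
  have fgD: "FAr D ((N, f, N') \<odot>\<^bsub>Nec\<^esub> (L1, g, L')) \<in> Arr M"
    "Dom M (FAr D ((N, f, N') \<odot>\<^bsub>Nec\<^esub> (L1, g, L'))) = FOb D (wedge N L1)"
    "Cod M (FAr D ((N, f, N') \<odot>\<^bsub>Nec\<^esub> (L1, g, L'))) = FOb D (wedge N' L')"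
    using D.FAr_closed[OF fg] by simp_all
  have "(composite (wedge N' L') y \<bullet> FAr D ((N, f, N') \<odot>\<^bsub>Nec\<^esub> (L1, g, L'))) \<bullet> \<mu> N L1 =
    (composite (wedge N' L') y \<bullet> \<mu> N' L') \<bullet> (FAr D (N, f, N') \<odot> FAr D (L1, g, L'))"
    using mu_natural[OF f g] fgD by (simp add: assoc del: Nec_sel(7))
  also have "\<dots> = (ECmp L (u 0 0) (w 0 0) (w (snd L') (snd L')) \<bullet> (composite N' u \<odot> composite L' w)) \<bullet>
    (FAr D (N, f, N') \<odot> FAr D (L1, g, L'))"
    using composite_wfam[OF fD(2) gD(2) u w uw] yy by simp
  also have "\<dots> = ECmp L (u 0 0) (w 0 0) (w (snd L') (snd L')) \<bullet>
    (composite N (pull K (N, f, N') u) \<odot> composite L1 (pull K (L1, g, L') w))"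
    using uw assms(3)[OF u] assms(4)[OF w] by (simp add: assoc tens_Cmp)
  also have "\<dots> = composite (wedge N L1) (wfam N (pull K (N, f, N') u) L1 (pull K (L1, g, L') w)) \<bullet>
    \<mu> N L1"
    using composite_wfam[OF fD(1) gD(1) pu pw pe] pull_ends[OF f u] pull_ends[OF g w] by simp
  also have "\<dots> = composite (wedge N L1) (pull K ((N, f, N') \<odot>\<^bsub>Nec\<^esub> (L1, g, L')) y) \<bullet> \<mu> N L1"
    unfolding pull ..
  finally show ?thesis
    by (rule iso_epi[OF mu(4)[OF fD(1) gD(1)], rotated 4])
      (use fgD pull wfam_fams[OF fD(1) gD(1) pu pw pe] in \<open>simp_all del: Nec_sel(7)\<close>)
qed

text \<open>Induction on the source. Out of a simplex this is naturality of the bead arrows. Out of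
  a wedge the map is a wedge of maps to simplices followed by \<open>join\<close>: the former is
  covered by the induction hypotheses, the latter by functoriality of the unit.\<close>

lemma composite_natural_simplex:
  "is_necklace N \<Longrightarrow> (N, f, simplex q) \<in> Arr Nec \<Longrightarrow> y \<in> fams K (simplex q) \<Longrightarrow>
    composite (simplex q) y \<bullet> FAr D (N, f, simplex q) = composite N (pull K (N, f, simplex q) y)"
proof (induction N arbitrary: f q y rule: necklace_induct)
  case (simplex n)
  have z: "y 0 q \<in> Sim K q" using famsD(1)[OF simplex(2), of 0 q] by simp
  note fD = Arr_NecD[OF simplex(1)]
  have d: "darr n f q" using fD(3) by simp
  have "pull K (simplex n, f, simplex q) y = sfam K n (Act K (n, f, q) (y 0 q))"
    using pull_sfam[OF simplex(1) z] unfolding fams_simplex[OF simplex(2), symmetric] .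
  then show ?case using bead_arr_act[OF simplex(1) z] act_closed[OF d z]
    by (simp add: composite_simplex)
next
  case (wedge N M')
  obtain f1 f2 i j where s: "q = i + j" "(N, f1, simplex i) \<in> Arr Nec" "(M', f2, simplex j) \<in> Arr Nec"
    "(wedge N M', f, simplex q) = join i j \<bullet>\<^bsub>Nec\<^esub> ((N, f1, simplex i) \<odot>\<^bsub>Nec\<^esub> (M', f2, simplex j))"
    using Nec_split_join[OF wedge.prems(1) wedge.hyps] by blast
  \<comment> \<open>The case of \<open>join\<close> itself: composing the front and back faces of
    \<open>z\<close> in \<open>L\<close> is what \<open>bead_arr_join\<close> computes.\<close>
  have J: "composite (simplex (i + j)) y \<bullet> FAr D (join i j) =
    composite (wedge (simplex i) (simplex j)) (pull K (join i j) y)"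
    if y: "y \<in> fams K (simplex (i + j))" for y
  proof -
    let ?z = "y 0 (i + j)"
    have z: "?z \<in> Sim K (i + j)" using famsD(1)[OF y, of 0 "i + j"] by simp
    let ?u = "sfam K i (face K (i + j) 0 i ?z)" and ?w = "sfam K j (face K (i + j) i (i + j) ?z)"
    have z1: "face K (i + j) 0 i ?z \<in> Sim K i" "face K (i + j) i (i + j) ?z \<in> Sim K j"
      using face_closed[of 0 i "i + j" ?z] face_closed[of i "i + j" "i + j" ?z] z by simp_all
    note uF = sfam_fams[OF z1(1)] and wF = sfam_fams[OF z1(2)]
    have pl: "pull K (join i j) y = wfam (simplex i) ?u (simplex j) ?w"
      using pull_join[OF z] fams_simplex[OF y] by simp
    have uv: "?u 0 0 = face K (i + j) 0 0 ?z" "?u i i = face K (i + j) i i ?z"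
      "?w 0 0 = face K (i + j) i i ?z" "?w j j = face K (i + j) (i + j) (i + j) ?z"
      using face_face[of 0 0 0 i "i + j" ?z] face_face[of 0 i i i "i + j" ?z]
        face_face[of i i i "i + j" "i + j" ?z] face_face[of i "i + j" "i + j" "i + j" "i + j" ?z] z
      by (simp_all add: sfam_def)
    have yv: "y 0 0 = face K (i + j) 0 0 ?z" "y (i + j) (i + j) = face K (i + j) (i + j) (i + j) ?z"
      using famsD(3)[OF y, of 0 "i + j" 0 0] famsD(3)[OF y, of 0 "i + j" "i + j" "i + j"] by simp_all
    have uw: "?u (snd (simplex i)) (snd (simplex i)) = ?w 0 0" using uv by simp
    note WF = wfam_fams[OF is_necklace_simplex is_necklace_simplex uF wF uw]
    have jD: "FAr D (join i j) \<in> Arr M" "Dom M (FAr D (join i j)) =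
      FOb D (wedge (simplex i) (simplex j))" "Cod M (FAr D (join i j)) = FOb D (simplex (i + j))"
      using D.FAr_closed[OF join_Arr[of i j]] by (simp_all add: join_def)
    have "(composite (simplex (i + j)) y \<bullet> FAr D (join i j)) \<bullet> \<mu> (simplex i) (simplex j) =
      bead_arr (i + j) ?z \<bullet> (FAr D (join i j) \<bullet> \<mu> (simplex i) (simplex j))"
      using jD z by (simp add: composite_simplex assoc)
    also have "\<dots> = composite (wedge (simplex i) (simplex j)) (pull K (join i j) y) \<bullet>
      \<mu> (simplex i) (simplex j)"
      unfolding bead_arr_join[OF z] pl
      using composite_wfam[OF is_necklace_simplex is_necklace_simplex uF wF uw] z1
        by (simp add: uv composite_simplex)
    finally show ?thesis
      by (rule iso_epi[OF mu(4)[OF is_necklace_simplex is_necklace_simplex], rotated 4])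
        (use jD pl WF z y yv in \<open>simp_all add: composite_simplex\<close>)
  qed
  have T: "composite (wedge (simplex i) (simplex j)) y \<bullet>
    FAr D ((N, f1, simplex i) \<odot>\<^bsub>Nec\<^esub> (M', f2, simplex j)) =
    composite (wedge N M') (pull K ((N, f1, simplex i) \<odot>\<^bsub>Nec\<^esub> (M', f2, simplex j)) y)"
    if "y \<in> fams K (wedge (simplex i) (simplex j))" for y
    by (rule composite_tens[OF s(2,3) wedge.IH(1)[OF s(2)] wedge.IH(2)[OF s(3)] that])
  show ?case
    unfolding s(4)
    using composite_Cmp[OF Nec_tens[OF s(2,3), unfolded Nec_sel(7)] join_Arr[of i j, unfolded join_def]
        T[unfolded Nec_sel(7)] J[unfolded join_def]] wedge.prems(2) s(1)
    unfolding Nec_sel(7) join_def by blast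
qed

text \<open>Induction on the target: over a wedge the map splits at the gluing joint, and over a
  simplex the previous lemma applies.\<close>

lemma composite_natural:
  "is_necklace N' \<Longrightarrow> (N, f, N') \<in> Arr Nec \<Longrightarrow> y \<in> fams K N' \<Longrightarrow>
    composite N' y \<bullet> FAr D (N, f, N') = composite N (pull K (N, f, N') y)"
proof (induction N' arbitrary: N f y rule: necklace_induct)
  case (simplex n)
  show ?case by (rule composite_natural_simplex[OF Arr_NecD(1)[OF simplex(1)] simplex])
next
  case (wedge A B)
  obtain N1 N2 f1 f2 where s: "N = wedge N1 N2" "(N1, f1, A) \<in> Arr Nec" "(N2, f2, B) \<in> Arr Nec"
    "(N, f, wedge A B) = (N1, f1, A) \<odot>\<^bsub>Nec\<^esub> (N2, f2, B)"
    using Nec_split_wedge[OF wedge.prems(1) wedge.hyps] by blast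
  show ?case
    unfolding s(4) unfolding s(1) by (rule composite_tens[OF s(2,3) wedge.IH(1)[OF s(2)] wedge.IH(2)[OF
      s(3)] wedge.prems(2)])
qed


section \<open>The functor from the free category to the left adjoint\<close>

definition out :: "'u \<Rightarrow> 'u \<Rightarrow> 'a" where
  "out a b = (SOME h. h \<in> hom M (FHom a b) (EHom L a b) \<and>
    (\<forall>N x. is_necklace N \<longrightarrow> x \<in> efams K a b N \<longrightarrow> h \<bullet> leg N x = composite N x))"

lemma out:
  assumes "a \<in> Sim K 0" "b \<in> Sim K 0"
  shows "out a b \<in> hom M (FHom a b) (EHom L a b)"
    "is_necklace N \<Longrightarrow> x \<in> efams K a b N \<Longrightarrow> out a b \<bullet> leg N x = composite N x"
proof -
  have "\<exists>h. h \<in> hom M (FHom a b) (EHom L a b) \<and>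
    (\<forall>N x. is_necklace N \<longrightarrow> x \<in> efams K a b N \<longrightarrow> h \<bullet> leg N x = composite N x)"
  proof (rule FHom_factor)
    fix N x assume "is_necklace N" "x \<in> efams K a b N"
    then show "composite N x \<in> hom M (FOb D N) (EHom L a b)"
      using composite_closed[of N x] efamsD[of x a b N] by simp
  next
    fix N f N' y assume f: "(N, f, N') \<in> Arr Nec" and y: "y \<in> efams K a b N'"
    show "composite N' y \<bullet> FAr D (N, f, N') = composite N (pull K (N, f, N') y)"
      by (rule composite_natural[OF Arr_NecD(2)[OF f] f efamsD(1)[OF y]])
  qed (use assms in simp)
  from someI_ex[OF this, folded out_def] show "out a b \<in> hom M (FHom a b) (EHom L a b)"
    "is_necklace N \<Longrightarrow> x \<in> efams K a b N \<Longrightarrow> out a b \<bullet> leg N x = composite N x" by blast+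
qed

lemma out_closed [simp]:
  assumes "a \<in> Sim K 0" "b \<in> Sim K 0"
  shows "out a b \<in> Arr M" "Dom M (out a b) = FHom a b" "Cod M (out a b) = EHom L a b"
  using out(1)[OF assms] by (auto simp: hom_iff)

definition Out :: "('u, 'u, 'a) efunc" where
  "Out = \<lparr>EFO = (\<lambda>a. a), EFH = out\<rparr>"

lemma Out_sel [simp]: "EFO Out a = a" "EFH Out a b = out a b"
  by (simp_all add: Out_def)

text \<open>The composition law is tested on pairs of legs, where \<open>FCmp\<close> glues
  necklaces and composites respect gluing.\<close>

lemma Out_functor: "enriched_functor M Free L Out"
proof -
  interpret Fr: enriched_category M Free by (rule enriched_Free)
  show ?thesis
  proof
    fix a assume "a \<in> EOb Free"
    then have a: "a \<in> Sim K 0" by simp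
    show "EFO Out a \<in> EOb L" using a by simp
    note p = efamsD[OF point_efams[OF a]]
    have "(out a a \<bullet> leg (simplex 0) (sfam K 0 a)) \<bullet> \<epsilon> = EId L a"
      using out(2)[OF a a is_necklace_simplex point_efams[OF a]] composite_point[OF p(1)] p(2) by simp
    then show "EFH Out a a \<bullet> EId Free a = EId L (EFO Out a)"
      using a p by (simp add: assoc)
  next
    fix a b assume "a \<in> EOb Free" "b \<in> EOb Free"
    then show "EFH Out a b \<in> hom M (EHom Free a b) (EHom L (EFO Out a) (EFO Out b))"
      by (simp add: out(1))
  next
    fix a b c assume "a \<in> EOb Free" "b \<in> EOb Free" "c \<in> EOb Free"
    then have v [simp]: "a \<in> Sim K 0" "b \<in> Sim K 0" "c \<in> Sim K 0" by simp_all
    have "out a c \<bullet> FCmp a b c = ECmp L a b c \<bullet> (out a b \<odot> out b c)"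
    proof (rule FHom_tens_ext)
      fix N x N' y assume A: "is_necklace N" "x \<in> efams K a b N" "is_necklace N'" "y \<in> efams K b c N'"
      note xD = efamsD[OF A(2)] and yD = efamsD[OF A(4)]
      note xy = wfam_efams[OF A(1,3,2,4)]
      note [simp] = A(1,3) xD yD efamsD[OF xy, unfolded snd_wedge]
      have xy': "x (snd N) (snd N) = y 0 0" by simp
      have "(out a c \<bullet> FCmp a b c) \<bullet> (leg N x \<odot> leg N' y) =
        (out a c \<bullet> leg (wedge N N') (wfam N x N' y)) \<bullet> \<mu> N N'"
        by (simp add: assoc FCmp_legs[OF A])
      also have "\<dots> = ECmp L a b c \<bullet> (composite N x \<odot> composite N' y)"
        using out(2)[OF v(1,3) _ xy] composite_wfam[OF A(1,3) xD(1) yD(1) xy'] by simp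
      also have "\<dots> = (ECmp L a b c \<bullet> (out a b \<odot> out b c)) \<bullet> (leg N x \<odot> leg N' y)"
        using out(2)[OF v(1,2) A(1,2)] out(2)[OF v(2,3) A(3,4)] by (simp add: assoc tens_Cmp)
      finally show "(out a c \<bullet> FCmp a b c) \<bullet> (leg N x \<odot> leg N' y) =
        (ECmp L a b c \<bullet> (out a b \<odot> out b c)) \<bullet> (leg N x \<odot> leg N' y)" .
    qed (simp_all add: hom_iff)
    then show "EFH Out a c \<bullet> ECmp Free a b c =
      ECmp L (EFO Out a) (EFO Out b) (EFO Out c) \<bullet> (EFH Out a b \<odot> EFH Out b c)"
      by simp
  qed
qed

text \<open>The functor from \<Phi>(n) to \<open>Free\<close> given by \<open>z\<close>: the
  hom-object from \<open>i\<close> to \<open>j\<close> enters through the leg of the one-bead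
  necklace on the face between them. Backward hom-objects are initial, so \<open>THE\<close> picks
  the only arrow.\<close>

definition free_simplex :: "nat \<Rightarrow> 'u \<Rightarrow> (nat, 'u, 'a) efunc" where
  "free_simplex n z = efunc_restrict {0..n} \<lparr>EFO = (\<lambda>i. face K n i i z),
     EFH = (\<lambda>i j. if i \<le> j then leg (simplex (j - i)) (sfam K (j - i) (face K n i j z))
       else (THE h. h \<in> hom M (initial_obj M) (FHom (face K n i i z) (face K n j j z))))\<rparr>"

lemma free_simplex_sel:
  "i \<le> n \<Longrightarrow> EFO (free_simplex n z) i = face K n i i z"
  "i \<le> j \<Longrightarrow> j \<le> n \<Longrightarrow> EFH (free_simplex n z) i j = leg (simplex (j - i)) (sfam K (j - i) (face K n i j z))"
  "\<not> i \<le> j \<Longrightarrow> i \<le> n \<Longrightarrow> j \<le> n \<Longrightarrow>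
    EFH (free_simplex n z) i j \<in> hom M (initial_obj M) (FHom (face K n i i z) (face K n j j z))"
  using initial_the[OF initial FHom_Obj] by (simp_all add: free_simplex_def)

lemma free_simplex_restrict [simp]: "efunc_restrict {0..n} (free_simplex n z) = free_simplex n z"
  by (simp add: free_simplex_def)

lemma face_sfam_ends:
  assumes "i \<le> j" "j \<le> n" "z \<in> Sim K n"
  shows "sfam K (j - i) (face K n i j z) \<in> efams K (face K n i i z) (face K n j j z) (simplex (j - i))"
proof -
  have "face K (j - i) 0 0 (face K n i j z) = face K n i i z"
    using face_face[of i i i j n z] assms by simp
  moreover have "face K (j - i) (j - i) (j - i) (face K n i j z) = face K n j j z"
    using face_face[of i j j j n z] assms by simp
  ultimately show ?thesis using sfam_fams[of "face K n i j z" "j - i"] assms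
    by (simp add: efams_def sfam_def)
qed

lemma free_simplex_hom:
  assumes ij: "i \<le> n" "j \<le> n" and z: "z \<in> Sim K n"
  shows "EFH (free_simplex n z) i j \<in> hom M (EHom (\<Phi> n) i j) (FHom (face K n i i z) (face K n j j z))"
proof (cases "i \<le> j")
  case True
  show ?thesis
    using efamsD[OF face_sfam_ends[OF True ij(2) z]] True ij by (simp add: free_simplex_sel hom_iff)
next
  case False
  then show ?thesis using free_simplex_sel(3)[OF False ij] by simp
qed

text \<open>For increasing indices, composition in \<Phi>(n) is \<open>join\<close> after
  \<open>\<mu>\<close>. Naturality of the legs turns it into restricting the face from
  \<open>i\<close> to \<open>k\<close> to its two parts, and these are what \<open>FCmp\<close>
  glues. In all other cases the source of the two arrows is initial.\<close>

lemma free_simplex_functor: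
  assumes z: "z \<in> Sim K n"
  shows "enriched_functor M (\<Phi> n) Free (free_simplex n z)"
proof -
  \<comment> \<open>That \<Phi>(n) is an enriched category is read off \<open>\<eta> n z\<close>, a
    functor of which it is the source.\<close>
  interpret E: enriched_functor M "\<Phi> n" L "\<eta> n z" by (rule eta_functor[OF z])
  interpret Fr: enriched_category M Free by (rule enriched_Free)
  let ?v = "\<lambda>i. face K n i i z" and ?g = "EFH (free_simplex n z)"
  show ?thesis
  proof
    fix i assume "i \<in> EOb (\<Phi> n)"
    then have i: "i \<le> n" by simp
    show "EFO (free_simplex n z) i \<in> EOb Free" using i z by (simp add: free_simplex_sel)
    show "?g i i \<bullet> EId (\<Phi> n) i = EId Free (EFO (free_simplex n z) i)"
      using i by (simp add: free_simplex_sel)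
  next
    fix i j assume "i \<in> EOb (\<Phi> n)" "j \<in> EOb (\<Phi> n)"
    then show "?g i j \<in> hom M (EHom (\<Phi> n) i j) (EHom Free (EFO (free_simplex n z) i) (EFO (free_simplex
      n z) j))"
      using free_simplex_hom[of i n j z] z by (simp add: free_simplex_sel)
  next
    fix i j k assume "i \<in> EOb (\<Phi> n)" "j \<in> EOb (\<Phi> n)" "k \<in> EOb (\<Phi> n)"
    then have ijk: "i \<le> n" "j \<le> n" "k \<le> n" by simp_all
    have gt: "?g i j \<in> Arr M" "Dom M (?g i j) = EHom (\<Phi> n) i j" "Cod M (?g i j) = FHom (?v i) (?v j)"
      if "i \<le> n" "j \<le> n" for i j using free_simplex_hom[OF that z] by (auto simp: hom_iff)
    have "?g i k \<bullet> ECmp (\<Phi> n) i j k = FCmp (?v i) (?v j) (?v k) \<bullet> (?g i j \<odot> ?g j k)"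
    proof (cases "i \<le> j \<and> j \<le> k")
      case True
      let ?a = "j - i" and ?b = "k - j"
      have ab: "?a + ?b = k - i" using True by simp
      let ?y = "face K n i k z"
      have y: "?y \<in> Sim K (?a + ?b)" using face_closed[of i k n z] True ijk z ab by simp
      have f1: "face K (?a + ?b) 0 ?a ?y = face K n i j z"
        using face_face[of i i j k n z] True ijk z ab by simp
      have f2: "face K (?a + ?b) ?a (?a + ?b) ?y = face K n j k z"
        using face_face[of i j k k n z] True ijk z ab by simp
      have e1: "sfam K ?a (face K n i j z) \<in> efams K (?v i) (?v j) (simplex ?a)"
        by (rule face_sfam_ends) (use True ijk z in auto)
      have e2: "sfam K ?b (face K n j k z) \<in> efams K (?v j) (?v k) (simplex ?b)"
        by (rule face_sfam_ends) (use True ijk z in auto)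
      have e3: "sfam K (?a + ?b) ?y \<in> efams K (?v i) (?v k) (simplex (?a + ?b))"
        unfolding ab by (rule face_sfam_ends) (use True ijk z in auto)
      have jD: "FAr D (join ?a ?b) \<in> Arr M" "Dom M (FAr D (join ?a ?b)) =
        FOb D (wedge (simplex ?a) (simplex ?b))"
        "Cod M (FAr D (join ?a ?b)) = FOb D (simplex (?a + ?b))"
        using D.FAr_closed[OF join_Arr[of ?a ?b]] by (simp_all add: join_def)
      have "?g i k \<bullet> ECmp (\<Phi> n) i j k = leg (simplex (?a + ?b)) (sfam K (?a + ?b) ?y) \<bullet>
        (FAr D (join ?a ?b) \<bullet> \<mu> (simplex ?a) (simplex ?b))"
        unfolding ab using True ijk by (simp add: free_simplex_sel)
      also have "\<dots> = (leg (simplex (?a + ?b)) (sfam K (?a + ?b) ?y) \<bullet> FAr D (join ?a ?b)) \<bullet>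
        \<mu> (simplex ?a) (simplex ?b)"
        using jD efamsD(1)[OF e3] by (subst assoc) auto
      also have "leg (simplex (?a + ?b)) (sfam K (?a + ?b) ?y) \<bullet> FAr D (join ?a ?b) =
          leg (wedge (simplex ?a) (simplex ?b)) (pull K (join ?a ?b) (sfam K (?a + ?b) ?y))"
        using leg_natural[OF join_Arr[of ?a ?b, unfolded join_def] efamsD(1)[OF e3]]
          by (simp add: join_def)
      also have "pull K (join ?a ?b) (sfam K (?a + ?b) ?y) =
          wfam (simplex ?a) (sfam K ?a (face K n i j z)) (simplex ?b) (sfam K ?b (face K n j k z))"
        using pull_join[OF y] f1 f2 by simp
      also have "leg (wedge (simplex ?a) (simplex ?b)) \<dots> \<bullet> \<mu> (simplex ?a) (simplex ?b) =
          FCmp (?v i) (?v j) (?v k) \<bullet> (leg (simplex ?a) (sfam K ?a (face K n i j z)) \<odot> leg (simplex ?b)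
            (sfam K ?b (face K n j k z)))"
        by (rule FCmp_legs[OF is_necklace_simplex e1 is_necklace_simplex e2, symmetric])
      also have "\<dots> = FCmp (?v i) (?v j) (?v k) \<bullet> (?g i j \<odot> ?g j k)"
        using True ijk by (simp add: free_simplex_sel)
      finally show ?thesis .
    next
      case False
      have H: "EHom (\<Phi> n) i j \<in> Obj M" "EHom (\<Phi> n) j k \<in> Obj M"
        using ijk by (simp_all del: nerve_diagram_sel(2,3))
      \<comment> \<open>One of the two factors is initial and tensoring preserves that, so any two
        arrows out of the product agree.\<close>
      have "is_initial M (EHom (\<Phi> n) i j \<otimes> EHom (\<Phi> n) j k)"
      proof (cases "i \<le> j")
        case True
        then have "EHom (\<Phi> n) j k = initial_obj M" using False by simp
        then show ?thesis using tens_initial(1)[OF H(1) initial] by simp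
      next
        case False
        then have "EHom (\<Phi> n) i j = initial_obj M" by simp
        then show ?thesis using tens_initial(2)[OF H(2) initial] by simp
      qed
      moreover have "?g i k \<bullet> ECmp (\<Phi> n) i j k \<in> hom M (EHom (\<Phi> n) i j \<otimes> EHom (\<Phi> n) j k) (FHom (?v i)
        (?v k))"
        using ijk gt by (simp add: hom_iff del: nerve_diagram_sel(2,3,4))
      moreover have "FCmp (?v i) (?v j) (?v k) \<bullet>
        (?g i j \<odot> ?g j k) \<in> hom M (EHom (\<Phi> n) i j \<otimes> EHom (\<Phi> n) j k) (FHom (?v i) (?v k))"
        using ijk gt by (simp add: hom_iff del: nerve_diagram_sel(2,3,4))
      ultimately show ?thesis by (rule initial_unique)
    qed
    then show "?g i k \<bullet> ECmp (\<Phi> n) i j k =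
      ECmp Free (EFO (free_simplex n z) i) (EFO (free_simplex n z) j) (EFO (free_simplex n z) k) \<bullet>
        (?g i j \<odot> ?g j k)"
      using ijk by (simp add: free_simplex_sel)
  qed
qed

definition free_map :: "nat \<Rightarrow> 'u \<Rightarrow> (nat, 'u, 'a) efunc" where
  "free_map n = (\<lambda>z \<in> Sim K n. free_simplex n z)"

lemma diagram_map_hom:
  assumes f: "darr m f n" and ij: "i \<le> m" "j \<le> m" and z: "z \<in> Sim K n"
  shows "EFH (nerve_diagram_map M D \<mu> \<epsilon> (m, f, n)) i j \<in> hom M (EHom (\<Phi> m) i j) (EHom (\<Phi> n) (f i) (f
    j))"
proof (cases "i \<le> j")
  case True
  have "FAr D (simplex (j - i), seg f i j, simplex (f j - f i)) \<in> hom M (FOb D (simplex (j - i))) (FOb D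
    (simplex (f j - f i)))"
    using D_Arr[OF seg_Nec[OF f True ij(2)]] by (simp add: hom_iff)
  then show ?thesis using True darrD(2)[OF f True ij(2)] by simp
next
  case False
  \<comment> \<open>Here \<open>z\<close> serves to obtain \<open>\<eta> n z\<close>, which
    certifies that the hom-objects of \<Phi>(n) are objects of \<open>M\<close>.\<close>
  interpret E: enriched_functor M "\<Phi> n" L "\<eta> n z" by (rule eta_functor[OF z])
  have "EHom (\<Phi> n) (f i) (f j) \<in> Obj M" using darrD(1)[OF f] ij by (simp del: nerve_diagram_sel(2,3))
  from initial_the[OF initial this] show ?thesis
    using False by (simp add: nerve_diagram_map_def del: nerve_diagram_sel(2))
qed

text \<open>On increasing pairs this is naturality of the legs along \<open>seg\<close>; on the
  remaining pairs both arrows leave an initial object.\<close>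

lemma free_map_simplicial: "free_map \<in> simplicial_maps K (nerve M D \<mu> \<epsilon> Free)"
  unfolding simplicial_maps_def mem_Collect_eq
proof (intro conjI allI ballI)
  have "free_simplex n z \<in> efunctors M (\<Phi> n) Free" if "z \<in> Sim K n" for n z
    unfolding efunctors_def using free_simplex_functor[OF that] by simp
  then show "free_map n \<in> Sim K n \<rightarrow>\<^sub>E Sim (nerve M D \<mu> \<epsilon> Free) n" for n
    by (auto simp: free_map_def nerve_def)
  fix m n \<phi> z assume \<phi>: "\<phi> \<in> hom Delta m n" and z: "z \<in> Sim K n"
  obtain f where f: "\<phi> = (m, f, n)" "darr m f n" using \<phi> by (auto simp: hom_Delta)
  let ?z = "Act K (m, f, n) z"
  have z': "?z \<in> Sim K m" using f(2) z by simp
  have fl: "f i \<le> n" if "i \<le> m" for i using darrD(1)[OF f(2) that] .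
  have v: "face K m i i ?z = face K n (f i) (f i) z" if "i \<le> m" for i
  proof -
    have "face K m i i ?z = Act K (0, seg f i i, 0) (face K n (f i) (f i) z)"
      using face_act[OF f(2) _ _ z, of i i] that by simp
    also have "\<dots> = face K n (f i) (f i) z"
      by (rule act_ident) (use fl[OF that] z in \<open>auto simp: seg_def\<close>)
    finally show ?thesis .
  qed
  have "free_simplex m ?z = efunc_restrict {0..m} (free_simplex m ?z)" by simp
  also have "\<dots> = efunc_restrict {0..m} (efunc_comp M (free_simplex n z) (nerve_diagram_map M D \<mu> \<epsilon> (m,
    f, n)))"
  proof (rule efunc_restrict_eqI)
    fix i assume "i \<in> {0..m}"
    then show "EFO (free_simplex m ?z) i =
      EFO (efunc_comp M (free_simplex n z) (nerve_diagram_map M D \<mu> \<epsilon> (m, f, n))) i"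
      using v fl by (simp add: free_simplex_sel)
  next
    fix i j assume "i \<in> {0..m}" "j \<in> {0..m}"
    then have ij: "i \<le> m" "j \<le> m" by simp_all
    have "EFH (free_simplex m ?z) i j =
      EFH (free_simplex n z) (f i) (f j) \<bullet> EFH (nerve_diagram_map M D \<mu> \<epsilon> (m, f, n)) i j"
    proof (cases "i \<le> j")
      case True
      note fij = darrD(2)[OF f(2) True ij(2)]
      note s = seg_Nec[OF f(2) True ij(2)]
      have w: "face K n (f i) (f j) z \<in> Sim K (f j - f i)" using fij fl[OF ij(2)] z by simp
      have "leg (simplex (f j - f i)) (sfam K (f j - f i) (face K n (f i) (f j) z)) \<bullet>
        FAr D (simplex (j - i), seg f i j, simplex (f j - f i)) =
        leg (simplex (j - i)) (sfam K (j - i) (face K m i j ?z))"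
        using leg_natural[OF s sfam_fams[OF w]] pull_sfam[OF s w] face_act[OF f(2) True ij(2) z] by simp
      then show ?thesis using True ij fl fij by (simp add: free_simplex_sel)
    next
      case False
      have g: "EFH (free_simplex n z) (f i) (f j) \<in> hom M (EHom (\<Phi> n) (f i) (f j)) (FHom (face K m i i
        ?z) (face K m j j ?z))"
        using free_simplex_hom[OF fl[OF ij(1)] fl[OF ij(2)] z] v ij by simp
      have h: "EFH (nerve_diagram_map M D \<mu> \<epsilon> (m, f, n)) i j \<in> hom M (initial_obj M) (EHom (\<Phi> n) (f i)
        (f j))"
        using diagram_map_hom[OF f(2) ij z] False by simp
      show ?thesis
        by (rule initial_unique[OF initial free_simplex_sel(3)[OF False ij]])
          (use g h in \<open>simp add: hom_iff\<close>)
    qed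
    then show "EFH (free_simplex m ?z) i j =
      EFH (efunc_comp M (free_simplex n z) (nerve_diagram_map M D \<mu> \<epsilon> (m, f, n))) i j"
      by simp
  qed
  finally show "free_map m (Act K \<phi> z) = Act (nerve M D \<mu> \<epsilon> Free) \<phi> (free_map n z)"
    using z z' f by (simp add: free_map_def nerve_def)
qed

lemma adj_factor:
  fixes C :: "('u, 'o, 'a) ecat"
  assumes "enriched_category M C" "g \<in> simplicial_maps K (nerve M D \<mu> \<epsilon> C)"
  shows "\<exists>!G. G \<in> efunctors M L C \<and> (\<forall>n. \<forall>x \<in> Sim K n. g n x =
    efunc_restrict {0..n} (efunc_comp M G (\<eta> n x)))"
  using adj assms unfolding nerve_left_adjoint_at_def by blast

text \<open>The universal property assigns to \<open>free_map\<close> a functor \<open>G\<close>.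
  Both \<open>Out\<close> after \<open>G\<close> and the identity of \<open>L\<close> carry
  \<open>\<eta>\<close> to itself, so they agree by uniqueness. In the other order the identity
  appears because \<open>G\<close> sends the composite of a necklace to its leg. Hence
  \<open>out a b\<close> is invertible and transports the colimit.\<close>

theorem left_adjoint_hom_colimit:
  assumes a: "a \<in> Sim K 0" and b: "b \<in> Sim K 0"
  shows "elts_colimit M D K a b (EHom L a b) composite"
proof -
  obtain G where G: "G \<in> efunctors M L Free"
    "\<And>n z. z \<in> Sim K n \<Longrightarrow> free_map n z = efunc_restrict {0..n} (efunc_comp M G (\<eta> n z))"
    using adj_factor[OF enriched_Free free_map_simplicial] by blast
  interpret G: enriched_functor M L Free G using G(1) by (simp add: efunctors_def)
  interpret O: enriched_functor M Free L Out by (rule Out_functor)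
  \<comment> \<open>At a vertex \<open>x\<close>, both \<open>free_map\<close> and
    \<open>\<eta>\<close> pick out the object \<open>x\<close>, so \<open>G\<close> fixes
    it.\<close>
  have GO [simp]: "EFO G x = x" if x: "x \<in> Sim K 0" for x
  proof -
    have "EFO (free_map 0 x) 0 = EFO G (EFO (\<eta> 0 x) 0)" using G(2)[OF x] by simp
    then show ?thesis using x eta_point[OF x] by (simp add: free_map_def free_simplex_sel)
  qed
  have GH: "EFH G (face K n i i z) (face K n j j z) \<bullet> EFH (\<eta> n z) i j = EFH (free_simplex n z) i j"
    if z: "z \<in> Sim K n" and ij: "i \<le> n" "j \<le> n" for n z i j
  proof -
    have "EFH (free_map n z) i j = EFH G (EFO (\<eta> n z) i) (EFO (\<eta> n z) j) \<bullet> EFH (\<eta> n z) i j"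
      using G(2)[OF z] ij by simp
    then show ?thesis using z eta_EFO[OF ij(1) z] eta_EFO[OF ij(2) z] by (simp add: free_map_def)
  qed
  have Gt [simp]: "EFH G x y \<in> Arr M" "Dom M (EFH G x y) = EHom L x y" "Cod M (EFH G x y) = FHom x y"
    if "x \<in> Sim K 0" "y \<in> Sim K 0" for x y using that by simp_all
  define OG where "OG = efunc_restrict (EOb L) (efunc_comp M Out G)"
  define ID where "ID = efunc_restrict (EOb L) (efunc_id M L)"
  have OG_in: "OG \<in> efunctors M L L"
    unfolding OG_def by (rule efunc_restrict_efunctors[OF enriched_functor_comp[OF
      G.enriched_functor_axioms Out_functor]])
  have ID_in: "ID \<in> efunctors M L L"
    unfolding ID_def by (rule efunc_restrict_efunctors[OF enriched_functor_id[OF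
      L.enriched_category_axioms]])
  have OG_eta: "\<eta> n z = efunc_restrict {0..n} (efunc_comp M OG (\<eta> n z))" if z: "z \<in> Sim K n" for n z
  proof -
    interpret E: enriched_functor M "\<Phi> n" L "\<eta> n z" by (rule eta_functor[OF z])
    have "efunc_restrict {0..n} (\<eta> n z) = efunc_restrict {0..n} (efunc_comp M OG (\<eta> n z))"
    proof (rule efunc_restrict_eqI)
      fix i assume "i \<in> {0..n}"
      then show "EFO (\<eta> n z) i = EFO (efunc_comp M OG (\<eta> n z)) i"
        using z by (simp add: OG_def eta_EFO)
    next
      fix i j assume "i \<in> {0..n}" "j \<in> {0..n}"
      then have ij: "i \<le> n" "j \<le> n" by simp_all
      let ?x = "face K n i i z" and ?y = "face K n j j z"
      have xy: "?x \<in> Sim K 0" "?y \<in> Sim K 0" using ij z by simp_all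
      have eh: "EFH (\<eta> n z) i j \<in> Arr M" "Dom M (EFH (\<eta> n z) i j) =
        EHom (\<Phi> n) i j" "Cod M (EFH (\<eta> n z) i j) = EHom L ?x ?y"
        using ij eta_EFO[OF ij(1) z] eta_EFO[OF ij(2) z] by (simp_all del: nerve_diagram_sel(2,3))
      have "EFH (efunc_comp M OG (\<eta> n z)) i j = (out ?x ?y \<bullet> EFH G ?x ?y) \<bullet> EFH (\<eta> n z) i j"
        using xy ij z by (simp add: OG_def eta_EFO)
      also have "\<dots> = out ?x ?y \<bullet> EFH (free_simplex n z) i j"
        using GH[OF z ij] xy eh by (simp add: assoc)
      also have "\<dots> = EFH (\<eta> n z) i j"
      proof (cases "i \<le> j")
        case True
        then show ?thesis
          using out(2)[OF xy is_necklace_simplex face_sfam_ends[OF True ij(2) z]] ij z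
          by (simp add: free_simplex_sel composite_simplex eta_EFH)
      next
        case False
        show ?thesis
          by (rule initial_unique[OF initial, where x = "EHom L ?x ?y"])
            (use free_simplex_sel(3)[OF False ij, of z] eh False xy in \<open>simp_all add: hom_iff\<close>)
      qed
      finally show "EFH (\<eta> n z) i j = EFH (efunc_comp M OG (\<eta> n z)) i j" by simp
    qed
    then show ?thesis using eta_restrict[OF z] by simp
  qed
  have ID_eta: "\<eta> n z = efunc_restrict {0..n} (efunc_comp M ID (\<eta> n z))" if z: "z \<in> Sim K n" for n z
  proof -
    interpret E: enriched_functor M "\<Phi> n" L "\<eta> n z" by (rule eta_functor[OF z])
    have "efunc_restrict {0..n} (\<eta> n z) = efunc_restrict {0..n} (efunc_comp M ID (\<eta> n z))"
    proof (rule efunc_restrict_eqI)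
      fix i assume "i \<in> {0..n}"
      then show "EFO (\<eta> n z) i = EFO (efunc_comp M ID (\<eta> n z)) i"
        using z by (simp add: ID_def eta_EFO efunc_id_def)
    next
      fix i j assume "i \<in> {0..n}" "j \<in> {0..n}"
      then show "EFH (\<eta> n z) i j = EFH (efunc_comp M ID (\<eta> n z)) i j"
        using z eta_EFO[of i n z] eta_EFO[of j n z]
          by (simp add: ID_def efunc_id_def del: nerve_diagram_sel(2,3))
    qed
    then show ?thesis using eta_restrict[OF z] by simp
  qed
  have "OG = ID"
    using adj_factor[OF L.enriched_category_axioms eta_maps] OG_in ID_in OG_eta ID_eta by blast
  then have "EFH OG a b = EFH ID a b" by simp
  then have 1: "out a b \<bullet> EFH G a b = Idt M (EHom L a b)"
    using a b by (simp add: OG_def ID_def efunc_id_def)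
  \<comment> \<open>On a single bead this is the defining property of \<open>G\<close>; on a wedge
    both sides are multiplicative, and \<open>\<mu>\<close> cancels.\<close>
  have legs: "EFH G (x 0 0) (x (snd N) (snd N)) \<bullet> composite N x =
    leg N x" if "is_necklace N" "x \<in> fams K N" for N x
    using that
  proof (induction N arbitrary: x rule: necklace_induct)
    case (simplex n)
    have z: "x 0 n \<in> Sim K n" using famsD(1)[OF simplex, of 0 n] by simp
    have v: "face K n 0 0 (x 0 n) = x 0 0" "face K n n n (x 0 n) = x n n"
      using famsD(3)[OF simplex, of 0 n 0 0] famsD(3)[OF simplex, of 0 n n n] by simp_all
    have "EFH G (x 0 0) (x n n) \<bullet> bead_arr n (x 0 n) = leg (simplex n) (sfam K n (x 0 n))"
      using GH[OF z, of 0 n] z by (simp add: v bead_arr_def free_simplex_sel)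
    then show ?case unfolding fams_simplex[OF simplex, symmetric] by (simp add: composite_simplex)
  next
    case (wedge N N')
    note N = wedge.hyps
    note p = wfam_parts[OF N wedge.prems]
    define u where "u = lfam N x"
    define w where "w = rfam N N' x"
    have u: "u \<in> fams K N" and w: "w \<in> fams K N'" and uw: "u (snd N) (snd N) =
      w 0 0" and x: "wfam N u N' w = x"
      using p by (simp_all add: u_def w_def)
    have ends: "x 0 0 = u 0 0" "x (snd N + snd N') (snd N + snd N') = w (snd N') (snd N')"
      using wfam_ends[where x=u and y=w, OF N uw] x by simp_all
    let ?a = "u 0 0" and ?b = "w 0 0" and ?c = "w (snd N') (snd N')"
    have v [simp]: "?a \<in> Sim K 0" "?b \<in> Sim K 0" "?c \<in> Sim K 0"
      using fams_vertex[OF u] fams_vertex[OF w] by simp_all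
    note [simp] = N u w wedge.prems uw ends
    have ue: "u \<in> efams K ?a ?b N" and we: "w \<in> efams K ?b ?c N'"
      using u w uw by (simp_all add: efams_def)
    have GE: "EFH G ?a ?c \<bullet> ECmp L ?a ?b ?c = FCmp ?a ?b ?c \<bullet> (EFH G ?a ?b \<odot> EFH G ?b ?c)"
      using G.EFH_ECmp[of ?a ?b ?c] by simp
    have "(EFH G ?a ?c \<bullet> composite (wedge N N') x) \<bullet> \<mu> N N' =
      EFH G ?a ?c \<bullet> (ECmp L ?a ?b ?c \<bullet> (composite N u \<odot> composite N' w))"
      using composite_wfam[OF N u w uw] x by (simp add: assoc)
    also have "\<dots> = (FCmp ?a ?b ?c \<bullet> (EFH G ?a ?b \<odot> EFH G ?b ?c)) \<bullet> (composite N u \<odot> composite N' w)"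
      by (simp add: assoc GE[symmetric])
    also have "\<dots> = FCmp ?a ?b ?c \<bullet> (leg N u \<odot> leg N' w)"
      using wedge.IH(1)[OF u] wedge.IH(2)[OF w] by (simp add: assoc tens_Cmp)
    also have "\<dots> = leg (wedge N N') x \<bullet> \<mu> N N'"
      using FCmp_legs[OF N(1) ue N(2) we] x by simp
    finally have "EFH G ?a ?c \<bullet> composite (wedge N N') x = leg (wedge N N') x"
      by (rule iso_epi[OF mu(4)[OF N], rotated 4]) simp_all
    then show ?case by simp
  qed
  have 2: "EFH G a b \<bullet> out a b = Idt M (FHom a b)"
  proof (rule FHom_ext)
    fix N x assume x: "is_necklace N" "x \<in> efams K a b N"
    note [simp] = x(1) efamsD[OF x(2)]
    show "(EFH G a b \<bullet> out a b) \<bullet> leg N x = Idt M (FHom a b) \<bullet> leg N x"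
      using legs[of N x] out(2)[OF a b x] a b by (simp add: assoc)
  qed (use a b in \<open>simp_all add: hom_iff\<close>)
  show ?thesis
    unfolding elts_colimit_def
  proof (rule is_colimit_iso[OF elts_functor FHom_colimit[unfolded elts_colimit_def]])
    show "out a b \<in> hom M (FHom a b) (EHom L a b)" by (rule out(1)[OF a b])
    show "EFH G a b \<in> hom M (EHom L a b) (FHom a b)" using a b by (simp add: hom_iff)
    show "EFH G a b \<bullet> out a b = Idt M (FHom a b)" by (rule 2)
    show "out a b \<bullet> EFH G a b = Idt M (EHom L a b)" by (rule 1)
    fix p assume "p \<in> Obj (elts K a b)"
    then show "(case p of (N, x) \<Rightarrow> composite N x) = out a b \<bullet> (case p of (N, x) \<Rightarrow> leg N x)"
      using out(2)[OF a b] by auto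
  qed
qed

end

section \<open>Left Kan extensions along the inclusion of active surjections\<close>

context category
begin

lemma is_coproduct_transport:
  assumes c: "is_coproduct C S X c \<iota>"
    and h: "h \<in> hom C c d" "h' \<in> hom C d c" "h' \<bullet> h = Idt C c" "h \<bullet> h' = Idt C d"
    and \<kappa>: "\<And>s. s \<in> S \<Longrightarrow> \<kappa> s = h \<bullet> \<iota> s"
  shows "is_coproduct C S X d \<kappa>"
proof -
  have t [simp]: "h \<in> Arr C" "Dom C h = c" "Cod C h = d" "h' \<in> Arr C" "Dom C h' = d" "Cod C h' = c"
    using h by (auto simp: hom_iff)
  have i [simp]: "\<iota> s \<in> Arr C" "Dom C (\<iota> s) = X s" "Cod C (\<iota> s) = c" if "s \<in> S" for s
    using is_coproduct_hom(2)[OF c that] by (auto simp: hom_iff)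
  have hh: "h' \<bullet> (h \<bullet> k) = k" if "k \<in> Arr C" "Cod C k = c" for k
    using that h(3) by (simp add: assoc[symmetric])
  show ?thesis
  proof (rule is_coproductI)
    show "d \<in> Obj C" using hom_Obj(2)[OF h(1)] .
    show "\<kappa> s \<in> hom C (X s) d" if "s \<in> S" for s using that \<kappa> by (simp add: hom_iff)
  next
    fix e \<kappa>' assume "e \<in> Obj C" "\<And>s. s \<in> S \<Longrightarrow> \<kappa>' s \<in> hom C (X s) e"
    then obtain k where k: "k \<in> hom C c e" "\<forall>s \<in> S. k \<bullet> \<iota> s = \<kappa>' s"
      using is_coproduct_factor[OF c] by blast
    then show "\<exists>h. h \<in> hom C d e \<and> (\<forall>s \<in> S. h \<bullet> \<kappa> s = \<kappa>' s)"
      by (intro exI[of _ "k \<bullet> h'"]) (auto simp: hom_iff assoc hh \<kappa>)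
  next
    fix e k k' assume k: "k \<in> hom C d e" "k' \<in> hom C d e" and eq: "\<And>s. s \<in> S \<Longrightarrow> k \<bullet> \<kappa> s = k' \<bullet> \<kappa> s"
    have "k \<bullet> h = k' \<bullet> h"
    proof (rule is_coproduct_ext[OF c])
      show "(k \<bullet> h) \<bullet> \<iota> s = (k' \<bullet> h) \<bullet> \<iota> s" if "s \<in> S" for s
        using eq[OF that] \<kappa>[OF that] k that by (simp add: hom_iff assoc)
    qed (use k in \<open>auto simp: hom_iff\<close>)
    then have "(k \<bullet> h) \<bullet> h' = (k' \<bullet> h) \<bullet> h'" by simp
    then show "k = k'" using k h(4) by (simp add: hom_iff assoc)
  qed
qed

text \<open>A cocone on the pairs is assembled for each \<open>t\<close> by itself, and the results
  are then assembled over \<open>T\<close>.\<close>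

lemma is_coproduct_Sigma:
  assumes c: "is_coproduct C T X c \<iota>" and j: "\<And>t. t \<in> T \<Longrightarrow> is_coproduct C (S t) (Y t) (X t) (j t)"
  shows "is_coproduct C (Sigma T S) (\<lambda>(t, s). Y t s) c (\<lambda>(t, s). \<iota> t \<bullet> j t s)"
proof (rule is_coproductI)
  have i [simp]: "\<iota> t \<in> Arr C" "Dom C (\<iota> t) = X t" "Cod C (\<iota> t) = c" if "t \<in> T" for t
    using is_coproduct_hom(2)[OF c that] by (auto simp: hom_iff)
  have j' [simp]: "j t s \<in> Arr C" "Dom C (j t s) = Y t s" "Cod C (j t s) =
    X t" if "t \<in> T" "s \<in> S t" for t s
    using is_coproduct_hom(2)[OF j that(2), OF that(1)] by (auto simp: hom_iff)
  show "c \<in> Obj C" by (rule is_coproduct_hom(1)[OF c])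
  show "(case p of (t, s) \<Rightarrow> \<iota> t \<bullet> j t s) \<in> hom C (case p of (t, s) \<Rightarrow> Y t s) c" if "p \<in> Sigma T S" for p
    using that by (auto simp: hom_iff)
  show "\<exists>h. h \<in> hom C c d \<and> (\<forall>p \<in> Sigma T S. h \<bullet> (case p of (t, s) \<Rightarrow> \<iota> t \<bullet> j t s) = \<kappa> p)"
    if d: "d \<in> Obj C" and \<kappa>: "\<And>p. p \<in> Sigma T S \<Longrightarrow> \<kappa> p \<in> hom C (case p of (t, s) \<Rightarrow> Y t s) d" for d \<kappa>
  proof -
    have "\<exists>k. k \<in> hom C (X t) d \<and> (\<forall>s \<in> S t. k \<bullet> j t s = \<kappa> (t, s))" if t: "t \<in> T" for t
      by (rule is_coproduct_factor[OF j[OF t] d]) (use \<kappa> t in force)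
    then obtain k where k: "\<And>t. t \<in> T \<Longrightarrow> k t \<in> hom C (X t) d" "\<And>t s. t \<in> T \<Longrightarrow> s \<in> S t \<Longrightarrow>
      k t \<bullet> j t s = \<kappa> (t, s)"
      by metis
    obtain h where h: "h \<in> hom C c d" "\<forall>t \<in> T. h \<bullet> \<iota> t = k t"
      using is_coproduct_factor[OF c d, of k] k(1) by blast
    have "h \<bullet> (\<iota> t \<bullet> j t s) = \<kappa> (t, s)" if "t \<in> T" "s \<in> S t" for t s
      using that h k(2) by (simp add: hom_iff assoc[symmetric])
    then show ?thesis using h(1) by (intro exI[of _ h]) auto
  qed
  show "h = h'" if h: "h \<in> hom C c d" "h' \<in> hom C c d"
    and eq: "\<And>p. p \<in> Sigma T S \<Longrightarrow> h \<bullet> (case p of (t, s) \<Rightarrow> \<iota> t \<bullet> j t s) =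
      h' \<bullet> (case p of (t, s) \<Rightarrow> \<iota> t \<bullet> j t s)" for d h h'
  proof (rule is_coproduct_ext[OF c h])
    fix t assume t: "t \<in> T"
    show "h \<bullet> \<iota> t = h' \<bullet> \<iota> t"
    proof (rule is_coproduct_ext[OF j[OF t]])
      show "(h \<bullet> \<iota> t) \<bullet> j t s = (h' \<bullet> \<iota> t) \<bullet> j t s" if "s \<in> S t" for s
        using eq[of "(t, s)"] t that h by (simp add: hom_iff assoc)
    qed (use t h in \<open>auto simp: hom_iff\<close>)
  qed
qed

lemma isomorphic_sym: "isomorphic C x y \<Longrightarrow> isomorphic C y x"
  unfolding isomorphic_def using is_iso_inv_arr by (force simp: hom_iff)

end

text \<open>The legs are corrected by the inverses of \<tau>, which are natural because \<tau> is.
  This replaces \<pi>D by the Kan extension \<open>E\<close> inside the colimit.\<close>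

lemma is_colimit_nat_iso:
  assumes c: "is_colimit J C F c \<iota>" and t: "nat_trans J C F G \<tau>" and iso: "\<And>j. j \<in> Obj J \<Longrightarrow>
    is_iso C (\<tau> j)"
  shows "is_colimit J C G c (\<lambda>j. \<iota> j \<bullet>\<^bsub>C\<^esub> inv_arr C (\<tau> j))"
proof -
  interpret t: nat_trans J C F G \<tau> by fact
  note ch = is_colimit_hom[OF c]
  have i [simp]: "\<iota> j \<in> Arr C" "Dom C (\<iota> j) = FOb F j" "Cod C (\<iota> j) = c" if "j \<in> Obj J" for j
    using ch(2)[OF that] by (auto simp: hom_iff)
  note D = t.F.D.assoc
  have inv_nat: "inv_arr C (\<tau> (Cod J f)) \<bullet>\<^bsub>C\<^esub> FAr G f =
    FAr F f \<bullet>\<^bsub>C\<^esub> inv_arr C (\<tau> (Dom J f))" if f: "f \<in> Arr J" for f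
  proof -
    have j: "Dom J f \<in> Obj J" "Cod J f \<in> Obj J" using f by auto
    have "inv_arr C (\<tau> (Cod J f)) \<bullet>\<^bsub>C\<^esub> (FAr G f \<bullet>\<^bsub>C\<^esub> \<tau> (Dom J f)) \<bullet>\<^bsub>C\<^esub> inv_arr C (\<tau> (Dom J f)) =
      FAr F f \<bullet>\<^bsub>C\<^esub> inv_arr C (\<tau> (Dom J f))"
      unfolding t.natural_Arr[OF f, symmetric] using f j iso by (simp add: D)
    then show ?thesis using f j iso by (simp add: D)
  qed
  show ?thesis
  proof (rule is_colimitI)
    show "c \<in> Obj C" by (rule ch)
    show "\<iota> j \<bullet>\<^bsub>C\<^esub> inv_arr C (\<tau> j) \<in> hom C (FOb G j) c" if "j \<in> Obj J" for j
      using that iso by (simp add: hom_iff)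
    show "(\<iota> (Cod J f) \<bullet>\<^bsub>C\<^esub> inv_arr C (\<tau> (Cod J f))) \<bullet>\<^bsub>C\<^esub> FAr G f =
      \<iota> (Dom J f) \<bullet>\<^bsub>C\<^esub> inv_arr C (\<tau> (Dom J f))"
      if f: "f \<in> Arr J" for f
      using f iso ch(3)[OF f, symmetric] by (simp add: D inv_nat)
    fix d \<kappa> assume d: "d \<in> Obj C" "\<And>j. j \<in> Obj J \<Longrightarrow> \<kappa> j \<in> hom C (FOb G j) d"
      "\<And>f. f \<in> Arr J \<Longrightarrow> \<kappa> (Cod J f) \<bullet>\<^bsub>C\<^esub> FAr G f = \<kappa> (Dom J f)"
    have k [simp]: "\<kappa> j \<in> Arr C" "Dom C (\<kappa> j) = FOb G j" "Cod C (\<kappa> j) = d" if "j \<in> Obj J" for j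
      using d(2)[OF that] by (auto simp: hom_iff)
    have "\<exists>h. h \<in> hom C c d \<and> (\<forall>j \<in> Obj J. h \<bullet>\<^bsub>C\<^esub> \<iota> j = \<kappa> j \<bullet>\<^bsub>C\<^esub> \<tau> j)"
    proof (rule is_colimit_factor[OF c d(1)])
      show "(\<kappa> (Cod J f) \<bullet>\<^bsub>C\<^esub> \<tau> (Cod J f)) \<bullet>\<^bsub>C\<^esub> FAr F f =
        \<kappa> (Dom J f) \<bullet>\<^bsub>C\<^esub> \<tau> (Dom J f)" if f: "f \<in> Arr J" for f
        using f d(3)[OF f, symmetric] by (simp add: D t.natural_Arr)
    qed (simp add: hom_iff)
    then obtain h where h: "h \<in> hom C c d" "\<forall>j \<in> Obj J. h \<bullet>\<^bsub>C\<^esub> \<iota> j = \<kappa> j \<bullet>\<^bsub>C\<^esub> \<tau> j" by blast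
    show "\<exists>!h. h \<in> hom C c d \<and> (\<forall>j\<in>Obj J. h \<bullet>\<^bsub>C\<^esub> (\<iota> j \<bullet>\<^bsub>C\<^esub> inv_arr C (\<tau> j)) = \<kappa> j)"
    proof (rule ex1I[of _ h])
      have "h \<bullet>\<^bsub>C\<^esub> (\<iota> j \<bullet>\<^bsub>C\<^esub> inv_arr C (\<tau> j)) = \<kappa> j" if j: "j \<in> Obj J" for j
      proof -
        have "h \<bullet>\<^bsub>C\<^esub> (\<iota> j \<bullet>\<^bsub>C\<^esub> inv_arr C (\<tau> j)) = (h \<bullet>\<^bsub>C\<^esub> \<iota> j) \<bullet>\<^bsub>C\<^esub> inv_arr C (\<tau> j)"
          using h(1) j iso[OF j] by (simp add: hom_iff D)
        then show ?thesis using h(2) j iso[OF j] by (simp add: D)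
      qed
      then show "h \<in> hom C c d \<and> (\<forall>j\<in>Obj J. h \<bullet>\<^bsub>C\<^esub> (\<iota> j \<bullet>\<^bsub>C\<^esub> inv_arr C (\<tau> j)) = \<kappa> j)"
        using h(1) by blast
      fix l assume l: "l \<in> hom C c d \<and> (\<forall>j\<in>Obj J. l \<bullet>\<^bsub>C\<^esub> (\<iota> j \<bullet>\<^bsub>C\<^esub> inv_arr C (\<tau> j)) = \<kappa> j)"
      show "l = h"
      proof (rule is_colimit_ext[OF t.F.cat_functor_axioms c _ h(1)])
        fix j assume j: "j \<in> Obj J"
        have lt: "l \<in> Arr C" "Dom C l = c" using l by (auto simp: hom_iff)
        have "(l \<bullet>\<^bsub>C\<^esub> (\<iota> j \<bullet>\<^bsub>C\<^esub> inv_arr C (\<tau> j))) \<bullet>\<^bsub>C\<^esub> \<tau> j = \<kappa> j \<bullet>\<^bsub>C\<^esub> \<tau> j" using l j by simp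
        then show "l \<bullet>\<^bsub>C\<^esub> \<iota> j = h \<bullet>\<^bsub>C\<^esub> \<iota> j" using lt j iso[OF j] h(2) by (simp add: D)
      qed (use l in blast)
    qed
  qed
qed

text \<open>These index the summands of the Kan extension at \<open>T\<close>. By unique
  factorisation they are the terminal objects of the connected components of the comma category of
  \<open>Nec_incl\<close> over \<open>T\<close>.\<close>

definition injs :: "necklace \<Rightarrow> (necklace \<times> (nat \<Rightarrow> nat)) set" where
  "injs T = {(Z, u). (Z, u, T) \<in> Arr Nec \<and> inj_on u {0..snd Z}}"

locale kan_along_active =
  C: category C + Nm: category Nec_minus + N: category Nec
  for C :: "('o, 'a, 'm) category_scheme" (structure)
    and D' :: "(necklace, necklace \<times> (nat \<Rightarrow> nat) \<times> necklace, 'o, 'a) func"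
    and E :: "(necklace, necklace \<times> (nat \<Rightarrow> nat) \<times> necklace, 'o, 'a) func"
    and \<alpha> and U :: "'u itself" +
  assumes infinite: "infinite (UNIV :: 'u set)" and cocomplete: "cocomplete U C"
    and kan: "is_left_kan_extension Nec_minus Nec C Nec_incl D' E \<alpha>"
begin

sublocale I: cat_functor Nec_minus Nec Nec_incl
  using kan unfolding is_left_kan_extension_def by blast

sublocale E: cat_functor Nec C E
  using kan unfolding is_left_kan_extension_def by blast

sublocale a: nat_trans Nec_minus C D' "func_comp E Nec_incl" \<alpha>
  using kan unfolding is_left_kan_extension_def by blast

lemma D'_Obj [simp]: "is_necklace Z \<Longrightarrow> FOb D' Z \<in> Obj C"
  using a.F.FOb_Obj[of Z] by simp

lemma D'_Arr [simp]:
  assumes "(Z, e, Z') \<in> Arr Nec_minus"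
  shows "FAr D' (Z, e, Z') \<in> Arr C" "Dom C (FAr D' (Z, e, Z')) = FOb D' Z" "Cod C (FAr D' (Z, e, Z')) =
    FOb D' Z'"
  using a.F.FAr_closed[OF assms] by simp_all

lemma E_Arr [simp]:
  assumes "(Z, e, Z') \<in> Arr Nec"
  shows "FAr E (Z, e, Z') \<in> Arr C" "Dom C (FAr E (Z, e, Z')) = FOb E Z" "Cod C (FAr E (Z, e, Z')) =
    FOb E Z'"
  using E.FAr_closed[OF assms] by simp_all

lemma alpha [simp]:
  assumes "is_necklace Z"
  shows "\<alpha> Z \<in> Arr C" "Dom C (\<alpha> Z) = FOb D' Z" "Cod C (\<alpha> Z) = FOb E Z"
  using a.component_closed[of Z] assms by simp_all

lemma alpha_natural: "(Z, e, Z') \<in> Arr Nec_minus \<Longrightarrow> FAr E (Z, e, Z') \<bullet> \<alpha> Z = \<alpha> Z' \<bullet> FAr D' (Z, e, Z')"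
  using a.natural_Arr[of "(Z, e, Z')"] by simp

abbreviation ident :: "necklace \<Rightarrow> nat \<Rightarrow> nat" where
  "ident Z \<equiv> \<lambda>i \<in> {0..snd Z}. i"

lemma ident_Arr [simp]: "is_necklace Z \<Longrightarrow> (Z, ident Z, Z) \<in> Arr Nec" "is_necklace Z \<Longrightarrow>
  (Z, ident Z, Z) \<in> Arr Nec_minus"
  using N.Idt_closed(1)[of Z] Nm.Idt_closed(1)[of Z] by simp_all

lemma ident_injs [simp]: "is_necklace Z \<Longrightarrow> (Z, ident Z) \<in> injs Z"
  by (simp add: injs_def inj_on_def)

lemma D'_ident [simp]: "is_necklace Z \<Longrightarrow> FAr D' (Z, ident Z, Z) = Idt C (FOb D' Z)"
  using a.F.FAr_Idt[of Z] by simp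

lemma E_ident [simp]: "is_necklace Z \<Longrightarrow> FAr E (Z, ident Z, Z) = Idt C (FOb E Z)"
  using E.FAr_Idt[of Z] by simp

section \<open>The coproduct over injective maps, made into a functor\<close>

definition Lan :: "necklace \<Rightarrow> 'o" where
  "Lan T = coproduct_obj C (injs T) (\<lambda>(Z, u). FOb D' Z)"

definition lan_inj :: "necklace \<Rightarrow> necklace \<times> (nat \<Rightarrow> nat) \<Rightarrow> 'a" where
  "lan_inj T = (SOME \<iota>. is_coproduct C (injs T) (\<lambda>(Z, u). FOb D' Z) (Lan T) \<iota>)"

lemma Lan_coproduct: "is_coproduct C (injs T) (\<lambda>(Z, u). FOb D' Z) (Lan T) (lan_inj T)"
proof -
  have "small U (injs T)"
    by (rule small_inj[OF small_Arr_Nec[OF infinite, of U], of "\<lambda>(Z, u). (Z, u, T)"])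
      (auto simp: injs_def inj_on_def)
  then have "\<exists>\<iota>. is_coproduct C (injs T) (\<lambda>(Z, u). FOb D' Z) (Lan T) \<iota>"
    unfolding Lan_def by (rule coproduct_obj[OF C.category_axioms cocomplete])
      (auto simp: injs_def dest: Arr_NecD(1))
  then show ?thesis unfolding lan_inj_def by (rule someI_ex)
qed

lemma Lan_Obj [simp]: "Lan T \<in> Obj C"
  by (rule C.is_coproduct_hom(1)[OF Lan_coproduct])

lemma lan_inj_closed [simp]:
  assumes "(Z, u) \<in> injs T"
  shows "lan_inj T (Z, u) \<in> Arr C" "Dom C (lan_inj T (Z, u)) = FOb D' Z" "Cod C (lan_inj T (Z, u)) =
    Lan T"
  using C.is_coproduct_hom(2)[OF Lan_coproduct assms] by (auto simp: hom_iff)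

lemma injsD:
  assumes "(Z, u) \<in> injs T"
  shows "(Z, u, T) \<in> Arr Nec" "is_necklace Z" "is_necklace T" "inj_on u {0..snd Z}"
  using assms by (auto simp: injs_def dest: Arr_NecD)

lemma injs_factor:
  assumes g: "(T, g, T') \<in> Arr Nec" and u: "(Z, u) \<in> injs T"
  obtains Z' e u' where "(Z, e, Z') \<in> Arr Nec_minus" "(Z', u') \<in> injs T'"
    "(T, g, T') \<bullet>\<^bsub>Nec\<^esub> (Z, u, T) = (Z', u', T') \<bullet>\<^bsub>Nec\<^esub> (Z, e, Z')"
proof -
  have "(T, g, T') \<bullet>\<^bsub>Nec\<^esub> (Z, u, T) \<in> Arr Nec" using N.Cmp_closed(1)[OF injsD(1)[OF u] g] by simp
  then have c: "(Z, compose {0..snd Z} g u, T') \<in> Arr Nec" by simp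
  obtain Z' e u' where f: "(Z, e, Z') \<in> Arr Nec_minus" "(Z', u', T') \<in> Arr Nec" "inj_on u' {0..snd Z'}"
    "(Z, compose {0..snd Z} g u, T') = (Z', u', T') \<bullet>\<^bsub>Nec\<^esub> (Z, e, Z')"
    using Nec_factor[OF c] by blast
  show thesis
    by (rule that[OF f(1)]) (use f in \<open>simp_all add: injs_def\<close>)
qed

lemma Lan_map_exists:
  assumes g: "(T, g, T') \<in> Arr Nec"
  shows "\<exists>h. h \<in> hom C (Lan T) (Lan T') \<and>
    (\<forall>Z u Z' e u'. (Z, u) \<in> injs T \<longrightarrow> (Z, e, Z') \<in> Arr Nec_minus \<longrightarrow> (Z', u') \<in> injs T' \<longrightarrow>
      (T, g, T') \<bullet>\<^bsub>Nec\<^esub> (Z, u, T) = (Z', u', T') \<bullet>\<^bsub>Nec\<^esub> (Z, e, Z') \<longrightarrow>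
      h \<bullet> lan_inj T (Z, u) = lan_inj T' (Z', u') \<bullet> FAr D' (Z, e, Z'))"
proof -
  have "\<forall>p \<in> injs T. \<exists>k. \<forall>Z' e u'. (fst p, e, Z') \<in> Arr Nec_minus \<longrightarrow> (Z', u') \<in> injs T' \<longrightarrow>
      (T, g, T') \<bullet>\<^bsub>Nec\<^esub> (fst p, snd p, T) = (Z', u', T') \<bullet>\<^bsub>Nec\<^esub> (fst p, e, Z') \<longrightarrow>
      k = lan_inj T' (Z', u') \<bullet> FAr D' (fst p, e, Z')"
  proof
    fix p assume "p \<in> injs T"
    then obtain Z u where p: "p = (Z, u)" "(Z, u) \<in> injs T" by (cases p) auto
    obtain Z' e u' where f: "(Z, e, Z') \<in> Arr Nec_minus" "(Z', u') \<in> injs T'"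
      "(T, g, T') \<bullet>\<^bsub>Nec\<^esub> (Z, u, T) = (Z', u', T') \<bullet>\<^bsub>Nec\<^esub> (Z, e, Z')" by (rule injs_factor[OF g p(2)])
    show "\<exists>k. \<forall>Z' e u'. (fst p, e, Z') \<in> Arr Nec_minus \<longrightarrow> (Z', u') \<in> injs T' \<longrightarrow>
      (T, g, T') \<bullet>\<^bsub>Nec\<^esub> (fst p, snd p, T) = (Z', u', T') \<bullet>\<^bsub>Nec\<^esub> (fst p, e, Z') \<longrightarrow>
      k = lan_inj T' (Z', u') \<bullet> FAr D' (fst p, e, Z')"
    proof (intro exI[of _ "lan_inj T' (Z', u') \<bullet> FAr D' (Z, e, Z')"] allI impI)
      fix Y e' v assume A: "(fst p, e', Y) \<in> Arr Nec_minus" "(Y, v) \<in> injs T'"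
        "(T, g, T') \<bullet>\<^bsub>Nec\<^esub> (fst p, snd p, T) = (Y, v, T') \<bullet>\<^bsub>Nec\<^esub> (fst p, e', Y)"
      have A': "(Z, e', Y) \<in> Arr Nec_minus" "(Z', u', T') \<bullet>\<^bsub>Nec\<^esub> (Z, e, Z') =
        (Y, v, T') \<bullet>\<^bsub>Nec\<^esub> (Z, e', Y)"
        using A f(3) p(1) by (simp_all del: Nec_sel)
      have "Z' = Y" "e = e'" "u' = v"
        by (rule Nec_factor_unique[OF f(1) injsD(1,4)[OF f(2)] A'(1) injsD(1,4)[OF A(2)] A'(2)])+
      then show "lan_inj T' (Z', u') \<bullet> FAr D' (Z, e, Z') = lan_inj T' (Y, v) \<bullet> FAr D' (fst p, e', Y)"
        using p(1) by simp
    qed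
  qed
  then obtain k where k: "\<And>Z u Z' e u'. (Z, u) \<in> injs T \<Longrightarrow> (Z, e, Z') \<in> Arr Nec_minus \<Longrightarrow>
    (Z', u') \<in> injs T' \<Longrightarrow>
      (T, g, T') \<bullet>\<^bsub>Nec\<^esub> (Z, u, T) = (Z', u', T') \<bullet>\<^bsub>Nec\<^esub> (Z, e, Z') \<Longrightarrow>
      k (Z, u) = lan_inj T' (Z', u') \<bullet> FAr D' (Z, e, Z')"
    unfolding bchoice_iff by (metis fst_conv snd_conv)
  have "\<exists>h. h \<in> hom C (Lan T) (Lan T') \<and> (\<forall>p \<in> injs T. h \<bullet> lan_inj T p = k p)"
  proof (rule C.is_coproduct_factor[OF Lan_coproduct])
    fix p assume "p \<in> injs T"
    then obtain Z u where p: "p = (Z, u)" "(Z, u) \<in> injs T" by (cases p) auto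
    obtain Z' e u' where f: "(Z, e, Z') \<in> Arr Nec_minus" "(Z', u') \<in> injs T'"
      "(T, g, T') \<bullet>\<^bsub>Nec\<^esub> (Z, u, T) = (Z', u', T') \<bullet>\<^bsub>Nec\<^esub> (Z, e, Z')" by (rule injs_factor[OF g p(2)])
    show "k p \<in> hom C (case p of (Z, u) \<Rightarrow> FOb D' Z) (Lan T')"
      using k[OF p(2) f] p(1) f(1,2) by (simp add: hom_iff)
  qed simp
  then obtain h where h: "h \<in> hom C (Lan T) (Lan T')" "\<forall>p \<in> injs T. h \<bullet> lan_inj T p = k p" by blast
  then show ?thesis using k by (intro exI[of _ h] conjI) auto
qed

definition Lan_map :: "necklace \<times> (nat \<Rightarrow> nat) \<times> necklace \<Rightarrow> 'a" where
  "Lan_map g = (SOME h. h \<in> hom C (Lan (Dom Nec g)) (Lan (Cod Nec g)) \<and>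
    (\<forall>Z u Z' e u'. (Z, u) \<in> injs (Dom Nec g) \<longrightarrow> (Z, e, Z') \<in> Arr Nec_minus \<longrightarrow>
      (Z', u') \<in> injs (Cod Nec g) \<longrightarrow>
      g \<bullet>\<^bsub>Nec\<^esub> (Z, u, Dom Nec g) = (Z', u', Cod Nec g) \<bullet>\<^bsub>Nec\<^esub> (Z, e, Z') \<longrightarrow>
      h \<bullet> lan_inj (Dom Nec g) (Z, u) = lan_inj (Cod Nec g) (Z', u') \<bullet> FAr D' (Z, e, Z')))"

lemma Lan_map:
  assumes g: "(T, g, T') \<in> Arr Nec"
  shows "Lan_map (T, g, T') \<in> hom C (Lan T) (Lan T')"
    "(Z, u) \<in> injs T \<Longrightarrow> (Z, e, Z') \<in> Arr Nec_minus \<Longrightarrow> (Z', u') \<in> injs T' \<Longrightarrow>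
      (T, g, T') \<bullet>\<^bsub>Nec\<^esub> (Z, u, T) = (Z', u', T') \<bullet>\<^bsub>Nec\<^esub> (Z, e, Z') \<Longrightarrow>
      Lan_map (T, g, T') \<bullet> lan_inj T (Z, u) = lan_inj T' (Z', u') \<bullet> FAr D' (Z, e, Z')"
proof -
  have "Dom Nec (T, g, T') = T" "Cod Nec (T, g, T') = T'" by simp_all
  note M = someI_ex[OF Lan_map_exists[OF g], folded Lan_map_def[of "(T, g, T')", unfolded this]]
  show "Lan_map (T, g, T') \<in> hom C (Lan T) (Lan T')" using M by blast
  show "(Z, u) \<in> injs T \<Longrightarrow> (Z, e, Z') \<in> Arr Nec_minus \<Longrightarrow> (Z', u') \<in> injs T' \<Longrightarrow>
      (T, g, T') \<bullet>\<^bsub>Nec\<^esub> (Z, u, T) = (Z', u', T') \<bullet>\<^bsub>Nec\<^esub> (Z, e, Z') \<Longrightarrow>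
      Lan_map (T, g, T') \<bullet> lan_inj T (Z, u) = lan_inj T' (Z', u') \<bullet> FAr D' (Z, e, Z')" using M by blast
qed

lemma Lan_map_closed [simp]:
  assumes "(T, g, T') \<in> Arr Nec"
  shows "Lan_map (T, g, T') \<in> Arr C" "Dom C (Lan_map (T, g, T')) = Lan T" "Cod C (Lan_map (T, g, T')) =
    Lan T'"
  using Lan_map(1)[OF assms] by (auto simp: hom_iff)

lemma Lan_ext:
  assumes "h \<in> hom C (Lan T) d" "h' \<in> hom C (Lan T) d"
    and "\<And>Z u. (Z, u) \<in> injs T \<Longrightarrow> h \<bullet> lan_inj T (Z, u) = h' \<bullet> lan_inj T (Z, u)"
  shows "h = h'"
  by (rule C.is_coproduct_ext[OF Lan_coproduct assms(1,2)]) (use assms(3) in auto)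

definition LanF :: "(necklace, necklace \<times> (nat \<Rightarrow> nat) \<times> necklace, 'o, 'a) func" where
  "LanF = \<lparr>FOb = Lan, FAr = Lan_map\<rparr>"

lemma LanF_sel [simp]: "FOb LanF T = Lan T" "FAr LanF g = Lan_map g"
  by (simp_all add: LanF_def)

lemma LanF_functor: "cat_functor Nec C LanF"
proof
  fix T assume "T \<in> Obj Nec"
  then have T: "is_necklace T" by simp
  show "FOb LanF T \<in> Obj C" by simp
  have "Lan_map (T, ident T, T) = Idt C (Lan T)"
  proof (rule Lan_ext)
    fix Z u assume u: "(Z, u) \<in> injs T"
    note uD = injsD[OF u]
    have "(T, ident T, T) \<bullet>\<^bsub>Nec\<^esub> (Z, u, T) = (Z, u, T) \<bullet>\<^bsub>Nec\<^esub> (Z, ident Z, Z)"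
      using N.Idt_Cmp[OF uD(1)] N.Cmp_Idt[OF uD(1)] by simp
    from Lan_map(2)[OF ident_Arr(1)[OF T] u ident_Arr(2)[OF uD(2)] u this]
    show "Lan_map (T, ident T, T) \<bullet> lan_inj T (Z, u) = Idt C (Lan T) \<bullet> lan_inj T (Z, u)"
      using u uD by simp
  qed (use T Lan_map(1) in \<open>auto simp: hom_iff\<close>)
  then show "FAr LanF (Idt Nec T) = Idt C (FOb LanF T)" by simp
next
  fix f x y assume "f \<in> hom Nec x y"
  then show "FAr LanF f \<in> hom C (FOb LanF x) (FOb LanF y)"
    using Lan_map(1) by (cases f rule: prod_cases3) (auto simp: hom_iff)
next
  fix f g x y z assume "f \<in> hom Nec x y" "g \<in> hom Nec y z"
  then obtain f' g' where f: "f = (x, f', y)" "(x, f', y) \<in> Arr Nec" and g: "g =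
    (y, g', z)" "(y, g', z) \<in> Arr Nec"
    by (cases f rule: prod_cases3; cases g rule: prod_cases3) (auto simp: hom_iff)
  have gf: "(x, compose {0..snd x} g' f', z) \<in> Arr Nec" using N.Cmp_closed(1)[OF f(2) g(2)] by simp
  have "Lan_map (x, compose {0..snd x} g' f', z) = Lan_map (y, g', z) \<bullet> Lan_map (x, f', y)"
  proof (rule Lan_ext)
    fix Z u assume u: "(Z, u) \<in> injs x"
    note uD = injsD[OF u]
    obtain Z1 e1 u1 where 1: "(Z, e1, Z1) \<in> Arr Nec_minus" "(Z1, u1) \<in> injs y"
      "(x, f', y) \<bullet>\<^bsub>Nec\<^esub> (Z, u, x) = (Z1, u1, y) \<bullet>\<^bsub>Nec\<^esub> (Z, e1, Z1)" by (rule injs_factor[OF f(2) u])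
    obtain Z2 e2 u2 where 2: "(Z1, e2, Z2) \<in> Arr Nec_minus" "(Z2, u2) \<in> injs z"
      "(y, g', z) \<bullet>\<^bsub>Nec\<^esub> (Z1, u1, y) = (Z2, u2, z) \<bullet>\<^bsub>Nec\<^esub> (Z1, e2, Z2)"
       by (rule injs_factor[OF g(2) 1(2)])
    note [simp] = 1(1) 2(1) u 1(2) 2(2) f(2) g(2)
    have e: "(Z, compose {0..snd Z} e2 e1, Z2) \<in> Arr Nec_minus"
      "FAr D' (Z, compose {0..snd Z} e2 e1, Z2) = FAr D' (Z1, e2, Z2) \<bullet> FAr D' (Z, e1, Z1)"
      using Nm.Cmp_closed(1)[OF 1(1) 2(1)] a.F.FAr_Cmp_Arr[OF 1(1) 2(1)] by simp_all
    have nm: "(Z, e1, Z1) \<in> Arr Nec" "(Z1, e2, Z2) \<in> Arr Nec" using 1 2 by simp_all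
    have "(x, compose {0..snd x} g' f', z) \<bullet>\<^bsub>Nec\<^esub> (Z, u, x) =
      ((y, g', z) \<bullet>\<^bsub>Nec\<^esub> (x, f', y)) \<bullet>\<^bsub>Nec\<^esub> (Z, u, x)"
      by simp
    also have "\<dots> = (y, g', z) \<bullet>\<^bsub>Nec\<^esub> ((x, f', y) \<bullet>\<^bsub>Nec\<^esub> (Z, u, x))"
      by (rule N.assoc) (use uD in simp_all)
    also have "\<dots> = ((y, g', z) \<bullet>\<^bsub>Nec\<^esub> (Z1, u1, y)) \<bullet>\<^bsub>Nec\<^esub> (Z, e1, Z1)"
      unfolding 1(3) by (rule N.assoc[symmetric]) (use nm injsD[OF 1(2)] in simp_all)
    also have "\<dots> = (Z2, u2, z) \<bullet>\<^bsub>Nec\<^esub> ((Z1, e2, Z2) \<bullet>\<^bsub>Nec\<^esub> (Z, e1, Z1))"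
      unfolding 2(3) by (rule N.assoc) (use nm injsD[OF 2(2)] in simp_all)
    also have "(Z1, e2, Z2) \<bullet>\<^bsub>Nec\<^esub> (Z, e1, Z1) = (Z, compose {0..snd Z} e2 e1, Z2)" by simp
    finally have "Lan_map (x, compose {0..snd x} g' f', z) \<bullet> lan_inj x (Z, u) =
      lan_inj z (Z2, u2) \<bullet> FAr D' (Z, compose {0..snd Z} e2 e1, Z2)"
      by (rule Lan_map(2)[OF gf u e(1) 2(2)])
    also have "\<dots> = (Lan_map (y, g', z) \<bullet> lan_inj y (Z1, u1)) \<bullet> FAr D' (Z, e1, Z1)"
      unfolding Lan_map(2)[OF g(2) 1(2) 2(1) 2(2) 2(3)] e(2) by (simp add: C.assoc)
    also have "\<dots> = (Lan_map (y, g', z) \<bullet> Lan_map (x, f', y)) \<bullet> lan_inj x (Z, u)"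
      using Lan_map(2)[OF f(2) u 1(1) 1(2) 1(3)] by (simp add: C.assoc)
    finally show "Lan_map (x, compose {0..snd x} g' f', z) \<bullet> lan_inj x (Z, u) =
      (Lan_map (y, g', z) \<bullet> Lan_map (x, f', y)) \<bullet> lan_inj x (Z, u)" .
  qed (use gf f g in \<open>auto simp: hom_iff\<close>)
  then show "FAr LanF (g \<bullet>\<^bsub>Nec\<^esub> f) = FAr LanF g \<bullet> FAr LanF f" using f g by simp
qed

lemma lan_unit_natural: "nat_trans Nec_minus C D' (func_comp LanF Nec_incl) (\<lambda>Z. lan_inj Z (Z, ident
  Z))"
proof -
  interpret LI: cat_functor Nec_minus C "func_comp LanF Nec_incl"
    by (rule cat_functor_comp[OF I.cat_functor_axioms LanF_functor])
  show ?thesis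
  proof
    fix Z assume "Z \<in> Obj Nec_minus"
    then show "lan_inj Z (Z, ident Z) \<in> hom C (FOb D' Z) (FOb (func_comp LanF Nec_incl) Z)"
      by (simp add: hom_iff)
  next
    fix f x y assume "f \<in> hom Nec_minus x y"
    then obtain e where f: "f = (x, e, y)" "(x, e, y) \<in> Arr Nec_minus"
      by (cases f rule: prod_cases3) (auto simp: hom_iff)
    have e: "(x, e, y) \<in> Arr Nec" using f by simp
    note eD = Arr_NecD(1,2)[OF e]
    have "(x, e, y) \<bullet>\<^bsub>Nec\<^esub> (x, ident x, x) = (y, ident y, y) \<bullet>\<^bsub>Nec\<^esub> (x, e, y)"
      using N.Idt_Cmp[OF e] N.Cmp_Idt[OF e] by simp
    from Lan_map(2)[OF e ident_injs[OF eD(1)] f(2) ident_injs[OF eD(2)] this]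
    show "lan_inj y (y, ident y) \<bullet> FAr D' f = FAr (func_comp LanF Nec_incl) f \<bullet> lan_inj x (x, ident x)"
      using f(1) by simp
  qed
qed

text \<open>The universal property of \<open>E\<close> gives \<gamma> from \<open>E\<close> to
  \<open>LanF\<close>, and the coproducts give \<delta> back. On \<open>LanF\<close> the round trip
  is the identity by testing on summands. On \<open>E\<close> it is a natural endomorphism
  compatible with \<alpha>, hence the identity by the uniqueness clause of the Kan
  extension.\<close>

theorem kan_coproduct:
  assumes T: "is_necklace T"
  shows "is_coproduct C (injs T) (\<lambda>(Z, u). FOb D' Z) (FOb E T) (\<lambda>(Z, u). FAr E (Z, u, T) \<bullet> \<alpha> Z)"
proof -
  have univ: "\<exists>!\<gamma>. \<gamma> \<in> extensional (Obj Nec) \<and> nat_trans Nec C E G \<gamma> \<and> (\<forall>x \<in> Obj Nec_minus. \<beta> x =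
    \<gamma> (FOb Nec_incl x) \<bullet> \<alpha> x)"
    if "cat_functor Nec C G" "nat_trans Nec_minus C D' (func_comp G Nec_incl) \<beta>" for G \<beta>
    using kan that unfolding is_left_kan_extension_def by blast
  obtain \<gamma> where \<gamma>: "nat_trans Nec C E LanF \<gamma>" "\<And>Z. is_necklace Z \<Longrightarrow> lan_inj Z (Z, ident Z) = \<gamma> Z \<bullet> \<alpha> Z"
    using univ[OF LanF_functor lan_unit_natural] by auto
  interpret g: nat_trans Nec C E LanF \<gamma> by (rule \<gamma>(1))
  have gc [simp]: "\<gamma> Z \<in> Arr C" "Dom C (\<gamma> Z) = FOb E Z" "Cod C (\<gamma> Z) = Lan Z" if "is_necklace Z" for Z
    using g.component_closed[of Z] that by simp_all
  have "\<forall>T. is_necklace T \<longrightarrow> (\<exists>h. h \<in> hom C (Lan T) (FOb E T) \<and> (\<forall>p \<in> injs T. h \<bullet> lan_inj T p =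
    (case p of (Z, u) \<Rightarrow> FAr E (Z, u, T) \<bullet> \<alpha> Z)))"
  proof (intro allI impI)
    fix T assume T: "is_necklace T"
    show "\<exists>h. h \<in> hom C (Lan T) (FOb E T) \<and> (\<forall>p \<in> injs T. h \<bullet> lan_inj T p =
      (case p of (Z, u) \<Rightarrow> FAr E (Z, u, T) \<bullet> \<alpha> Z))"
    proof (rule C.is_coproduct_factor[OF Lan_coproduct])
      show "FOb E T \<in> Obj C" using E.FOb_Obj[of T] T by simp
      fix p assume "p \<in> injs T"
      then obtain Z u where p: "p = (Z, u)" "(Z, u) \<in> injs T" by (cases p) auto
      show "(case p of (Z, u) \<Rightarrow> FAr E (Z, u, T) \<bullet> \<alpha> Z) \<in> hom C (case p of (Z, u) \<Rightarrow> FOb D' Z) (FOb E T)"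
        using injsD(1,2)[OF p(2)] p(1) by (simp add: hom_iff)
    qed
  qed
  then obtain \<delta> where \<delta>: "\<And>T. is_necklace T \<Longrightarrow> \<delta> T \<in> hom C (Lan T) (FOb E T)"
    "\<And>T Z u. is_necklace T \<Longrightarrow> (Z, u) \<in> injs T \<Longrightarrow> \<delta> T \<bullet> lan_inj T (Z, u) = FAr E (Z, u, T) \<bullet> \<alpha> Z"
    by (metis (mono_tags, lifting) case_prod_conv)
  have dc [simp]: "\<delta> Z \<in> Arr C" "Dom C (\<delta> Z) = Lan Z" "Cod C (\<delta> Z) = FOb E Z" if "is_necklace Z" for Z
    using \<delta>(1)[OF that] by (auto simp: hom_iff)
  have gd: "\<gamma> T \<bullet> \<delta> T = Idt C (Lan T)" if T: "is_necklace T" for T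
  proof (rule Lan_ext)
    fix Z u assume u: "(Z, u) \<in> injs T"
    note uD = injsD[OF u]
    have "(\<gamma> T \<bullet> \<delta> T) \<bullet> lan_inj T (Z, u) = (\<gamma> T \<bullet> FAr E (Z, u, T)) \<bullet> \<alpha> Z"
      using T u uD \<delta>(2)[OF T u] by (simp add: C.assoc)
    also have "\<gamma> T \<bullet> FAr E (Z, u, T) = Lan_map (Z, u, T) \<bullet> \<gamma> Z" using g.natural_Arr[OF uD(1)] by simp
    also have "(Lan_map (Z, u, T) \<bullet> \<gamma> Z) \<bullet> \<alpha> Z = Lan_map (Z, u, T) \<bullet> lan_inj Z (Z, ident Z)"
      using uD \<gamma>(2)[OF uD(2)] by (simp add: C.assoc)
    also have "\<dots> = lan_inj T (Z, u) \<bullet> FAr D' (Z, ident Z, Z)"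
      by (rule Lan_map(2)[OF uD(1) ident_injs[OF uD(2)] ident_Arr(2)[OF uD(2)] u refl])
    also have "\<dots> = lan_inj T (Z, u)" using u uD by simp
    finally show "(\<gamma> T \<bullet> \<delta> T) \<bullet> lan_inj T (Z, u) = Idt C (Lan T) \<bullet> lan_inj T (Z, u)" using u by simp
  qed (use T in \<open>auto simp: hom_iff\<close>)
  \<comment> \<open>On the summand at \<open>u\<close>, both sides are \<alpha> followed by
    \<open>E\<close> of one and the same necklace map, factored in two ways.\<close>
  have dn: "\<delta> T' \<bullet> Lan_map (T, g, T') = FAr E (T, g, T') \<bullet> \<delta> T" if g: "(T, g, T') \<in> Arr Nec" for T g T'
  proof (rule Lan_ext)
    note T = Arr_NecD(1,2)[OF g]
    note [simp] = T g
    fix Z u assume u: "(Z, u) \<in> injs T"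
    note uD = injsD[OF u]
    obtain Z' e u' where f: "(Z, e, Z') \<in> Arr Nec_minus" "(Z', u') \<in> injs T'"
      "(T, g, T') \<bullet>\<^bsub>Nec\<^esub> (Z, u, T) = (Z', u', T') \<bullet>\<^bsub>Nec\<^esub> (Z, e, Z')" by (rule injs_factor[OF g u])
    note u'D = injsD[OF f(2)]
    have e: "(Z, e, Z') \<in> Arr Nec" using f by simp
    note [simp] = uD(1,2) u'D(1,2) e f(1,2) u
    have "FAr E ((T, g, T') \<bullet>\<^bsub>Nec\<^esub> (Z, u, T)) = FAr E (T, g, T') \<bullet> FAr E (Z, u, T)"
      by (rule E.FAr_Cmp_Arr) simp_all
    moreover have "FAr E ((Z', u', T') \<bullet>\<^bsub>Nec\<^esub> (Z, e, Z')) = FAr E (Z', u', T') \<bullet> FAr E (Z, e, Z')"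
      by (rule E.FAr_Cmp_Arr) simp_all
    ultimately have Eg: "FAr E (T, g, T') \<bullet> FAr E (Z, u, T) = FAr E (Z', u', T') \<bullet> FAr E (Z, e, Z')"
      using f(3) by metis
    have "(\<delta> T' \<bullet> Lan_map (T, g, T')) \<bullet> lan_inj T (Z, u) =
      (\<delta> T' \<bullet> lan_inj T' (Z', u')) \<bullet> FAr D' (Z, e, Z')"
      using Lan_map(2)[OF g u f] by (simp add: C.assoc)
    also have "\<dots> = (FAr E (Z', u', T') \<bullet> FAr E (Z, e, Z')) \<bullet> \<alpha> Z"
      using \<delta>(2)[OF T(2) f(2)] alpha_natural[OF f(1)] by (simp add: C.assoc)
    also have "\<dots> = (FAr E (T, g, T') \<bullet> \<delta> T) \<bullet> lan_inj T (Z, u)"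
      unfolding Eg[symmetric] using \<delta>(2)[OF T(1) u] by (simp add: C.assoc)
    finally show "(\<delta> T' \<bullet> Lan_map (T, g, T')) \<bullet> lan_inj T (Z, u) =
      (FAr E (T, g, T') \<bullet> \<delta> T) \<bullet> lan_inj T (Z, u)" .
  qed (use g Arr_NecD(1,2)[OF g] in \<open>auto simp: hom_iff\<close>)
  \<comment> \<open>The restriction to the objects is the normal form in which uniqueness is stated
    for Kan extensions.\<close>
  have n1: "nat_trans Nec C E E (restrict (\<lambda>T. \<delta> T \<bullet> \<gamma> T) (Obj Nec))"
  proof
    fix T assume "T \<in> Obj Nec"
    then show "restrict (\<lambda>T. \<delta> T \<bullet> \<gamma> T) (Obj Nec) T \<in> hom C (FOb E T) (FOb E T)" by (simp add: hom_iff)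
  next
    fix f x y assume "f \<in> hom Nec x y"
    then obtain g where f: "f = (x, g, y)" "(x, g, y) \<in> Arr Nec"
      by (cases f rule: prod_cases3) (auto simp: hom_iff)
    note xy [simp] = Arr_NecD(1,2)[OF f(2)] f(2)
    have "(\<delta> y \<bullet> \<gamma> y) \<bullet> FAr E (x, g, y) = (\<delta> y \<bullet> Lan_map (x, g, y)) \<bullet> \<gamma> x"
      using g.natural_Arr[OF f(2)] by (simp add: C.assoc)
    also have "\<dots> = FAr E (x, g, y) \<bullet> (\<delta> x \<bullet> \<gamma> x)" unfolding dn[OF f(2)] by (simp add: C.assoc)
    finally show "restrict (\<lambda>T. \<delta> T \<bullet> \<gamma> T) (Obj Nec) y \<bullet> FAr E f =
      FAr E f \<bullet> restrict (\<lambda>T. \<delta> T \<bullet> \<gamma> T) (Obj Nec) x"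
      using f(1) by simp
  qed
  have n2: "nat_trans Nec C E E (restrict (\<lambda>T. Idt C (FOb E T)) (Obj Nec))"
  proof
    fix T assume "T \<in> Obj Nec"
    then show "restrict (\<lambda>T. Idt C (FOb E T)) (Obj Nec) T \<in> hom C (FOb E T) (FOb E T)"
      using E.FOb_Obj[of T] by (simp add: hom_iff)
  next
    fix f x y assume "f \<in> hom Nec x y"
    then obtain g where f: "f = (x, g, y)" "(x, g, y) \<in> Arr Nec"
      by (cases f rule: prod_cases3) (auto simp: hom_iff)
    note xy [simp] = Arr_NecD(1,2)[OF f(2)] f(2)
    show "restrict (\<lambda>T. Idt C (FOb E T)) (Obj Nec) y \<bullet> FAr E f =
      FAr E f \<bullet> restrict (\<lambda>T. Idt C (FOb E T)) (Obj Nec) x"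
      using f(1) by simp
  qed
  have u1: "\<forall>x \<in> Obj Nec_minus. \<alpha> x = restrict (\<lambda>T. \<delta> T \<bullet> \<gamma> T) (Obj Nec) (FOb Nec_incl x) \<bullet> \<alpha> x"
  proof
    fix Z assume "Z \<in> Obj Nec_minus"
    then have Z: "is_necklace Z" by simp
    have "(\<delta> Z \<bullet> \<gamma> Z) \<bullet> \<alpha> Z = \<delta> Z \<bullet> lan_inj Z (Z, ident Z)" using Z \<gamma>(2)[OF Z] by (simp add: C.assoc)
    also have "\<dots> = \<alpha> Z" using \<delta>(2)[OF Z ident_injs[OF Z]] Z by simp
    finally show "\<alpha> Z = restrict (\<lambda>T. \<delta> T \<bullet> \<gamma> T) (Obj Nec) (FOb Nec_incl Z) \<bullet> \<alpha> Z" using Z by simp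
  qed
  have u2: "\<forall>x \<in> Obj Nec_minus. \<alpha> x = restrict (\<lambda>T. Idt C (FOb E T)) (Obj Nec) (FOb Nec_incl x) \<bullet> \<alpha> x"
    by simp
  have "restrict (\<lambda>T. \<delta> T \<bullet> \<gamma> T) (Obj Nec) = restrict (\<lambda>T. Idt C (FOb E T)) (Obj Nec)"
    using univ[OF E.cat_functor_axioms a.nat_trans_axioms] n1 n2 u1 u2 restrict_extensional[of _ "Obj
      Nec"] by blast
  then have dg: "\<delta> T \<bullet> \<gamma> T = Idt C (FOb E T)"
    using T by (metis (mono_tags, lifting) Nec_sel(1) mem_Collect_eq restrict_apply')
  show ?thesis
    by (rule C.is_coproduct_transport[OF Lan_coproduct \<delta>(1)[OF T] _ gd[OF T] dg])
      (use T \<delta>(2)[OF T] in \<open>auto simp: hom_iff\<close>)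
qed


text \<open>
  A cocone under \<open>E\<close> on the necklaces in \<open>K\<close> is determined by its restriction along \<open>\<alpha>\<close> to
  nondegenerate necklaces, because every necklace is the pullback of a unique nondegenerate one
  along an active surjection.
\<close>

theorem nondegenerate_coproduct:
  assumes K: "simplicial_set K" and c: "elts_colimit C E K a b c \<iota>"
  shows "is_coproduct C {(N, y). is_necklace N \<and> y \<in> efams K a b N \<and> nondeg K N y} (\<lambda>(N, y). FOb D' N) c
    (\<lambda>(N, y). \<iota> N y \<bullet> \<alpha> N)"
    (is "is_coproduct C ?S _ _ _")
proof -
  interpret K: simplicial_set K by fact
  note ch = elts_colimit_hom[OF c]
  have i [simp]: "\<iota> N x \<in> Arr C" "Dom C (\<iota> N x) = FOb E N" "Cod C (\<iota> N x) = c"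
    if "is_necklace N" "x \<in> efams K a b N" for N x
    using ch(2)[OF that] by (auto simp: hom_iff)
  \<comment> \<open>On each summand of \<open>E N\<close> the leg at \<open>x\<close> passes through
    the leg at any \<open>y\<close> that has the same pullback along an active surjection. With
    \<open>y\<close> nondegenerate, arrows that agree on the nondegenerate legs agree on all
    legs.\<close>
  have nd_leg: "\<iota> N x \<bullet> (FAr E (Z, u, N) \<bullet> \<alpha> Z) = (\<iota> Y y \<bullet> \<alpha> Y) \<bullet> FAr D' (Z, e, Y)"
    if x: "is_necklace N" "x \<in> efams K a b N" and u: "(Z, u, N) \<in> Arr Nec" and e: "(Z, e, Y) \<in> Arr
      Nec_minus"
      and y: "y \<in> efams K a b Y" and xy: "pull K (Z, u, N) x = pull K (Z, e, Y) y" for N x Z u e Y y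
  proof -
    have e': "(Z, e, Y) \<in> Arr Nec" using e by simp
    note [simp] = x u e e' y Arr_NecD(1,2)[OF u] Arr_NecD(1,2)[OF e']
    have "\<iota> N x \<bullet> (FAr E (Z, u, N) \<bullet> \<alpha> Z) = (\<iota> N x \<bullet> FAr E (Z, u, N)) \<bullet> \<alpha> Z" by (simp add: C.assoc)
    also have "\<dots> = (\<iota> Y y \<bullet> FAr E (Z, e, Y)) \<bullet> \<alpha> Z" using ch(3)[OF u x(2)] ch(3)[OF e' y] xy by simp
    also have "\<dots> = (\<iota> Y y \<bullet> \<alpha> Y) \<bullet> FAr D' (Z, e, Y)" using alpha_natural[OF e] by (simp add: C.assoc)
    finally show ?thesis .
  qed
  have factor: "\<exists>Y e y. (Z, e, Y) \<in> Arr Nec_minus \<and> y \<in> efams K a b Y \<and> nondeg K Y y \<and> x =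
    pull K (Z, e, Y) y"
    if x: "is_necklace Z" "x \<in> efams K a b Z" for Z x
  proof -
    obtain Y e y where "(Z, e, Y) \<in> Arr Nec_minus" "y \<in> fams K Y" "nondeg K Y y" "x =
      pull K (Z, e, Y) y"
      using K.nondeg_factor_exists[OF x(1) efams_fams[OF x(2)]] by blast
    moreover from this have "y \<in> efams K a b Y"
      using K.pull_ends[of Z e Y y] x(2) by (simp add: efams_def)
    ultimately show ?thesis by blast
  qed
  have uniq: "Y = Y' \<and> e = e' \<and> y = y'"
    if "(Z, e, Y) \<in> Arr Nec_minus" "y \<in> efams K a b Y" "nondeg K Y y"
      "(Z, e', Y') \<in> Arr Nec_minus" "y' \<in> efams K a b Y'" "nondeg K Y' y'"
      "pull K (Z, e, Y) y = pull K (Z, e', Y') y'" for Z Y e y Y' e' y'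
    by (rule K.nondeg_factor_unique[OF Arr_NecD(1)[OF Nec_minusD[OF that(1)]] that(1) efams_fams[OF
      that(2)] that(3,4)
        efams_fams[OF that(5)] that(6,7)])
  show ?thesis
  proof (rule C.is_coproductI)
    show "c \<in> Obj C" by (rule ch(1))
    show "(case p of (N, y) \<Rightarrow> \<iota> N y \<bullet> \<alpha> N) \<in> hom C (case p of (N, y) \<Rightarrow> FOb D' N) c" if p: "p \<in> ?S" for p
    proof -
      obtain N y where "p = (N, y)" "is_necklace N" "y \<in> efams K a b N" using p by auto
      then show ?thesis by (simp add: hom_iff)
    qed
  next
    fix d h h' assume h: "h \<in> hom C c d" "h' \<in> hom C c d"
      and eq: "\<And>p. p \<in> ?S \<Longrightarrow> h \<bullet> (case p of (N, y) \<Rightarrow> \<iota> N y \<bullet> \<alpha> N) =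
        h' \<bullet> (case p of (N, y) \<Rightarrow> \<iota> N y \<bullet> \<alpha> N)"
    have hA: "h \<in> Arr C" "Dom C h = c" "Cod C h = d" "h' \<in> Arr C" "Dom C h' = c" "Cod C h' = d"
      using h by (auto simp: hom_iff)
    show "h = h'"
    proof (rule is_colimit_ext[OF K.on_elts_functor[OF E.cat_functor_axioms] c[unfolded
      elts_colimit_def] h])
      fix p assume "p \<in> Obj (elts K a b)"
      then obtain N x where p: "p = (N, x)" and x: "is_necklace N" "x \<in> efams K a b N" by auto
      have "h \<bullet> \<iota> N x = h' \<bullet> \<iota> N x"
      proof (rule C.is_coproduct_ext[OF kan_coproduct[OF x(1)]])
        fix q assume "q \<in> injs N"
        then obtain Z u where q: "q = (Z, u)" and u: "(Z, u) \<in> injs N" by (cases q) auto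
        note uD = injsD[OF u]
        obtain Y e y where y: "(Z, e, Y) \<in> Arr Nec_minus" "y \<in> efams K a b Y" "nondeg K Y y"
          "pull K (Z, u, N) x = pull K (Z, e, Y) y"
          using factor[OF uD(2) K.pull_efams[OF uD(1) x(2)]] by blast
        have Y: "is_necklace Y" by (rule Arr_NecD(2)[OF Nec_minusD[OF y(1)]])
        have L: "k \<bullet> (\<iota> N x \<bullet> (FAr E (Z, u, N) \<bullet> \<alpha> Z)) = (k \<bullet> (\<iota> Y y \<bullet> \<alpha> Y)) \<bullet> FAr D' (Z, e, Y)"
          if "k \<in> Arr C" "Dom C k = c" for k
          unfolding nd_leg[OF x uD(1) y(1,2,4)] using that y Y by (simp add: C.assoc)
        have "h \<bullet> (\<iota> Y y \<bullet> \<alpha> Y) = h' \<bullet> (\<iota> Y y \<bullet> \<alpha> Y)" using eq[of "(Y, y)"] Y y by simp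
        then have hh: "h \<bullet> (\<iota> N x \<bullet> (FAr E (Z, u, N) \<bullet> \<alpha> Z)) = h' \<bullet> (\<iota> N x \<bullet> (FAr E (Z, u, N) \<bullet> \<alpha> Z))"
          unfolding L[OF hA(1,2)] L[OF hA(4,5)] by simp
        show "(h \<bullet> \<iota> N x) \<bullet> (case q of (Z, u) \<Rightarrow> FAr E (Z, u, N) \<bullet> \<alpha> Z) =
          (h' \<bullet> \<iota> N x) \<bullet> (case q of (Z, u) \<Rightarrow> FAr E (Z, u, N) \<bullet> \<alpha> Z)"
          using hh x hA uD q by (simp add: C.assoc)
      qed (use hA x in \<open>auto simp: hom_iff\<close>)
      then show "h \<bullet> (case p of (N, x) \<Rightarrow> \<iota> N x) = h' \<bullet> (case p of (N, x) \<Rightarrow> \<iota> N x)" using p by simp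
    qed
  next
    fix d \<phi> assume d: "d \<in> Obj C" and \<phi>: "\<And>p. p \<in> ?S \<Longrightarrow> \<phi> p \<in> hom C (case p of (N, y) \<Rightarrow> FOb D' N) d"
    have \<phi>A: "\<phi> (Y, y) \<in> Arr C" "Dom C (\<phi> (Y, y)) = FOb D' Y" "Cod C (\<phi> (Y, y)) = d"
      if "is_necklace Y" "y \<in> efams K a b Y" "nondeg K Y y" for Y y
      using \<phi>[of "(Y, y)"] that by (auto simp: hom_iff)
    \<comment> \<open>The value forced on \<open>D' Z\<close> by a possibly degenerate family
      \<open>x\<close>: pass to its nondegenerate quotient and apply \<phi> there. The choice is
      harmless because the quotient is unique.\<close>
    define ext where "ext Z x = (SOME k. \<exists>Y e y. (Z, e, Y) \<in> Arr Nec_minus \<and> y \<in> efams K a b Y \<and>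
      nondeg K Y y \<and>
      x = pull K (Z, e, Y) y \<and> k = \<phi> (Y, y) \<bullet> FAr D' (Z, e, Y))" for Z x
    have ext: "ext Z (pull K (Z, e, Y) y) = \<phi> (Y, y) \<bullet> FAr D' (Z, e, Y)"
      if "(Z, e, Y) \<in> Arr Nec_minus" "y \<in> efams K a b Y" "nondeg K Y y" for Z e Y y
      unfolding ext_def
    proof (rule some_equality)
      show "\<exists>Y' e' y'. (Z, e', Y') \<in> Arr Nec_minus \<and> y' \<in> efams K a b Y' \<and> nondeg K Y' y' \<and>
        pull K (Z, e, Y) y = pull K (Z, e', Y') y' \<and> \<phi> (Y, y) \<bullet> FAr D' (Z, e, Y) =
          \<phi> (Y', y') \<bullet> FAr D' (Z, e', Y')"
        using that by blast
      fix k assume "\<exists>Y' e' y'. (Z, e', Y') \<in> Arr Nec_minus \<and> y' \<in> efams K a b Y' \<and> nondeg K Y' y' \<and>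
        pull K (Z, e, Y) y = pull K (Z, e', Y') y' \<and> k = \<phi> (Y', y') \<bullet> FAr D' (Z, e', Y')"
      then obtain Y' e' y' where 1: "(Z, e', Y') \<in> Arr Nec_minus" "y' \<in> efams K a b Y'" "nondeg K Y' y'"
        "pull K (Z, e, Y) y = pull K (Z, e', Y') y'" "k = \<phi> (Y', y') \<bullet> FAr D' (Z, e', Y')" by blast
      then show "k = \<phi> (Y, y) \<bullet> FAr D' (Z, e, Y)" using uniq[OF that 1(1-4)] by simp
    qed
    have ext_closed: "ext Z x \<in> Arr C \<and> Dom C (ext Z x) = FOb D' Z \<and> Cod C (ext Z x) = d"
      if x: "is_necklace Z" "x \<in> efams K a b Z" for Z x
    proof -
      obtain Y e y where y: "(Z, e, Y) \<in> Arr Nec_minus" "y \<in> efams K a b Y" "nondeg K Y y" "x =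
        pull K (Z, e, Y) y"
        using factor[OF x] by blast
      have Y: "is_necklace Y" by (rule Arr_NecD(2)[OF Nec_minusD[OF y(1)]])
      show ?thesis unfolding y(4) ext[OF y(1-3)] using \<phi>A[OF Y y(2,3)] y(1) by simp
    qed
    \<comment> \<open>The nondegenerate quotient does not change when a family is pulled back along
      an active surjection; the two surjections compose.\<close>
    have ext_pull: "ext Z (pull K (Z, e, Z') x) = ext Z' x \<bullet> FAr D' (Z, e, Z')"
      if e: "(Z, e, Z') \<in> Arr Nec_minus" and x: "x \<in> efams K a b Z'" for Z e Z' x
    proof -
      have e': "(Z, e, Z') \<in> Arr Nec" using e by simp
      note Z = Arr_NecD(1,2)[OF e']
      obtain Y f y where y: "(Z', f, Y) \<in> Arr Nec_minus" "y \<in> efams K a b Y" "nondeg K Y y" "x =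
        pull K (Z', f, Y) y"
        using factor[OF Z(2) x] by blast
      have f': "(Z', f, Y) \<in> Arr Nec" using y by simp
      have Y: "is_necklace Y" by (rule Arr_NecD(2)[OF f'])
      have fe: "(Z, compose {0..snd Z} f e, Y) \<in> Arr Nec_minus"
        using Nm.Cmp_closed(1)[OF e y(1)] by simp
      have fe': "FAr D' (Z, compose {0..snd Z} f e, Y) = FAr D' (Z', f, Y) \<bullet> FAr D' (Z, e, Z')"
        using a.F.FAr_Cmp_Arr[OF e y(1)] by simp
      have "pull K (Z, e, Z') x = pull K (Z, compose {0..snd Z} f e, Y) y"
        unfolding y(4) using K.pull_Cmp[OF e' f' efams_fams[OF y(2)]] by simp
      then have "ext Z (pull K (Z, e, Z') x) = \<phi> (Y, y) \<bullet> (FAr D' (Z', f, Y) \<bullet> FAr D' (Z, e, Z'))"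
        using ext[OF fe y(2,3)] fe' by simp
      also have "\<dots> = (\<phi> (Y, y) \<bullet> FAr D' (Z', f, Y)) \<bullet> FAr D' (Z, e, Z')"
        using \<phi>A[OF Y y(2,3)] y(1) e by (simp add: C.assoc)
      finally show ?thesis using ext[OF y(1-3)] y(4) by simp
    qed
    \<comment> \<open>As \<open>E N\<close> is a coproduct over the injections into
      \<open>N\<close>, the forced values on the pullbacks along them assemble into one
      arrow.\<close>
    have "\<forall>N x. is_necklace N \<and> x \<in> efams K a b N \<longrightarrow> (\<exists>k. k \<in> hom C (FOb E N) d \<and>
      (\<forall>q \<in> injs N. k \<bullet> (case q of (Z, u) \<Rightarrow> FAr E (Z, u, N) \<bullet> \<alpha> Z) =
        (case q of (Z, u) \<Rightarrow> ext Z (pull K (Z, u, N) x))))"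
    proof (intro allI impI, elim conjE)
      fix N x assume x: "is_necklace N" "x \<in> efams K a b N"
      show "\<exists>k. k \<in> hom C (FOb E N) d \<and>
        (\<forall>q \<in> injs N. k \<bullet> (case q of (Z, u) \<Rightarrow> FAr E (Z, u, N) \<bullet> \<alpha> Z) =
          (case q of (Z, u) \<Rightarrow> ext Z (pull K (Z, u, N) x)))"
      proof (rule C.is_coproduct_factor[OF kan_coproduct[OF x(1)] d])
        fix q assume "q \<in> injs N"
        then obtain Z u where q: "q = (Z, u)" and u: "(Z, u) \<in> injs N" by (cases q) auto
        show "(case q of (Z, u) \<Rightarrow> ext Z (pull K (Z, u, N) x)) \<in> hom C (case q of (Z, u) \<Rightarrow> FOb D' Z) d"
          using ext_closed[OF injsD(2)[OF u] K.pull_efams[OF injsD(1)[OF u] x(2)]] q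
            by (simp add: hom_iff)
      qed
    qed
    then obtain \<psi> where \<psi>: "\<And>N x. is_necklace N \<Longrightarrow> x \<in> efams K a b N \<Longrightarrow> \<psi> N x \<in> hom C (FOb E N) d"
      "\<And>N x Z u. is_necklace N \<Longrightarrow> x \<in> efams K a b N \<Longrightarrow> (Z, u) \<in> injs N \<Longrightarrow>
        \<psi> N x \<bullet> (FAr E (Z, u, N) \<bullet> \<alpha> Z) = ext Z (pull K (Z, u, N) x)"
      by (metis (mono_tags, lifting) case_prod_conv)
    have \<psi>A: "\<psi> N x \<in> Arr C" "Dom C (\<psi> N x) = FOb E N" "Cod C (\<psi> N x) = d"
      if "is_necklace N" "x \<in> efams K a b N" for N x using \<psi>(1)[OF that] by (auto simp: hom_iff)
    have nat: "\<psi> N' x \<bullet> FAr E (N, g, N') = \<psi> N (pull K (N, g, N') x)"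
      if g: "(N, g, N') \<in> Arr Nec" and x: "x \<in> efams K a b N'" for N g N' x
    proof -
      note N = Arr_NecD(1,2)[OF g]
      note x' = K.pull_efams[OF g x]
      show ?thesis
      proof (rule C.is_coproduct_ext[OF kan_coproduct[OF N(1)]])
        fix q assume "q \<in> injs N"
        then obtain Z u where q: "q = (Z, u)" and u: "(Z, u) \<in> injs N" by (cases q) auto
        note uD = injsD[OF u]
        obtain Z' e u' where f: "(Z, e, Z') \<in> Arr Nec_minus" "(Z', u') \<in> injs N'"
          "(N, g, N') \<bullet>\<^bsub>Nec\<^esub> (Z, u, N) = (Z', u', N') \<bullet>\<^bsub>Nec\<^esub> (Z, e, Z')" by (rule injs_factor[OF g u])
        note u'D = injsD[OF f(2)]
        have e: "(Z, e, Z') \<in> Arr Nec" using f by simp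
        note A [simp] = g N uD(1,2) u'D(1,2) e f(1,2) u \<psi>A[OF N(2) x]
        have E: "FAr E (N, g, N') \<bullet> FAr E (Z, u, N) = FAr E (Z', u', N') \<bullet> FAr E (Z, e, Z')"
        proof -
          have "FAr E ((N, g, N') \<bullet>\<^bsub>Nec\<^esub> (Z, u, N)) = FAr E (N, g, N') \<bullet> FAr E (Z, u, N)"
            by (rule E.FAr_Cmp_Arr) simp_all
          moreover have "FAr E ((Z', u', N') \<bullet>\<^bsub>Nec\<^esub> (Z, e, Z')) = FAr E (Z', u', N') \<bullet> FAr E (Z, e, Z')"
            by (rule E.FAr_Cmp_Arr) simp_all
          ultimately show ?thesis using f(3) by metis
        qed
        have pp: "pull K (Z, u, N) (pull K (N, g, N') x) = pull K (Z, e, Z') (pull K (Z', u', N') x)"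
          using K.pull_Cmp[OF uD(1) g efams_fams[OF x]] K.pull_Cmp[OF e u'D(1) efams_fams[OF x]] f(3)
            by simp
        have "(\<psi> N' x \<bullet> FAr E (N, g, N')) \<bullet> (FAr E (Z, u, N) \<bullet> \<alpha> Z) =
          \<psi> N' x \<bullet> ((FAr E (N, g, N') \<bullet> FAr E (Z, u, N)) \<bullet> \<alpha> Z)"
          by (simp add: C.assoc)
        also have "\<dots> = \<psi> N' x \<bullet> (FAr E (Z', u', N') \<bullet> (FAr E (Z, e, Z') \<bullet> \<alpha> Z))"
          unfolding E by (simp add: C.assoc)
        also have "\<dots> = (\<psi> N' x \<bullet> (FAr E (Z', u', N') \<bullet> \<alpha> Z')) \<bullet> FAr D' (Z, e, Z')"
          unfolding alpha_natural[OF f(1)] by (simp add: C.assoc)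
        also have "\<dots> = ext Z' (pull K (Z', u', N') x) \<bullet> FAr D' (Z, e, Z')"
          using \<psi>(2)[OF N(2) x f(2)] by simp
        also have "\<dots> = ext Z (pull K (Z, u, N) (pull K (N, g, N') x))"
          unfolding pp by (rule ext_pull[OF f(1) K.pull_efams[OF u'D(1) x], symmetric])
        also have "\<dots> = \<psi> N (pull K (N, g, N') x) \<bullet> (FAr E (Z, u, N) \<bullet> \<alpha> Z)"
          using \<psi>(2)[OF N(1) x' u] by simp
        finally show "(\<psi> N' x \<bullet> FAr E (N, g, N')) \<bullet> (case q of (Z, u) \<Rightarrow> FAr E (Z, u, N) \<bullet> \<alpha> Z) =
          \<psi> N (pull K (N, g, N') x) \<bullet> (case q of (Z, u) \<Rightarrow> FAr E (Z, u, N) \<bullet> \<alpha> Z)" using q by simp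
      qed (use \<psi>(1)[OF N(1) x'] \<psi>A[OF N(2) x] g in \<open>auto simp: hom_iff\<close>)
    qed
    have "\<exists>h. h \<in> hom C c d \<and> (\<forall>j \<in> Obj (elts K a b). h \<bullet> (case j of (N, x) \<Rightarrow> \<iota> N x) =
      (case j of (N, x) \<Rightarrow> \<psi> N x))"
      by (rule is_colimit_factor[OF c[unfolded elts_colimit_def] d]) (use \<psi>(1) nat in auto)
    then obtain h where h: "h \<in> hom C c d" "\<And>N x. is_necklace N \<Longrightarrow> x \<in> efams K a b N \<Longrightarrow> h \<bullet> \<iota> N x = \<psi> N x"
      by fastforce
    have "h \<bullet> (\<iota> N y \<bullet> \<alpha> N) = \<phi> (N, y)" if y: "is_necklace N" "y \<in> efams K a b N" "nondeg K N y" for N y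
    proof -
      \<comment> \<open>Composing with \<alpha> restricts to the summand of \<open>E N\<close> at
        the identity injection.\<close>
      have "h \<bullet> (\<iota> N y \<bullet> \<alpha> N) = \<psi> N y \<bullet> (FAr E (N, ident N, N) \<bullet> \<alpha> N)"
        using h y by (simp add: hom_iff C.assoc[symmetric])
      also have "\<dots> = ext N (pull K (N, ident N, N) y)" by (rule \<psi>(2)[OF y(1,2) ident_injs[OF y(1)]])
      also have "\<dots> = \<phi> (N, y)" using ext[OF ident_Arr(2)[OF y(1)] y(2,3)] \<phi>A[OF y] y(1) by simp
      finally show ?thesis .
    qed
    then show "\<exists>h. h \<in> hom C c d \<and> (\<forall>p \<in> ?S. h \<bullet> (case p of (N, y) \<Rightarrow> \<iota> N y \<bullet> \<alpha> N) = \<phi> p)"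
      using h(1) by (intro exI[of _ h]) auto
  qed
qed

end


section \<open>Copowers in a closed category\<close>

text \<open>Tensoring with \<open>X\<close> is left adjoint to the internal hom, so it preserves the
  coproduct: an arrow out of \<open>c \<otimes> X\<close> is curried, tested on the copies of the
  unit, and uncurried.\<close>

lemma (in sym_monoidal_closed_category) free_obj_tens:
  assumes c: "is_coproduct V S (\<lambda>_. Unt V) c \<iota>" and X: "X \<in> Obj V"
  shows "is_coproduct V S (\<lambda>_. X) (c \<otimes> X) (\<lambda>s. (\<iota> s \<odot> Idt V X) \<bullet> inv_arr V (LUn V X))"
proof -
  note ch = is_coproduct_hom[OF c]
  have i [simp]: "\<iota> s \<in> Arr V" "Dom V (\<iota> s) = Unt V" "Cod V (\<iota> s) = c" if "s \<in> S" for s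
    using ch(2)[OF that] by (auto simp: hom_iff)
  note [simp] = X ch(1) LUn_iso[OF X]
  have L [simp]: "inv_arr V (LUn V X) \<in> Arr V" "Dom V (inv_arr V (LUn V X)) =
    X" "Cod V (inv_arr V (LUn V X)) = Unt V \<otimes> X"
    by simp_all
  have ev: "Eval V X d \<in> Arr V" "Dom V (Eval V X d) = IHom V X d \<otimes> X" "Cod V (Eval V X d) =
    d" "IHom V X d \<in> Obj V"
    if "d \<in> Obj V" for d using Eval_hom[OF X that] IHom_Obj[OF X that] by (auto simp: hom_iff)
  show ?thesis
  proof (rule is_coproductI)
    show "c \<otimes> X \<in> Obj V" by simp
    show "(\<iota> s \<odot> Idt V X) \<bullet> inv_arr V (LUn V X) \<in> hom V X (c \<otimes> X)" if "s \<in> S" for s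
      using that by (simp add: hom_iff)
  next
    fix d \<kappa> assume d: "d \<in> Obj V" and \<kappa>: "\<And>s. s \<in> S \<Longrightarrow> \<kappa> s \<in> hom V X d"
    note [simp] = d ev[OF d]
    have k [simp]: "\<kappa> s \<in> Arr V" "Dom V (\<kappa> s) = X" "Cod V (\<kappa> s) = d" if "s \<in> S" for s
      using \<kappa>[OF that] by (auto simp: hom_iff)
    have "\<exists>g. g \<in> hom V (Unt V) (IHom V X d) \<and> Eval V X d \<bullet> (g \<odot> Idt V X) =
      \<kappa> s \<bullet> LUn V X" if "s \<in> S" for s
      using Eval_universal[of "Unt V" X d "\<kappa> s \<bullet> LUn V X"] that by (auto simp: hom_iff)
    then obtain g where g: "\<And>s. s \<in> S \<Longrightarrow> g s \<in> hom V (Unt V) (IHom V X d)"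
      "\<And>s. s \<in> S \<Longrightarrow> Eval V X d \<bullet> (g s \<odot> Idt V X) = \<kappa> s \<bullet> LUn V X" by metis
    obtain h where h: "h \<in> hom V c (IHom V X d)" "\<forall>s \<in> S. h \<bullet> \<iota> s = g s"
      using is_coproduct_factor[OF c, of "IHom V X d" g] g(1) by auto
    have "(Eval V X d \<bullet> (h \<odot> Idt V X)) \<bullet> ((\<iota> s \<odot> Idt V X) \<bullet> inv_arr V (LUn V X)) =
      \<kappa> s" if s: "s \<in> S" for s
    proof -
      have "(Eval V X d \<bullet> (h \<odot> Idt V X)) \<bullet> ((\<iota> s \<odot> Idt V X) \<bullet> inv_arr V (LUn V X)) =
        (Eval V X d \<bullet> ((h \<odot> Idt V X) \<bullet> (\<iota> s \<odot> Idt V X))) \<bullet> inv_arr V (LUn V X)"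
        using h(1) s by (simp add: hom_iff assoc)
      also have "(h \<odot> Idt V X) \<bullet> (\<iota> s \<odot> Idt V X) = g s \<odot> Idt V X"
        using h s by (simp add: hom_iff tens_Cmp)
      finally show ?thesis using g(2)[OF s] s by (simp add: assoc)
    qed
    then show "\<exists>h. h \<in> hom V (c \<otimes> X) d \<and> (\<forall>s\<in>S. h \<bullet> ((\<iota> s \<odot> Idt V X) \<bullet> inv_arr V (LUn V X)) = \<kappa> s)"
      using h(1) by (intro exI[of _ "Eval V X d \<bullet> (h \<odot> Idt V X)"]) (auto simp: hom_iff)
  next
    fix d h h' assume h: "h \<in> hom V (c \<otimes> X) d" "h' \<in> hom V (c \<otimes> X) d"
      and eq: "\<And>s. s \<in> S \<Longrightarrow> h \<bullet> ((\<iota> s \<odot> Idt V X) \<bullet> inv_arr V (LUn V X)) =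
        h' \<bullet> ((\<iota> s \<odot> Idt V X) \<bullet> inv_arr V (LUn V X))"
    have d: "d \<in> Obj V" by (rule hom_Obj(2)[OF h(1)])
    note [simp] = d ev[OF d]
    obtain g where g: "g \<in> hom V c (IHom V X d)" "Eval V X d \<bullet> (g \<odot> Idt V X) = h"
      using Eval_universal[OF ch(1) X d h(1)] by blast
    obtain g' where g': "g' \<in> hom V c (IHom V X d)" "Eval V X d \<bullet> (g' \<odot> Idt V X) = h'"
      using Eval_universal[OF ch(1) X d h(2)] by blast
    have gt: "g \<in> Arr V" "Dom V g = c" "Cod V g = IHom V X d" "g' \<in> Arr V" "Dom V g' = c" "Cod V g' =
      IHom V X d"
      using g(1) g'(1) by (auto simp: hom_iff)
    have "g = g'"
    proof (rule is_coproduct_ext[OF c g(1) g'(1)])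
      fix s assume s: "s \<in> S"
      have ht: "h \<in> Arr V" "Dom V h = c \<otimes> X" "h' \<in> Arr V" "Dom V h' = c \<otimes> X"
        using h by (auto simp: hom_iff)
      have "(h \<bullet> ((\<iota> s \<odot> Idt V X) \<bullet> inv_arr V (LUn V X))) \<bullet> LUn V X =
        (h' \<bullet> ((\<iota> s \<odot> Idt V X) \<bullet> inv_arr V (LUn V X))) \<bullet> LUn V X"
        using eq[OF s] by simp
      then have hh: "h \<bullet> (\<iota> s \<odot> Idt V X) = h' \<bullet> (\<iota> s \<odot> Idt V X)" using ht s by (simp add: assoc)
      have e: "Eval V X d \<bullet> ((k \<bullet> \<iota> s) \<odot> Idt V X) = (Eval V X d \<bullet> (k \<odot> Idt V X)) \<bullet> (\<iota> s \<odot> Idt V X)"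
        if "k \<in> Arr V" "Dom V k = c" "Cod V k = IHom V X d" for k
        using that s by (simp add: assoc tens_Cmp)
      have "Eval V X d \<bullet> ((g \<bullet> \<iota> s) \<odot> Idt V X) = Eval V X d \<bullet> ((g' \<bullet> \<iota> s) \<odot> Idt V X)"
        unfolding e[OF gt(1-3)] e[OF gt(4-6)] g(2) g'(2) by (rule hh)
      moreover have "g \<bullet> \<iota> s \<in> hom V (Unt V) (IHom V X d)" "g' \<bullet> \<iota> s \<in> hom V (Unt V) (IHom V X d)"
        using gt s by (simp_all add: hom_iff)
      moreover have "Eval V X d \<bullet> ((g \<bullet> \<iota> s) \<odot> Idt V X) \<in> hom V (Unt V \<otimes> X) d"
        using gt s by (simp add: hom_iff)
      ultimately show "g \<bullet> \<iota> s = g' \<bullet> \<iota> s"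
        using Eval_universal[OF Unt_Obj X d, of "Eval V X d \<bullet> ((g \<bullet> \<iota> s) \<odot> Idt V X)"] by metis
    qed
    then show "h = h'" using g(2) g'(2) by simp
  qed
qed


section \<open>Hom-objects of the left adjoint\<close>

text \<open>\<open>underlying_monoidal\<close> copies the category fields of
  \<open>underlying\<close> into a larger record. Colimit notions read only these fields and so pass
  between the two; cocompleteness is given for the smaller record, while the construction of
  \<open>Free\<close> runs over the larger one.\<close>

lemma underlying_monoidal_sel [simp]:
  "Obj (underlying_monoidal V W) = Obj (underlying V W)" "Arr (underlying_monoidal V W) =
   Arr (underlying V W)"
  "Dom (underlying_monoidal V W) = Dom (underlying V W)" "Cod (underlying_monoidal V W) =
   Cod (underlying V W)"
  "Idt (underlying_monoidal V W) = Idt (underlying V W)" "Cmp (underlying_monoidal V W) =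
   Cmp (underlying V W)"
  by (simp_all add: underlying_monoidal_def)

lemma underlying_hom [simp]: "hom (underlying_monoidal V W) = hom (underlying V W)"
  by (simp add: hom_def fun_eq_iff)

lemma underlying_category: "category (underlying_monoidal V W) \<longleftrightarrow> category (underlying V W)"
  by (simp add: category_def)

lemma underlying_functor_iff:
  "cat_functor J (underlying_monoidal V W) F \<longleftrightarrow> cat_functor J (underlying V W) F"
  by (simp add: cat_functor_def cat_functor_axioms_def underlying_category)

lemma underlying_colimit:
  "is_colimit J (underlying_monoidal V W) F c \<iota> \<longleftrightarrow> is_colimit J (underlying V W) F c \<iota>"
  by (simp add: is_colimit_def is_cocone_def)

lemma underlying_cocomplete: "cocomplete U (underlying_monoidal V W) \<longleftrightarrow> cocomplete U (underlying V W)"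
  by (simp add: cocomplete_def underlying_functor_iff underlying_colimit)

lemma underlying_preserves:
  "preserves_colimits U (underlying_monoidal V W) (underlying_monoidal V W) G \<longleftrightarrow>
    preserves_colimits U (underlying V W) (underlying V W) G"
  by (simp add: preserves_colimits_def underlying_functor_iff underlying_colimit)

lemma underlying_cocomplete_monoidal:
  fixes U :: "'u itself"
  assumes base: "enrichment_base V W U" and M: "monoidal_category (underlying_monoidal V W)"
  shows "cocomplete_monoidal (underlying_monoidal V W) U"
proof -
  interpret B: enrichment_base V W U by fact
  interpret M: monoidal_category "underlying_monoidal V W" by fact
  have O: "Obj (underlying V W) = EOb W" by (simp add: underlying_def)
  show ?thesis
  proof
    show "infinite (UNIV :: 'u set)" by (rule B.infinite_universe)
    show "cocomplete U (underlying_monoidal V W)"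
      using B.W_cocomplete by (simp add: underlying_cocomplete)
    fix x assume "x \<in> Obj (underlying_monoidal V W)"
    then have x: "x \<in> EOb W" by (simp add: O)
    show "preserves_colimits U (underlying_monoidal V W) (underlying_monoidal V W) (M.tensL x)"
      "preserves_colimits U (underlying_monoidal V W) (underlying_monoidal V W) (M.tensR x)"
      using B.tens_left_cocontinuous[OF x] B.tens_right_cocontinuous[OF x]
      by (simp_all add: underlying_preserves M.tensL_def M.tensR_def)
  qed
qed

lemma nondegenerate_maps_small:
  fixes K :: "'u sset"
  assumes inf: "infinite (UNIV :: 'u set)" and K: "simplicial_set K" and N: "is_necklace N"
  shows "small (U :: 'u itself) (nondegenerate_maps K N a b)"
proof -
  note b = simplicial_set.nondegenerate_maps_bij[OF K N, of a b]
  show ?thesis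
    by (rule small_inj[OF small_fams[OF inf, of U K], of "\<lambda>g. (N, of_map N g)"])
      (use b N in \<open>auto simp: bij_betw_def inj_on_def\<close>)
qed

text \<open>Both objects are coproducts of copies of \<open>D' N\<close>, one for each necklace
  \<open>N\<close> with a nondegenerate map to \<open>K\<close> from \<open>a\<close> to
  \<open>b\<close>: the first by \<open>nondegenerate_coproduct\<close>, the second because a
  copower of the unit tensored with \<open>D' N\<close> is a copower of \<open>D' N\<close>.\<close>

theorem corollary4p17:
  fixes U :: "'u itself"
    and V :: "('o, 'a) sym_closed"
    and W :: "('w, 'o, 'a) monoidal_ecat"
    and D :: "(necklace, necklace \<times> (nat \<Rightarrow> nat) \<times> necklace, 'w, 'w \<times> 'a \<times> 'w) func"
    and \<mu> :: "necklace \<Rightarrow> necklace \<Rightarrow> 'w \<times> 'a \<times> 'w"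
    and \<epsilon> :: "'w \<times> 'a \<times> 'w"
    and P :: "('w, 'o, 'a) efunc"
    and D' :: "(necklace, necklace \<times> (nat \<Rightarrow> nat) \<times> necklace, 'o, 'a) func"
    and K :: "'u sset"
    and L :: "('u, 'w, 'w \<times> 'a \<times> 'w) ecat"
    and \<eta> :: "nat \<Rightarrow> 'u \<Rightarrow> (nat, 'u, 'w \<times> 'a \<times> 'w) efunc"
    and a b :: 'u
  assumes base: "enrichment_base V W U"
    and D: "strong_monoidal_functor Nec (underlying_monoidal V W) D \<mu> \<epsilon>"
    and P: "enriched_functor V W (self_enriched V) P"
    and P_colimits: "preserves_colimits U (underlying V W) V (underlying_functor V P)"
    and P_tensors: "tensor_preserving V W P"
    and D': "cat_functor Nec_minus V D'"
    and Lan: "\<exists>E \<alpha>. is_left_kan_extension Nec_minus Nec V Nec_incl D' E \<alpha> \<and>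
                naturally_isomorphic Nec V (func_comp (underlying_functor V P) D) E"
    and K: "simplicial_set K"
    and L: "nerve_left_adjoint_at (underlying_monoidal V W) D \<mu> \<epsilon> K L \<eta>"
    and a: "a \<in> Sim K 0"
    and b: "b \<in> Sim K 0"
  shows "isomorphic V (EFO P (EHom L a b))
    (coproduct_obj V (Obj Nec)
      (\<lambda>T. free_obj V (nondegenerate_maps K T a b) \<otimes>\<^bsub>V\<^esub> FOb D' T))"
proof -
  let ?W = "underlying_monoidal V W" and ?P = "underlying_functor V P"
  interpret B: enrichment_base V W U by fact
  interpret D: strong_monoidal_functor Nec ?W D \<mu> \<epsilon> by fact
  interpret D': cat_functor Nec_minus V D' by fact
  interpret K: simplicial_set K by fact
  note inf = B.infinite_universe
  \<comment> \<open>That the underlying category of \<open>W\<close> is monoidal is part of the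
    hypothesis that \<open>D\<close> is strong monoidal.\<close>
  have "cocomplete_monoidal ?W U"
    by (rule underlying_cocomplete_monoidal[OF base D.N.monoidal_category_axioms])
  then interpret R: realization ?W D \<mu> \<epsilon> K U
    by (simp add: realization_def D K)
  interpret A: nerve_adjoint ?W D \<mu> \<epsilon> K U L \<eta> by unfold_locales (rule L)
  obtain E \<alpha> \<tau> where kan: "is_left_kan_extension Nec_minus Nec V Nec_incl D' E \<alpha>"
    and \<tau>: "nat_trans Nec V (func_comp ?P D) E \<tau>" "\<And>N. is_necklace N \<Longrightarrow> is_iso V (\<tau> N)"
    using Lan unfolding naturally_isomorphic_def by auto
  interpret t: nat_trans Nec V "func_comp ?P D" E \<tau> by (rule \<tau>(1))
  interpret E: kan_along_active V D' E \<alpha> U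
    by unfold_locales (use inf B.V_cocomplete kan in auto)

  let ?J = "elts K a b"
  have "is_colimit ?J (underlying V W) (on_elts D) (EHom L a b) (\<lambda>(N, x). A.composite N x)"
    using A.left_adjoint_hom_colimit[OF a b] by (simp add: elts_colimit_def underlying_colimit)
  moreover have "cat_functor ?J (underlying V W) (on_elts D)"
    using R.elts_functor[of a b] by (simp add: underlying_functor_iff)
  moreover have GF: "cat_functor ?J V (func_comp ?P (on_elts D))"
    unfolding func_comp_on_elts by (rule K.on_elts_functor[OF t.F.cat_functor_axioms])
  \<comment> \<open>Preservation is assumed for index categories inside \<open>'u\<close>; it
    carries over to the category of necklaces in \<open>K\<close> because that category is
    small.\<close>
  ultimately have "is_colimit ?J V (func_comp ?P (on_elts D)) (FOb ?P (EHom L a b)) (\<lambda>j. FAr ?P (case j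
    of (N, x) \<Rightarrow> A.composite N x))"
    using preserves_small[OF P_colimits] small_elts[OF inf, of U K a b] by blast
  then have PL: "is_colimit ?J V (on_elts (func_comp ?P D)) (EFO P (EHom L a b)) (\<lambda>j. FAr ?P (case j of
    (N, x) \<Rightarrow> A.composite N x))"
    unfolding func_comp_on_elts by (simp add: underlying_functor_def)
  have "nat_trans ?J V (on_elts (func_comp ?P D)) (on_elts E) (\<lambda>(N, x). \<tau> N)"
  proof (intro nat_trans.intro nat_trans_axioms.intro)
    show "cat_functor ?J V (on_elts (func_comp ?P D))" using GF by (simp add: func_comp_on_elts)
    show "cat_functor ?J V (on_elts E)" by (rule K.on_elts_functor[OF t.G.cat_functor_axioms])
    show "(case x of (N, x) \<Rightarrow> \<tau> N) \<in> hom V (FOb (on_elts (func_comp ?P D)) x) (FOb (on_elts E) x)"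
      if "x \<in> Obj ?J" for x using that t.component_hom by auto
    show "(case y of (N, x) \<Rightarrow> \<tau> N) \<bullet>\<^bsub>V\<^esub> FAr (on_elts (func_comp ?P D)) f =
      FAr (on_elts E) f \<bullet>\<^bsub>V\<^esub> (case x of (N, x) \<Rightarrow> \<tau> N)"
      if "f \<in> hom ?J x y" for f x y
      using that t.natural_Arr by (cases f) (auto simp: hom_iff simp del: Nec_sel func_comp_simps)
  qed
  moreover have "is_iso V (case j of (N, x) \<Rightarrow> \<tau> N)" if "j \<in> Obj ?J" for j using that \<tau>(2) by auto
  ultimately have "is_colimit ?J V (on_elts E) (EFO P (EHom L a b))
      (\<lambda>j. FAr ?P (case j of (N, x) \<Rightarrow> A.composite N x) \<bullet>\<^bsub>V\<^esub> inv_arr V (case j of (N, x) \<Rightarrow> \<tau> N))"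
    by (rule is_colimit_nat_iso[OF PL])
  then have "elts_colimit V E K a b (EFO P (EHom L a b)) (\<lambda>N x. FAr ?P (A.composite N x) \<bullet>\<^bsub>V\<^esub> inv_arr V
    (\<tau> N))"
    by (simp add: elts_colimit_def case_prod_unfold)
  note cop1 = E.nondegenerate_coproduct[OF K this]

  have smN: "small U (nondegenerate_maps K N a b)" if "is_necklace N" for N
    by (rule nondegenerate_maps_small[OF inf K that])
  let ?X = "\<lambda>N. free_obj V (nondegenerate_maps K N a b) \<otimes>\<^bsub>V\<^esub> FOb D' N"
  have "\<exists>j. is_coproduct V (nondegenerate_maps K N a b) (\<lambda>_. FOb D' N) (?X N) j" if N: "is_necklace N"
    for N
  proof -
    obtain \<iota> where "is_coproduct V (nondegenerate_maps K N a b) (\<lambda>_. Unt V) (free_obj V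
      (nondegenerate_maps K N a b)) \<iota>"
      unfolding free_obj_def using coproduct_obj[OF B.V.category_axioms B.V_cocomplete smN[OF N], of
        "\<lambda>_. Unt V"] B.V.Unt_Obj by blast
    then show ?thesis using B.V.free_obj_tens E.D'_Obj[OF N] by blast
  qed
  then obtain j where j: "\<And>N. is_necklace N \<Longrightarrow>
    is_coproduct V (nondegenerate_maps K N a b) (\<lambda>_. FOb D' N) (?X N) (j N)"
    by metis
  have "\<exists>\<iota>. is_coproduct V (Obj Nec) ?X (coproduct_obj V (Obj Nec) ?X) \<iota>"
    by (rule coproduct_obj[OF B.V.category_axioms B.V_cocomplete])
      (use small_necklaces[OF inf] B.V.is_coproduct_hom(1)[OF j] in auto)
  then obtain \<iota> where \<iota>: "is_coproduct V (Obj Nec) ?X (coproduct_obj V (Obj Nec) ?X) \<iota>" by blast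
  note cop2 = B.V.is_coproduct_Sigma[OF \<iota> j]
  \<comment> \<open>Simplicial maps out of a necklace are exchanged for families along
    \<open>of_map\<close>, which keeps the necklace and hence the summand.\<close>
  have "isomorphic V (coproduct_obj V (Obj Nec) ?X) (EFO P (EHom L a b))"
  proof (rule B.V.is_coproduct_iso[OF cop2 cop1])
    note bij = K.nondegenerate_maps_bij[of _ a b]
    show "bij_betw (\<lambda>(N, g). (N, of_map N g)) (Sigma (Obj Nec) (\<lambda>N. nondegenerate_maps K N a b))
      {(N, y). is_necklace N \<and> y \<in> efams K a b N \<and> nondeg K N y}"
    proof (rule bij_betw_imageI)
      show "inj_on (\<lambda>(N, g). (N, of_map N g)) (Sigma (Obj Nec) (\<lambda>N. nondegenerate_maps K N a b))"
        using bij by (auto simp: bij_betw_def inj_on_def)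
      show "(\<lambda>(N, g). (N, of_map N g)) ` Sigma (Obj Nec) (\<lambda>N. nondegenerate_maps K N a b) =
        {(N, y). is_necklace N \<and> y \<in> efams K a b N \<and> nondeg K N y}"
      proof (intro set_eqI iffI)
        fix p assume "p \<in> {(N, y). is_necklace N \<and> y \<in> efams K a b N \<and> nondeg K N y}"
        then obtain N y where p: "p = (N, y)" "is_necklace N" "y \<in> efams K a b N" "nondeg K N y" by auto
        then have "y \<in> of_map N ` nondegenerate_maps K N a b"
          using bij[OF p(2)] by (auto simp: bij_betw_def efams_def)
        then show "p \<in> (\<lambda>(N, g). (N, of_map N g)) ` Sigma (Obj Nec) (\<lambda>N. nondegenerate_maps K N a b)"
          using p by force
      next
        fix p assume "p \<in> (\<lambda>(N, g). (N, of_map N g)) ` Sigma (Obj Nec) (\<lambda>N. nondegenerate_maps K N a b)"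
        then obtain N g where p: "p = (N, of_map N g)" "is_necklace N" "g \<in> nondegenerate_maps K N a b"
          by auto
        then show "p \<in> {(N, y). is_necklace N \<and> y \<in> efams K a b N \<and> nondeg K N y}"
          using bij_betwE[OF bij[OF p(2)]] by (auto simp: efams_def)
      qed
    qed
  qed auto
  then show ?thesis by (rule B.V.isomorphic_sym)
qed

end
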